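(* Let the boundary conditions be local, i.e. $X=\bigoplus_{v\in V}X_v$, $L=\bigoplus_{v\in V}L_v$, assume that for all $v\in V_1$ there exists $\xi^v\in X_v$ with $\xi^v(v)=1$, and let $H$ be the operator associated with $\tau$. (a) Assume that $X_v$ is a sublattice of $\mathbb K^{E_{1,v}}$ (if $v\in V_0$) or of $\mathbb K^{E_{1,v}\cup\{v\}}$ (if $v\in V_1$) and that $(e^{-tL_v})_{t\geq0}$ is positivity preserving, for all $v\in V$. Then $(e^{-tH})_{t\geq0}$ is a positivity preserving $C_0$-semigroup on $\mathcal H_\Gamma$. (b) Assume that $X_v$ is a Stonean sublattice of $\mathbb K^{E_{1,v}}$ (if $v\in V_0$) or of $\mathbb K^{E_{1,v}\cup\{v\}}$ (if $v\in V_1$) and that $(e^{-tL_v})_{t\geq0}$ is a submarkovian $C_0$-semigroup on $X_v$, for all $v\in V$. Then $(e^{-tH})_{t\geq0}$ is a submarkovian $C_0$-semigroup on $\mathcal H_\Gamma$.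
   Context: **Setting.** $\mathbb K\in\{\mathbb R,\mathbb C\}$; all function spaces consist of $\mathbb K$-valued functions. $\Gamma=(V,E,\gamma)$ is a finite directed graph: $V$ (vertices) and $E$ (edges) are finite disjoint sets and $\gamma=(\gamma_0,\gamma_1)\colon E\to V\times V$ assigns to each edge a starting vertex $\gamma_0(e)$ and an end vertex $\gamma_1(e)$. Each $e\in E$ corresponds to an interval $[a_e,b_e]\subseteq\mathbb R$, $a_e<b_e$, and carries a finite Borel measure $\mu_e$ on $[a_e,b_e]$ such that either $\mu_e=0$, or $a_e,b_e\in\operatorname{spt}\mu_e$ and $\mu_e(\{a_e,b_e\})=0$. Put $E_0:=\{e\in E:\mu_e=0\}$, $E_1:=E\setminus E_0$. Each $v\in V$ has a weight $\mu_v\geq0$; put $V_0:=\{v\in V:\mu_v=0\}$, $V_1:=V\setminus V_0$. **Hilbert space.** $\mathcal H_\Gamma:=\mathcal H_E\oplus\mathbb K^{V_1}$ with $\mathcal H_E:=\bigoplus_{e\in E_1}L_2([a_e,b_e],\mu_e)$ and scalar product $(f\mid g)_{\mathcal H_\Gamma}=\sum_{e\in E_1}(f_e\mid g_e)_{L_2([a_e,b_e],\mu_e)}+\sum_{v\in V_1}f_v\overline{g_v}\,\mu_v$ for $f=((f_e)_{e\in E_1},(f_v)_{v\in V_1})$ and $g$ likewise. Thus $\mathcal H_\Gamma$ is the $L_2$-space of the disjoint union of the $([a_e,b_e],\mu_e)$, $e\in E_1$, and the point masses $\mu_v$ at $v\in V_1$; order, modulus and sup-norm are understood accordingly. **The map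 $\iota$.** For $e\in E_1$ let $C_{\mu_e}[a_e,b_e]$ be the set of $f\in C[a_e,b_e]$ that are affine linear on the components of $[a_e,b_e]\setminus\operatorname{spt}\mu_e$, and $W^1_{2,\mu_e}(a_e,b_e):=W^1_2(a_e,b_e)\cap C_{\mu_e}[a_e,b_e]$. Let $D(\iota_e)$ be the set of $f\in L_2([a_e,b_e],\mu_e)$ for which there is $g\in W^1_2(a_e,b_e)\cap C[a_e,b_e]$ with $g=f$ $\mu_e$-a.e. For $f\in D(\iota_e)$, $\iota_ef$ denotes the unique $g\in W^1_{2,\mu_e}(a_e,b_e)$ with $g=f$ $\mu_e$-a.e. (existence and uniqueness are known). Define $D(\iota):=\{f\in\mathcal H_\Gamma: f_e\in D(\iota_e)\ (e\in E_1)\}$, $(\iota f)_e:=\iota_ef_e$ $(e\in E_1)$, $(\iota f)_v:=f_v$ $(v\in V_1)$. **Trace.** With $E_1':=E_1\times\{0,1\}$, define $\operatorname{tr}\colon\prod_{e\in E_1}C[a_e,b_e]\times\mathbb K^{V_1}\to\mathbb K^{E_1'\cup V_1}$ by $\operatorname{tr}f(e,0):=f_e(a_e)$, $\operatorname{tr}f(e,1):=f_e(b_e)$ $(e\in E_1)$, $\operatorname{tr}f(v):=f_v$ $(v\in V_1)$. The space $\mathbb K^{E_1'\cup V_1}$ has the scalar product $(\xi\mid\eta):=\sum_{(e,j)\in E_1'}\xi(e,j)\overline{\eta(e,j)}+\sum_{v\in V_1}\xi(v)\overline{\eta(v)}\,\mu_v$. **Form.** For a subspace $X$ of $\mathbb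 K^{E_1'\cup V_1}$ and a self-adjoint operator $L$ in $X$ (with respect to the scalar product $(\xi\mid\eta)=\sum_{(e,j)\in E_1'}\xi(e,j)\overline{\eta(e,j)}+\sum_{v\in V_1}\xi(v)\overline{\eta(v)}\,\mu_v$ of $\mathbb K^{E_1'\cup V_1}$, restricted to $X$) define $$D(\tau):=\{f\in D(\iota):\operatorname{tr}(\iota f)\in X\},$$ $$\tau(f,g):=\sum_{e\in E_1}\int_{a_e}^{b_e}(\iota_ef_e)'(x)\overline{(\iota_eg_e)'(x)}\,dx+\bigl(L\operatorname{tr}(\iota f)\mid\operatorname{tr}(\iota g)\bigr)\qquad(f,g\in D(\tau)).$$ **Local boundary conditions.** For $v\in V$ let $E_{1,v,j}:=\{e\in E_1:\gamma_j(e)=v\}$ $(j=0,1)$ and $E_{1,v}:=(E_{1,v,0}\times\{0\})\cup(E_{1,v,1}\times\{1\})$, so that $E_1'$ is the disjoint union of the $E_{1,v}$, $v\in V$. The spaces $\mathbb K^{E_{1,v}}$ $(v\in V_0)$ and $\mathbb K^{E_{1,v}\cup\{v\}}$ $(v\in V_1)$ carry the scalar products inherited from $\mathbb K^{E_1'\cup V_1}$, which is their orthogonal direct sum. The boundary conditions are local if for each $v\in V$ there are a subspace $X_v\subseteq\mathbb K^{E_{1,v}}$ (if $v\in V_0$), resp. $X_v\subseteq\mathbb K^{E_{1,v}\cup\{v\}}$ (if $v\in V_1$), and a self-adjoint operator $L_v$ in $X_v$ such that $X=\bigoplus_{v\in V}X_v$ and $L=\bigoplus_{v\in V}L_v$.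 The existence, for all $v\in V_1$, of $\xi^v\in X_v$ with $\xi^v(v)=1$ is equivalent to density of $D(\tau)$ in $\mathcal H_\Gamma$. In that case $\tau$ is a densely defined, symmetric, bounded below, closed form; the associated operator $H$ (self-adjoint and bounded below) is defined by: $f\in D(H)$ and $Hf=h$ if and only if $f\in D(\tau)$, $h\in\mathcal H_\Gamma$ and $\tau(f,g)=(h\mid g)_{\mathcal H_\Gamma}$ for all $g\in D(\tau)$. $(e^{-tH})_{t\geq0}$ is the $C_0$-semigroup on $\mathcal H_\Gamma$ generated by $-H$. **Lattices.** For a finite set $S$, $\mathbb K^S$ is considered as the function space $C(S)$, with $|x|$ and (for real $x,y$) $x\wedge y$ defined pointwise. A sublattice of $\mathbb K^S$ is a subspace $Y$ such that $x\in Y$ implies $|x|\in Y$. A sublattice $Y$ is called Stonean if additionally $x\wedge\mathbf 1\in Y$ for all real $x\in Y$, where $\mathbf 1$ is the constant function $1$. **Semigroups.** A semigroup $(T(t))_{t\geq0}$ on $\mathcal H_\Gamma$ (resp. on a sublattice $Y$ of $\mathbb K^S$) is positivity preserving (positive) if $T(t)f\geq0$ for all $f\geq0$ in the space and all $t\geq0$. It is submarkovian if it is positivity preserving and $\|T(t)f\|_\infty\leq\|f\|_\infty$ for all $t\geq0$ and all bounded $f$ in the space. *)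

theory Defs
  imports
    "HOL-Analysis.Analysis"
    "HOL-Probability.Essential_Supremum"
    "HOL-Library.Nonpos_Ints"
    "Graph_Theory.Digraph"
begin

text \<open>
  The scalar field is a set \<open>K\<close> of complex numbers, which the theorem takes to be either
  \<open>\<real>\<close> or \<open>UNIV\<close>; \<open>K\<close>-valued functions are complex functions with values in \<open>K\<close>.
\<close>

section \<open>Finite-dimensional function spaces\<close>

text \<open>
  \<open>KS K S\<close> is the space of \<open>K\<close>-valued functions on \<open>S\<close>, extended by \<open>0\<close> off \<open>S\<close>. Hence
  \<open>KS K S'\<close> with \<open>S' \<subseteq> S\<close> is literally a subspace of \<open>KS K S\<close>, and direct sums over disjoint
  index sets are internal.
\<close>

definition KS :: "complex set \<Rightarrow> 's set \<Rightarrow> ('s \<Rightarrow> complex) set" where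
  "KS K S = {x. (\<forall>s\<in>S. x s \<in> K) \<and> (\<forall>s. s \<notin> S \<longrightarrow> x s = 0)}"

definition subspace_of :: "complex set \<Rightarrow> ('s \<Rightarrow> complex) set \<Rightarrow> ('s \<Rightarrow> complex) set \<Rightarrow> bool" where
  "subspace_of K W Y \<longleftrightarrow> Y \<subseteq> W \<and> (\<lambda>_. 0) \<in> Y \<and>
     (\<forall>x\<in>Y. \<forall>y\<in>Y. (\<lambda>s. x s + y s) \<in> Y) \<and> (\<forall>c\<in>K. \<forall>x\<in>Y. (\<lambda>s. c * x s) \<in> Y)"

definition sublattice :: "complex set \<Rightarrow> 's set \<Rightarrow> ('s \<Rightarrow> complex) set \<Rightarrow> bool" where
  "sublattice K S Y \<longleftrightarrow> subspace_of K (KS K S) Y \<and>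
     (\<forall>x\<in>Y. (\<lambda>s. complex_of_real (cmod (x s))) \<in> Y)"

definition stonean_sublattice :: "complex set \<Rightarrow> 's set \<Rightarrow> ('s \<Rightarrow> complex) set \<Rightarrow> bool" where
  "stonean_sublattice K S Y \<longleftrightarrow> sublattice K S Y \<and>
     (\<forall>x\<in>Y. (\<forall>s\<in>S. x s \<in> \<real>) \<longrightarrow>
        (\<lambda>s. complex_of_real (min (Re (x s)) (indicator S s))) \<in> Y)"

text \<open>The operator exponential \<open>exp (t L)\<close>, for operators on finite-dimensional spaces only.\<close>

definition op_exp :: "(('s \<Rightarrow> complex) \<Rightarrow> 's \<Rightarrow> complex) \<Rightarrow> real \<Rightarrow> ('s \<Rightarrow> complex) \<Rightarrow> 's \<Rightarrow> complex" where
  "op_exp L t x = (\<lambda>s. \<Sum>n. complex_of_real (t ^ n / fact n) * (L ^^ n) x s)"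

definition nonneg_on :: "'s set \<Rightarrow> ('s \<Rightarrow> complex) \<Rightarrow> bool" where
  "nonneg_on S x \<longleftrightarrow> (\<forall>s\<in>S. x s \<in> \<real>\<^sub>\<ge>\<^sub>0)"

definition sup_norm_on :: "'s set \<Rightarrow> ('s \<Rightarrow> complex) \<Rightarrow> ennreal" where
  "sup_norm_on S x = (SUP s\<in>S. ennreal (cmod (x s)))"

text \<open>
  The next two notions are used both on subspaces of \<open>KS K S\<close> and on the Hilbert space of a network,
  with the respective cone (\<open>pos\<close>) and sup-norm (\<open>nrm\<close>, with value \<open>\<infinity>\<close> for unbounded elements).
\<close>

definition positivity_preserving ::
  "'f set \<Rightarrow> ('f \<Rightarrow> bool) \<Rightarrow> (real \<Rightarrow> 'f \<Rightarrow> 'f) \<Rightarrow> bool" where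
  "positivity_preserving Y pos T \<longleftrightarrow> (\<forall>t\<ge>0. \<forall>f\<in>Y. pos f \<longrightarrow> pos (T t f))"

definition submarkovian ::
  "'f set \<Rightarrow> ('f \<Rightarrow> bool) \<Rightarrow> ('f \<Rightarrow> ennreal) \<Rightarrow> (real \<Rightarrow> 'f \<Rightarrow> 'f) \<Rightarrow> bool" where
  "submarkovian Y pos nrm T \<longleftrightarrow> positivity_preserving Y pos T \<and>
     (\<forall>t\<ge>0. \<forall>f\<in>Y. nrm f < \<infinity> \<longrightarrow> nrm (T t f) \<le> nrm f)"

section \<open>Function spaces on an interval\<close>

definition L2 :: "complex set \<Rightarrow> 'a measure \<Rightarrow> ('a \<Rightarrow> complex) set" where
  "L2 K M = {f \<in> borel_measurable M. (\<forall>x\<in>space M. f x \<in> K) \<and> integrable M (\<lambda>x. (cmod (f x))\<^sup>2)}"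

abbreviation leb :: "real \<Rightarrow> real \<Rightarrow> real measure" where
  "leb a b \<equiv> restrict_space lborel {a<..<b}"

text \<open>Weak derivatives are tested against compactly supported \<open>C\<^sup>1\<close>-functions on \<open>(a, b)\<close>.\<close>

definition test_fun :: "real \<Rightarrow> real \<Rightarrow> (real \<Rightarrow> real) \<Rightarrow> bool" where
  "test_fun a b \<phi> \<longleftrightarrow> \<phi> C1_differentiable_on UNIV \<and> closure {x. \<phi> x \<noteq> 0} \<subseteq> {a<..<b}"

definition is_weak_deriv :: "real \<Rightarrow> real \<Rightarrow> (real \<Rightarrow> complex) \<Rightarrow> (real \<Rightarrow> complex) \<Rightarrow> bool" where
  "is_weak_deriv a b f g \<longleftrightarrow> (\<forall>\<phi>. test_fun a b \<phi> \<longrightarrow>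
     (LINT x|leb a b. f x * complex_of_real (deriv \<phi> x)) = - (LINT x|leb a b. g x * complex_of_real (\<phi> x)))"

definition W12 :: "complex set \<Rightarrow> real \<Rightarrow> real \<Rightarrow> (real \<Rightarrow> complex) set" where
  "W12 K a b = {f \<in> L2 K (leb a b). \<exists>g \<in> L2 K (leb a b). is_weak_deriv a b f g}"

text \<open>Unique up to Lebesgue null sets.\<close>

definition weak_deriv :: "complex set \<Rightarrow> real \<Rightarrow> real \<Rightarrow> (real \<Rightarrow> complex) \<Rightarrow> real \<Rightarrow> complex" where
  "weak_deriv K a b f = (SOME g. g \<in> L2 K (leb a b) \<and> is_weak_deriv a b f g)"

definition Cont :: "complex set \<Rightarrow> real \<Rightarrow> real \<Rightarrow> (real \<Rightarrow> complex) set" where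
  "Cont K a b = {f. continuous_on {a..b} f \<and> (\<forall>x\<in>{a..b}. f x \<in> K)}"

definition spt :: "'a::topological_space measure \<Rightarrow> 'a set" where
  "spt M = {x \<in> space M. \<forall>U. open U \<and> x \<in> U \<longrightarrow> emeasure M (U \<inter> space M) \<noteq> 0}"

definition Cont_mu :: "complex set \<Rightarrow> real \<Rightarrow> real \<Rightarrow> real measure \<Rightarrow> (real \<Rightarrow> complex) set" where
  "Cont_mu K a b M = {f \<in> Cont K a b.
     \<forall>C\<in>components ({a..b} - spt M). \<exists>p q. \<forall>x\<in>C. f x = p * complex_of_real x + q}"

definition W12_mu :: "complex set \<Rightarrow> real \<Rightarrow> real \<Rightarrow> real measure \<Rightarrow> (real \<Rightarrow> complex) set" where
  "W12_mu K a b M = W12 K a b \<inter> Cont_mu K a b M"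

definition dom_iota_edge :: "complex set \<Rightarrow> real \<Rightarrow> real \<Rightarrow> real measure \<Rightarrow> (real \<Rightarrow> complex) set" where
  "dom_iota_edge K a b M = {f \<in> L2 K M. \<exists>g \<in> W12 K a b \<inter> Cont K a b. AE x in M. g x = f x}"

text \<open>The values on \<open>[a, b]\<close> are uniquely determined; those outside \<open>[a, b]\<close> play no role.\<close>

definition iota_edge ::
  "complex set \<Rightarrow> real \<Rightarrow> real \<Rightarrow> real measure \<Rightarrow> (real \<Rightarrow> complex) \<Rightarrow> real \<Rightarrow> complex" where
  "iota_edge K a b M f = (SOME g. g \<in> W12_mu K a b M \<and> (AE x in M. g x = f x))"

section \<open>Networks\<close>

text \<open>
  In \<^locale>\<open>fin_digraph\<close> loops and multiple arcs are allowed; the starting vertex of an arc is its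
  \<^const>\<open>tail\<close>, the end vertex its \<^const>\<open>head\<close>. Vertices and edges are disjoint by typing.
\<close>

record ('v, 'e) network =
  graph :: "('v, 'e) pre_digraph"
  lft :: "'e \<Rightarrow> real"
  rgt :: "'e \<Rightarrow> real"
  emeas :: "'e \<Rightarrow> real measure"
  vweight :: "'v \<Rightarrow> real"

definition V1 :: "('v, 'e) network \<Rightarrow> 'v set" where
  "V1 N = {v \<in> verts (graph N). vweight N v \<noteq> 0}"

definition E1 :: "('v, 'e) network \<Rightarrow> 'e set" where
  "E1 N = {e \<in> arcs (graph N). emeas N e \<noteq> null_measure (emeas N e)}"

locale weighted_network = fin_digraph "graph N" for N :: "('v, 'e) network" +
  assumes lft_less_rgt: "e \<in> arcs (graph N) \<Longrightarrow> lft N e < rgt N e"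
    and finite_emeas: "e \<in> arcs (graph N) \<Longrightarrow> finite_measure (emeas N e)"
    and sets_emeas: "e \<in> arcs (graph N) \<Longrightarrow>
          sets (emeas N e) = sets (restrict_space borel {lft N e..rgt N e})"
    and ends_in_spt: "e \<in> E1 N \<Longrightarrow> {lft N e, rgt N e} \<subseteq> spt (emeas N e)"
    and ends_null: "e \<in> E1 N \<Longrightarrow> emeasure (emeas N e) {lft N e, rgt N e} = 0"
    and vweight_nonneg: "v \<in> verts (graph N) \<Longrightarrow> vweight N v \<ge> 0"

section \<open>The Hilbert space\<close>

text \<open>
  Elements are represented by functions \<open>f\<close> on the disjoint union of intervals and vertices:
  \<open>f (Inl (e, x))\<close> is the value of \<open>f\<^sub>e\<close> at \<open>x\<close>, and \<open>f (Inr v)\<close> is \<open>f\<^sub>v\<close>. Representatives at distance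
  \<open>0\<close> are identified; this disregards \<open>\<mu>\<^sub>e\<close>-null sets and all values off \<open>E\<^sub>1\<close> and \<open>V\<^sub>1\<close>.
\<close>

type_synonym ('v, 'e) gfun = "('e \<times> real) + 'v \<Rightarrow> complex"

abbreviation edge_part :: "('v, 'e) gfun \<Rightarrow> 'e \<Rightarrow> real \<Rightarrow> complex" where
  "edge_part f e \<equiv> (\<lambda>x. f (Inl (e, x)))"

definition HS :: "complex set \<Rightarrow> ('v, 'e) network \<Rightarrow> ('v, 'e) gfun set" where
  "HS K N = {f. (\<forall>e\<in>E1 N. edge_part f e \<in> L2 K (emeas N e)) \<and> (\<forall>v\<in>V1 N. f (Inr v) \<in> K)}"

definition hinner :: "('v, 'e) network \<Rightarrow> ('v, 'e) gfun \<Rightarrow> ('v, 'e) gfun \<Rightarrow> complex" where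
  "hinner N f g =
     (\<Sum>e\<in>E1 N. LINT x|emeas N e. edge_part f e x * cnj (edge_part g e x)) +
     (\<Sum>v\<in>V1 N. f (Inr v) * cnj (g (Inr v)) * complex_of_real (vweight N v))"

definition hdist :: "('v, 'e) network \<Rightarrow> ('v, 'e) gfun \<Rightarrow> ('v, 'e) gfun \<Rightarrow> real" where
  "hdist N f g = sqrt (Re (hinner N (\<lambda>p. f p - g p) (\<lambda>p. f p - g p)))"

abbreviation hnorm :: "('v, 'e) network \<Rightarrow> ('v, 'e) gfun \<Rightarrow> real" where
  "hnorm N f \<equiv> hdist N f (\<lambda>_. 0)"

definition hnonneg :: "('v, 'e) network \<Rightarrow> ('v, 'e) gfun \<Rightarrow> bool" where
  "hnonneg N f \<longleftrightarrow> (\<forall>e\<in>E1 N. AE x in emeas N e. edge_part f e x \<in> \<real>\<^sub>\<ge>\<^sub>0) \<and>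
     (\<forall>v\<in>V1 N. f (Inr v) \<in> \<real>\<^sub>\<ge>\<^sub>0)"

definition hsup_norm :: "('v, 'e) network \<Rightarrow> ('v, 'e) gfun \<Rightarrow> ennreal" where
  "hsup_norm N f = max
     (SUP e\<in>E1 N. esssup (emeas N e) (\<lambda>x. ennreal (cmod (edge_part f e x))))
     (SUP v\<in>V1 N. ennreal (cmod (f (Inr v))))"

definition C0_semigroup ::
  "complex set \<Rightarrow> ('v, 'e) network \<Rightarrow> (real \<Rightarrow> ('v, 'e) gfun \<Rightarrow> ('v, 'e) gfun) \<Rightarrow> bool" where
  "C0_semigroup K N T \<longleftrightarrow>
     (\<forall>t\<ge>0. \<forall>f\<in>HS K N. T t f \<in> HS K N) \<and>
     (\<forall>t\<ge>0. \<forall>c\<in>K. \<forall>f\<in>HS K N. \<forall>g\<in>HS K N.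
        hdist N (T t (\<lambda>p. c * f p + g p)) (\<lambda>p. c * T t f p + T t g p) = 0) \<and>
     (\<forall>t\<ge>0. \<exists>B. \<forall>f\<in>HS K N. hnorm N (T t f) \<le> B * hnorm N f) \<and>
     (\<forall>f\<in>HS K N. hdist N (T 0 f) f = 0) \<and>
     (\<forall>s\<ge>0. \<forall>t\<ge>0. \<forall>f\<in>HS K N. hdist N (T (s + t) f) (T s (T t f)) = 0) \<and>
     (\<forall>f\<in>HS K N. ((\<lambda>t. hdist N (T t f) f) \<longlongrightarrow> 0) (at_right 0))"

text \<open>
  Operators in the Hilbert space are given by their graphs, invariant under the identification
  of representatives.
\<close>

type_synonym ('v, 'e) hop = "(('v, 'e) gfun \<times> ('v, 'e) gfun) set"

definition generator ::
  "complex set \<Rightarrow> ('v, 'e) network \<Rightarrow> (real \<Rightarrow> ('v, 'e) gfun \<Rightarrow> ('v, 'e) gfun) \<Rightarrow> ('v, 'e) hop" where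
  "generator K N T = {(f, h). f \<in> HS K N \<and> h \<in> HS K N \<and>
     ((\<lambda>t. hdist N (\<lambda>p. (T t f p - f p) / complex_of_real t) h) \<longlongrightarrow> 0) (at_right 0)}"

definition neg_op :: "('v, 'e) hop \<Rightarrow> ('v, 'e) hop" where
  "neg_op A = {(f, \<lambda>p. - h p) | f h. (f, h) \<in> A}"

definition generated_semigroup ::
  "complex set \<Rightarrow> ('v, 'e) network \<Rightarrow> ('v, 'e) hop \<Rightarrow> (real \<Rightarrow> ('v, 'e) gfun \<Rightarrow> ('v, 'e) gfun) \<Rightarrow> bool" where
  "generated_semigroup K N A T \<longleftrightarrow> C0_semigroup K N T \<and> generator K N T = A"

section \<open>Boundary values and the form\<close>

text \<open>
  \<open>Inl (e, 0)\<close> and \<open>Inl (e, 1)\<close> stand for the left and the right end point of the edge \<open>e\<close>.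
\<close>

type_synonym ('v, 'e) bvec = "('e \<times> nat) + 'v \<Rightarrow> complex"

definition bd_index :: "('v, 'e) network \<Rightarrow> (('e \<times> nat) + 'v) set" where
  "bd_index N = (E1 N \<times> {0, 1}) <+> V1 N"

definition E1_at :: "('v, 'e) network \<Rightarrow> 'v \<Rightarrow> ('e \<times> nat) set" where
  "E1_at N v = ({e \<in> E1 N. tail (graph N) e = v} \<times> {0}) \<union> ({e \<in> E1 N. head (graph N) e = v} \<times> {1})"

definition bd_index_at :: "('v, 'e) network \<Rightarrow> 'v \<Rightarrow> (('e \<times> nat) + 'v) set" where
  "bd_index_at N v = E1_at N v <+> (if v \<in> V1 N then {v} else {})"

definition binner :: "('v, 'e) network \<Rightarrow> ('v, 'e) bvec \<Rightarrow> ('v, 'e) bvec \<Rightarrow> complex" where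
  "binner N \<xi> \<eta> = (\<Sum>p\<in>E1 N \<times> {0, 1}. \<xi> (Inl p) * cnj (\<eta> (Inl p))) +
     (\<Sum>v\<in>V1 N. \<xi> (Inr v) * cnj (\<eta> (Inr v)) * complex_of_real (vweight N v))"

definition selfadjoint_in ::
  "complex set \<Rightarrow> ('v, 'e) network \<Rightarrow> ('v, 'e) bvec set \<Rightarrow> (('v, 'e) bvec \<Rightarrow> ('v, 'e) bvec) \<Rightarrow> bool" where
  "selfadjoint_in K N X L \<longleftrightarrow> L ` X \<subseteq> X \<and>
     (\<forall>x\<in>X. \<forall>y\<in>X. L (\<lambda>i. x i + y i) = (\<lambda>i. L x i + L y i)) \<and>
     (\<forall>c\<in>K. \<forall>x\<in>X. L (\<lambda>i. c * x i) = (\<lambda>i. c * L x i)) \<and>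
     (\<forall>x\<in>X. \<forall>y\<in>X. binner N (L x) y = binner N x (L y))"

definition btrace :: "('v, 'e) network \<Rightarrow> ('v, 'e) gfun \<Rightarrow> ('v, 'e) bvec" where
  "btrace N f = (\<lambda>i. if i \<in> bd_index N
     then (case i of Inl (e, j) \<Rightarrow> f (Inl (e, if j = 0 then lft N e else rgt N e)) | Inr v \<Rightarrow> f (Inr v))
     else 0)"

definition dom_iota :: "complex set \<Rightarrow> ('v, 'e) network \<Rightarrow> ('v, 'e) gfun set" where
  "dom_iota K N = {f \<in> HS K N.
     \<forall>e\<in>E1 N. edge_part f e \<in> dom_iota_edge K (lft N e) (rgt N e) (emeas N e)}"

definition iota :: "complex set \<Rightarrow> ('v, 'e) network \<Rightarrow> ('v, 'e) gfun \<Rightarrow> ('v, 'e) gfun" where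
  "iota K N f = (\<lambda>p. case p of
     Inl (e, x) \<Rightarrow> iota_edge K (lft N e) (rgt N e) (emeas N e) (edge_part f e) x
   | Inr v \<Rightarrow> f (Inr v))"

definition dom_tau :: "complex set \<Rightarrow> ('v, 'e) network \<Rightarrow> ('v, 'e) bvec set \<Rightarrow> ('v, 'e) gfun set" where
  "dom_tau K N X = {f \<in> dom_iota K N. btrace N (iota K N f) \<in> X}"

definition tau :: "complex set \<Rightarrow> ('v, 'e) network \<Rightarrow> (('v, 'e) bvec \<Rightarrow> ('v, 'e) bvec) \<Rightarrow>
    ('v, 'e) gfun \<Rightarrow> ('v, 'e) gfun \<Rightarrow> complex" where
  "tau K N L f g =
     (\<Sum>e\<in>E1 N. LINT x|leb (lft N e) (rgt N e).
        weak_deriv K (lft N e) (rgt N e) (edge_part (iota K N f) e) x *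
        cnj (weak_deriv K (lft N e) (rgt N e) (edge_part (iota K N g) e) x)) +
     binner N (L (btrace N (iota K N f))) (btrace N (iota K N g))"

definition form_operator :: "complex set \<Rightarrow> ('v, 'e) network \<Rightarrow> ('v, 'e) bvec set \<Rightarrow>
    (('v, 'e) bvec \<Rightarrow> ('v, 'e) bvec) \<Rightarrow> ('v, 'e) hop" where
  "form_operator K N X L = {(f, h). f \<in> dom_tau K N X \<and> h \<in> HS K N \<and>
     (\<forall>g\<in>dom_tau K N X. tau K N L f g = hinner N h g)}"

definition local_bc :: "complex set \<Rightarrow> ('v, 'e) network \<Rightarrow>
    ('v, 'e) bvec set \<Rightarrow> (('v, 'e) bvec \<Rightarrow> ('v, 'e) bvec) \<Rightarrow>
    ('v \<Rightarrow> ('v, 'e) bvec set) \<Rightarrow> ('v \<Rightarrow> ('v, 'e) bvec \<Rightarrow> ('v, 'e) bvec) \<Rightarrow> bool" where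
  "local_bc K N X L Xv Lv \<longleftrightarrow>
     (\<forall>v\<in>verts (graph N). subspace_of K (KS K (bd_index_at N v)) (Xv v) \<and> selfadjoint_in K N (Xv v) (Lv v)) \<and>
     X = {\<lambda>i. \<Sum>v\<in>verts (graph N). x v i | x. \<forall>v\<in>verts (graph N). x v \<in> Xv v} \<and>
     (\<forall>x. (\<forall>v\<in>verts (graph N). x v \<in> Xv v) \<longrightarrow>
        L (\<lambda>i. \<Sum>v\<in>verts (graph N). x v i) = (\<lambda>i. \<Sum>v\<in>verts (graph N). Lv v (x v) i))"

end

theory Submission imports Defs "HOL-Library.Function_Algebras" begin

text \<open>
  A closed convex set is invariant under the semigroup of a form \<open>\<tau>\<close> if its nearest-point projection \<open>P\<close>
  maps \<open>D(\<tau>)\<close> to itself and \<open>Re \<tau>(f, f - P f) \<ge> - \<omega> \<parallel>f - P f\<parallel>\<^sup>2\<close>: by a Gronwall argument the squared distance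
  to the set then grows at most by the factor \<open>exp (2 \<omega> t)\<close> along the semigroup. Here \<open>P\<close> acts pointwise, as
  the positive part for positivity, and as the projection onto a disc of radius \<open>r\<close> for the sup-norm bound.
  On an edge, \<open>P\<close> is firmly nonexpansive, so \<open>P \<circ> f\<close> has an \<open>L\<^sub>2\<close>-derivative, and since the derivative of
  \<open>\<iota> f\<close> is orthogonal to the derivatives of the Sobolev functions vanishing on \<open>spt \<mu>\<close>, passing from
  \<open>P \<circ> \<iota> f\<close> to \<open>\<iota> (P \<circ> f)\<close> does not change the form. The boundary term
  splits over the vertices, where the invariance of the disc or cone under \<open>exp (-t L\<^sub>v)\<close> is differentiated
  at \<open>t = 0\<close>; the rest is absorbed by the trace inequality.
\<close>

text \<open>Vectors are representatives, not classes, so the Hilbert space theory is built for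
  positive semidefinite forms on sets of functions, and equality becomes
  \<open>nrm (x - y) = 0\<close>. It is built over the reals, with the real part of the scalar
  product, which treats both scalar fields at once; \<open>K\<close>-linearity of the semigroup
  returns at the end, because multiplication by a scalar of modulus at most 1 commutes with the
  resolvents. The conclusion concerns every \<open>T\<close> with the given generator, so invariance
  may use only the semigroup laws and the generator, while existence is a separate construction from
  dyadic powers of resolvents. The constant \<open>\<omega>\<close> enters because \<open>L\<close>
  has no sign: for a boundary vector \<open>x\<close>, its projection \<open>y\<close> and
  \<open>d = x - y\<close>, local invariance gives \<open>Re (L y | d) \<ge> 0\<close>, but
  \<open>(L d | d)\<close> can be negative and is paid for by half of the derivative energy of
  \<open>u - P u\<close> and a multiple of the squared distance. The radial projection onto a disc
  is not a lattice operation; Stonean sublattices of finite-dimensional function spaces still admit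
  it, since they are closed under all pointwise maps that fix 0.\<close>

instantiation "fun" :: (type, real_vector) real_vector
begin
definition scaleR_fun_def: "r *\<^sub>R f = (\<lambda>x. r *\<^sub>R f x)"
instance by standard (auto simp: scaleR_fun_def fun_eq_iff algebra_simps)
end

section \<open>Semi-inner products\<close>

locale semi_inner =
 fixes H :: "'a::real_vector set" and ip :: "'a \<Rightarrow> 'a \<Rightarrow> real"
 assumes subspace_H: "subspace H"
  and ip_sym: "x \<in> H \<Longrightarrow> y \<in> H \<Longrightarrow> ip x y = ip y x"
  and ip_add: "x \<in> H \<Longrightarrow> y \<in> H \<Longrightarrow> z \<in> H \<Longrightarrow> ip (x + y) z = ip x z + ip y z"
  and ip_scale: "x \<in> H \<Longrightarrow> y \<in> H \<Longrightarrow> ip (r *\<^sub>R x) y = r * ip x y"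
  and ip_pos: "x \<in> H \<Longrightarrow> 0 \<le> ip x x"
begin

definition nrm :: "'a \<Rightarrow> real" where "nrm x = sqrt (ip x x)"

definition cau :: "(nat \<Rightarrow> 'a) \<Rightarrow> bool" where
 "cau x \<longleftrightarrow> (\<forall>e>0. \<exists>M. \<forall>m\<ge>M. \<forall>n\<ge>M. nrm (x m - x n) < e)"

lemma mem [simp]:
 "0 \<in> H" "x \<in> H \<Longrightarrow> y \<in> H \<Longrightarrow> x + y \<in> H" "x \<in> H \<Longrightarrow> y \<in> H \<Longrightarrow> x - y \<in> H"
 "x \<in> H \<Longrightarrow> r *\<^sub>R x \<in> H" "x \<in> H \<Longrightarrow> - x \<in> H"
 using subspace_H by (auto simp: subspace_0 subspace_add subspace_diff subspace_scale subspace_neg)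

lemma ip_add_right: "x \<in> H \<Longrightarrow> y \<in> H \<Longrightarrow> z \<in> H \<Longrightarrow> ip z (x + y) = ip z x + ip z y"
 by (metis ip_add ip_sym mem(2))

lemma ip_scale_right: "x \<in> H \<Longrightarrow> y \<in> H \<Longrightarrow> ip x (r *\<^sub>R y) = r * ip x y"
 by (metis ip_scale ip_sym mem(4))

lemma ip_minus: "x \<in> H \<Longrightarrow> y \<in> H \<Longrightarrow> ip (- x) y = - ip x y"
 using ip_scale[of x y "-1"] by simp

lemma ip_minus_right: "x \<in> H \<Longrightarrow> y \<in> H \<Longrightarrow> ip x (- y) = - ip x y"
 using ip_scale_right[of x y "-1"] by simp

lemma ip_diff: "x \<in> H \<Longrightarrow> y \<in> H \<Longrightarrow> z \<in> H \<Longrightarrow> ip (x - y) z = ip x z - ip y z"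
 using ip_add[of x "- y" z] by (simp add: ip_minus)

lemma ip_diff_right: "x \<in> H \<Longrightarrow> y \<in> H \<Longrightarrow> z \<in> H \<Longrightarrow> ip z (x - y) = ip z x - ip z y"
 using ip_add_right[of x "- y" z] by (simp add: ip_minus_right)

lemma ip_zero [simp]: "x \<in> H \<Longrightarrow> ip 0 x = 0" "x \<in> H \<Longrightarrow> ip x 0 = 0"
 using ip_scale[of x x 0] ip_scale_right[of x x 0] by auto

lemmas ip_lin = ip_add ip_add_right ip_scale ip_scale_right ip_diff ip_diff_right ip_minus ip_minus_right

lemma nrm_sq: "x \<in> H \<Longrightarrow> (nrm x)\<^sup>2 = ip x x"
 by (simp add: nrm_def ip_pos)

lemma nrm_nonneg [simp]: "x \<in> H \<Longrightarrow> 0 \<le> nrm x"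
 by (simp add: nrm_def ip_pos)

lemma nrm_zero [simp]: "nrm 0 = 0"
 by (simp add: nrm_def)

lemma ip_le_nrm:
 assumes "x \<in> H" "y \<in> H" shows "\<bar>ip x y\<bar> \<le> nrm x * nrm y"
proof -
 have q: "0 \<le> ip x x + 2 * t * ip x y + t\<^sup>2 * ip y y" for t
  using ip_pos[of "x + t *\<^sub>R y"] assms ip_sym[of y x] by (simp add: ip_lin algebra_simps power2_eq_square)
 have "(ip x y)\<^sup>2 \<le> ip x x * ip y y"
 proof (cases "ip y y = 0")
  case True
  have "ip x y = 0"
  proof (rule ccontr)
   assume n: "ip x y \<noteq> 0"
   \<comment> \<open>This value of \<open>t\<close> makes the right-hand side equal to -1.\<close>
   have "0 \<le> ip x x + 2 * (- (ip x x + 1) / (2 * ip x y)) * ip x y"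
    using q[of "- (ip x x + 1) / (2 * ip x y)"] True by simp
   then show False using n by (simp add: field_simps)
  qed
  then show ?thesis using True by simp
 next
  case False
  then have p: "ip y y > 0" using ip_pos assms by fastforce
  have "0 \<le> ip x x + 2 * (- ip x y / ip y y) * ip x y + (- ip x y / ip y y)\<^sup>2 * ip y y"
   using q by blast
  also have "\<dots> = ip x x - (ip x y)\<^sup>2 / ip y y"
   using p by (simp add: field_simps power2_eq_square)
  finally show ?thesis using p by (simp add: field_simps)
 qed
 then have "sqrt ((ip x y)\<^sup>2) \<le> sqrt (ip x x * ip y y)" by (rule real_sqrt_le_mono)
 then show ?thesis by (simp add: nrm_def real_sqrt_mult)
qed

lemma nrm_triangle:
 assumes "x \<in> H" "y \<in> H" shows "nrm (x + y) \<le> nrm x + nrm y"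
proof (rule power2_le_imp_le)
 have "(nrm (x + y))\<^sup>2 = ip x x + 2 * ip x y + ip y y"
  using assms ip_sym[of y x] by (simp add: nrm_sq ip_lin)
 also have "\<dots> \<le> (nrm x)\<^sup>2 + 2 * (nrm x * nrm y) + (nrm y)\<^sup>2"
  using ip_le_nrm[OF assms] assms by (simp add: nrm_sq)
 finally show "(nrm (x + y))\<^sup>2 \<le> (nrm x + nrm y)\<^sup>2" by (simp add: power2_sum)
qed (use assms in simp)

lemma nrm_scale: "x \<in> H \<Longrightarrow> nrm (r *\<^sub>R x) = \<bar>r\<bar> * nrm x"
 by (simp add: nrm_def ip_lin real_sqrt_mult power2_eq_square[symmetric] mult.assoc[symmetric])

lemma nrm_minus [simp]: "x \<in> H \<Longrightarrow> nrm (- x) = nrm x"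
 using nrm_scale[of x "-1"] by simp

lemma nrm_diff_commute: "x \<in> H \<Longrightarrow> y \<in> H \<Longrightarrow> nrm (x - y) = nrm (y - x)"
 using nrm_minus[of "x - y"] by simp

lemma nrm_diff_triangle:
 "x \<in> H \<Longrightarrow> y \<in> H \<Longrightarrow> z \<in> H \<Longrightarrow> nrm (x - z) \<le> nrm (x - y) + nrm (y - z)"
 using nrm_triangle[of "x - y" "y - z"] by simp

lemma nrm_le_add: "x \<in> H \<Longrightarrow> y \<in> H \<Longrightarrow> nrm x \<le> nrm (x - y) + nrm y"
 using nrm_triangle[of "x - y" y] by simp

lemma nrm_add_diff:
 "x \<in> H \<Longrightarrow> y \<in> H \<Longrightarrow> x' \<in> H \<Longrightarrow> y' \<in> H \<Longrightarrow> nrm ((x + y) - (x' + y')) \<le> nrm (x - x') + nrm (y - y')"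
 using nrm_triangle[of "x - x'" "y - y'"] by (simp add: algebra_simps)

lemma nrm_diff_diff:
 "x \<in> H \<Longrightarrow> y \<in> H \<Longrightarrow> \<bar>nrm x - nrm y\<bar> \<le> nrm (x - y)"
 using nrm_le_add[of x y] nrm_le_add[of y x] nrm_diff_commute[of x y] by simp

lemma nrm_cong: "x \<in> H \<Longrightarrow> y \<in> H \<Longrightarrow> nrm (x - y) = 0 \<Longrightarrow> nrm x = nrm y"
 using nrm_diff_diff[of x y] by simp

lemma ip_null: "d \<in> H \<Longrightarrow> z \<in> H \<Longrightarrow> nrm d = 0 \<Longrightarrow> ip d z = 0"
 using ip_le_nrm[of d z] by simp

lemma ip_cong: "x \<in> H \<Longrightarrow> y \<in> H \<Longrightarrow> z \<in> H \<Longrightarrow> nrm (x - y) = 0 \<Longrightarrow> ip x z = ip y z"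
 using ip_null[of "x - y" z] by (simp add: ip_lin)

lemma null_trans:
 "x \<in> H \<Longrightarrow> y \<in> H \<Longrightarrow> z \<in> H \<Longrightarrow> nrm (x - y) = 0 \<Longrightarrow> nrm (y - z) = 0 \<Longrightarrow> nrm (x - z) = 0"
 using nrm_diff_triangle[of x y z] nrm_nonneg[of "x - z"] by (simp del: nrm_nonneg)

lemma tendsto_ip:
 assumes "((\<lambda>i. nrm (x i - y)) \<longlongrightarrow> 0) F" "\<And>i. x i \<in> H" "y \<in> H" "z \<in> H"
 shows "((\<lambda>i. ip (x i) z) \<longlongrightarrow> ip y z) F"
proof -
 have "((\<lambda>i. ip (x i) z - ip y z) \<longlongrightarrow> 0) F"
 proof (rule Lim_null_comparison)
  show "\<forall>\<^sub>F i in F. norm (ip (x i) z - ip y z) \<le> nrm (x i - y) * nrm z"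
   using ip_le_nrm[of "x _ - y" z] assms by (simp add: ip_lin)
  show "((\<lambda>i. nrm (x i - y) * nrm z) \<longlongrightarrow> 0) F"
   using assms(1) by (rule tendsto_mult_left_zero)
 qed
 then show ?thesis using Lim_null by blast
qed

lemma tendsto_nrm:
 assumes "((\<lambda>i. nrm (x i - y)) \<longlongrightarrow> 0) F" "\<And>i. x i \<in> H" "y \<in> H"
 shows "((\<lambda>i. nrm (x i)) \<longlongrightarrow> nrm y) F"
proof -
 have "((\<lambda>i. nrm (x i) - nrm y) \<longlongrightarrow> 0) F"
  by (rule Lim_null_comparison[OF _ assms(1)]) (use nrm_diff_diff assms in simp)
 then show ?thesis using Lim_null by blast
qed

lemma limit_unique:
 assumes "((\<lambda>i. nrm (x i - y)) \<longlongrightarrow> 0) F" "((\<lambda>i. nrm (x i - z)) \<longlongrightarrow> 0) F"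
  "\<And>i. x i \<in> H" "y \<in> H" "z \<in> H" "F \<noteq> bot"
 shows "nrm (y - z) = 0"
proof -
 have "((\<lambda>i. nrm (x i - y) + nrm (x i - z)) \<longlongrightarrow> 0) F"
  using tendsto_add[OF assms(1,2)] by simp
 moreover have "nrm (y - z) \<le> nrm (x i - y) + nrm (x i - z)" for i
  using nrm_diff_triangle[of y "x i" z] assms(3-5) nrm_diff_commute[of y "x i"] by simp
 ultimately have "nrm (y - z) \<le> 0"
  by (intro tendsto_lowerbound[of _ 0 F]) (auto simp: assms(6))
 then show ?thesis using assms by (metis mem(3) nrm_nonneg order_antisym)
qed

lemma convergent_cau:
 assumes "(\<lambda>n. nrm (x n - y)) \<longlonglongrightarrow> 0" "\<And>n. x n \<in> H" "y \<in> H"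
 shows "cau x"
 unfolding cau_def
proof (intro allI impI)
 fix e :: real assume "e > 0"
 then obtain M where M: "\<And>n. n \<ge> M \<Longrightarrow> \<bar>nrm (x n - y)\<bar> < e / 2"
  using LIMSEQ_D[OF assms(1), of "e/2"] by auto
 have "nrm (x m - x n) < e" if "m \<ge> M" "n \<ge> M" for m n
  using nrm_diff_triangle[of "x m" y "x n"] nrm_diff_commute[of y "x n"] M[OF that(1)] M[OF that(2)] assms(2,3)
  by simp
 then show "\<exists>M. \<forall>m\<ge>M. \<forall>n\<ge>M. nrm (x m - x n) < e" by blast
qed

text \<open>Minimises the quadratic functional \<open>ip v v - 2 * l v\<close>.\<close>

lemma riesz_sequence:
 assumes add: "\<And>x y. x \<in> H \<Longrightarrow> y \<in> H \<Longrightarrow> l (x + y) = l x + l y"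
  and scale: "\<And>x r. x \<in> H \<Longrightarrow> l (r *\<^sub>R x) = r * l x"
  and bound: "\<And>x. x \<in> H \<Longrightarrow> \<bar>l x\<bar> \<le> C * nrm x"
 shows "\<exists>v. (\<forall>n. v n \<in> H) \<and> cau v \<and> (\<forall>w\<in>H. (\<lambda>n. ip (v n) w) \<longlonglongrightarrow> l w)"
proof -
 define F where "F v = ip v v - 2 * l v" for v
 define m where "m = Inf (F ` H)"
 have lb: "- C\<^sup>2 \<le> F v" if "v \<in> H" for v
 proof -
  have "0 \<le> (nrm v - C)\<^sup>2" by simp
  then have "- C\<^sup>2 \<le> (nrm v)\<^sup>2 - 2 * (C * nrm v)" by (simp add: power2_diff algebra_simps)
  also have "\<dots> \<le> F v" using bound[OF that] that by (simp add: F_def nrm_sq)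
  finally show ?thesis .
 qed
 then have bdd: "bdd_below (F ` H)" by (auto intro!: bdd_belowI2)
 have mF: "m \<le> F v" if "v \<in> H" for v
  unfolding m_def using that by (intro cInf_lower bdd) auto
 have "\<exists>v\<in>H. F v < m + 1 / (real n + 1)" for n
 proof -
  have "Inf (F ` H) < m + 1 / (real n + 1)" by (simp add: m_def)
  then show ?thesis using cInf_less_iff[OF _ bdd] mem(1) by blast
 qed
 then obtain v where v: "\<And>n. v n \<in> H" "\<And>n. F (v n) < m + 1 / (real n + 1)" by metis
 \<comment> \<open>If \<open>u\<close> minimises \<open>F\<close> up to \<open>e\<close>, the
   quadratic polynomial obtained along \<open>u + t *\<^sub>R w\<close> stays nonnegative although
   its constant term is only \<open>e\<close>. Its discriminant then bounds
   \<open>ip u w - l w\<close>: almost minimisers almost represent \<open>l\<close>.\<close>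
 have ineq: "(ip u w - l w)\<^sup>2 \<le> e * ip w w" if "u \<in> H" "w \<in> H" "F u \<le> m + e" "e > 0" for u w e
 proof -
  have q: "0 \<le> e + 2 * t * (ip u w - l w) + t\<^sup>2 * ip w w" for t
   using mF[of "u + t *\<^sub>R w"] that ip_sym[of w u]
   by (simp add: F_def ip_lin add scale algebra_simps power2_eq_square)
  show ?thesis
  proof (cases "ip w w = 0")
   case True
   have "ip u w - l w = 0"
   proof (rule ccontr)
    assume n: "ip u w - l w \<noteq> 0"
    have "0 \<le> e + 2 * (- e / (ip u w - l w)) * (ip u w - l w)"
     using q[of "- e / (ip u w - l w)"] True by simp
    then show False using n that by simp
   qed
   then show ?thesis using True by simp
  next
   case False
   then have p: "ip w w > 0" using ip_pos that by fastforce
   have "0 \<le> e + 2 * (- (ip u w - l w) / ip w w) * (ip u w - l w) + (- (ip u w - l w) / ip w w)\<^sup>2 * ip w w"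
    using q by blast
   also have "\<dots> = e - (ip u w - l w)\<^sup>2 / ip w w"
    using p by (simp add: field_simps power2_eq_square)
   finally show ?thesis using p by (simp add: field_simps)
  qed
 qed
 have "cau v"
  unfolding cau_def
 proof (intro allI impI)
  fix e :: real assume e: "e > 0"
  obtain M :: nat where M: "4 / e\<^sup>2 < real M" using reals_Archimedean2 by blast
  have "nrm (v i - v j) < e" if "i \<ge> M" "j \<ge> M" for i j
  proof (rule power2_less_imp_less)
   \<comment> \<open>Parallelogram identity for \<open>F\<close>: the linear parts cancel, and the
     midpoint cannot fall below the infimum \<open>m\<close>.\<close>
   have "(nrm (v i - v j))\<^sup>2 = 2 * F (v i) + 2 * F (v j) - 4 * F ((1/2) *\<^sub>R (v i + v j))"
    using v ip_sym[of "v i" "v j"] by (simp add: nrm_sq F_def ip_lin add scale algebra_simps)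
   also have "\<dots> < 2 * (m + 1 / (real i + 1)) + 2 * (m + 1 / (real j + 1)) - 4 * m"
    using v(2)[of i] v(2)[of j] mF[of "(1/2) *\<^sub>R (v i + v j)"] v(1) by simp
   also have "\<dots> \<le> 2 * (1 / (real M + 1)) + 2 * (1 / (real M + 1))"
   proof -
    have "1 / (real i + 1) \<le> 1 / (real M + 1)" "1 / (real j + 1) \<le> 1 / (real M + 1)"
     using that by (auto intro!: divide_left_mono)
    then show ?thesis by (simp add: algebra_simps)
   qed
   also have "\<dots> = 4 / (real M + 1)" by simp
   also have "\<dots> \<le> e\<^sup>2"
   proof -
    have "4 < (real M + 1) * e\<^sup>2"
     using M zero_less_power[OF e, of 2] by (simp only: pos_divide_less_eq distrib_right mult_1)
    then show ?thesis by (simp add: pos_divide_le_eq mult.commute)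
   qed
   finally show "(nrm (v i - v j))\<^sup>2 < e\<^sup>2" .
  qed (use e in simp)
  then show "\<exists>M. \<forall>m\<ge>M. \<forall>n\<ge>M. nrm (v m - v n) < e" by blast
 qed
 moreover have "(\<lambda>n. ip (v n) w) \<longlonglongrightarrow> l w" if w: "w \<in> H" for w
 proof -
  have "(\<lambda>n. ip (v n) w - l w) \<longlonglongrightarrow> 0"
  proof (rule Lim_null_comparison)
   show "\<forall>\<^sub>F n in sequentially. norm (ip (v n) w - l w) \<le> sqrt (1 / (real n + 1) * ip w w)"
   proof (intro always_eventually allI)
    fix n
    have "(ip (v n) w - l w)\<^sup>2 \<le> 1 / (real n + 1) * ip w w"
     by (rule ineq) (use v w in \<open>auto simp: less_imp_le\<close>)
    then have "sqrt ((ip (v n) w - l w)\<^sup>2) \<le> sqrt (1 / (real n + 1) * ip w w)"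
     by (rule real_sqrt_le_mono)
    then show "norm (ip (v n) w - l w) \<le> sqrt (1 / (real n + 1) * ip w w)" by simp
   qed
   have "(\<lambda>n. 1 / (real n + 1)) \<longlonglongrightarrow> 0"
    using LIMSEQ_inverse_real_of_nat by (simp add: inverse_eq_divide add.commute)
   then have "(\<lambda>n. sqrt (1 / (real n + 1) * ip w w)) \<longlonglongrightarrow> sqrt (0 * ip w w)"
    by (intro tendsto_intros)
   then show "(\<lambda>n. sqrt (1 / (real n + 1) * ip w w)) \<longlonglongrightarrow> 0" by simp
  qed
  then show ?thesis using Lim_null by blast
 qed
 ultimately show ?thesis using v(1) by blast
qed

end

locale semi_hilbert = semi_inner +
 assumes complete: "(\<And>n. x n \<in> H) \<Longrightarrow> cau x \<Longrightarrow> \<exists>y\<in>H. (\<lambda>n. nrm (x n - y)) \<longlonglongrightarrow> 0"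
begin

lemma riesz:
 assumes "\<And>x y. x \<in> H \<Longrightarrow> y \<in> H \<Longrightarrow> l (x + y) = l x + l y"
  and "\<And>x r. x \<in> H \<Longrightarrow> l (r *\<^sub>R x) = r * l x"
  and "\<And>x. x \<in> H \<Longrightarrow> \<bar>l x\<bar> \<le> C * nrm x"
 shows "\<exists>u\<in>H. \<forall>w\<in>H. ip u w = l w"
proof -
 obtain v where v: "\<And>n. v n \<in> H" "cau v" "\<And>w. w \<in> H \<Longrightarrow> (\<lambda>n. ip (v n) w) \<longlonglongrightarrow> l w"
  using riesz_sequence[OF assms] by blast
 then obtain u where u: "u \<in> H" "(\<lambda>n. nrm (v n - u)) \<longlonglongrightarrow> 0" using complete by blast
 show ?thesis
  using u v tendsto_ip[OF u(2) v(1) u(1)] by (blast intro: LIMSEQ_unique)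
qed

text \<open>\<open>W\<close> need not be closed: the minimising sequence stays in \<open>W\<close>,
  and only its limit \<open>y\<close> is taken in \<open>H\<close>. This is why the Riesz argument
  is stated for sequences in a space without completeness. The residual is orthogonal to
  \<open>W\<close> because the approximations represent \<open>ip x\<close> on \<open>W\<close> in
  the limit.\<close>

lemma projection:
 assumes W: "subspace W" "W \<subseteq> H" and x: "x \<in> H"
 shows "\<exists>w y. (\<forall>n. w n \<in> W) \<and> y \<in> H \<and> (\<lambda>n. nrm (w n - y)) \<longlonglongrightarrow> 0 \<and> (\<forall>z\<in>W. ip (x - y) z = 0)"
proof -
 interpret W: semi_inner W ip
  using W ip_sym ip_add ip_scale ip_pos by unfold_locales (auto simp: subset_iff)
 have "\<exists>w. (\<forall>n. w n \<in> W) \<and> W.cau w \<and> (\<forall>z\<in>W. (\<lambda>n. ip (w n) z) \<longlonglongrightarrow> ip x z)"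
  using W x ip_le_nrm[OF x]
  by (intro W.riesz_sequence[of "ip x" "nrm x"]) (auto simp: ip_lin subset_iff W.nrm_def nrm_def)
 then obtain w where w: "\<And>n. w n \<in> W" "W.cau w" "\<And>z. z \<in> W \<Longrightarrow> (\<lambda>n. ip (w n) z) \<longlonglongrightarrow> ip x z"
  by blast
 have wH: "w n \<in> H" for n using w(1) W(2) by blast
 obtain y where y: "y \<in> H" "(\<lambda>n. nrm (w n - y)) \<longlonglongrightarrow> 0"
  using complete[of w, OF wH] w(2) by (auto simp: cau_def W.cau_def W.nrm_def nrm_def)
 have "ip (x - y) z = 0" if z: "z \<in> W" for z
 proof -
  have zH: "z \<in> H" using z W by blast
  have "ip x z = ip y z"
   using LIMSEQ_unique[OF w(3)[OF z] tendsto_ip[OF y(2) wH y(1) zH]] .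
  then show ?thesis using x y zH by (simp add: ip_lin)
 qed
 then show ?thesis using w(1) y by blast
qed

lemma dense_if_orthogonal_null:
 assumes W: "subspace W" "W \<subseteq> H" and x: "x \<in> H"
  and orth: "\<And>h. h \<in> H \<Longrightarrow> (\<And>z. z \<in> W \<Longrightarrow> ip h z = 0) \<Longrightarrow> ip h h = 0" and e: "e > 0"
 shows "\<exists>w\<in>W. nrm (x - w) < e"
proof -
 obtain w y where w: "\<And>n. w n \<in> W" "y \<in> H" "(\<lambda>n. nrm (w n - y)) \<longlonglongrightarrow> 0" "\<forall>z\<in>W. ip (x - y) z = 0"
  using projection[OF W x] by blast
 have wH: "w n \<in> H" for n using w(1) W(2) by blast
 have "ip (x - y) (x - y) = 0" using orth[of "x - y"] w x by simp
 then have 0: "nrm (x - y) = 0" by (simp add: nrm_def)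
 obtain n where "nrm (w n - y) < e"
  using LIMSEQ_D[OF w(3) e] by (metis abs_less_iff diff_zero order_refl real_norm_def)
 moreover have "nrm (x - w n) \<le> nrm (x - y) + nrm (y - w n)"
  using nrm_diff_triangle[of x y "w n"] x w(2) wH by simp
 ultimately have "nrm (x - w n) < e" using 0 nrm_diff_commute[of y "w n"] w(2) wH by simp
 then show ?thesis using w(1) by blast
qed

end

section \<open>The semigroup of a closed form\<close>

locale coercive_form = semi_hilbert H ip + V: semi_hilbert V a
 for H :: "'a::real_vector set" and ip :: "'a \<Rightarrow> 'a \<Rightarrow> real" and V :: "'a set" and a +
 assumes V_sub: "V \<subseteq> H"
  and coercive: "v \<in> V \<Longrightarrow> ip v v \<le> a v v"
  and dense: "h \<in> H \<Longrightarrow> (\<And>v. v \<in> V \<Longrightarrow> ip h v = 0) \<Longrightarrow> ip h h = 0"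
  and null: "d \<in> H \<Longrightarrow> nrm d = 0 \<Longrightarrow> d \<in> V \<and> a d d = 0"
begin

definition opA :: "'a \<Rightarrow> 'a \<Rightarrow> bool" where
 "opA u h \<longleftrightarrow> u \<in> V \<and> h \<in> H \<and> (\<forall>v\<in>V. a u v = ip h v)"

lemma VH [simp]: "v \<in> V \<Longrightarrow> v \<in> H" using V_sub by blast

lemma opA_mem: "opA u h \<Longrightarrow> u \<in> V" "opA u h \<Longrightarrow> u \<in> H" "opA u h \<Longrightarrow> h \<in> H"
 by (auto simp: opA_def)

lemma opA_eq: "opA u h \<Longrightarrow> v \<in> V \<Longrightarrow> a u v = ip h v"
 by (auto simp: opA_def)

text \<open>Relies on \<open>null\<close>: \<open>V\<close> contains every element of length zero,
  and \<open>a\<close> vanishes on it, so neither membership in \<open>V\<close> nor the form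
  notices a change of representative.\<close>

lemma opA_cong:
 assumes "opA u h" "u' \<in> H" "h' \<in> H" "nrm (u' - u) = 0" "nrm (h' - h) = 0"
 shows "opA u' h'"
proof -
 have d: "u' - u \<in> V" "V.nrm (u' - u) = 0"
  using null[of "u' - u"] assms opA_mem by (auto simp: V.nrm_def)
 then have "(u' - u) + u \<in> V" using opA_mem[OF assms(1)] V.mem(2) by blast
 then have u': "u' \<in> V" by simp
 have "a u' v = a u v" "ip h' v = ip h v" if "v \<in> V" for v
  using V.ip_cong[OF u' opA_mem(1)[OF assms(1)] that d(2)] ip_cong[of h' h v] assms opA_mem that by auto
 then show ?thesis using assms u' by (auto simp: opA_def)
qed

text \<open>Riesz representation in \<open>V\<close> for the form \<open>ip + s * a\<close>.
  Coercivity makes its norm equivalent to that of \<open>a\<close>, with constants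
  \<open>sqrt s\<close> and \<open>sqrt (1 + s)\<close>, so completeness is inherited.\<close>

lemma resolvent_exists:
 assumes h: "h \<in> H" and s: "s > 0"
 shows "\<exists>u\<in>V. \<forall>v\<in>V. ip u v + s * a u v = ip h v"
proof -
 let ?b = "\<lambda>u v. ip u v + s * a u v"
 interpret B: semi_inner V ?b
  using s V.subspace_H ip_sym V.ip_sym ip_pos V.ip_pos
  by unfold_locales (auto simp: ip_lin V.ip_lin algebra_simps)
 have up: "B.nrm v \<le> sqrt (1 + s) * V.nrm v" if "v \<in> V" for v
  using coercive[OF that] s unfolding B.nrm_def V.nrm_def real_sqrt_mult[symmetric]
  by (auto simp: algebra_simps)
 have lo: "sqrt s * V.nrm v \<le> B.nrm v" if "v \<in> V" for v
  using ip_pos[of v] that s unfolding B.nrm_def V.nrm_def real_sqrt_mult[symmetric] by simp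
 interpret B: semi_hilbert V ?b
 proof
  fix x assume x: "\<And>n. x n \<in> V" "B.cau x"
  have "V.cau x" unfolding V.cau_def
  proof (intro allI impI)
   fix e :: real assume "e > 0"
   then have "sqrt s * e > 0" using s by simp
   then obtain M where M: "\<forall>m\<ge>M. \<forall>n\<ge>M. B.nrm (x m - x n) < sqrt s * e"
    using x(2) unfolding B.cau_def by meson
   have "V.nrm (x m - x n) < e" if "m \<ge> M" "n \<ge> M" for m n
   proof -
    have "sqrt s * V.nrm (x m - x n) < sqrt s * e"
     using lo[of "x m - x n"] M that x(1) by (smt (verit) V.mem(3))
    then show ?thesis using s by simp
   qed
   then show "\<exists>M. \<forall>m\<ge>M. \<forall>n\<ge>M. V.nrm (x m - x n) < e" by blast
  qed
  then obtain y where y: "y \<in> V" "(\<lambda>n. V.nrm (x n - y)) \<longlonglongrightarrow> 0"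
   using V.complete x(1) by blast
  have "(\<lambda>n. B.nrm (x n - y)) \<longlonglongrightarrow> 0"
  proof (rule Lim_null_comparison)
   show "\<forall>\<^sub>F n in sequentially. norm (B.nrm (x n - y)) \<le> sqrt (1 + s) * V.nrm (x n - y)"
    using up y(1) x(1) by simp
   show "(\<lambda>n. sqrt (1 + s) * V.nrm (x n - y)) \<longlonglongrightarrow> 0"
    using y(2) by (rule tendsto_mult_right_zero)
  qed
  then show "\<exists>y\<in>V. (\<lambda>n. B.nrm (x n - y)) \<longlonglongrightarrow> 0" using y by blast
 qed
 have bd: "\<bar>ip h v\<bar> \<le> nrm h * B.nrm v" if "v \<in> V" for v
 proof -
  have "\<bar>ip h v\<bar> \<le> nrm h * nrm v" using ip_le_nrm h that by simp
  also have "nrm v \<le> B.nrm v" using s V.ip_pos[OF that] by (simp add: nrm_def B.nrm_def)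
  finally show ?thesis using h by (simp add: mult_left_mono)
 qed
 show ?thesis
  by (rule B.riesz[OF _ _ bd]) (use h in \<open>auto simp: ip_lin\<close>)
qed

text \<open>The resolvent \<open>(1 + s A)\<^sup>-\<^sup>1\<close>, determined up to elements of norm \<open>0\<close>.\<close>

definition J :: "real \<Rightarrow> 'a \<Rightarrow> 'a" where
 "J s h = (if s \<le> 0 then h else SOME u. u \<in> V \<and> (\<forall>v\<in>V. ip u v + s * a u v = ip h v))"

lemma J_zero [simp]: "s \<le> 0 \<Longrightarrow> J s h = h" by (simp add: J_def)

lemma J_V:
 assumes "s > 0" "h \<in> H" shows "J s h \<in> V" "v \<in> V \<Longrightarrow> ip (J s h) v + s * a (J s h) v = ip h v"
proof -
 have "\<exists>u. u \<in> V \<and> (\<forall>v\<in>V. ip u v + s * a u v = ip h v)"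
  using resolvent_exists[OF assms(2,1)] by blast
 from someI_ex[OF this] assms(1)
 show "J s h \<in> V" "v \<in> V \<Longrightarrow> ip (J s h) v + s * a (J s h) v = ip h v"
  by (auto simp: J_def)
qed

lemma J_H [simp]: "h \<in> H \<Longrightarrow> J s h \<in> H"
 using J_V by (cases "s > 0") auto

text \<open>Testing the difference of the two equations with \<open>d\<close> itself and discarding
  \<open>s * a d d\<close> leaves \<open>nrm d * nrm d \<le> nrm (k - h) * nrm d\<close>. Since
  \<open>u\<close> may solve the equation for any right-hand side \<open>k\<close>, this one
  estimate yields uniqueness, nonexpansiveness and the error bound for products of
  resolvents.\<close>

lemma J_est:
 assumes "s > 0" "h \<in> H" "u \<in> V" "k \<in> H" "\<And>v. v \<in> V \<Longrightarrow> ip u v + s * a u v = ip k v"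
 shows "nrm (u - J s h) \<le> nrm (k - h)"
proof -
 define d where "d = u - J s h"
 have d: "d \<in> V" "d \<in> H" using assms J_V by (auto simp: d_def)
 have "ip d d + s * a d d = ip (k - h) d"
 proof -
  have "ip d d + s * a d d = (ip u d + s * a u d) - (ip (J s h) d + s * a (J s h) d)"
   using assms J_V[OF assms(1,2)] d by (simp add: d_def ip_lin V.ip_lin algebra_simps)
  also have "\<dots> = ip (k - h) d" using assms J_V[OF assms(1,2)] d by (simp add: ip_lin)
  finally show ?thesis .
 qed
 then have "ip d d \<le> ip (k - h) d" using V.ip_pos[OF d(1)] assms(1) by (smt (verit) mult_nonneg_nonneg)
 then have "nrm d * nrm d \<le> nrm (k - h) * nrm d"
  using ip_le_nrm[of "k - h" d] d assms by (simp add: nrm_sq[symmetric] power2_eq_square)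
 then have "nrm d \<le> nrm (k - h) \<or> nrm d \<le> 0"
  using mult_right_le_imp_le[of "nrm d" "nrm d" "nrm (k - h)"] by linarith
 moreover have "0 \<le> nrm (k - h)" using assms by simp
 ultimately show ?thesis unfolding d_def by linarith
qed

lemma J_unique:
 assumes "s > 0" "h \<in> H" "u \<in> V" "\<And>v. v \<in> V \<Longrightarrow> ip u v + s * a u v = ip h v"
 shows "nrm (u - J s h) = 0"
 using J_est[OF assms(1-3,2)] assms nrm_nonneg[of "u - J s h"] J_H[OF assms(2), of s] by fastforce

lemma J_unique_opA:
 assumes "s > 0" "opA u k" shows "nrm (u - J s (u + s *\<^sub>R k)) = 0"
 using assms by (intro J_unique) (auto simp: opA_def ip_lin)

lemma J_nonexp:
 assumes "h \<in> H" "k \<in> H" shows "nrm (J s h - J s k) \<le> nrm (h - k)"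
 using J_est[of s k "J s h" h] assms J_V by (cases "s > 0") auto

lemma J_linear:
 assumes "h \<in> H" "k \<in> H" shows "nrm (J s (c *\<^sub>R h + k) - (c *\<^sub>R J s h + J s k)) = 0"
proof (cases "s > 0")
 case True
 have "nrm ((c *\<^sub>R J s h + J s k) - J s (c *\<^sub>R h + k)) = 0"
  by (rule J_unique) (use True assms J_V[OF True] in \<open>auto simp: ip_lin V.ip_lin algebra_simps simp flip: distrib_left\<close>)
 then show ?thesis using nrm_diff_commute assms by simp
qed simp

lemma J_opA:
 assumes "s > 0" "h \<in> H" shows "opA (J s h) ((1/s) *\<^sub>R (h - J s h))"
 using assms J_V[OF assms]
 by (auto simp: opA_def ip_lin field_simps)

text \<open>\<open>(y - J s y) / s\<close> is the value of the operator at \<open>J s y\<close>; it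
  also solves the resolvent equation for \<open>k\<close>, so uniqueness identifies it with
  \<open>J s k\<close>.\<close>

lemma J_comm_opA:
 assumes "opA y k" shows "opA (J s y) (J s k)"
proof (cases "s > 0")
 case True
 note yk = opA_mem[OF assms]
 define w where "w = (1/s) *\<^sub>R (y - J s y)"
 have w: "opA (J s y) w" unfolding w_def by (rule J_opA[OF True yk(2)])
 have "nrm (w - J s k) = 0"
 proof (rule J_unique[OF True yk(3)])
  show "w \<in> V" using yk J_V[OF True] by (simp add: w_def)
  fix v assume v: "v \<in> V"
  have "s * a w v = a y v - a (J s y) v" using yk J_V[OF True] v True by (simp add: w_def V.ip_lin)
  also have "\<dots> = ip k v - ip w v" using assms w v by (simp add: opA_eq)
  finally show "ip w v + s * a w v = ip k v" by simp
 qed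
 then show ?thesis
  using opA_cong[OF w, of "J s y" "J s k"] yk opA_mem[OF w] nrm_diff_commute[of w "J s k"] by simp
qed (use assms in simp)

lemma J_norm: "h \<in> H \<Longrightarrow> nrm (J s h) \<le> nrm h"
proof (cases "s > 0")
 case True
 assume h: "h \<in> H"
 have "nrm (0 - J s h) \<le> nrm (0 - h)" by (rule J_est) (use True h in auto)
 then show ?thesis using h by simp
qed simp

text \<open>Apply \<open>J s\<close> to \<open>y + s *\<^sub>R k\<close>, which it maps back to
  \<open>y\<close>, and use linearity. This makes one resolvent step an exact difference equation,
  which is later summed to differentiate the semigroup.\<close>

lemma J_step:
 assumes "opA y k" "s \<ge> 0" shows "nrm (J s y - (y - s *\<^sub>R J s k)) = 0"
proof (cases "s > 0")
 case True
 note yk = opA_mem[OF assms(1)]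
 have "nrm (y - J s (y + s *\<^sub>R k)) = 0" by (rule J_unique_opA[OF True assms(1)])
 moreover have "nrm (J s (s *\<^sub>R k + y) - (s *\<^sub>R J s k + J s y)) = 0"
  by (rule J_linear) (use yk in auto)
 ultimately have "nrm (y - (s *\<^sub>R J s k + J s y)) = 0"
  using null_trans[of y "J s (y + s *\<^sub>R k)" "s *\<^sub>R J s k + J s y"] yk by (simp add: add.commute)
 then show ?thesis
  using nrm_minus[of "y - (s *\<^sub>R J s k + J s y)"] yk by (simp add: algebra_simps)
qed (use assms in simp)

lemma J_close:
 assumes "opA y k" "s \<ge> 0" shows "nrm (J s y - y) \<le> s * nrm k"
proof -
 note yk = opA_mem[OF assms(1)]
 have "nrm (J s y - y) \<le> nrm (J s y - (y - s *\<^sub>R J s k)) + nrm ((y - s *\<^sub>R J s k) - y)"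
  by (rule nrm_diff_triangle) (use yk in auto)
 also have "\<dots> = s * nrm (J s k)" using J_step[OF assms] yk assms(2) by (simp add: nrm_scale)
 also have "\<dots> \<le> s * nrm k" using J_norm yk assms(2) by (simp add: mult_left_mono)
 finally show ?thesis .
qed

text \<open>With \<open>u = J s (J t y)\<close>, the operator has the value
  \<open>(p - u) / s\<close> at \<open>u\<close>. Hence \<open>q'\<close> is
  \<open>(1 + t A) u\<close>, and it solves the resolvent equation that determines
  \<open>J s y\<close>.\<close>

lemma J_commute:
 assumes y: "y \<in> H" shows "nrm (J s (J t y) - J t (J s y)) = 0"
proof (cases "s > 0 \<and> t > 0")
 case True
 define p where "p = J t y"
 define u where "u = J s p"
 define q where "q = J s y"
 define q' where "q' = u + (t / s) *\<^sub>R (p - u)"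
 have mem: "p \<in> V" "u \<in> V" "q \<in> V" "q' \<in> V" using J_V True y by (auto simp: p_def u_def q_def q'_def)
 have pe: "ip p v + t * a p v = ip y v" and ue: "ip u v + s * a u v = ip p v" if "v \<in> V" for v
  using J_V True y that mem by (auto simp: p_def u_def)
 have tau: "t * a u v = (t/s) * (ip p v - ip u v)" if "v \<in> V" for v
 proof -
  have "t * a u v = (t/s) * (s * a u v)" using True by simp
  also have "s * a u v = ip p v - ip u v" using ue[OF that] by simp
  finally show ?thesis .
 qed
 have "nrm (q' - J s y) = 0"
 proof (rule J_unique)
  fix v assume v: "v \<in> V"
  have "ip q' v + s * a q' v = ip u v + (t/s) * (ip p v - ip u v) + (s * a u v + t * a p v - t * a u v)"
   using mem v True by (simp add: q'_def ip_lin V.ip_lin algebra_simps)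
  also note tau[OF v]
  finally show "ip q' v + s * a q' v = ip y v" using pe[OF v] ue[OF v] by simp
 qed (use True y mem in auto)
 then have qq: "nrm (q' - q) = 0" by (simp add: q_def)
 have "nrm (u - J t q) = 0"
 proof (rule J_unique)
  fix v assume v: "v \<in> V"
  have "ip u v + t * a u v = ip u v + (t/s) * (ip p v - ip u v)" using tau[OF v] by simp
  also have "\<dots> = ip q' v" using mem v by (simp add: q'_def ip_lin)
  also have "\<dots> = ip q v" using ip_cong[of q' q v] qq mem v by simp
  finally show "ip u v + t * a u v = ip q v" .
 qed (use True mem in auto)
 then show ?thesis by (simp add: u_def q_def p_def)
next
 case False
 then show ?thesis by auto
qed

text \<open>Because \<open>(1 + s A) (1 + t A) = 1 + (s + t) A + s t A^2\<close>, the product of the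
  resolvents solves the equation for \<open>s + t\<close> with the right-hand side perturbed by
  \<open>s t A^2 u\<close>, an error of second order in the step sizes.\<close>

lemma J_add:
 assumes y: "opA y y1" "opA y1 y2" and st: "s \<ge> 0" "t \<ge> 0"
 shows "nrm (J s (J t y) - J (s + t) y) \<le> s * t * nrm y2"
proof (cases "s = 0 \<or> t = 0")
 case True
 then show ?thesis using st y by (auto simp: opA_mem)
next
 case False
 then have pos: "s > 0" "t > 0" using st by auto
 define p where "p = J t y" define p1 where "p1 = J t y1"
 define u where "u = J s p" define u1 where "u1 = J s p1" define u2 where "u2 = J s (J t y2)"
 have op: "opA p p1" "opA p1 (J t y2)" "opA u u1" "opA u1 u2"
  unfolding p_def p1_def u_def u1_def u2_def by (intro J_comm_opA y)+
 note m = opA_mem[OF op(1)] opA_mem[OF op(2)] opA_mem[OF op(3)] opA_mem[OF op(4)] opA_mem[OF y(1)] opA_mem[OF y(2)]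
 have e1: "ip p v = ip u v + s * ip u1 v" if "v \<in> V" for v
  using J_V(2)[OF pos(1) m(2) that] opA_eq[OF op(3) that] by (simp add: u_def)
 have e2: "ip p1 v = ip u1 v + s * ip u2 v" if "v \<in> V" for v
  using J_V(2)[OF pos(1) m(3) that] opA_eq[OF op(4) that] by (simp add: u1_def)
 have e3: "ip y v = ip p v + t * ip p1 v" if "v \<in> V" for v
  using J_V(2)[OF pos(2) opA_mem(2)[OF y(1)] that] opA_eq[OF op(1) that] by (simp add: p_def)
 have "nrm (u - J (s + t) y) \<le> nrm ((y - (s * t) *\<^sub>R u2) - y)"
 proof (rule J_est)
  fix v assume v: "v \<in> V"
  show "ip u v + (s + t) * a u v = ip (y - (s * t) *\<^sub>R u2) v"
   using e1[OF v] e2[OF v] e3[OF v] m v opA_eq[OF op(3) v] by (simp add: ip_lin algebra_simps)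
 qed (use pos m in auto)
 also have "\<dots> = s * t * nrm u2" using m pos by (simp add: nrm_scale)
 also have "\<dots> \<le> s * t * nrm y2"
 proof -
  have "nrm u2 \<le> nrm y2" using J_norm[of "J t y2" s] J_norm[of y2 t] m by (simp add: u2_def)
  then show ?thesis using pos by (simp add: mult_left_mono)
 qed
 finally show ?thesis by (simp add: u_def p_def)
qed

lemma J_tendsto_V:
 assumes "x \<in> V" "s > 0" shows "(nrm (J s x - x))\<^sup>2 \<le> s * a x x"
proof -
 define u where "u = J s x"
 have u: "u \<in> V" "ip u (x - u) + s * a u (x - u) = ip x (x - u)"
  using J_V[OF assms(2), of x] assms by (auto simp: u_def)
 have "(nrm (J s x - x))\<^sup>2 = ip (x - u) (x - u)"
  using assms u nrm_diff_commute[of u x] by (simp add: nrm_sq[symmetric] u_def)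
 also have "\<dots> = s * (a u x - a u u)" using u assms by (simp add: ip_lin V.ip_lin algebra_simps)
 also have "\<dots> \<le> s * a x x"
 proof -
  have "0 \<le> a (u - x) (u - x)" by (rule V.ip_pos) (use u assms in simp)
  then have "2 * a u x \<le> a u u + a x x" using u assms V.ip_sym[of x u] by (simp add: V.ip_lin)
  moreover have "0 \<le> a u u" "0 \<le> a x x" using V.ip_pos u assms by auto
  ultimately show ?thesis using assms by (intro mult_left_mono) auto
 qed
 finally show ?thesis .
qed

lemma J_tendsto:
 assumes x: "x \<in> H" shows "((\<lambda>s. nrm (J s x - x)) \<longlongrightarrow> 0) (at_right 0)"
proof (rule tendstoI)
 fix e :: real assume e: "e > 0"
 obtain w where w: "w \<in> V" "nrm (x - w) < e / 3"
  using dense_if_orthogonal_null[OF V.subspace_H V_sub x dense, of "e/3"] e by auto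
 have "((\<lambda>s. sqrt (s * a w w)) \<longlongrightarrow> sqrt (0 * a w w)) (at_right 0)"
  by (intro tendsto_intros)
 then have "\<forall>\<^sub>F s in at_right 0. sqrt (s * a w w) < e / 3"
  using e by (intro order_tendstoD(2)) auto
 moreover have "\<forall>\<^sub>F s::real in at_right 0. s > 0" by (simp add: eventually_at_right_less)
 ultimately show "\<forall>\<^sub>F s in at_right 0. dist (nrm (J s x - x)) 0 < e"
 proof eventually_elim
  case (elim s)
  have "nrm (J s w - w) = sqrt ((nrm (J s w - w))\<^sup>2)" using w by simp
  also have "\<dots> \<le> sqrt (s * a w w)" by (rule real_sqrt_le_mono) (use J_tendsto_V w elim in auto)
  finally have 1: "nrm (J s w - w) < e / 3" using elim by simp
  have "nrm (J s x - x) \<le> nrm (J s x - J s w) + nrm (J s w - x)"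
   by (rule nrm_diff_triangle) (use x w in auto)
  also have "nrm (J s w - x) \<le> nrm (J s w - w) + nrm (w - x)"
   by (rule nrm_diff_triangle) (use x w in auto)
  also have "nrm (J s x - J s w) \<le> nrm (x - w)" by (rule J_nonexp) (use x w in auto)
  finally have "nrm (J s x - x) < e" using 1 w nrm_diff_commute[of x w] x by simp
  then show ?case using x by simp
 qed
qed

text \<open>The domain of the squared operator, with a bound \<open>c\<close> on the second image:
  the class on which the splitting error of resolvents is uniform. Resolvents preserve it with the
  same \<open>c\<close>.\<close>

definition D2 :: "real \<Rightarrow> 'a set" where
 "D2 c = {y. \<exists>y1 y2. opA y y1 \<and> opA y1 y2 \<and> nrm y2 \<le> c}"

lemma D2_H: "y \<in> D2 c \<Longrightarrow> y \<in> H" by (auto simp: D2_def opA_mem)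

lemma D2_J: "y \<in> D2 c \<Longrightarrow> J s y \<in> D2 c"
 unfolding D2_def by (clarsimp, meson J_comm_opA J_norm opA_mem(3) order_trans)

text \<open>Two applications of the resolvent reach the domain of the square, and for small
  \<open>s\<close> each moves the vector by less than \<open>e / 2\<close>, the second by
  nonexpansiveness.\<close>

lemma dense_D2:
 assumes x: "x \<in> H" and e: "e > 0"
 shows "\<exists>c. \<exists>y\<in>D2 c. nrm (x - y) < e"
proof -
 have "\<forall>\<^sub>F s in at_right 0. dist (nrm (J s x - x)) 0 < e / 2"
  using tendstoD[OF J_tendsto[OF x], of "e/2"] e by simp
 moreover have "\<forall>\<^sub>F s::real in at_right 0. s > 0" by (simp add: eventually_at_right_less)
 ultimately have "\<exists>s>0. nrm (J s x - x) < e / 2"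
  using eventually_happens'[of "at_right (0::real)" "\<lambda>s. s > 0 \<and> nrm (J s x - x) < e / 2"] x
  by (auto elim: eventually_elim2 simp: eventually_conj_iff)
 then obtain s where s: "s > 0" "nrm (J s x - x) < e / 2" by blast
 define y where "y = J s (J s x)"
 define z where "z = (1/s) *\<^sub>R (x - J s x)"
 have "opA (J s x) z" unfolding z_def by (rule J_opA[OF s(1) x])
 then have 1: "opA y (J s z)" unfolding y_def by (rule J_comm_opA)
 have 2: "opA (J s z) ((1/s) *\<^sub>R (z - J s z))" by (rule J_opA[OF s(1)]) (use x in \<open>simp add: z_def\<close>)
 have "y \<in> D2 (nrm ((1/s) *\<^sub>R (z - J s z)))" unfolding D2_def using 1 2 by blast
 moreover have "nrm (x - y) < e"
 proof -
  have "nrm (x - y) \<le> nrm (x - J s x) + nrm (J s x - J s (J s x))"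
   unfolding y_def by (rule nrm_diff_triangle) (use x in auto)
  also have "nrm (J s x - J s (J s x)) \<le> nrm (x - J s x)" by (rule J_nonexp) (use x in auto)
  finally show ?thesis using s(2) nrm_diff_commute[of x "J s x"] x by simp
 qed
 ultimately show ?thesis by blast
qed

end

section \<open>Limits modulo elements of length zero, and C0-semigroups over the reals\<close>

context semi_inner
begin

lemma cau_geometric:
 assumes x: "\<And>n. x n \<in> H" and step: "\<And>n. nrm (x (Suc n) - x n) \<le> K * (1/2) ^ n"
 shows "cau x"
proof -
 have K: "K \<ge> 0" using step[of 0] nrm_nonneg[of "x 1 - x 0"] x by (simp del: nrm_nonneg)
 have tel: "nrm (x (n + k) - x n) \<le> 2 * K * (1/2) ^ n - 2 * K * (1/2) ^ (n + k)" for n k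
 proof (induction k)
  case (Suc k)
  have "nrm (x (n + Suc k) - x n) \<le> nrm (x (Suc (n + k)) - x (n + k)) + nrm (x (n + k) - x n)"
   using nrm_diff_triangle[of "x (Suc (n + k))" "x (n + k)" "x n"] x by simp
  also have "\<dots> \<le> K * (1/2) ^ (n + k) + (2 * K * (1/2) ^ n - 2 * K * (1/2) ^ (n + k))"
   using step[of "n + k"] Suc by (intro add_mono) auto
  finally show ?case by simp
 qed simp
 have le: "nrm (x m - x n) \<le> 2 * K * (1/2) ^ n" if mn: "n \<le> m" for m n
 proof -
  obtain k where "m = n + k" using mn le_Suc_ex by blast
  then show ?thesis using tel[of n k] K by (smt (verit) mult_nonneg_nonneg zero_le_power divide_nonneg_pos)
 qed
 show ?thesis unfolding cau_def
 proof (intro allI impI)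
  fix e :: real assume e: "e > 0"
  have "(\<lambda>n. 2 * K * (1/2) ^ n) \<longlonglongrightarrow> 2 * K * 0" by (intro tendsto_intros) auto
  then have "\<forall>\<^sub>F n in sequentially. 2 * K * (1/2) ^ n < e" by (rule order_tendstoD) (use e in simp)
  then obtain M where M: "\<And>n. n \<ge> M \<Longrightarrow> 2 * K * (1/2) ^ n < e" by (auto simp: eventually_sequentially)
  have "nrm (x m - x n) < e" if mn: "m \<ge> M" "n \<ge> M" for m n
  proof (cases "n \<le> m")
   case True then show ?thesis using le[OF True] M[OF mn(2)] by linarith
  next
   case False
   then show ?thesis using le[of m n] M[OF mn(1)] nrm_diff_commute[of "x m" "x n"] x by simp
  qed
  then show "\<exists>M. \<forall>m\<ge>M. \<forall>n\<ge>M. nrm (x m - x n) < e" by blast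
 qed
qed

lemma limit_cong:
 assumes "((\<lambda>i. nrm (x i - y)) \<longlongrightarrow> 0) F" "((\<lambda>i. nrm (x i - x' i)) \<longlongrightarrow> 0) F"
  "\<And>i. x i \<in> H" "\<And>i. x' i \<in> H" "y \<in> H"
 shows "((\<lambda>i. nrm (x' i - y)) \<longlongrightarrow> 0) F"
proof (rule Lim_null_comparison)
 show "((\<lambda>i. nrm (x i - x' i) + nrm (x i - y)) \<longlongrightarrow> 0) F" using tendsto_add[OF assms(2,1)] by simp
 show "\<forall>\<^sub>F i in F. norm (nrm (x' i - y)) \<le> nrm (x i - x' i) + nrm (x i - y)"
  using nrm_diff_triangle[of "x' _" "x _" y] nrm_diff_commute[of "x' _" "x _"] assms by simp
qed

lemma limit_linear:
 assumes "((\<lambda>i. nrm (x i - x')) \<longlongrightarrow> 0) F" "((\<lambda>i. nrm (y i - y')) \<longlongrightarrow> 0) F"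
  "\<And>i. x i \<in> H" "\<And>i. y i \<in> H" "x' \<in> H" "y' \<in> H"
 shows "((\<lambda>i. nrm ((c *\<^sub>R x i + y i) - (c *\<^sub>R x' + y'))) \<longlongrightarrow> 0) F"
proof (rule Lim_null_comparison)
 have "((\<lambda>i. \<bar>c\<bar> * nrm (x i - x') + nrm (y i - y')) \<longlongrightarrow> \<bar>c\<bar> * 0 + 0) F"
  by (intro tendsto_intros assms)
 then show "((\<lambda>i. \<bar>c\<bar> * nrm (x i - x') + nrm (y i - y')) \<longlongrightarrow> 0) F" by simp
 show "\<forall>\<^sub>F i in F. norm (nrm ((c *\<^sub>R x i + y i) - (c *\<^sub>R x' + y'))) \<le> \<bar>c\<bar> * nrm (x i - x') + nrm (y i - y')"
  using nrm_add_diff[of "c *\<^sub>R x _" "y _" "c *\<^sub>R x'" y'] nrm_scale[of "x _ - x'" c] assms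
  by (simp add: scaleR_diff_right)
qed

end

text \<open>Equations hold modulo elements of length zero, and each \<open>T t\<close> has its own
  bound \<open>B\<close>. No bound uniform in small \<open>t\<close> is included, since
  \<open>C0_semigroup\<close> does not contain one.\<close>

locale real_c0_semigroup = semi_inner H ip
 for H :: "'a::real_vector set" and ip :: "'a \<Rightarrow> 'a \<Rightarrow> real" +
 fixes T :: "real \<Rightarrow> 'a \<Rightarrow> 'a"
 assumes T_mem: "t \<ge> 0 \<Longrightarrow> x \<in> H \<Longrightarrow> T t x \<in> H"
  and T_linear: "t \<ge> 0 \<Longrightarrow> x \<in> H \<Longrightarrow> y \<in> H \<Longrightarrow> nrm (T t (c *\<^sub>R x + y) - (c *\<^sub>R T t x + T t y)) = 0"
  and T_bounded: "t \<ge> 0 \<Longrightarrow> \<exists>B. \<forall>x\<in>H. nrm (T t x) \<le> B * nrm x"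
  and T_zero: "x \<in> H \<Longrightarrow> nrm (T 0 x - x) = 0"
  and T_add: "s \<ge> 0 \<Longrightarrow> t \<ge> 0 \<Longrightarrow> x \<in> H \<Longrightarrow> nrm (T (s + t) x - T s (T t x)) = 0"
  and T_cont: "x \<in> H \<Longrightarrow> ((\<lambda>t. nrm (T t x - x)) \<longlongrightarrow> 0) (at_right 0)"
begin

definition gen :: "'a \<Rightarrow> 'a \<Rightarrow> bool" where
 "gen x y \<longleftrightarrow> x \<in> H \<and> y \<in> H \<and>
   ((\<lambda>t. nrm ((1 / t) *\<^sub>R (T t x - x) - y)) \<longlongrightarrow> 0) (at_right 0)"

lemma T_diff:
 assumes "t \<ge> 0" "x \<in> H" "y \<in> H" shows "nrm (T t (x - y) - (T t x - T t y)) = 0"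
 using T_linear[OF assms(1,3,2), of "-1"] by (simp add: algebra_simps)

end

section \<open>Construction of the semigroup from dyadic powers of resolvents\<close>

context coercive_form
begin

lemma J_cong:
 assumes "x \<in> H" "y \<in> H" "nrm (x - y) = 0" shows "nrm (J s x - J s y) = 0"
proof (rule order.antisym)
 show "nrm (J s x - J s y) \<le> 0" using J_nonexp[OF assms(1,2), of s] assms(3) by linarith
qed (use assms in simp)

lemma Jpow_H [simp]: "x \<in> H \<Longrightarrow> (J s ^^ k) x \<in> H"
 by (induction k) auto

lemma Jpow_nonexp: "x \<in> H \<Longrightarrow> y \<in> H \<Longrightarrow> nrm ((J s ^^ k) x - (J s ^^ k) y) \<le> nrm (x - y)"
proof (induction k)
 case (Suc k)
 have "nrm ((J s ^^ Suc k) x - (J s ^^ Suc k) y) \<le> nrm ((J s ^^ k) x - (J s ^^ k) y)"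
  unfolding funpow.simps comp_def by (rule J_nonexp) (use Suc.prems in auto)
 then show ?case using Suc by linarith
qed simp

lemma Jpow_norm: "x \<in> H \<Longrightarrow> nrm ((J s ^^ k) x) \<le> nrm x"
proof (induction k)
 case (Suc k)
 have "nrm ((J s ^^ Suc k) x) \<le> nrm ((J s ^^ k) x)"
  unfolding funpow.simps comp_def by (rule J_norm) (use Suc.prems in auto)
 then show ?case using Suc by linarith
qed simp

lemma Jpow_cong:
 assumes "x \<in> H" "y \<in> H" "nrm (x - y) = 0" shows "nrm ((J s ^^ k) x - (J s ^^ k) y) = 0"
proof (rule order.antisym)
 show "nrm ((J s ^^ k) x - (J s ^^ k) y) \<le> 0" using Jpow_nonexp[OF assms(1,2), of k s] assms(3) by linarith
qed (use assms in simp)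

lemma Jpow_comm:
 assumes "\<And>x. x \<in> H \<Longrightarrow> B x \<in> H"
  and nonexp: "\<And>x y. x \<in> H \<Longrightarrow> y \<in> H \<Longrightarrow> nrm (B x - B y) \<le> nrm (x - y)"
  and comm: "\<And>x. x \<in> H \<Longrightarrow> nrm (J s (B x) - B (J s x)) = 0"
  and x: "x \<in> H"
 shows "nrm ((J s ^^ k) (B x) - B ((J s ^^ k) x)) = 0"
proof (induction k)
 case (Suc k)
 let ?y = "(J s ^^ k) x"
 have "nrm (J s ((J s ^^ k) (B x)) - J s (B ?y)) = 0"
  by (rule J_cong[OF _ _ Suc]) (use assms(1) x in auto)
 moreover have "nrm (J s (B ?y) - B (J s ?y)) = 0" using comm x by simp
 ultimately have "nrm (J s ((J s ^^ k) (B x)) - B (J s ?y)) = 0"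
  by (rule null_trans[rotated 3]) (use assms(1) x in auto)
 then show ?case by simp
qed (use assms(1) x in simp)

lemma Jpow_linear:
 assumes "x \<in> H" "y \<in> H"
 shows "nrm ((J s ^^ k) (c *\<^sub>R x + y) - (c *\<^sub>R (J s ^^ k) x + (J s ^^ k) y)) = 0"
proof (induction k)
 case (Suc k)
 let ?z = "c *\<^sub>R (J s ^^ k) x + (J s ^^ k) y"
 have "nrm (J s ((J s ^^ k) (c *\<^sub>R x + y)) - J s ?z) = 0"
  by (rule J_cong[OF _ _ Suc]) (use assms in auto)
 moreover have "nrm (J s ?z - (c *\<^sub>R J s ((J s ^^ k) x) + J s ((J s ^^ k) y))) = 0"
  by (rule J_linear) (use assms in auto)
 ultimately show ?case
  using null_trans[of "J s ((J s ^^ k) (c *\<^sub>R x + y))" "J s ?z"] assms by simp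
qed simp

text \<open>Commutation rearranges the two powers into \<open>k\<close> factors of the form
  \<open>J s (J t y)\<close>. Each is exchanged for \<open>J (s + t) y\<close> at cost
  \<open>s * t * c\<close>, and nonexpansiveness keeps the errors from growing. As
  \<open>D2 c\<close> is invariant under resolvents, the induction can vary
  \<open>y\<close>.\<close>

lemma Jpow_add_time:
 assumes "y \<in> D2 c" "s \<ge> 0" "t \<ge> 0"
 shows "nrm ((J s ^^ k) ((J t ^^ k) y) - (J (s + t) ^^ k) y) \<le> real k * (s * t * c)"
 using assms(1)
proof (induction k arbitrary: y)
 case (Suc k)
 have y: "y \<in> H" by (rule D2_H[OF Suc.prems])
 have j: "J (s + t) y \<in> D2 c" by (rule D2_J[OF Suc.prems])
 let ?A = "(J s ^^ Suc k) ((J t ^^ Suc k) y)"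
 let ?B = "(J s ^^ k) ((J t ^^ k) (J s (J t y)))"
 let ?C = "(J s ^^ k) ((J t ^^ k) (J (s + t) y))"
 let ?D = "(J (s + t) ^^ Suc k) y"
 have "nrm ((J t ^^ k) (J s (J t y)) - J s ((J t ^^ k) (J t y))) = 0"
  by (rule Jpow_comm) (use y J_nonexp J_commute in auto)
 then have "nrm (J s ((J t ^^ k) (J t y)) - (J t ^^ k) (J s (J t y))) = 0"
  using nrm_diff_commute[of "J s ((J t ^^ k) (J t y))" "(J t ^^ k) (J s (J t y))"] y by simp
 then have "nrm (?A - ?B) = 0"
  unfolding funpow_Suc_right comp_def by (intro Jpow_cong) (use y in auto)
 moreover have "nrm (?B - ?C) \<le> s * t * c"
 proof -
  have "nrm (?B - ?C) \<le> nrm ((J t ^^ k) (J s (J t y)) - (J t ^^ k) (J (s + t) y))"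
   by (rule Jpow_nonexp) (use y in auto)
  also have "\<dots> \<le> nrm (J s (J t y) - J (s + t) y)" by (rule Jpow_nonexp) (use y in auto)
  also have "\<dots> \<le> s * t * c"
  proof -
   obtain y1 y2 where y12: "opA y y1" "opA y1 y2" "nrm y2 \<le> c" using Suc.prems by (auto simp: D2_def)
   have "nrm (J s (J t y) - J (s + t) y) \<le> s * t * nrm y2" by (rule J_add[OF y12(1,2) assms(2,3)])
   also have "\<dots> \<le> s * t * c" using y12(3) assms by (simp add: mult_left_mono)
   finally show ?thesis .
  qed
  finally show ?thesis .
 qed
 moreover have "nrm (?C - ?D) \<le> real k * (s * t * c)"
  unfolding funpow_Suc_right comp_def by (rule Suc.IH[OF j])
 moreover have "nrm (?A - ?D) \<le> nrm (?A - ?B) + (nrm (?B - ?C) + nrm (?C - ?D))"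
  using nrm_diff_triangle[of ?A ?B ?D] nrm_diff_triangle[of ?B ?C ?D] y by simp
 ultimately show ?case by (simp add: algebra_simps)
qed simp

text \<open>Backward Euler scheme with \<open>2 ^ n\<close> equal steps. The number of steps is
  dyadic because passing from \<open>n\<close> to \<open>n + 1\<close> then replaces every
  \<open>J (s + s)\<close> by two factors \<open>J s\<close>.\<close>

definition Tn :: "nat \<Rightarrow> real \<Rightarrow> 'a \<Rightarrow> 'a" where
 "Tn n t x = (J (t / 2 ^ n) ^^ (2 ^ n)) x"

lemma Tn_H [simp]: "x \<in> H \<Longrightarrow> Tn n t x \<in> H" by (simp add: Tn_def)

text \<open>Halving each of the \<open>2 ^ n\<close> steps costs the square of the new step size
  times \<open>c\<close>. The total is \<open>t^2 * c / 4\<close> times \<open>(1/2) ^ n\<close>,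
  hence summable in \<open>n\<close>.\<close>

lemma Tn_step:
 assumes "y \<in> D2 c" "t \<ge> 0" shows "nrm (Tn (Suc n) t y - Tn n t y) \<le> t\<^sup>2 * c * (1/2) ^ n"
proof -
 let ?s = "t / 2 ^ Suc n"
 obtain y1 y2 where "opA y1 y2" "nrm y2 \<le> c" using assms(1) by (auto simp: D2_def)
 then have c: "c \<ge> 0" using nrm_nonneg[of y2] opA_mem(3) by (meson order_trans)
 have "(2::nat) ^ Suc n = 2 ^ n + 2 ^ n" by simp
 then have "Tn (Suc n) t y = (J ?s ^^ 2 ^ n) ((J ?s ^^ 2 ^ n) y)"
  by (simp only: Tn_def funpow_add comp_apply)
 moreover have "Tn n t y = (J (?s + ?s) ^^ 2 ^ n) y" by (simp add: Tn_def)
 ultimately have "nrm (Tn (Suc n) t y - Tn n t y) \<le> real (2 ^ n) * (?s * ?s * c)"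
  using Jpow_add_time[OF assms(1), where s = ?s and t = ?s and k = "2 ^ n"] assms by simp
 also have "\<dots> = t\<^sup>2 * c * (1/2) ^ n / 4"
  by (simp add: field_simps power2_eq_square power_divide)
 also have "\<dots> \<le> t\<^sup>2 * c * (1/2) ^ n" using c by simp
 finally show ?thesis .
qed

lemma Tn_nonexp: "x \<in> H \<Longrightarrow> y \<in> H \<Longrightarrow> nrm (Tn n t x - Tn n t y) \<le> nrm (x - y)"
 unfolding Tn_def by (rule Jpow_nonexp)

lemma Tn_cau:
 assumes x: "x \<in> H" and t: "t \<ge> 0" shows "cau (\<lambda>n. Tn n t x)"
 unfolding cau_def
proof (intro allI impI)
 fix e :: real assume e: "e > 0"
 obtain c y where y: "y \<in> D2 c" "nrm (x - y) < e / 3" using dense_D2[OF x, of "e/3"] e by auto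
 have yH: "y \<in> H" by (rule D2_H[OF y(1)])
 have "cau (\<lambda>n. Tn n t y)" by (rule cau_geometric) (use Tn_step[OF y(1) t] yH in auto)
 then obtain M where M: "\<And>m n. m \<ge> M \<Longrightarrow> n \<ge> M \<Longrightarrow> nrm (Tn m t y - Tn n t y) < e / 3"
  unfolding cau_def using e by (meson divide_pos_pos zero_less_numeral)
 have "nrm (Tn m t x - Tn n t x) < e" if mn: "m \<ge> M" "n \<ge> M" for m n
 proof -
  have "nrm (Tn m t x - Tn n t x) \<le> nrm (Tn m t x - Tn m t y) + (nrm (Tn m t y - Tn n t y) + nrm (Tn n t y - Tn n t x))"
   using nrm_diff_triangle[of "Tn m t x" "Tn m t y" "Tn n t x"]
    nrm_diff_triangle[of "Tn m t y" "Tn n t y" "Tn n t x"] x yH by simp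
  then show ?thesis
   using Tn_nonexp[OF x yH, of m t] Tn_nonexp[OF yH x, of n t] M[OF mn] y(2) nrm_diff_commute[OF x yH] by simp
 qed
 then show "\<exists>M. \<forall>m\<ge>M. \<forall>n\<ge>M. nrm (Tn m t x - Tn n t x) < e" by blast
qed

definition S :: "real \<Rightarrow> 'a \<Rightarrow> 'a" where
 "S t x = (SOME y. y \<in> H \<and> (\<lambda>n. nrm (Tn n t x - y)) \<longlonglongrightarrow> 0)"

lemma S_lim:
 assumes "t \<ge> 0" "x \<in> H" shows "S t x \<in> H" "(\<lambda>n. nrm (Tn n t x - S t x)) \<longlonglongrightarrow> 0"
proof -
 have "\<exists>y. y \<in> H \<and> (\<lambda>n. nrm (Tn n t x - y)) \<longlonglongrightarrow> 0"
  using complete[of "\<lambda>n. Tn n t x"] Tn_cau[OF assms(2,1)] assms by auto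
 from someI_ex[OF this] show "S t x \<in> H" "(\<lambda>n. nrm (Tn n t x - S t x)) \<longlonglongrightarrow> 0"
  unfolding S_def by blast+
qed

lemma S_nonexp:
 assumes "t \<ge> 0" "x \<in> H" "y \<in> H" shows "nrm (S t x - S t y) \<le> nrm (x - y)"
proof (rule tendsto_upperbound)
 have "(\<lambda>n. nrm ((-1) *\<^sub>R Tn n t y + Tn n t x - ((-1) *\<^sub>R S t y + S t x))) \<longlonglongrightarrow> 0"
  by (rule limit_linear) (use S_lim assms in auto)
 then have "(\<lambda>n. nrm ((Tn n t x - Tn n t y) - (S t x - S t y))) \<longlonglongrightarrow> 0" by (simp add: algebra_simps)
 then show "(\<lambda>n. nrm (Tn n t x - Tn n t y)) \<longlonglongrightarrow> nrm (S t x - S t y)"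
  by (rule tendsto_nrm) (use S_lim assms in auto)
qed (use Tn_nonexp assms in auto)

lemma S_norm:
 assumes "t \<ge> 0" "x \<in> H" shows "nrm (S t x) \<le> nrm x"
proof (rule tendsto_upperbound)
 show "(\<lambda>n. nrm (Tn n t x)) \<longlonglongrightarrow> nrm (S t x)"
  by (rule tendsto_nrm) (use S_lim assms in auto)
qed (use Jpow_norm assms in \<open>auto simp: Tn_def\<close>)

lemma S_linear:
 assumes "t \<ge> 0" "x \<in> H" "y \<in> H" shows "nrm (S t (c *\<^sub>R x + y) - (c *\<^sub>R S t x + S t y)) = 0"
proof (rule limit_unique[of "\<lambda>n. Tn n t (c *\<^sub>R x + y)"])
 have l: "(\<lambda>n. nrm (c *\<^sub>R Tn n t x + Tn n t y - (c *\<^sub>R S t x + S t y))) \<longlonglongrightarrow> 0"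
  by (rule limit_linear) (use S_lim assms in auto)
 have z: "nrm (c *\<^sub>R Tn n t x + Tn n t y - Tn n t (c *\<^sub>R x + y)) = 0" for n
  using Jpow_linear[OF assms(2,3), where s = "t / 2 ^ n" and k = "2 ^ n" and c = c] assms
   nrm_diff_commute[of "Tn n t (c *\<^sub>R x + y)" "c *\<^sub>R Tn n t x + Tn n t y"] by (simp add: Tn_def)
 show "(\<lambda>n. nrm (Tn n t (c *\<^sub>R x + y) - (c *\<^sub>R S t x + S t y))) \<longlonglongrightarrow> 0"
  by (rule limit_cong[OF l]) (use z S_lim assms in auto)
qed (use S_lim assms in auto)

text \<open>Meant for multiplication by a scalar as \<open>B\<close>: nonexpansiveness lets
  commutation with one resolvent pass to powers and then to their limit.\<close>

lemma S_comm:
 assumes t: "t \<ge> 0" and B: "\<And>x. x \<in> H \<Longrightarrow> B x \<in> H"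
  and nonexp: "\<And>x y. x \<in> H \<Longrightarrow> y \<in> H \<Longrightarrow> nrm (B x - B y) \<le> nrm (x - y)"
  and comm: "\<And>x s. x \<in> H \<Longrightarrow> nrm (J s (B x) - B (J s x)) = 0"
  and x: "x \<in> H"
 shows "nrm (S t (B x) - B (S t x)) = 0"
proof (rule limit_unique[of "\<lambda>n. Tn n t (B x)"])
 have l: "(\<lambda>n. nrm (B (Tn n t x) - B (S t x))) \<longlonglongrightarrow> 0"
  by (rule Lim_null_comparison[OF _ S_lim(2)[OF t x]]) (use nonexp S_lim(1)[OF t x] x B in simp)
 have z: "nrm (B (Tn n t x) - Tn n t (B x)) = 0" for n
 proof -
  have "nrm (Tn n t (B x) - B (Tn n t x)) = 0"
   unfolding Tn_def by (rule Jpow_comm[OF B nonexp comm x])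
  then show ?thesis using nrm_diff_commute[of "Tn n t (B x)" "B (Tn n t x)"] B[OF x] B[of "Tn n t x"] x by simp
 qed
 show "(\<lambda>n. nrm (Tn n t (B x) - B (S t x))) \<longlonglongrightarrow> 0"
  by (rule limit_cong[OF l]) (use z S_lim t x B in auto)
qed (use S_lim t B x in auto)

lemma S_zero:
 assumes "x \<in> H" shows "nrm (S 0 x - x) = 0"
proof -
 have J0: "(J 0 ^^ k) x = x" for k by (induction k) auto
 have "Tn n 0 x = x" for n using J0 by (simp add: Tn_def)
 then have "(\<lambda>n. nrm (x - S 0 x)) \<longlonglongrightarrow> 0" using S_lim(2)[of 0 x] assms by simp
 then show ?thesis using S_lim(1)[of 0 x] assms nrm_diff_commute by (simp add: LIMSEQ_const_iff)
qed

text \<open>The same number of steps is used for \<open>s\<close>, for \<open>t\<close> and for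
  \<open>s + t\<close>, so the semigroup law holds up to an error \<open>s * t * c / 2 ^ n\<close>
  for arbitrary real times, and no detour through rational times is needed.\<close>

lemma S_add_D2:
 assumes y: "y \<in> D2 c" and s: "s \<ge> 0" and t: "t \<ge> 0"
 shows "nrm (S (s + t) y - S s (S t y)) = 0"
proof (rule limit_unique[of "\<lambda>n. Tn n (s + t) y"])
 have yH: "y \<in> H" by (rule D2_H[OF y])
 note m = S_lim[OF t yH] S_lim[OF s S_lim(1)[OF t yH]]
 have l: "(\<lambda>n. nrm (Tn n s (Tn n t y) - S s (S t y))) \<longlonglongrightarrow> 0"
 proof (rule Lim_null_comparison)
  show "(\<lambda>n. nrm (Tn n t y - S t y) + nrm (Tn n s (S t y) - S s (S t y))) \<longlonglongrightarrow> 0"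
   using tendsto_add[OF m(2) m(4)] by simp
  have "nrm (Tn n s (Tn n t y) - S s (S t y)) \<le> nrm (Tn n t y - S t y) + nrm (Tn n s (S t y) - S s (S t y))" for n
   using nrm_diff_triangle[of "Tn n s (Tn n t y)" "Tn n s (S t y)" "S s (S t y)"]
    Tn_nonexp[of "Tn n t y" "S t y" n s] m yH by simp
  then show "\<forall>\<^sub>F n in sequentially. norm (nrm (Tn n s (Tn n t y) - S s (S t y)))
   \<le> nrm (Tn n t y - S t y) + nrm (Tn n s (S t y) - S s (S t y))" using yH m by simp
 qed
 show "(\<lambda>n. nrm (Tn n (s + t) y - S s (S t y))) \<longlonglongrightarrow> 0"
 proof (rule limit_cong[OF l])
  show "(\<lambda>n. nrm (Tn n s (Tn n t y) - Tn n (s + t) y)) \<longlonglongrightarrow> 0"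
  proof (rule Lim_null_comparison)
   have "(\<lambda>n. s * t * c * (1/2) ^ n) \<longlonglongrightarrow> s * t * c * 0" by (intro tendsto_intros) auto
   then show "(\<lambda>n. s * t * c * (1/2) ^ n) \<longlonglongrightarrow> 0" by simp
   have "nrm (Tn n s (Tn n t y) - Tn n (s + t) y) \<le> s * t * c * (1/2) ^ n" for n
   proof -
    have "nrm (Tn n s (Tn n t y) - Tn n (s + t) y) \<le> real (2 ^ n) * (s / 2 ^ n * (t / 2 ^ n) * c)"
     unfolding Tn_def add_divide_distrib by (rule Jpow_add_time[OF y]) (use s t in auto)
    also have "\<dots> = s * t * c * (1/2) ^ n" by (simp add: power_divide)
    finally show ?thesis .
   qed
   then show "\<forall>\<^sub>F n in sequentially. norm (nrm (Tn n s (Tn n t y) - Tn n (s + t) y)) \<le> s * t * c * (1/2) ^ n"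
    using yH by simp
  qed
 qed (use yH m in auto)
 show "(\<lambda>n. nrm (Tn n (s + t) y - S (s + t) y)) \<longlonglongrightarrow> 0" using S_lim s t yH by simp
qed (use S_lim D2_H[OF y] s t in auto)

lemma S_add:
 assumes x: "x \<in> H" and s: "s \<ge> 0" and t: "t \<ge> 0"
 shows "nrm (S (s + t) x - S s (S t x)) = 0"
proof -
 note m = S_lim(1)[OF t] S_lim(1)[OF s] S_lim(1)[of "s + t"]
 have "nrm (S (s + t) x - S s (S t x)) \<le> e" if e: "e > 0" for e
 proof -
  obtain c y where y: "y \<in> D2 c" "nrm (x - y) < e / 2" using dense_D2[OF x, of "e/2"] e by auto
  have yH: "y \<in> H" by (rule D2_H[OF y(1)])
  have "nrm (S (s + t) x - S s (S t x)) \<le> nrm (S (s + t) x - S (s + t) y)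
    + (nrm (S (s + t) y - S s (S t y)) + nrm (S s (S t y) - S s (S t x)))"
   using nrm_diff_triangle[of "S (s + t) x" "S (s + t) y" "S s (S t x)"]
    nrm_diff_triangle[of "S (s + t) y" "S s (S t y)" "S s (S t x)"] x yH m s t by simp
  also have "nrm (S (s + t) y - S s (S t y)) = 0" by (rule S_add_D2[OF y(1) s t])
  also have "nrm (S (s + t) x - S (s + t) y) \<le> nrm (x - y)" using S_nonexp s t x yH by simp
  also have "nrm (S s (S t y) - S s (S t x)) \<le> nrm (x - y)"
   using S_nonexp[OF s, of "S t y" "S t x"] S_nonexp[OF t yH x] nrm_diff_commute[OF x yH] m x yH by simp
  finally show ?thesis using y(2) by simp
 qed
 then have "nrm (S (s + t) x - S s (S t x)) \<le> 0" by (rule field_le_epsilon[of _ 0, simplified])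
 then show ?thesis using nrm_nonneg[of "S (s + t) x - S s (S t x)"] m x s t by (simp del: nrm_nonneg)
qed

lemma Jpow_close:
 assumes "opA z z1" "s \<ge> 0" shows "nrm ((J s ^^ k) z - z) \<le> real k * s * nrm z1"
proof (induction k)
 case (Suc k)
 note m = opA_mem[OF assms(1)]
 have "nrm ((J s ^^ Suc k) z - z) \<le> nrm ((J s ^^ k) (J s z) - (J s ^^ k) z) + nrm ((J s ^^ k) z - z)"
  unfolding funpow_Suc_right comp_def by (rule nrm_diff_triangle) (use m in auto)
 also have "nrm ((J s ^^ k) (J s z) - (J s ^^ k) z) \<le> nrm (J s z - z)" by (rule Jpow_nonexp) (use m in auto)
 also have "\<dots> \<le> s * nrm z1" by (rule J_close[OF assms])
 finally show ?case using Suc by (simp add: algebra_simps)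
qed (use opA_mem[OF assms(1)] in simp)

text \<open>The bound \<open>d\<close> is on the elapsed time \<open>k * s\<close> and does not
  depend on the number of steps, so the estimate survives the limit of the Euler schemes.\<close>

lemma Jpow_uniform:
 assumes y: "y \<in> H" and e: "e > 0"
 shows "\<exists>d>0. \<forall>s k. s \<ge> 0 \<longrightarrow> real k * s \<le> d \<longrightarrow> nrm ((J s ^^ k) y - y) \<le> e"
proof -
 obtain c z where z: "z \<in> D2 c" "nrm (y - z) < e / 3" using dense_D2[OF y, of "e/3"] e by auto
 obtain z1 where z1: "opA z z1" using z(1) by (auto simp: D2_def)
 note m = opA_mem[OF z1]
 define d where "d = e / 3 / (nrm z1 + 1)"
 have n1: "nrm z1 + 1 > 0" using nrm_nonneg[OF m(3)] by linarith
 have "nrm ((J s ^^ k) y - y) \<le> e" if s: "s \<ge> 0" and k: "real k * s \<le> d" for s k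
 proof -
  have "nrm ((J s ^^ k) y - y) \<le> nrm ((J s ^^ k) y - (J s ^^ k) z) + (nrm ((J s ^^ k) z - z) + nrm (z - y))"
   using nrm_diff_triangle[of "(J s ^^ k) y" "(J s ^^ k) z" y]
    nrm_diff_triangle[of "(J s ^^ k) z" z y] y m by simp
  also have "nrm ((J s ^^ k) y - (J s ^^ k) z) \<le> nrm (y - z)" by (rule Jpow_nonexp) (use m y in auto)
  also have "nrm ((J s ^^ k) z - z) \<le> real k * s * nrm z1" by (rule Jpow_close[OF z1 s])
  also have "\<dots> \<le> d * (nrm z1 + 1)" using k s m n1 e by (intro mult_mono) (auto simp: d_def)
  also have "\<dots> = e / 3" using n1 by (simp add: d_def field_simps)
  finally show ?thesis using z(2) nrm_diff_commute[of y z] y m by simp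
 qed
 moreover have "d > 0" using e n1 by (simp add: d_def)
 ultimately show ?thesis by blast
qed

lemma S_close:
 assumes y: "y \<in> H" and e: "e > 0"
 shows "\<exists>d>0. \<forall>t. 0 \<le> t \<longrightarrow> t \<le> d \<longrightarrow> nrm (S t y - y) \<le> e"
proof -
 obtain d where d: "d > 0" "\<And>s k. s \<ge> 0 \<Longrightarrow> real k * s \<le> d \<Longrightarrow> nrm ((J s ^^ k) y - y) \<le> e"
  using Jpow_uniform[OF y e] by blast
 have "nrm (S t y - y) \<le> e" if t: "0 \<le> t" "t \<le> d" for t
 proof (rule tendsto_upperbound)
  have "(\<lambda>n. nrm ((1 *\<^sub>R Tn n t y + (- y)) - (1 *\<^sub>R S t y + (- y)))) \<longlonglongrightarrow> 0"
   by (rule limit_linear) (use S_lim t y in auto)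
  then have "(\<lambda>n. nrm ((Tn n t y - y) - (S t y - y))) \<longlonglongrightarrow> 0" by simp
  then show "(\<lambda>n. nrm (Tn n t y - y)) \<longlonglongrightarrow> nrm (S t y - y)"
   by (rule tendsto_nrm) (use S_lim t y in auto)
  show "\<forall>\<^sub>F n in sequentially. nrm (Tn n t y - y) \<le> e"
   using d(2)[where k = "2 ^ _" and s = "t / 2 ^ _"] t by (simp add: Tn_def)
 qed simp
 then show ?thesis using d(1) by blast
qed

text \<open>Each step changes the iterate of \<open>x\<close> by exactly \<open>- s\<close> times
  the corresponding iterate of \<open>y\<close>. Replacing that iterate by \<open>y\<close> costs at
  most \<open>s * e\<close>, and the \<open>m\<close> costs add up.\<close>

lemma Jpow_derivative:
 assumes x: "opA x y" and s: "s \<ge> 0" and bd: "\<And>k. k \<le> m \<Longrightarrow> nrm ((J s ^^ k) y - y) \<le> e"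
 shows "nrm ((J s ^^ m) x - x + (real m * s) *\<^sub>R y) \<le> real m * s * e"
 using bd
proof (induction m)
 case (Suc m)
 note mm = opA_mem[OF x]
 define A where "A = (J s ^^ Suc m) x"
 define B where "B = (J s ^^ Suc m) y"
 define C where "C = (J s ^^ m) x"
 have H: "A \<in> H" "B \<in> H" "C \<in> H" unfolding A_def B_def C_def by (intro Jpow_H mm)+
 let ?x' = "(- s) *\<^sub>R J s y + x"
 have "nrm ((J s ^^ m) (J s x) - (J s ^^ m) ?x') = 0"
  using J_step[OF x s] mm by (intro Jpow_cong) auto
 moreover have "nrm ((J s ^^ m) ?x' - ((- s) *\<^sub>R (J s ^^ m) (J s y) + (J s ^^ m) x)) = 0"
  by (rule Jpow_linear) (use mm in auto)
 ultimately have 0: "nrm (A - ((- s) *\<^sub>R B + C)) = 0"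
  unfolding A_def B_def C_def funpow_Suc_right comp_def by (rule null_trans[rotated 3]) (use mm in auto)
 define R where "R = A - ((- s) *\<^sub>R B + C)"
 have RH: "R \<in> H" using H by (simp add: R_def)
 have "A - x + (real (Suc m) * s) *\<^sub>R y = (R + (- s) *\<^sub>R (B - y)) + (C - x + (real m * s) *\<^sub>R y)"
  by (simp add: R_def algebra_simps)
 then have "nrm (A - x + (real (Suc m) * s) *\<^sub>R y) = nrm ((R + (- s) *\<^sub>R (B - y)) + (C - x + (real m * s) *\<^sub>R y))"
  by (rule arg_cong)
 moreover have "nrm ((R + (- s) *\<^sub>R (B - y)) + (C - x + (real m * s) *\<^sub>R y))
   \<le> nrm (R + (- s) *\<^sub>R (B - y)) + nrm (C - x + (real m * s) *\<^sub>R y)"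
  by (rule nrm_triangle) (use mm RH H in simp_all)
 moreover have "nrm (R + (- s) *\<^sub>R (B - y)) \<le> nrm R + nrm ((- s) *\<^sub>R (B - y))"
  by (rule nrm_triangle) (use mm RH H in simp_all)
 moreover have "nrm ((- s) *\<^sub>R (B - y)) \<le> s * e"
  using Suc.prems[of "Suc m"] s mm H by (subst nrm_scale) (auto simp: mult_left_mono B_def simp del: funpow.simps)
 moreover have "nrm (C - x + (real m * s) *\<^sub>R y) \<le> real m * s * e"
  unfolding C_def by (rule Suc.IH) (use Suc.prems in simp)
 moreover have "s * e + real m * s * e = real (Suc m) * s * e" by (simp add: algebra_simps)
 ultimately show ?case using 0 unfolding R_def A_def by linarith
qed simp

lemma S_derivative:
 assumes x: "opA x y" and e: "e > 0"
 shows "\<exists>d>0. \<forall>t. 0 \<le> t \<longrightarrow> t \<le> d \<longrightarrow> nrm (S t x - x + t *\<^sub>R y) \<le> t * e"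
proof -
 note mm = opA_mem[OF x]
 obtain d where d: "d > 0" "\<And>s k. s \<ge> 0 \<Longrightarrow> real k * s \<le> d \<Longrightarrow> nrm ((J s ^^ k) y - y) \<le> e"
  using Jpow_uniform[OF mm(3) e] by blast
 have "nrm (S t x - x + t *\<^sub>R y) \<le> t * e" if t: "0 \<le> t" "t \<le> d" for t
 proof (rule tendsto_upperbound)
  have "(\<lambda>n. nrm ((1 *\<^sub>R Tn n t x + (t *\<^sub>R y - x)) - (1 *\<^sub>R S t x + (t *\<^sub>R y - x)))) \<longlonglongrightarrow> 0"
   by (rule limit_linear) (use S_lim t mm in auto)
  then have "(\<lambda>n. nrm ((Tn n t x - x + t *\<^sub>R y) - (S t x - x + t *\<^sub>R y))) \<longlonglongrightarrow> 0" by simp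
  then show "(\<lambda>n. nrm (Tn n t x - x + t *\<^sub>R y)) \<longlonglongrightarrow> nrm (S t x - x + t *\<^sub>R y)"
   by (rule tendsto_nrm) (use S_lim t mm in auto)
  have "nrm (Tn n t x - x + t *\<^sub>R y) \<le> t * e" for n
  proof -
   have "nrm ((J (t / 2 ^ n) ^^ k) y - y) \<le> e" if "k \<le> 2 ^ n" for k
   proof (rule d(2))
    have "real k * (t / 2 ^ n) \<le> 2 ^ n * (t / 2 ^ n)"
     using that t by (intro mult_right_mono) (auto dest: of_nat_mono[where 'a=real])
    then show "real k * (t / 2 ^ n) \<le> d" using t by simp
   qed (use t in simp)
   then show ?thesis using Jpow_derivative[OF x, where s = "t / 2 ^ n" and m = "2 ^ n" and e = e] t by (simp add: Tn_def)
  qed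
  then show "\<forall>\<^sub>F n in sequentially. nrm (Tn n t x - x + t *\<^sub>R y) \<le> t * e" by simp
 qed simp
 then show ?thesis using d(1) by blast
qed

lemma S_semigroup: "real_c0_semigroup H ip S"
proof
 fix t :: real and x assume "0 \<le> t" "x \<in> H"
 then show "S t x \<in> H" by (rule S_lim)
next
 fix t :: real assume "0 \<le> t"
 then show "\<exists>B. \<forall>x\<in>H. nrm (S t x) \<le> B * nrm x" using S_norm by (intro exI[of _ 1]) auto
next
 fix x assume x: "x \<in> H"
 show "((\<lambda>t. nrm (S t x - x)) \<longlongrightarrow> 0) (at_right 0)"
 proof (rule tendstoI)
  fix e :: real assume e: "e > 0"
  obtain d where d: "d > 0" "\<And>t. 0 \<le> t \<Longrightarrow> t \<le> d \<Longrightarrow> nrm (S t x - x) \<le> e / 2"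
   using S_close[OF x, of "e/2"] e by auto
  show "\<forall>\<^sub>F t in at_right 0. dist (nrm (S t x - x)) 0 < e"
   unfolding eventually_at_right_field
  proof (intro exI[of _ d] conjI allI impI)
   fix t assume t: "0 < t" "t < d"
   then have "S t x \<in> H" using S_lim x by simp
   then show "dist (nrm (S t x - x)) 0 < e" using d(2)[of t] t e x by simp
  qed (rule d(1))
 qed
qed (use S_linear S_zero S_add in auto)

end

section \<open>Exponential shifts and identification of the generator\<close>

lemma tendsto_exp_quotient: "((\<lambda>t::real. (exp (w * t) - 1) / t - w) \<longlongrightarrow> 0) (at_right 0)"
proof -
 have "((\<lambda>t. exp (w * t)) has_field_derivative w) (at 0)"
  by (rule derivative_eq_intros refl | simp)+
 then have "((\<lambda>t. (exp (w * t) - 1) / t) \<longlongrightarrow> w) (at 0)"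
  unfolding has_field_derivative_iff by simp
 then have "((\<lambda>t. (exp (w * t) - 1) / t) \<longlongrightarrow> w) (at_right 0)"
  unfolding filterlim_at_split by blast
 then show ?thesis by (rule LIM_zero)
qed

context real_c0_semigroup
begin

text \<open>The constructed semigroup belongs to a form shifted by a multiple of the scalar product
  in order to be coercive; the factor \<open>exp (w * t)\<close> undoes the shift.\<close>

lemma shift: "real_c0_semigroup H ip (\<lambda>t x. exp (w * t) *\<^sub>R T t x)"
proof
 fix t :: real and x assume "0 \<le> t" "x \<in> H"
 then show "exp (w * t) *\<^sub>R T t x \<in> H" using T_mem by simp
next
 fix t :: real and x y c assume t: "0 \<le> t" "x \<in> H" "y \<in> H"
 have "exp (w * t) *\<^sub>R T t (c *\<^sub>R x + y) - (c *\<^sub>R exp (w * t) *\<^sub>R T t x + exp (w * t) *\<^sub>R T t y)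
  = exp (w * t) *\<^sub>R (T t (c *\<^sub>R x + y) - (c *\<^sub>R T t x + T t y))" by (simp add: algebra_simps)
 then show "nrm (exp (w * t) *\<^sub>R T t (c *\<^sub>R x + y) - (c *\<^sub>R exp (w * t) *\<^sub>R T t x + exp (w * t) *\<^sub>R T t y)) = 0"
  using T_linear[OF t, of c] t T_mem by (simp add: nrm_scale)
next
 fix t :: real assume t: "0 \<le> t"
 then obtain B where "\<forall>x\<in>H. nrm (T t x) \<le> B * nrm x" using T_bounded by blast
 then show "\<exists>B. \<forall>x\<in>H. nrm (exp (w * t) *\<^sub>R T t x) \<le> B * nrm x"
  using T_mem t by (intro exI[of _ "exp (w * t) * B"]) (simp add: nrm_scale mult_left_mono mult.assoc)
next
 fix x assume "x \<in> H"
 then show "nrm (exp (w * 0) *\<^sub>R T 0 x - x) = 0" using T_zero by simp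
next
 fix s t :: real and x assume s: "0 \<le> s" and t: "0 \<le> t" and x: "x \<in> H"
 let ?c = "exp (w * s)" and ?d = "exp (w * t)"
 have m: "T t x \<in> H" "T (s + t) x \<in> H" "T s (T t x) \<in> H" "T s (?d *\<^sub>R T t x) \<in> H" "T s 0 \<in> H"
  using s t x by (simp_all add: T_mem)
 have "nrm (T s (?d *\<^sub>R T t x) - (?d *\<^sub>R T s (T t x) + T s 0)) = 0"
  using T_linear[OF s m(1), of 0 ?d] by simp
 \<comment> \<open>Linearity holds only modulo elements of length zero, so \<open>T s 0\<close> need
   not be \<open>0\<close>; the operator bound shows that it is negligible.\<close>
 moreover have "nrm (T s 0) = 0"
 proof -
  obtain B where "\<forall>x\<in>H. nrm (T s x) \<le> B * nrm x" using T_bounded s by blast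
  then have "nrm (T s 0) \<le> B * nrm 0" using mem(1) by blast
  then have "nrm (T s 0) \<le> 0" by simp
  then show ?thesis using nrm_nonneg[OF m(5)] by linarith
 qed
 then have "nrm ((?d *\<^sub>R T s (T t x) + T s 0) - ?d *\<^sub>R T s (T t x)) = 0"
  by (simp only: add_diff_cancel_left')
 ultimately have 1: "nrm (T s (?d *\<^sub>R T t x) - ?d *\<^sub>R T s (T t x)) = 0"
  by (rule null_trans[rotated 3]) (use m in auto)
 have 2: "nrm (?d *\<^sub>R T (s + t) x - ?d *\<^sub>R T s (T t x)) = 0"
  using T_add[OF s t x] m nrm_scale[of "T (s + t) x - T s (T t x)" ?d] by (simp add: scaleR_diff_right)
 have "nrm (?d *\<^sub>R T (s + t) x - T s (?d *\<^sub>R T t x)) = 0"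
 proof (rule null_trans[OF _ _ _ 2])
  show "nrm (?d *\<^sub>R T s (T t x) - T s (?d *\<^sub>R T t x)) = 0"
   using 1 nrm_diff_commute[OF m(4), of "?d *\<^sub>R T s (T t x)"] m(3) by simp
 qed (use m in auto)
 then have "nrm (?c *\<^sub>R (?d *\<^sub>R T (s + t) x - T s (?d *\<^sub>R T t x))) = 0"
  using m by (subst nrm_scale) auto
 then show "nrm (exp (w * (s + t)) *\<^sub>R T (s + t) x - ?c *\<^sub>R T s (?d *\<^sub>R T t x)) = 0"
  by (simp add: scaleR_diff_right distrib_left exp_add)
next
 fix x assume x: "x \<in> H"
 show "((\<lambda>t. nrm (exp (w * t) *\<^sub>R T t x - x)) \<longlongrightarrow> 0) (at_right 0)"
 proof (rule Lim_null_comparison)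
  have "((\<lambda>t. exp (w * t) * nrm (T t x - x) + \<bar>exp (w * t) - 1\<bar> * nrm x) \<longlongrightarrow>
    exp (w * 0) * 0 + \<bar>exp (w * 0) - 1\<bar> * nrm x) (at_right 0)"
   by (intro tendsto_intros T_cont x)
  then show "((\<lambda>t. exp (w * t) * nrm (T t x - x) + \<bar>exp (w * t) - 1\<bar> * nrm x) \<longlongrightarrow> 0) (at_right 0)" by simp
  show "\<forall>\<^sub>F t in at_right 0. norm (nrm (exp (w * t) *\<^sub>R T t x - x))
   \<le> exp (w * t) * nrm (T t x - x) + \<bar>exp (w * t) - 1\<bar> * nrm x"
   using eventually_at_right_less[of "0::real"]
  proof eventually_elim
   case (elim t)
   then have m: "T t x \<in> H" using T_mem x by simp
   have "exp (w * t) *\<^sub>R T t x - x = exp (w * t) *\<^sub>R (T t x - x) + (exp (w * t) - 1) *\<^sub>R x"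
    by (simp add: algebra_simps)
   then have "nrm (exp (w * t) *\<^sub>R T t x - x) \<le> nrm (exp (w * t) *\<^sub>R (T t x - x)) + nrm ((exp (w * t) - 1) *\<^sub>R x)"
    using nrm_triangle m x by simp
   then show ?case using m x by (simp add: nrm_scale)
  qed
 qed
qed

lemma gen_shift:
 assumes "gen x y" shows "real_c0_semigroup.gen H ip (\<lambda>t x. exp (w * t) *\<^sub>R T t x) x (y + w *\<^sub>R x)"
proof -
 interpret U: real_c0_semigroup H ip "\<lambda>t x. exp (w * t) *\<^sub>R T t x" by (rule shift)
 have x: "x \<in> H" "y \<in> H" and l: "((\<lambda>t. nrm ((1 / t) *\<^sub>R (T t x - x) - y)) \<longlongrightarrow> 0) (at_right 0)"
  using assms by (auto simp: gen_def)
 let ?e = "\<lambda>t. exp (w * t) * nrm ((1 / t) *\<^sub>R (T t x - x) - y) + \<bar>exp (w * t) - 1\<bar> * nrm y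
  + \<bar>(exp (w * t) - 1) / t - w\<bar> * nrm x"
 have "((\<lambda>t. nrm ((1 / t) *\<^sub>R (exp (w * t) *\<^sub>R T t x - x) - (y + w *\<^sub>R x))) \<longlongrightarrow> 0) (at_right 0)"
 proof (rule Lim_null_comparison)
  have "(?e \<longlongrightarrow> exp (w * 0) * 0 + \<bar>exp (w * 0) - 1\<bar> * nrm y + \<bar>0\<bar> * nrm x) (at_right 0)"
   by (intro tendsto_intros l tendsto_exp_quotient)
  then show "(?e \<longlongrightarrow> 0) (at_right 0)" by simp
  show "\<forall>\<^sub>F t in at_right 0. norm (nrm ((1 / t) *\<^sub>R (exp (w * t) *\<^sub>R T t x - x) - (y + w *\<^sub>R x))) \<le> ?e t"
   using eventually_at_right_less[of "0::real"]
  proof eventually_elim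
   case (elim t)
   then have m: "T t x \<in> H" using T_mem x by simp
   let ?a = "exp (w * t) *\<^sub>R ((1 / t) *\<^sub>R (T t x - x) - y)"
   let ?b = "(exp (w * t) - 1) *\<^sub>R y" and ?c = "((exp (w * t) - 1) / t - w) *\<^sub>R x"
   have eq0: "i *\<^sub>R (E *\<^sub>R X - x) - (y + w *\<^sub>R x) = E *\<^sub>R (i *\<^sub>R (X - x) - y) + (E - 1) *\<^sub>R y + ((E - 1) * i - w) *\<^sub>R x" for i E X
    by (simp add: algebra_simps)
   have eq: "(1 / t) *\<^sub>R (exp (w * t) *\<^sub>R T t x - x) - (y + w *\<^sub>R x) = ?a + ?b + ?c"
    using eq0[of "1/t" "exp (w * t)" "T t x"] by simp
   have "nrm (?a + ?b + ?c) \<le> nrm (?a + ?b) + nrm ?c" by (rule nrm_triangle) (use m x in auto)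
   moreover have "nrm (?a + ?b) \<le> nrm ?a + nrm ?b" by (rule nrm_triangle) (use m x in auto)
   moreover have "nrm ?a = exp (w * t) * nrm ((1 / t) *\<^sub>R (T t x - x) - y)"
    "nrm ?b = \<bar>exp (w * t) - 1\<bar> * nrm y" "nrm ?c = \<bar>(exp (w * t) - 1) / t - w\<bar> * nrm x"
    using m x by (subst nrm_scale; simp)+
   moreover have "norm (nrm (?a + ?b + ?c)) = nrm (?a + ?b + ?c)" using m x by simp
   ultimately show ?case unfolding eq by linarith
  qed
 qed
 then show ?thesis using x by (simp add: U.gen_def)
qed

lemma gen_shift_iff:
 "real_c0_semigroup.gen H ip (\<lambda>t x. exp (w * t) *\<^sub>R T t x) x y \<longleftrightarrow> gen x (y - w *\<^sub>R x)"
proof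
 interpret U: real_c0_semigroup H ip "\<lambda>t x. exp (w * t) *\<^sub>R T t x" by (rule shift)
 assume "U.gen x y"
 then have "real_c0_semigroup.gen H ip (\<lambda>t x. exp (- w * t) *\<^sub>R exp (w * t) *\<^sub>R T t x) x (y + (- w) *\<^sub>R x)"
  by (rule U.gen_shift)
 moreover have "exp (- w * t) * exp (w * t) = 1" for t by (simp flip: exp_add)
 ultimately show "gen x (y - w *\<^sub>R x)" by simp
next
 assume "gen x (y - w *\<^sub>R x)"
 from gen_shift[OF this, of w] show "real_c0_semigroup.gen H ip (\<lambda>t x. exp (w * t) *\<^sub>R T t x) x y" by simp
qed

lemma gen_scale_add:
 assumes "gen x y" "gen x' y'" shows "gen (c *\<^sub>R x + x') (c *\<^sub>R y + y')"
proof -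
 have m: "x \<in> H" "y \<in> H" "x' \<in> H" "y' \<in> H" using assms by (auto simp: gen_def)
 have "((\<lambda>t. nrm ((1 / t) *\<^sub>R (T t (c *\<^sub>R x + x') - (c *\<^sub>R x + x')) - (c *\<^sub>R y + y'))) \<longlongrightarrow> 0) (at_right 0)"
 proof (rule Lim_null_comparison)
  have "((\<lambda>t. \<bar>c\<bar> * nrm ((1 / t) *\<^sub>R (T t x - x) - y) + nrm ((1 / t) *\<^sub>R (T t x' - x') - y')) \<longlongrightarrow> \<bar>c\<bar> * 0 + 0) (at_right 0)"
   using assms by (intro tendsto_intros) (auto simp: gen_def)
  then show "((\<lambda>t. \<bar>c\<bar> * nrm ((1 / t) *\<^sub>R (T t x - x) - y) + nrm ((1 / t) *\<^sub>R (T t x' - x') - y')) \<longlongrightarrow> 0) (at_right 0)" by simp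
  show "\<forall>\<^sub>F t in at_right 0. norm (nrm ((1 / t) *\<^sub>R (T t (c *\<^sub>R x + x') - (c *\<^sub>R x + x')) - (c *\<^sub>R y + y')))
   \<le> \<bar>c\<bar> * nrm ((1 / t) *\<^sub>R (T t x - x) - y) + nrm ((1 / t) *\<^sub>R (T t x' - x') - y')"
   using eventually_at_right_less[of "0::real"]
  proof eventually_elim
   case (elim t)
   then have t: "t \<ge> 0" by simp
   have mm: "T t x \<in> H" "T t x' \<in> H" "T t (c *\<^sub>R x + x') \<in> H" using T_mem t m by simp_all
   let ?r = "T t (c *\<^sub>R x + x') - (c *\<^sub>R T t x + T t x')"
   let ?a = "(1 / t) *\<^sub>R (T t x - x) - y" and ?b = "(1 / t) *\<^sub>R (T t x' - x') - y'"
   have eq: "(1 / t) *\<^sub>R (T t (c *\<^sub>R x + x') - (c *\<^sub>R x + x')) - (c *\<^sub>R y + y') = (1 / t) *\<^sub>R ?r + (c *\<^sub>R ?a + ?b)"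
    by (simp add: algebra_simps)
   have "nrm ((1 / t) *\<^sub>R ?r + (c *\<^sub>R ?a + ?b)) \<le> nrm ((1 / t) *\<^sub>R ?r) + nrm (c *\<^sub>R ?a + ?b)"
    by (rule nrm_triangle) (use m mm in auto)
   moreover have "nrm (c *\<^sub>R ?a + ?b) \<le> nrm (c *\<^sub>R ?a) + nrm ?b"
    by (rule nrm_triangle) (use m mm in auto)
   moreover have "nrm ((1 / t) *\<^sub>R ?r) = 0" using T_linear[OF t m(1,3), of c] mm by (subst nrm_scale) auto
   moreover have "nrm (c *\<^sub>R ?a) = \<bar>c\<bar> * nrm ?a" using m mm by (intro nrm_scale) auto
   moreover have "norm (nrm ((1 / t) *\<^sub>R ?r + (c *\<^sub>R ?a + ?b))) = nrm ((1 / t) *\<^sub>R ?r + (c *\<^sub>R ?a + ?b))"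
    using m mm by (simp del: nrm_nonneg add: nrm_nonneg)
   ultimately show ?case unfolding eq by linarith
  qed
 qed
 then show ?thesis using m by (simp add: gen_def)
qed

end

context coercive_form
begin

text \<open>One inclusion is the derivative formula on the domain of the operator. For the other,
  the generator of a contraction semigroup is dissipative while \<open>1 + A\<close> is onto, so the
  generator cannot properly extend \<open>- A\<close>.\<close>

lemma gen_S: "real_c0_semigroup.gen H ip S x y \<longleftrightarrow> opA x (- y)"
proof
 interpret S: real_c0_semigroup H ip S by (rule S_semigroup)
 have opA_gen: "S.gen x y" if A: "opA x (- y)" for x y
 proof -
  have m: "x \<in> H" "y \<in> H" using opA_mem[OF A] mem(5)[of "- y"] by auto
  have "((\<lambda>t. nrm ((1 / t) *\<^sub>R (S t x - x) - y)) \<longlongrightarrow> 0) (at_right 0)"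
  proof (rule tendstoI)
   fix e :: real assume e: "e > 0"
   obtain d where d: "d > 0" "\<And>t. 0 \<le> t \<Longrightarrow> t \<le> d \<Longrightarrow> nrm (S t x - x + t *\<^sub>R (- y)) \<le> t * (e / 2)"
    using S_derivative[OF A, of "e/2"] e by auto
   show "\<forall>\<^sub>F t in at_right 0. dist (nrm ((1 / t) *\<^sub>R (S t x - x) - y)) 0 < e"
    unfolding eventually_at_right_field
   proof (intro exI[of _ d] conjI allI impI)
    fix t assume t: "0 < t" "t < d"
    have mm: "S t x \<in> H" using S_lim t m by simp
    have "(1 / t) *\<^sub>R (S t x - x) - y = (1 / t) *\<^sub>R (S t x - x + t *\<^sub>R (- y))"
     using t by (simp add: algebra_simps)
    also have "nrm \<dots> = (1 / t) * nrm (S t x - x + t *\<^sub>R (- y))" using mm m t by (subst nrm_scale) auto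
    also have "\<dots> \<le> (1 / t) * (t * (e / 2))" using d(2)[of t] t by (intro mult_left_mono) auto
    also have "\<dots> < e" using t e by simp
    finally show "dist (nrm ((1 / t) *\<^sub>R (S t x - x) - y)) 0 < e" using mm m by simp
   qed (rule d(1))
  qed
  then show ?thesis using m by (simp add: S.gen_def)
 qed
 show "opA x (- y) \<Longrightarrow> S.gen x y" by (rule opA_gen)
 assume g: "S.gen x y"
 then have m: "x \<in> H" "y \<in> H" by (auto simp: S.gen_def)
 \<comment> \<open>\<open>z\<close> solves \<open>z + A z = x - y\<close>, the equation that
   \<open>x\<close> itself should satisfy. The difference \<open>u = x - z\<close> then satisfies
   \<open>S.gen u u\<close>, which contractivity permits only for length zero.\<close>
 define z where "z = J 1 (x - y)"
 have z: "opA z (x - y - z)" using J_opA[of 1 "x - y"] m by (simp add: z_def)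
 note zm = opA_mem[OF z]
 define u where "u = (- 1) *\<^sub>R z + x"
 have um: "u \<in> H" using zm m by (simp add: u_def)
 have "S.gen z (- (x - y - z))" by (rule opA_gen) (use z in simp)
 from S.gen_scale_add[OF this g, of "- 1"] have gu: "S.gen u u"
  by (simp add: u_def algebra_simps)
 have "ip u u \<le> 0"
 proof (rule tendsto_upperbound)
  \<comment> \<open>\<open>max t 0\<close> keeps the vectors in \<open>H\<close> for every index;
    for \<open>t > 0\<close> nothing changes.\<close>
  show "((\<lambda>t. ip ((1 / max t 0) *\<^sub>R (S (max t 0) u - u)) u) \<longlongrightarrow> ip u u) (at_right 0)"
  proof (rule tendsto_ip)
   have "((\<lambda>t. nrm ((1 / t) *\<^sub>R (S t u - u) - u)) \<longlongrightarrow> 0) (at_right 0)" using gu by (simp add: S.gen_def)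
   moreover have "\<forall>\<^sub>F t in at_right 0. nrm ((1 / t) *\<^sub>R (S t u - u) - u) = nrm ((1 / max t 0) *\<^sub>R (S (max t 0) u - u) - u)"
    using eventually_at_right_less[of "0::real"] by eventually_elim simp
   ultimately show "((\<lambda>t. nrm ((1 / max t 0) *\<^sub>R (S (max t 0) u - u) - u)) \<longlongrightarrow> 0) (at_right 0)"
    by (rule Lim_transform_eventually)
  qed (use um S_lim in auto)
  show "\<forall>\<^sub>F t in at_right 0. ip ((1 / max t 0) *\<^sub>R (S (max t 0) u - u)) u \<le> 0"
   using eventually_at_right_less[of "0::real"]
  proof eventually_elim
   case (elim t)
   then have s: "S t u \<in> H" "nrm (S t u) \<le> nrm u" using S_lim S_norm um by auto
   have "ip (S t u) u \<le> nrm (S t u) * nrm u" using ip_le_nrm[OF s(1) um] by linarith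
   also have "\<dots> \<le> nrm u * nrm u" using s um by (intro mult_right_mono) auto
   also have "\<dots> = ip u u" using nrm_sq[OF um] by (simp add: power2_eq_square)
   finally show ?case using elim s um by (simp add: ip_lin mult_nonneg_nonpos divide_nonpos_pos)
  qed
 qed simp
 then have "ip u u = 0" using ip_pos[OF um] by simp
 then have "nrm (x - z) = 0" by (simp add: nrm_def u_def)
 moreover have "- y - (x - y - z) = - (x - z)" by simp
 ultimately show "opA x (- y)" using m zm nrm_diff_commute[of x z] by (intro opA_cong[OF z]) auto
qed

text \<open>\<open>opA\<close> belongs to the shifted form, hence the argument
  \<open>w *\<^sub>R x - y\<close>. The last conjunct exports commutation with operators
  \<open>B\<close> that preserve \<open>opA\<close>; it is what later turns real linearity into
  \<open>K\<close>-linearity.\<close>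

theorem semigroup_exists:
 "\<exists>T. real_c0_semigroup H ip T \<and>
  (\<forall>x y. real_c0_semigroup.gen H ip T x y \<longleftrightarrow> opA x (w *\<^sub>R x - y)) \<and>
  (\<forall>B t x. (\<forall>x\<in>H. B x \<in> H) \<longrightarrow> (\<forall>x\<in>H. \<forall>y\<in>H. B (x - y) = B x - B y) \<longrightarrow>
   (\<forall>x\<in>H. \<forall>r. B (r *\<^sub>R x) = r *\<^sub>R B x) \<longrightarrow> (\<forall>x\<in>H. nrm (B x) \<le> nrm x) \<longrightarrow>
   (\<forall>u h. opA u h \<longrightarrow> opA (B u) (B h)) \<longrightarrow> t \<ge> 0 \<longrightarrow> x \<in> H \<longrightarrow> nrm (T t (B x) - B (T t x)) = 0)"
proof (intro exI[of _ "\<lambda>t x. exp (w * t) *\<^sub>R S t x"] conjI allI impI)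
 interpret S: real_c0_semigroup H ip S by (rule S_semigroup)
 show "real_c0_semigroup H ip (\<lambda>t x. exp (w * t) *\<^sub>R S t x)" by (rule S.shift)
 show "real_c0_semigroup.gen H ip (\<lambda>t x. exp (w * t) *\<^sub>R S t x) x y = opA x (w *\<^sub>R x - y)" for x y
  unfolding S.gen_shift_iff gen_S by simp
 fix B t x assume B: "\<forall>x\<in>H. B x \<in> H" and diff: "\<forall>x\<in>H. \<forall>y\<in>H. B (x - y) = B x - B y"
  and scale: "\<forall>x\<in>H. \<forall>r. B (r *\<^sub>R x) = r *\<^sub>R B x" and norm: "\<forall>x\<in>H. nrm (B x) \<le> nrm x"
  and op: "\<forall>u h. opA u h \<longrightarrow> opA (B u) (B h)" and t: "t \<ge> (0::real)" and x: "x \<in> H"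
 have "nrm (J s (B y) - B (J s y)) = 0" if y: "y \<in> H" for s y
 proof (cases "s > 0")
  case True
  have "opA (B (J s y)) (B ((1/s) *\<^sub>R (y - J s y)))" using J_opA[OF True y] op by blast
  moreover have "B ((1/s) *\<^sub>R (y - J s y)) = (1/s) *\<^sub>R (B y - B (J s y))"
   using scale diff y by simp
  ultimately have "nrm (B (J s y) - J s (B (J s y) + s *\<^sub>R (1/s) *\<^sub>R (B y - B (J s y)))) = 0"
   using J_unique_opA[OF True] by metis
  then have "nrm (B (J s y) - J s (B y)) = 0" using True by simp
  then show ?thesis using nrm_diff_commute[of "B (J s y)" "J s (B y)"] B y by simp
 next
  case False
  then show ?thesis by simp
 qed
 then have "nrm (S t (B x) - B (S t x)) = 0"
 proof (intro S_comm[OF t _ _ _ x])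
  fix x y assume "x \<in> H" "y \<in> H"
  then show "nrm (B x - B y) \<le> nrm (x - y)" using norm diff by (metis mem(3))
 qed (use B in auto)
 then have "nrm (exp (w * t) *\<^sub>R (S t (B x) - B (S t x))) = 0"
  using S_lim(1)[OF t] B x by (subst nrm_scale) auto
 then show "nrm (exp (w * t) *\<^sub>R S t (B x) - B (exp (w * t) *\<^sub>R S t x)) = 0"
  using scale S_lim(1)[OF t x] by (simp add: scaleR_diff_right)
qed

lemma dense_opA:
 assumes "x \<in> H" "e > 0" shows "\<exists>y h. opA y h \<and> nrm (x - y) < e"
 using dense_D2[OF assms] by (auto simp: D2_def)

end

section \<open>Gronwall estimate, continuity of orbits, and invariance of convex sets\<close>

text \<open>By continuity there is a largest time in \<open>[0, t]\<close> at which
  \<open>f s \<le> f 0 + e' * s\<close>, and the bound on right increments would carry this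
  inequality beyond any such time smaller than \<open>t\<close>. The slope
  \<open>e' = e / (t + 1)\<close> adds at most \<open>e\<close> in total.\<close>

lemma nonincreasing_if_right_derivative:
 fixes f :: "real \<Rightarrow> real"
 assumes cont: "continuous_on {0..} f"
  and dini: "\<And>t e. t \<ge> 0 \<Longrightarrow> e > 0 \<Longrightarrow> \<exists>d>0. \<forall>h. 0 < h \<longrightarrow> h < d \<longrightarrow> f (t + h) \<le> f t + h * e"
  and t: "t \<ge> 0"
 shows "f t \<le> f 0"
proof (rule field_le_epsilon)
 fix e :: real assume e: "e > 0"
 define e' where "e' = e / (t + 1)"
 have e': "e' > 0" using e t by (simp add: e'_def)
 define A where "A = {s \<in> {0..t}. f s \<le> f 0 + e' * s}"
 have "continuous_on {0..t} (\<lambda>s. f s - e' * s)"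
  by (intro continuous_on_diff continuous_on_subset[OF cont] continuous_intros) auto
 then have "closed ({0..t} \<inter> (\<lambda>s. f s - e' * s) -` {..f 0})"
  by (rule continuous_closed_preimage) auto
 also have "{0..t} \<inter> (\<lambda>s. f s - e' * s) -` {..f 0} = A" by (auto simp: A_def algebra_simps)
 finally have "closed A" .
 moreover have A: "A \<subseteq> {0..t}" "0 \<in> A" using t by (auto simp: A_def)
 moreover have bdd: "bdd_above A" using A(1) by (meson bdd_above_Icc bdd_above_mono)
 ultimately have c: "Sup A \<in> A" by (intro closed_contains_Sup) auto
 have up: "s \<le> Sup A" if "s \<in> A" for s
  by (rule cSup_upper[OF that bdd])
 have "Sup A = t"
 proof (rule ccontr)
  assume "Sup A \<noteq> t"
  then have lt: "Sup A < t" "Sup A \<ge> 0" using c A by fastforce+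
  obtain d where d: "d > 0" "\<And>h. 0 < h \<Longrightarrow> h < d \<Longrightarrow> f (Sup A + h) \<le> f (Sup A) + h * e'"
   using dini[OF lt(2) e'] by blast
  define h where "h = min (d / 2) (t - Sup A)"
  have h: "0 < h" "h < d" "Sup A + h \<le> t" using d(1) lt by (auto simp: h_def)
  have "f (Sup A + h) \<le> f 0 + e' * (Sup A + h)"
   using d(2)[OF h(1,2)] c by (simp add: A_def algebra_simps)
  then have "Sup A + h \<in> A" using h lt by (simp add: A_def)
  then show False using up[of "Sup A + h"] h by simp
 qed
 then have "f t \<le> f 0 + e' * t" using c by (simp add: A_def)
 also have "e' * t \<le> e" using e t by (simp add: e'_def field_simps)
 finally show "f t \<le> f 0 + e" by simp
qed

text \<open>The factor \<open>exp (- w * t)\<close> reduces the claim to monotonicity, with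
  \<open>1 + w * h \<le> exp (w * h)\<close> absorbing the growth term. The error stays below
  \<open>h * e\<close> because the weight is at most 1 for \<open>w \<ge> 0\<close>.\<close>

lemma gronwall_right_derivative:
 fixes f :: "real \<Rightarrow> real"
 assumes cont: "continuous_on {0..} f" and nonneg: "\<And>t. t \<ge> 0 \<Longrightarrow> 0 \<le> f t" and w: "w \<ge> 0"
  and dini: "\<And>t e. t \<ge> 0 \<Longrightarrow> e > 0 \<Longrightarrow>
   \<exists>d>0. \<forall>h. 0 < h \<longrightarrow> h < d \<longrightarrow> f (t + h) \<le> f t + h * (w * f t + e)"
  and t: "t \<ge> 0"
 shows "f t \<le> exp (w * t) * f 0"
proof -
 have "exp (- w * t) * f t \<le> exp (- w * 0) * f 0"
 proof (rule nonincreasing_if_right_derivative[OF _ _ t])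
  show "continuous_on {0..} (\<lambda>t. exp (- w * t) * f t)" by (intro continuous_intros cont)
  fix s e :: real assume s: "s \<ge> 0" and e: "e > 0"
  obtain d where d: "d > 0" "\<And>h. 0 < h \<Longrightarrow> h < d \<Longrightarrow> f (s + h) \<le> f s + h * (w * f s + e)"
   using dini[OF s e] by blast
  have "exp (- w * (s + h)) * f (s + h) \<le> exp (- w * s) * f s + h * e" if h: "0 < h" "h < d" for h
  proof -
   have "exp (- w * (s + h)) * f (s + h) \<le> exp (- w * (s + h)) * ((1 + w * h) * f s + h * e)"
    using d(2)[OF h] by (intro mult_left_mono) (auto simp: algebra_simps)
   also have "\<dots> \<le> exp (- w * (s + h)) * (exp (w * h) * f s + h * e)"
    using exp_ge_add_one_self[of "w * h"] nonneg[OF s] h by (intro mult_left_mono add_mono mult_right_mono) auto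
   also have "\<dots> = exp (- w * s) * f s + exp (- w * (s + h)) * (h * e)"
   proof -
    have "exp (- w * (s + h)) * exp (w * h) = exp (- w * s)" by (subst exp_add[symmetric]) (simp add: algebra_simps)
    then show ?thesis by (metis distrib_left mult.assoc)
   qed
   also have "exp (- w * (s + h)) * (h * e) \<le> 1 * (h * e)"
    using w s h e by (intro mult_right_mono) auto
   finally show ?thesis by simp
  qed
  then show "\<exists>d>0. \<forall>h. 0 < h \<longrightarrow> h < d \<longrightarrow> exp (- w * (s + h)) * f (s + h) \<le> exp (- w * s) * f s + h * e"
   using d(1) by blast
 qed
 then have "exp (w * t) * (exp (- w * t) * f t) \<le> exp (w * t) * f 0" by (intro mult_left_mono) auto
 then show ?thesis by (simp add: mult.assoc[symmetric] flip: exp_add)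
qed

context real_c0_semigroup
begin

lemma T_diff_bound:
 assumes "t \<ge> 0" shows "\<exists>B\<ge>0. \<forall>x\<in>H. \<forall>y\<in>H. nrm (T t x - T t y) \<le> B * nrm (x - y)"
proof -
 obtain B where B: "\<And>x. x \<in> H \<Longrightarrow> nrm (T t x) \<le> B * nrm x" using T_bounded[OF assms] by blast
 have "nrm (T t x - T t y) \<le> \<bar>B\<bar> * nrm (x - y)" if x: "x \<in> H" "y \<in> H" for x y
 proof -
  have "nrm (T t x - T t y) = nrm (T t (x - y))"
   by (rule nrm_cong[symmetric]) (use T_diff[OF assms x] T_mem assms x in auto)
  also have "\<dots> \<le> B * nrm (x - y)" using B x by simp
  also have "\<dots> \<le> \<bar>B\<bar> * nrm (x - y)" using x by (intro mult_right_mono) auto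
  finally show ?thesis .
 qed
 then show ?thesis by (intro exI[of _ "\<bar>B\<bar>"]) auto
qed

lemma T_small:
 assumes "x \<in> H" "e > 0" shows "\<exists>d>0. \<forall>h. 0 \<le> h \<longrightarrow> h < d \<longrightarrow> nrm (T h x - x) < e"
proof -
 have "\<forall>\<^sub>F h in at_right 0. dist (nrm (T h x - x)) 0 < e"
  using tendstoD[OF T_cont] assms by blast
 then obtain d where d: "d > 0" "\<And>h. 0 < h \<Longrightarrow> h < d \<Longrightarrow> dist (nrm (T h x - x)) 0 < e"
  unfolding eventually_at_right_field by blast
 have "nrm (T h x - x) < e" if "0 \<le> h" "h < d" for h
  using d(2)[of h] that T_zero[OF assms(1)] assms T_mem by (cases "h = 0") auto
 then show ?thesis using d(1) by blast
qed

lemma T_right: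
 assumes "t \<ge> 0" "x \<in> H" "e > 0" shows "\<exists>d>0. \<forall>h. 0 \<le> h \<longrightarrow> h < d \<longrightarrow> nrm (T (t + h) x - T t x) < e"
proof -
 obtain B where B: "B \<ge> 0" "\<And>x y. x \<in> H \<Longrightarrow> y \<in> H \<Longrightarrow> nrm (T t x - T t y) \<le> B * nrm (x - y)"
  using T_diff_bound[OF assms(1)] by blast
 have "e / (B + 1) > 0" using B assms by simp
 then obtain d where d: "d > 0" "\<And>h. 0 \<le> h \<Longrightarrow> h < d \<Longrightarrow> nrm (T h x - x) < e / (B + 1)"
  using T_small[OF assms(2)] by blast
 have "nrm (T (t + h) x - T t x) < e" if h: "0 \<le> h" "h < d" for h
 proof -
  have m: "T h x \<in> H" "T t (T h x) \<in> H" "T t x \<in> H" "T (t + h) x \<in> H" using T_mem assms h by simp_all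
  have "nrm (T (t + h) x - T t x) \<le> nrm (T (t + h) x - T t (T h x)) + nrm (T t (T h x) - T t x)"
   by (rule nrm_diff_triangle) (use m in auto)
  also have "nrm (T (t + h) x - T t (T h x)) = 0" using T_add assms h by simp
  also have "nrm (T t (T h x) - T t x) \<le> B * nrm (T h x - x)" by (rule B) (use m assms in auto)
  also have "\<dots> \<le> B * (e / (B + 1))" using d(2)[OF h] B by (intro mult_left_mono) auto
  also have "\<dots> < e" using B assms by (simp add: field_simps)
  finally show ?thesis by simp
 qed
 then show ?thesis using d(1) by blast
qed

text \<open>Right continuity yields points of continuity arbitrarily close to \<open>0\<close>, by nested intervals;
 the semigroup law propagates continuity to the right. This avoids local boundedness of \<open>T\<close>.\<close>

lemma continuity_point:
 assumes x: "x \<in> H" and e0: "e0 > 0"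
 shows "\<exists>t0. 0 < t0 \<and> t0 < e0 \<and> (\<forall>e>0. \<exists>d>0. \<forall>s. \<bar>s - t0\<bar> < d \<longrightarrow> nrm (T s x - T t0 x) < e)"
proof -
 define P where "P = (\<lambda>n p. 0 < fst p \<and> fst p < snd p \<and> snd p < e0 \<and>
   (\<forall>s\<in>{fst p..snd p}. nrm (T s x - T (fst p) x) \<le> 1 / (real n + 1)))"
 \<comment> \<open>Nesting is strict at both ends, so the common point is interior to every interval
   and the oscillation bounds hold on both sides of it.\<close>
 define Q where "Q = (\<lambda>(p::real \<times> real) q. fst p < fst q \<and> snd q < snd p)"
 have ex: "\<exists>p. P n p \<and> l < fst p \<and> snd p < r" if lr: "0 \<le> l" "l < r" "r \<le> e0" for l r :: real and n
 proof -
  define m where "m = (l + r) / 2"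
  have m: "l < m" "m < r" "0 \<le> m" using lr by (auto simp: m_def)
  obtain d where d: "d > 0" "\<And>h. 0 \<le> h \<Longrightarrow> h < d \<Longrightarrow> nrm (T (m + h) x - T m x) < 1 / (real n + 1)"
   using T_right[OF m(3) x, of "1 / (real n + 1)"] by auto
  define q where "q = m + min (d / 2) ((r - m) / 2)"
  have q: "m < q" "q < r" "q - m < d" using d(1) m by (auto simp: q_def min_def field_simps)
  have "nrm (T s x - T m x) \<le> 1 / (real n + 1)" if "s \<in> {m..q}" for s
   using d(2)[of "s - m"] that q by auto
  then have "P n (m, q)" using m q lr by (auto simp: P_def)
  then show ?thesis using m q by (intro exI[of _ "(m, q)"]) auto
 qed
 have "\<exists>f. \<forall>n. P n (f n) \<and> Q (f n) (f (Suc n))"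
 proof (rule dependent_nat_choice)
  show "\<exists>p. P 0 p" using ex[of 0 e0 0] e0 by auto
  fix p n assume "P n p"
  then show "\<exists>q. P (Suc n) q \<and> Q p q" using ex[of "fst p" "snd p" "Suc n"] by (auto simp: P_def Q_def)
 qed
 then obtain f where P: "\<And>n. P n (f n)" and Q: "\<And>n. Q (f n) (f (Suc n))" by blast
 define l where "l n = fst (f n)" for n define r where "r n = snd (f n)" for n
 have lr: "0 < l n" "l n < r n" "r n < e0" "l n < l (Suc n)" "r (Suc n) < r n" for n
  using P[of n] Q[of n] by (auto simp: P_def Q_def l_def r_def)
 have osc: "nrm (T s x - T (l n) x) \<le> 1 / (real n + 1)" if "l n \<le> s" "s \<le> r n" for s n
  using P[of n] that by (auto simp: P_def l_def r_def)
 have mono: "incseq l" by (rule incseq_SucI) (use lr(4) less_imp_le in blast)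
 have mono': "decseq r" by (rule decseq_SucI) (use lr(5) less_imp_le in blast)
 have cross: "l m < r n" for m n
 proof -
  have "l m \<le> l (max m n)" "r (max m n) \<le> r n" using mono mono' by (auto simp: incseq_def decseq_def)
  then show ?thesis using lr(2)[of "max m n"] by linarith
 qed
 define t0 where "t0 = (SUP n. l n)"
 have bdd: "bdd_above (range l)" using cross[of _ 0] by (auto intro!: bdd_aboveI2[of _ _ "r 0"] less_imp_le)
 have t0: "l n < t0" "t0 < r n" for n
 proof -
  have "l (Suc n) \<le> t0" unfolding t0_def by (rule cSUP_upper[OF _ bdd]) simp
  then show "l n < t0" using lr(4)[of n] by linarith
  have "t0 \<le> r (Suc n)" unfolding t0_def by (rule cSUP_least) (use cross less_imp_le in auto)
  then show "t0 < r n" using lr(5)[of n] by linarith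
 qed
 have pos: "0 < t0" "t0 < e0" using lr(1,3)[of 0] t0[of 0] by linarith+
 have "\<exists>d>0. \<forall>s. \<bar>s - t0\<bar> < d \<longrightarrow> nrm (T s x - T t0 x) < e" if e: "e > 0" for e
 proof -
  obtain n :: nat where n: "2 / e < real n" using reals_Archimedean2 by blast
  have small: "2 / (real n + 1) < e"
  proof -
   have "2 < real n * e" using n e by (simp add: field_simps)
   also have "\<dots> \<le> (real n + 1) * e" using e by (intro mult_right_mono) auto
   finally show ?thesis by (simp add: pos_divide_less_eq mult.commute)
  qed
  have "nrm (T s x - T t0 x) < e" if s: "\<bar>s - t0\<bar> < min (t0 - l n) (r n - t0)" for s
  proof -
   have sl: "l n \<le> s" "s \<le> r n" using s by (auto simp: abs_less_iff)
   have m: "T s x \<in> H" "T t0 x \<in> H" "T (l n) x \<in> H"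
    using T_mem[OF _ x] sl(1) lr(1)[of n] pos(1) by (auto intro!: T_mem x)
   have "nrm (T s x - T t0 x) \<le> nrm (T s x - T (l n) x) + nrm (T (l n) x - T t0 x)"
    by (rule nrm_diff_triangle) (use m in auto)
   also have "\<dots> \<le> 1 / (real n + 1) + 1 / (real n + 1)"
    using osc[OF sl] osc[of n t0] t0[of n] nrm_diff_commute[OF m(3,2)] by (intro add_mono) auto
   also have "\<dots> < e" using small by simp
   finally show ?thesis .
  qed
  moreover have "min (t0 - l n) (r n - t0) > 0" using t0[of n] by simp
  ultimately show ?thesis by blast
 qed
 then show ?thesis using pos by blast
qed

lemma T_continuous:
 assumes x: "x \<in> H" and t: "t \<ge> 0" and e: "e > 0"
 shows "\<exists>d>0. \<forall>s\<ge>0. \<bar>s - t\<bar> < d \<longrightarrow> nrm (T s x - T t x) < e"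
proof (cases "t = 0")
 case True
 obtain d where d: "d > 0" "\<And>h. 0 \<le> h \<Longrightarrow> h < d \<Longrightarrow> nrm (T (0 + h) x - T 0 x) < e"
  using T_right[of 0, OF _ x e] by auto
 then show ?thesis using True by (intro exI[of _ d]) auto
next
 case False
 then have t: "t > 0" using t by simp
 obtain t0 where t0: "0 < t0" "t0 < t" "\<And>e. e > 0 \<Longrightarrow> \<exists>d>0. \<forall>s. \<bar>s - t0\<bar> < d \<longrightarrow> nrm (T s x - T t0 x) < e"
  using continuity_point[OF x t] by blast
 have tt: "t - t0 \<ge> 0" using t0 by simp
 obtain B where B: "B \<ge> 0" "\<And>x y. x \<in> H \<Longrightarrow> y \<in> H \<Longrightarrow> nrm (T (t - t0) x - T (t - t0) y) \<le> B * nrm (x - y)"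
  using T_diff_bound[OF tt] by blast
 have "e / (B + 1) > 0" using B e by simp
 then obtain d where d: "d > 0" "\<And>s. \<bar>s - t0\<bar> < d \<Longrightarrow> nrm (T s x - T t0 x) < e / (B + 1)"
  using t0(3) by meson
 have "nrm (T s x - T t x) < e" if s: "\<bar>s - t\<bar> < min d t0" for s
 proof -
  define s' where "s' = s - t + t0"
  have s': "s' > 0" "\<bar>s' - t0\<bar> < d" "(t - t0) + s' = s" using s by (auto simp: s'_def)
  have m: "T s' x \<in> H" "T t0 x \<in> H" "T (t - t0) (T s' x) \<in> H" "T (t - t0) (T t0 x) \<in> H" "T s x \<in> H" "T t x \<in> H"
   using T_mem[OF _ x] s'(1) s t0(1,2) tt by (auto intro!: T_mem x)
  have 1: "nrm (T s x - T (t - t0) (T s' x)) = 0" using T_add[OF tt _ x, of s'] s' by simp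
  have 2: "nrm (T t x - T (t - t0) (T t0 x)) = 0" using T_add[OF tt _ x, of t0] t0 by simp
  have "nrm (T s x - T t x) \<le> nrm (T s x - T (t - t0) (T s' x)) + (nrm (T (t - t0) (T s' x) - T (t - t0) (T t0 x))
    + nrm (T (t - t0) (T t0 x) - T t x))"
   using nrm_diff_triangle[OF m(5,3,6)] nrm_diff_triangle[OF m(3,4,6)] by linarith
  also have "\<dots> \<le> B * nrm (T s' x - T t0 x)"
   using 1 2 nrm_diff_commute[OF m(6,4)] B(2)[OF m(1,2)] by simp
  also have "\<dots> \<le> B * (e / (B + 1))" using d(2)[OF s'(2)] B by (intro mult_left_mono) auto
  also have "\<dots> < e" using B e by (simp add: field_simps)
  finally show ?thesis .
 qed
 moreover have "min d t0 > 0" using d t0 by simp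
 ultimately show ?thesis by blast
qed

lemma continuous_along_orbit:
 assumes x: "x \<in> H" and f: "\<And>y z. y \<in> H \<Longrightarrow> z \<in> H \<Longrightarrow> \<bar>f y - f z\<bar> \<le> nrm (y - z)"
 shows "continuous_on {0..} (\<lambda>t. f (T t x))"
 unfolding continuous_on_iff
proof (intro ballI allI impI)
 fix t e :: real assume t: "t \<in> {0..}" and e: "e > 0"
 obtain d where d: "d > 0" "\<And>s. s \<ge> 0 \<Longrightarrow> \<bar>s - t\<bar> < d \<Longrightarrow> nrm (T s x - T t x) < e"
  using T_continuous[OF x _ e, of t] t by auto
 have "dist (f (T s x)) (f (T t x)) < e" if "s \<in> {0..}" "dist s t < d" for s
  using f[of "T s x" "T t x"] d(2)[of s] that t T_mem x by (auto simp: dist_real_def)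
 then show "\<exists>d>0. \<forall>s\<in>{0..}. dist s t < d \<longrightarrow> dist (f (T s x)) (f (T t x)) < e" using d(1) by blast
qed

lemma gen_T:
 assumes g: "gen x y" and t: "t \<ge> 0" shows "gen (T t x) (T t y)"
proof -
 have x: "x \<in> H" "y \<in> H" using g by (auto simp: gen_def)
 have m: "T t x \<in> H" "T t y \<in> H" using T_mem t x by auto
 obtain B where B: "B \<ge> 0" "\<And>x y. x \<in> H \<Longrightarrow> y \<in> H \<Longrightarrow> nrm (T t x - T t y) \<le> B * nrm (x - y)"
  using T_diff_bound[OF t] by blast
 have "((\<lambda>h. nrm ((1 / h) *\<^sub>R (T h (T t x) - T t x) - T t y)) \<longlongrightarrow> 0) (at_right 0)"
 proof (rule Lim_null_comparison)
  show "((\<lambda>h. B * nrm ((1 / h) *\<^sub>R (T h x - x) - y)) \<longlongrightarrow> 0) (at_right 0)"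
   using g by (intro tendsto_mult_right_zero) (simp add: gen_def)
  show "\<forall>\<^sub>F h in at_right 0. norm (nrm ((1 / h) *\<^sub>R (T h (T t x) - T t x) - T t y))
   \<le> B * nrm ((1 / h) *\<^sub>R (T h x - x) - y)"
   using eventually_at_right_less[of "0::real"]
  proof eventually_elim
   case (elim h)
   then have h: "h \<ge> 0" by simp
   define z where "z = (1 / h) *\<^sub>R (T h x - x)"
   have zm: "z \<in> H" "T h x \<in> H" using T_mem h x by (simp_all add: z_def)
   have mm: "T h (T t x) \<in> H" "T t (T h x) \<in> H" "T t z \<in> H" "T t (T h x - x) \<in> H" "T t 0 \<in> H"
    using T_mem t h zm m x by simp_all
   have "nrm (T (h + t) x - T h (T t x)) = 0" by (rule T_add[OF h t x(1)])
   then have 1: "nrm (T h (T t x) - T (t + h) x) = 0"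
    using nrm_diff_commute[OF mm(1), of "T (t + h) x"] T_mem t h x by (simp add: add.commute)
   have 2: "nrm (T (t + h) x - T t (T h x)) = 0" by (rule T_add[OF t h x(1)])
   have 3: "nrm (T h (T t x) - T t (T h x)) = 0"
    by (rule null_trans[OF _ _ _ 1 2]) (use mm T_mem t h x in auto)
   have "h *\<^sub>R z + x = T h x" using elim by (simp add: z_def)
   then have 4: "nrm (T t (T h x) - (h *\<^sub>R T t z + T t x)) = 0"
    using T_linear[OF t zm(1) x(1), of h] by simp
   have 5: "nrm (T h (T t x) - (h *\<^sub>R T t z + T t x)) = 0"
    by (rule null_trans[OF _ _ _ 3 4]) (use mm m in auto)
   have "(1 / h) *\<^sub>R (T h (T t x) - T t x) - T t y
    = (1 / h) *\<^sub>R (T h (T t x) - (h *\<^sub>R T t z + T t x)) + (T t z - T t y)"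
    using elim by (simp add: algebra_simps)
   then have "nrm ((1 / h) *\<^sub>R (T h (T t x) - T t x) - T t y)
    = nrm ((1 / h) *\<^sub>R (T h (T t x) - (h *\<^sub>R T t z + T t x)) + (T t z - T t y))"
    by (rule arg_cong)
   moreover have "nrm ((1 / h) *\<^sub>R (T h (T t x) - (h *\<^sub>R T t z + T t x)) + (T t z - T t y))
    \<le> nrm ((1 / h) *\<^sub>R (T h (T t x) - (h *\<^sub>R T t z + T t x))) + nrm (T t z - T t y)"
    by (rule nrm_triangle) (use mm m in auto)
   moreover have "nrm ((1 / h) *\<^sub>R (T h (T t x) - (h *\<^sub>R T t z + T t x))) = 0"
    using 5 mm m by (subst nrm_scale) auto
   ultimately have "nrm ((1 / h) *\<^sub>R (T h (T t x) - T t x) - T t y) \<le> nrm (T t z - T t y)" by linarith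
   also have "\<dots> \<le> B * nrm (z - y)" by (rule B) (use zm x in auto)
   finally show ?case using mm m by (simp add: z_def)
  qed
 qed
 then show ?thesis using m by (simp add: gen_def)
qed

text \<open>The squared distance to the range of the projection \<open>P\<close> is the Lyapunov function.\<close>

theorem invariance:
 assumes gen: "\<And>x y. gen x y \<Longrightarrow> x \<in> V \<and> (\<forall>v\<in>V. b x v = - ip y v)"
  and dense: "\<And>x e. x \<in> H \<Longrightarrow> e > 0 \<Longrightarrow> \<exists>y z. gen y z \<and> nrm (x - y) < e"
  and P: "\<And>x. x \<in> H \<Longrightarrow> P x \<in> H"
  and nearest: "\<And>x y. x \<in> H \<Longrightarrow> y \<in> H \<Longrightarrow> nrm (x - P x) \<le> nrm (x - P y)"
  and form: "\<And>u. u \<in> V \<Longrightarrow> u - P u \<in> V \<and> - w * ip (u - P u) (u - P u) \<le> b u (u - P u)"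
  and w: "w \<ge> 0" and x: "x \<in> H" "nrm (x - P x) = 0" and t: "t \<ge> 0"
 shows "nrm (T t x - P (T t x)) = 0"
proof -
 define \<delta> where "\<delta> y = nrm (y - P y)" for y
 have \<delta>_le: "\<delta> y \<le> nrm (y - P z)" if "y \<in> H" "z \<in> H" for y z using nearest that by (simp add: \<delta>_def)
 have \<delta>_lip: "\<delta> y \<le> \<delta> z + nrm (y - z)" if "y \<in> H" "z \<in> H" for y z
  using \<delta>_le[OF that] nrm_diff_triangle[of y z "P z"] P that by (simp add: \<delta>_def)
 have \<delta>_abs: "\<bar>\<delta> y - \<delta> z\<bar> \<le> nrm (y - z)" if "y \<in> H" "z \<in> H" for y z
  using \<delta>_lip[OF that] \<delta>_lip[OF that(2,1)] nrm_diff_commute[OF that] by linarith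
 have decay: "(\<delta> (T t f))\<^sup>2 \<le> exp (2 * w * t) * (\<delta> f)\<^sup>2" if fg: "gen f g" for f g
 proof -
  have f: "f \<in> H" "g \<in> H" using fg by (auto simp: gen_def)
  have "(\<delta> (T t f))\<^sup>2 \<le> exp (2 * w * t) * (\<delta> (T 0 f))\<^sup>2"
  proof (rule gronwall_right_derivative[OF _ _ _ _ t])
   show "continuous_on {0..} (\<lambda>t. (\<delta> (T t f))\<^sup>2)"
    by (intro continuous_intros continuous_along_orbit f \<delta>_abs)
   fix s e :: real assume s: "s \<ge> 0" and e: "e > 0"
   define u where "u = T s f" define y where "y = T s g"
   have gu: "gen u y" unfolding u_def y_def by (rule gen_T[OF fg s])
   have m: "u \<in> H" "y \<in> H" "P u \<in> H" using gu P by (auto simp: gen_def)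
   define q where "q = u - P u"
   have q: "q \<in> H" using m by (simp add: q_def)
   \<comment> \<open>The form inequality read through the generator: since
     \<open>b u q = - ip y q\<close>, a lower bound for the form limits the growth of the squared
     distance.\<close>
   have yq: "ip q y \<le> w * (\<delta> u)\<^sup>2"
   proof -
    have "u \<in> V" "\<And>v. v \<in> V \<Longrightarrow> b u v = - ip y v" using gen[OF gu] by auto
    then have "b u q = - ip y q" "- w * ip q q \<le> b u q" using form[of u] by (auto simp: q_def)
    then have "ip q y \<le> w * ip q q" using ip_sym[OF q m(2)] by linarith
    then show ?thesis using nrm_sq[OF q] by (simp add: \<delta>_def q_def)
   qed
   \<comment> \<open>\<open>e1\<close> bounds the first-order remainder of the orbit; with this
     value the cross term \<open>2 * nrm q * e1\<close> is at most \<open>e / 2\<close>.\<close>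
   define e1 where "e1 = min 1 (e / (4 * (nrm q + 1)))"
   have nq: "nrm q \<ge> 0" "nrm y \<ge> 0" using q m by auto
   have e1: "e1 > 0" "e1 \<le> 1" using e nq by (auto simp: e1_def)
   have e1q: "2 * (nrm q * e1) \<le> e / 2"
   proof -
    have "nrm q * e1 \<le> (nrm q + 1) * (e / (4 * (nrm q + 1)))" using nq e1 by (intro mult_mono) (auto simp: e1_def)
    also have "\<dots> = e / 4" using nq by (simp add: field_simps)
    finally show ?thesis by simp
   qed
   have "\<forall>\<^sub>F h in at_right 0. dist (nrm ((1 / h) *\<^sub>R (T h u - u) - y)) 0 < e1"
    using gu by (intro tendstoD e1) (simp add: gen_def)
   then obtain d where d: "d > 0" "\<And>h. 0 < h \<Longrightarrow> h < d \<Longrightarrow> dist (nrm ((1 / h) *\<^sub>R (T h u - u) - y)) 0 < e1"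
    unfolding eventually_at_right_field by blast
   \<comment> \<open>The second bound keeps the quadratic term \<open>ip z z\<close> below
     \<open>h * (e / 2)\<close>.\<close>
   define d' where "d' = min d (e / (2 * (nrm y + 1)\<^sup>2))"
   have d': "d' > 0" using d e nq by (simp add: d'_def)
   have "(\<delta> (T (s + h) f))\<^sup>2 \<le> (\<delta> (T s f))\<^sup>2 + h * (2 * w * (\<delta> (T s f))\<^sup>2 + e)" if h: "0 < h" "h < d'" for h
   proof -
    have hm: "T h u \<in> H" "T (s + h) f \<in> H" using T_mem h s m f by simp_all
    define r where "r = T h u - u - h *\<^sub>R y"
    have r: "r \<in> H" using hm m by (simp add: r_def)
    have nr: "nrm r \<le> h * e1"
    proof -
     have "r = h *\<^sub>R ((1 / h) *\<^sub>R (T h u - u) - y)" using h by (simp add: r_def scaleR_diff_right)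
     then have "nrm r = \<bar>h\<bar> * nrm ((1 / h) *\<^sub>R (T h u - u) - y)" using hm m by (metis nrm_scale mem(3,4))
     also have "\<dots> \<le> h * e1" using d(2)[of h] h hm m by (intro mult_mono) (auto simp: d'_def)
     finally show ?thesis .
    qed
    define z where "z = h *\<^sub>R y + r"
    have z: "z \<in> H" using m r by (simp add: z_def)
    have nz: "nrm z \<le> h * (nrm y + 1)"
    proof -
     have "nrm z \<le> nrm (h *\<^sub>R y) + nrm r" unfolding z_def by (rule nrm_triangle) (use m r in auto)
     also have "\<dots> \<le> h * nrm y + h * 1"
     proof (rule add_mono)
      show "nrm (h *\<^sub>R y) \<le> h * nrm y" using nrm_scale[OF m(2), of h] h by simp
      have "h * e1 \<le> h * 1" using e1 h by (intro mult_left_mono) auto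
      then show "nrm r \<le> h * 1" using nr by linarith
     qed
     finally show ?thesis by (simp add: distrib_left)
    qed
    have qz: "ip q z \<le> h * (w * (\<delta> u)\<^sup>2) + nrm q * (h * e1)"
    proof -
     have "ip q z = h * ip q y + ip q r" using q m r by (simp add: z_def ip_lin)
     also have "h * ip q y \<le> h * (w * (\<delta> u)\<^sup>2)" using yq h by (intro mult_left_mono) auto
     also have "ip q r \<le> nrm q * nrm r" using ip_le_nrm[OF q r] by linarith
     also have "\<dots> \<le> nrm q * (h * e1)" using nr nq by (intro mult_left_mono) auto
     finally show ?thesis by simp
    qed
    have zz: "ip z z \<le> h * (e / 2)"
    proof -
     have "ip z z = (nrm z)\<^sup>2" using nrm_sq[OF z] by simp
     also have "\<dots> \<le> (h * (nrm y + 1))\<^sup>2" using nz z by (intro power_mono) auto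
     also have "\<dots> = h * (h * (nrm y + 1)\<^sup>2)" by (simp add: power2_eq_square algebra_simps)
     also have "\<dots> \<le> h * (e / 2)"
     proof (intro mult_left_mono)
      have "h \<le> e / (2 * (nrm y + 1)\<^sup>2)" using h by (simp add: d'_def)
      moreover have "(nrm y + 1)\<^sup>2 > 0" using nq by (simp add: add_nonneg_pos)
      ultimately show "h * (nrm y + 1)\<^sup>2 \<le> e / 2" by (simp add: field_simps)
     qed (use h in simp)
     finally show ?thesis .
    qed
    \<comment> \<open>The projection \<open>P u\<close> stays fixed while the orbit moves on: the
      new distance is at most the distance to this old nearest point, which can be expanded in
      \<open>h\<close>.\<close>
    have "\<delta> (T (s + h) f) \<le> \<delta> (T h u) + nrm (T (s + h) f - T h u)" by (rule \<delta>_lip) (use hm in auto)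
    also have "nrm (T (s + h) f - T h u) = 0" using T_add[of h s f] s h f by (simp add: u_def add.commute)
    also have "\<delta> (T h u) \<le> nrm (T h u - P u)" by (rule \<delta>_le) (use hm m in auto)
    also have "T h u - P u = q + z" by (simp add: q_def z_def r_def)
    finally have "\<delta> (T (s + h) f) \<le> nrm (q + z)" by simp
    then have "(\<delta> (T (s + h) f))\<^sup>2 \<le> (nrm (q + z))\<^sup>2"
     using hm P by (intro power_mono) (auto simp: \<delta>_def)
    also have "\<dots> = ip q q + 2 * ip q z + ip z z"
     using q z ip_sym[OF z q] by (simp add: nrm_sq ip_lin)
    also have "\<dots> \<le> (\<delta> u)\<^sup>2 + 2 * (h * (w * (\<delta> u)\<^sup>2) + nrm q * (h * e1)) + h * (e / 2)"
     using qz zz nrm_sq[OF q] by (simp add: \<delta>_def q_def)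
    also have "\<dots> = (\<delta> u)\<^sup>2 + h * (2 * w * (\<delta> u)\<^sup>2 + 2 * (nrm q * e1) + e / 2)"
     by (simp add: algebra_simps)
    also have "\<dots> \<le> (\<delta> u)\<^sup>2 + h * (2 * w * (\<delta> u)\<^sup>2 + e / 2 + e / 2)"
    proof -
     have "2 * w * (\<delta> u)\<^sup>2 + 2 * (nrm q * e1) + e / 2 \<le> 2 * w * (\<delta> u)\<^sup>2 + e / 2 + e / 2" using e1q by simp
     from mult_left_mono[OF this, of h] h show ?thesis by linarith
    qed
    finally show ?thesis by (simp add: u_def add.commute)
   qed
   then show "\<exists>d>0. \<forall>h. 0 < h \<longrightarrow> h < d \<longrightarrow>
     (\<delta> (T (s + h) f))\<^sup>2 \<le> (\<delta> (T s f))\<^sup>2 + h * (2 * w * (\<delta> (T s f))\<^sup>2 + e)"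
    using d' by blast
  qed (use w in auto)
  also have "\<delta> (T 0 f) = \<delta> f"
  proof -
   have "T 0 f \<in> H" using T_mem f by simp
   then show ?thesis using \<delta>_abs[of "T 0 f" f] T_zero[OF f(1)] f by simp
  qed
  finally show ?thesis .
 qed
 obtain B where B: "B \<ge> 0" "\<And>x y. x \<in> H \<Longrightarrow> y \<in> H \<Longrightarrow> nrm (T t x - T t y) \<le> B * nrm (x - y)"
  using T_diff_bound[OF t] by blast
 have m: "T t x \<in> H" using T_mem t x by simp
 \<comment> \<open>The decay estimate concerns orbits in the domain of the generator. Density and
   the bound of the single operator \<open>T t\<close> extend its conclusion to
   \<open>x\<close>.\<close>
 have "\<delta> (T t x) \<le> e" if e: "e > 0" for e
 proof -
  define C where "C = exp (w * t) + B"
  have C: "C > 0" using B by (simp add: C_def add_pos_nonneg)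
  obtain f g where fg: "gen f g" "nrm (x - f) < e / C" using dense[OF x(1), of "e / C"] e C by auto
  have f: "f \<in> H" "T t f \<in> H" using fg T_mem t by (auto simp: gen_def)
  have "(\<delta> (T t f))\<^sup>2 \<le> (exp (w * t) * \<delta> f)\<^sup>2"
   using decay[OF fg(1)] exp_double[of "w * t"] by (simp add: power_mult_distrib mult.assoc)
  then have "\<delta> (T t f) \<le> exp (w * t) * \<delta> f"
   by (rule power2_le_imp_le) (use f P in \<open>auto simp: \<delta>_def\<close>)
  also have "\<delta> f \<le> nrm (x - f)" using \<delta>_lip[OF f(1) x(1)] x nrm_diff_commute[OF x(1) f(1)] by (simp add: \<delta>_def)
  finally have 1: "\<delta> (T t f) \<le> exp (w * t) * nrm (x - f)" by simp
  have "\<delta> (T t x) \<le> \<delta> (T t f) + nrm (T t x - T t f)" by (rule \<delta>_lip[OF m f(2)])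
  also have "\<dots> \<le> exp (w * t) * nrm (x - f) + B * nrm (x - f)" by (intro add_mono 1 B(2) x f)
  also have "\<dots> = C * nrm (x - f)" by (simp add: C_def algebra_simps)
  also have "\<dots> \<le> C * (e / C)" using fg(2) C by (intro mult_left_mono) auto
  finally show ?thesis using C by simp
 qed
 then have "\<delta> (T t x) \<le> 0" by (rule field_le_epsilon[of _ 0, simplified])
 then show ?thesis using P m by (simp add: \<delta>_def order.antisym)
qed

end

section \<open>The space \<open>L\<^sub>2\<close>\<close>

locale scalars =
 fixes K :: "complex set"
 assumes K_cases: "K = \<real> \<or> K = UNIV"
begin

lemma K_closed_ops [simp, intro]:
 "0 \<in> K" "1 \<in> K" "complex_of_real r \<in> K" "z \<in> K \<Longrightarrow> w \<in> K \<Longrightarrow> z + w \<in> K" "z \<in> K \<Longrightarrow> w \<in> K \<Longrightarrow> z - w \<in> K"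
 "z \<in> K \<Longrightarrow> w \<in> K \<Longrightarrow> z * w \<in> K" "z \<in> K \<Longrightarrow> cnj z \<in> K" "z \<in> K \<Longrightarrow> - z \<in> K" "z \<in> K \<Longrightarrow> r *\<^sub>R z \<in> K"
 using K_cases by (auto simp: scaleR_conv_of_real Reals_cnj_iff)

lemma closed_K: "closed K" using K_cases closed_complex_Reals by auto

lemma K_sum [intro]: "(\<And>i. i \<in> I \<Longrightarrow> f i \<in> K) \<Longrightarrow> sum f I \<in> K"
 by (induction I rule: infinite_finite_induct) auto

lemma K_integral:
 assumes "\<And>x. x \<in> space M \<Longrightarrow> f x \<in> K" shows "integral\<^sup>L M f \<in> K"
proof (cases "K = UNIV")
 case False
 then have K: "K = \<real>" using K_cases by simp
 have "integral\<^sup>L M f = integral\<^sup>L M (\<lambda>x. complex_of_real (Re (f x)))"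
  using assms K by (intro Bochner_Integration.integral_cong) (auto simp: complex_is_Real_iff complex_eq_iff)
 also have "\<dots> \<in> K" by (simp add: K)
 finally show ?thesis .
qed simp

end

definition l2ip :: "'a measure \<Rightarrow> ('a \<Rightarrow> complex) \<Rightarrow> ('a \<Rightarrow> complex) \<Rightarrow> real" where
 "l2ip M f g = Re (LINT x|M. f x * cnj (g x))"

lemma cmod_sq_add_le: "(cmod (z + w))\<^sup>2 \<le> 2 * (cmod z)\<^sup>2 + 2 * (cmod w)\<^sup>2"
proof -
 have "(cmod (z + w))\<^sup>2 \<le> (cmod z + cmod w)\<^sup>2" by (intro power_mono norm_triangle_ineq) auto
 also have "\<dots> \<le> 2 * (cmod z)\<^sup>2 + 2 * (cmod w)\<^sup>2"
  using zero_le_power2[of "cmod z - cmod w"] by (simp add: power2_sum power2_diff)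
 finally show ?thesis .
qed

context scalars
begin

lemma L2_D:
 assumes "f \<in> L2 K M"
 shows "f \<in> borel_measurable M" "x \<in> space M \<Longrightarrow> f x \<in> K" "integrable M (\<lambda>x. (cmod (f x))\<^sup>2)"
 using assms by (auto simp: L2_def)

lemma L2_add: assumes "f \<in> L2 K M" "g \<in> L2 K M" shows "(\<lambda>x. f x + g x) \<in> L2 K M"
proof -
 note [measurable] = L2_D(1)[OF assms(1)] L2_D(1)[OF assms(2)]
 have "integrable M (\<lambda>x. (cmod (f x + g x))\<^sup>2)"
 proof (rule Bochner_Integration.integrable_bound)
  show "integrable M (\<lambda>x. 2 * (cmod (f x))\<^sup>2 + 2 * (cmod (g x))\<^sup>2)"
   using L2_D(3)[OF assms(1)] L2_D(3)[OF assms(2)] by simp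
  show "AE x in M. norm ((cmod (f x + g x))\<^sup>2) \<le> norm (2 * (cmod (f x))\<^sup>2 + 2 * (cmod (g x))\<^sup>2)"
   using cmod_sq_add_le[of "f _" "g _"] by simp
 qed measurable
 then show ?thesis using assms by (auto simp: L2_def)
qed

lemma L2_mult: assumes "f \<in> L2 K M" "c \<in> K" shows "(\<lambda>x. c * f x) \<in> L2 K M"
 using assms by (auto simp: L2_def norm_mult power_mult_distrib)

lemma L2_scale: assumes "f \<in> L2 K M" shows "(\<lambda>x. r *\<^sub>R f x) \<in> L2 K M"
 using L2_mult[OF assms, of "complex_of_real r"] by (simp add: scaleR_conv_of_real)

lemma L2_zero: "(\<lambda>_. 0) \<in> L2 K M" by (auto simp: L2_def)

lemma L2_diff: assumes "f \<in> L2 K M" "g \<in> L2 K M" shows "(\<lambda>x. f x - g x) \<in> L2 K M"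
 using L2_add[OF assms(1) L2_mult[OF assms(2), of "- 1"]] by simp

lemma L2_norm: assumes "f \<in> L2 K M" shows "(\<lambda>x. complex_of_real (cmod (f x))) \<in> L2 K M"
proof -
 note [measurable] = L2_D(1)[OF assms]
 show ?thesis using L2_D(3)[OF assms] by (auto simp: L2_def)
qed

lemma L2_product_integrable:
 assumes "f \<in> L2 K M" "g \<in> L2 K M"
 shows "integrable M (\<lambda>x. f x * cnj (g x))" "integrable M (\<lambda>x. f x * g x)" "integrable M (\<lambda>x. cmod (f x) * cmod (g x))"
proof -
 note [measurable] = L2_D(1)[OF assms(1)] L2_D(1)[OF assms(2)]
 have i: "integrable M (\<lambda>x. (cmod (f x))\<^sup>2 + (cmod (g x))\<^sup>2)"
  using L2_D(3)[OF assms(1)] L2_D(3)[OF assms(2)] by simp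
 have le: "cmod z * cmod w \<le> (cmod z)\<^sup>2 + (cmod w)\<^sup>2" for z w
  using zero_le_power2[of "cmod z - cmod w"] zero_le_power2[of "cmod z"] zero_le_power2[of "cmod w"]
  unfolding power2_diff by linarith
 have cnj_meas[measurable]: "(\<lambda>x. cnj (g x)) \<in> borel_measurable M"
  by (rule borel_measurable_continuous_on[OF _ L2_D(1)[OF assms(2)]]) (intro continuous_intros)
 show "integrable M (\<lambda>x. f x * cnj (g x))"
  by (rule Bochner_Integration.integrable_bound[OF i]) (use le in \<open>auto simp: norm_mult\<close>)
 show "integrable M (\<lambda>x. f x * g x)"
  by (rule Bochner_Integration.integrable_bound[OF i]) (use le in \<open>auto simp: norm_mult\<close>)
 show "integrable M (\<lambda>x. cmod (f x) * cmod (g x))"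
  by (rule Bochner_Integration.integrable_bound[OF i]) (use le in \<open>auto simp: norm_mult\<close>)
qed

lemma L2_bounded:
 assumes "finite_measure M" "f \<in> borel_measurable M" "\<And>x. x \<in> space M \<Longrightarrow> f x \<in> K" "\<And>x. x \<in> space M \<Longrightarrow> cmod (f x) \<le> B"
 shows "f \<in> L2 K M"
proof -
 note [measurable] = assms(2)
 have "integrable M (\<lambda>x. (cmod (f x))\<^sup>2)"
  by (rule finite_measure.integrable_const_bound[OF assms(1), of _ "B\<^sup>2"])
   (use assms(4) in \<open>auto intro!: AE_I2 power_mono\<close>)
 then show ?thesis using assms by (auto simp: L2_def)
qed

lemma L2_self: "l2ip M f f = (LINT x|M. (cmod (f x))\<^sup>2)"
proof -
 have "(LINT x|M. f x * cnj (f x)) = (LINT x|M. complex_of_real ((cmod (f x))\<^sup>2))"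
  by (simp only: complex_norm_square)
 then show ?thesis unfolding l2ip_def by (simp only: integral_complex_of_real Re_complex_of_real)
qed

lemma L2_semi_inner: "semi_inner (L2 K M) (l2ip M)"
proof
 show "subspace (L2 K M)"
  using L2_zero L2_add L2_scale unfolding subspace_def zero_fun_def plus_fun_def scaleR_fun_def by blast
 fix f g h :: "'a \<Rightarrow> complex" and r :: real
 assume f: "f \<in> L2 K M" and g: "g \<in> L2 K M"
 have "cnj (LINT x|M. g x * cnj (f x)) = (LINT x|M. cnj (g x * cnj (f x)))"
  by (rule integral_bounded_linear'[OF bounded_linear_cnj bounded_linear_cnj, symmetric]) simp
 then have "cnj (LINT x|M. g x * cnj (f x)) = (LINT x|M. f x * cnj (g x))" by (simp add: mult.commute)
 then show "l2ip M f g = l2ip M g f" unfolding l2ip_def by (metis complex_cnj(1) cnj.sel(1))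
 show "l2ip M (r *\<^sub>R f) g = r * l2ip M f g"
  by (simp add: l2ip_def scaleR_fun_def scaleR_conv_of_real mult.assoc)
 show "0 \<le> l2ip M f f" by (simp add: L2_self)
 assume h: "h \<in> L2 K M"
 show "l2ip M (f + g) h = l2ip M f h + l2ip M g h"
  using L2_product_integrable(1)[OF f h] L2_product_integrable(1)[OF g h]
  by (simp add: l2ip_def plus_fun_def distrib_right)
qed

lemma L2_nrm_sq: "f \<in> L2 K M \<Longrightarrow> (semi_inner.nrm (l2ip M) f)\<^sup>2 = (LINT x|M. (cmod (f x))\<^sup>2)"
 using semi_inner.nrm_sq[OF L2_semi_inner] by (simp add: L2_self)

lemma L2_nn_integral:
 "f \<in> L2 K M \<Longrightarrow> (\<integral>\<^sup>+x. ennreal ((cmod (f x))\<^sup>2) \<partial>M) = ennreal ((semi_inner.nrm (l2ip M) f)\<^sup>2)"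
 unfolding L2_nrm_sq by (intro nn_integral_eq_integral L2_D(3)) auto

lemma L2_cauchy_schwarz:
 assumes f: "f \<in> L2 K M" and g: "g \<in> L2 K M"
 shows "cmod (LINT x|M. f x * cnj (g x)) \<le> semi_inner.nrm (l2ip M) f * semi_inner.nrm (l2ip M) g"
  "(LINT x|M. cmod (f x) * cmod (g x)) \<le> semi_inner.nrm (l2ip M) f * semi_inner.nrm (l2ip M) g"
proof -
 interpret semi_inner "L2 K M" "l2ip M" by (rule L2_semi_inner)
 let ?n = "\<lambda>f x. complex_of_real (cmod (f x))"
 have n: "nrm (?n h) = nrm h" for h by (simp add: nrm_def L2_self)
 have "l2ip M (?n f) (?n g) = (LINT x|M. cmod (f x) * cmod (g x))"
 proof -
  have "(LINT x|M. ?n f x * cnj (?n g x)) = (LINT x|M. complex_of_real (cmod (f x) * cmod (g x)))" by simp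
  then show ?thesis unfolding l2ip_def by (simp only: integral_complex_of_real Re_complex_of_real)
 qed
 then show 1: "(LINT x|M. cmod (f x) * cmod (g x)) \<le> nrm f * nrm g"
  using ip_le_nrm[OF L2_norm[OF f] L2_norm[OF g]] by (simp add: n)
 have "cmod (LINT x|M. f x * cnj (g x)) \<le> (LINT x|M. cmod (f x) * cmod (g x))"
  using integral_norm_bound[of M "\<lambda>x. f x * cnj (g x)"] by (simp add: norm_mult)
 then show "cmod (LINT x|M. f x * cnj (g x)) \<le> nrm f * nrm g" using 1 by linarith
qed

lemma L2_nrm_cong:
 assumes "f \<in> L2 K M" "g \<in> L2 K M"
 shows "semi_inner.nrm (l2ip M) (f - g) = 0 \<longleftrightarrow> (AE x in M. f x = g x)"
proof -
 interpret semi_inner "L2 K M" "l2ip M" by (rule L2_semi_inner)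
 have d: "f - g \<in> L2 K M" using assms by simp
 have "nrm (f - g) = 0 \<longleftrightarrow> (LINT x|M. (cmod ((f - g) x))\<^sup>2) = 0"
  using L2_nrm_sq[OF d] by (metis power_eq_0_iff zero_neq_numeral zero_power2)
 also have "\<dots> \<longleftrightarrow> (AE x in M. (cmod ((f - g) x))\<^sup>2 = 0)"
  by (rule integral_nonneg_eq_0_iff_AE) (use L2_D(3)[OF d] in auto)
 finally show ?thesis by simp
qed

text \<open>Riesz-Fischer theorem, for representatives that must take values in \<open>K\<close>
  everywhere on the space.\<close>

lemma L2_semi_hilbert: "semi_hilbert (L2 K M) (l2ip M)"
proof (rule semi_hilbert.intro[OF L2_semi_inner], unfold_locales)
 interpret semi_inner "L2 K M" "l2ip M" by (rule L2_semi_inner)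
 fix f :: "nat \<Rightarrow> 'a \<Rightarrow> complex" assume f: "\<And>n. f n \<in> L2 K M" and cau: "cau f"
 have [measurable]: "f n \<in> borel_measurable M" for n by (rule L2_D(1)[OF f])
 have "\<exists>r. \<forall>n. (\<forall>i\<ge>r n. \<forall>j\<ge>r n. nrm (f i - f j) < (1/2) ^ n) \<and> r n \<le> r (Suc n)"
 proof (rule dependent_nat_choice)
  show "\<exists>M. \<forall>i\<ge>M. \<forall>j\<ge>M. nrm (f i - f j) < (1/2) ^ 0" using cau by (simp add: cau_def)
  fix x n
  have "(1/2::real) ^ Suc n > 0" by simp
  then obtain M where "\<forall>i\<ge>M. \<forall>j\<ge>M. nrm (f i - f j) < (1/2) ^ Suc n" using cau unfolding cau_def by blast
  then show "\<exists>y. (\<forall>i\<ge>y. \<forall>j\<ge>y. nrm (f i - f j) < (1/2) ^ Suc n) \<and> x \<le> y"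
   by (intro exI[of _ "max x M"]) auto
 qed
 then obtain r where r: "\<And>n i j. i \<ge> r n \<Longrightarrow> j \<ge> r n \<Longrightarrow> nrm (f i - f j) < (1/2) ^ n" "\<And>n. r n \<le> r (Suc n)"
  by blast
 define d where "d n = f (r (Suc n)) - f (r n)" for n
 have d: "d n \<in> L2 K M" for n using f by (simp add: d_def)
 have dm[measurable]: "d n \<in> borel_measurable M" for n by (rule L2_D(1)[OF d])
 \<comment> \<open>The weights \<open>2 ^ n\<close> make the increments geometrically small at
   almost every point. They are affordable because \<open>nrm (d n) \<le> (1/2) ^ n\<close> enters
   squared.\<close>
 have "(\<integral>\<^sup>+x. (\<Sum>n. ennreal (2 ^ n * (cmod (d n x))\<^sup>2)) \<partial>M) = (\<Sum>n. \<integral>\<^sup>+x. ennreal (2 ^ n * (cmod (d n x))\<^sup>2) \<partial>M)"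
  by (rule nn_integral_suminf) measurable
 also have "\<dots> \<le> (\<Sum>n. ennreal ((1/2) ^ n))"
 proof (rule suminf_le)
  fix n
  have "(\<integral>\<^sup>+x. ennreal (2 ^ n * (cmod (d n x))\<^sup>2) \<partial>M) = ennreal (2 ^ n) * (\<integral>\<^sup>+x. ennreal ((cmod (d n x))\<^sup>2) \<partial>M)"
   by (subst nn_integral_cmult[symmetric]) (auto simp: ennreal_mult intro!: nn_integral_cong)
  also have "\<dots> = ennreal (2 ^ n * (nrm (d n))\<^sup>2)" by (simp add: L2_nn_integral[OF d] ennreal_mult)
  also have "\<dots> \<le> ennreal ((1/2) ^ n)"
  proof (rule ennreal_leI)
   have "nrm (d n) \<le> (1/2) ^ n" using r(1)[of n "r (Suc n)" "r n"] r(2)[of n] by (simp add: d_def)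
   then have "(nrm (d n))\<^sup>2 \<le> ((1/2) ^ n)\<^sup>2" using d by (intro power_mono) auto
   then have "2 ^ n * (nrm (d n))\<^sup>2 \<le> 2 ^ n * ((1/2) ^ n)\<^sup>2" by simp
   also have "\<dots> = (1/2) ^ n" by (simp add: power2_eq_square power_divide)
   finally show "2 ^ n * (nrm (d n))\<^sup>2 \<le> (1/2) ^ n" .
  qed
  finally show "(\<integral>\<^sup>+x. ennreal (2 ^ n * (cmod (d n x))\<^sup>2) \<partial>M) \<le> ennreal ((1/2) ^ n)" .
 qed auto
 also have "\<dots> < \<infinity>" by (subst suminf_ennreal2) (auto intro!: summable_geometric)
 finally have "AE x in M. (\<Sum>n. ennreal (2 ^ n * (cmod (d n x))\<^sup>2)) \<noteq> \<infinity>"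
  by (intro nn_integral_noteq_infinite) auto
 then have conv: "AE x in M. convergent (\<lambda>n. f (r n) x)"
 proof (rule AE_mp, intro AE_I2 impI)
  fix x assume fin: "(\<Sum>n. ennreal (2 ^ n * (cmod (d n x))\<^sup>2)) \<noteq> \<infinity>"
  define C where "C = enn2real (\<Sum>n. ennreal (2 ^ n * (cmod (d n x))\<^sup>2))"
  have C: "C \<ge> 0" "(\<Sum>n. ennreal (2 ^ n * (cmod (d n x))\<^sup>2)) = ennreal C"
   unfolding C_def using fin by (auto simp only: enn2real_nonneg ennreal_enn2real less_top infinity_ennreal_def)
  have bd: "cmod (d n x) \<le> sqrt C * (sqrt (1/2)) ^ n" for n
  proof -
   have "ennreal (2 ^ n * (cmod (d n x))\<^sup>2) \<le> ennreal C"
   proof -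
    have "(\<Sum>i\<in>{n}. ennreal (2 ^ i * (cmod (d i x))\<^sup>2)) \<le> (\<Sum>n. ennreal (2 ^ n * (cmod (d n x))\<^sup>2))"
     by (rule sum_le_suminf) auto
    then show ?thesis unfolding C(2) by simp
   qed
   then have "2 ^ n * (cmod (d n x))\<^sup>2 \<le> C" using C by (simp add: ennreal_le_iff)
   then have "(1/2) ^ n * (2 ^ n * (cmod (d n x))\<^sup>2) \<le> (1/2) ^ n * C" by (rule mult_left_mono) simp
   moreover have "(1/2) ^ n * (2 ^ n * (cmod (d n x))\<^sup>2) = (1/2 * 2) ^ n * (cmod (d n x))\<^sup>2"
    unfolding power_mult_distrib by (simp only: mult.assoc)
   ultimately have "(cmod (d n x))\<^sup>2 \<le> C * (1/2) ^ n" by (simp add: mult.commute)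
   then have "sqrt ((cmod (d n x))\<^sup>2) \<le> sqrt (C * (1/2) ^ n)" by (rule real_sqrt_le_mono)
   then show ?thesis unfolding real_sqrt_mult real_sqrt_power by simp
  qed
  have "summable (\<lambda>n. sqrt C * (sqrt (1/2)) ^ n)"
   by (intro summable_mult summable_geometric) (simp add: real_sqrt_lt_1_iff)
  then have "summable (\<lambda>n. d n x)" by (rule summable_comparison_test'[where N=0]) (use bd in auto)
  then have "convergent (\<lambda>n. \<Sum>i<n. d i x)" by (simp add: summable_iff_convergent)
  moreover have "(\<Sum>i<n. d i x) = f (r n) x - f (r 0) x" for n
   by (induction n) (auto simp: d_def)
  ultimately have "convergent (\<lambda>n. f (r n) x - f (r 0) x)" by simp
  then have "convergent (\<lambda>n. f (r n) x - f (r 0) x + f (r 0) x)" by (intro convergent_add convergent_const)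
  then show "convergent (\<lambda>n. f (r n) x)" by simp
 qed
 \<comment> \<open>On the null set without convergence \<open>lim\<close> is arbitrary; resetting
   values outside \<open>K\<close> to 0 keeps \<open>g\<close> measurable and
   \<open>K\<close>-valued everywhere. Almost everywhere the limit lies in the closed set
   \<open>K\<close> anyway.\<close>
 define g where "g x = (let y = lim (\<lambda>n. f (r n) x) in if y \<in> K then y else 0)" for x
 have K_borel[measurable]: "K \<in> sets borel" using closed_K by (rule borel_closed)
 have [measurable]: "(\<lambda>x. lim (\<lambda>n. f (r n) x)) \<in> borel_measurable M"
  by (rule borel_measurable_lim_metric) measurable
 have gm[measurable]: "g \<in> borel_measurable M" unfolding g_def Let_def by measurable
 have glim: "AE x in M. (\<lambda>n. f (r n) x) \<longlonglongrightarrow> g x"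
  using conv
 proof (rule AE_mp, intro AE_I2 impI)
  fix x assume x: "x \<in> space M" and c: "convergent (\<lambda>n. f (r n) x)"
  then have l: "(\<lambda>n. f (r n) x) \<longlonglongrightarrow> lim (\<lambda>n. f (r n) x)" by (simp add: convergent_LIMSEQ_iff)
  moreover have "lim (\<lambda>n. f (r n) x) \<in> K"
   by (rule closed_sequentially[OF closed_K _ l]) (rule L2_D(2)[OF f x])
  ultimately show "(\<lambda>n. f (r n) x) \<longlonglongrightarrow> g x" by (simp add: g_def)
 qed
 \<comment> \<open>Fatou along the subsequence estimates the distance of every late
   \<open>f m\<close> from \<open>g\<close> before square integrability of \<open>g\<close> is
   known; that follows afterwards, since \<open>g\<close> differs from a member of the space by
   another member.\<close>
 have fatou: "(\<integral>\<^sup>+x. ennreal ((cmod (f m x - g x))\<^sup>2) \<partial>M) \<le> ennreal (((1/2) ^ k)\<^sup>2)" if m: "m \<ge> r k" for m k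
 proof -
  have "(\<integral>\<^sup>+x. ennreal ((cmod (f m x - g x))\<^sup>2) \<partial>M)
   = (\<integral>\<^sup>+x. liminf (\<lambda>n. ennreal ((cmod (f m x - f (r n) x))\<^sup>2)) \<partial>M)"
  proof (rule nn_integral_cong_AE, rule AE_mp[OF glim], intro AE_I2 impI)
   fix x assume "(\<lambda>n. f (r n) x) \<longlonglongrightarrow> g x"
   then have "(\<lambda>n. ennreal ((cmod (f m x - f (r n) x))\<^sup>2)) \<longlonglongrightarrow> ennreal ((cmod (f m x - g x))\<^sup>2)"
    by (intro tendsto_intros)
   then show "ennreal ((cmod (f m x - g x))\<^sup>2) = liminf (\<lambda>n. ennreal ((cmod (f m x - f (r n) x))\<^sup>2))"
    by (rule lim_imp_Liminf[OF sequentially_bot, symmetric])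
  qed
  also have "\<dots> \<le> liminf (\<lambda>n. \<integral>\<^sup>+x. ennreal ((cmod (f m x - f (r n) x))\<^sup>2) \<partial>M)"
   by (rule nn_integral_liminf) measurable
  also have "\<dots> \<le> limsup (\<lambda>n. \<integral>\<^sup>+x. ennreal ((cmod (f m x - f (r n) x))\<^sup>2) \<partial>M)"
   by (rule Liminf_le_Limsup) simp
  also have "\<dots> \<le> ennreal (((1/2) ^ k)\<^sup>2)"
  proof (rule Limsup_bounded)
   have "(\<integral>\<^sup>+x. ennreal ((cmod (f m x - f (r n) x))\<^sup>2) \<partial>M) \<le> ennreal (((1/2) ^ k)\<^sup>2)" if n: "n \<ge> k" for n
   proof -
    have "r k \<le> r n" by (rule lift_Suc_mono_le[of r, OF r(2) n])
    then have "nrm (f m - f (r n)) \<le> (1/2) ^ k" using r(1)[OF m, of "r n"] by simp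
    then have "(nrm (f m - f (r n)))\<^sup>2 \<le> ((1/2) ^ k)\<^sup>2" using f by (intro power_mono) auto
    then show ?thesis using L2_nn_integral[of "f m - f (r n)"] f by (simp add: ennreal_leI)
   qed
   then show "\<forall>\<^sub>F n in sequentially. (\<integral>\<^sup>+x. ennreal ((cmod (f m x - f (r n) x))\<^sup>2) \<partial>M) \<le> ennreal (((1/2) ^ k)\<^sup>2)"
    by (auto simp: eventually_sequentially)
  qed
  finally show ?thesis .
 qed
 have gK: "g x \<in> K" for x by (simp add: g_def Let_def)
 have diff: "f m - g \<in> L2 K M" if m: "m \<ge> r k" for m k
 proof -
  have "integrable M (\<lambda>x. (cmod (f m x - g x))\<^sup>2)"
  proof (rule integrableI_bounded)
   have "(\<integral>\<^sup>+x. ennreal (norm ((cmod (f m x - g x))\<^sup>2)) \<partial>M) \<le> ennreal (((1/2) ^ k)\<^sup>2)" using fatou[OF m] by simp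
   then show "(\<integral>\<^sup>+x. ennreal (norm ((cmod (f m x - g x))\<^sup>2)) \<partial>M) < \<infinity>" by (rule order.strict_trans1) simp
  qed measurable
  moreover have "(\<lambda>x. f m x - g x) \<in> borel_measurable M" by measurable
  ultimately show ?thesis using L2_D(2)[OF f] gK by (auto simp: L2_def fun_diff_def)
 qed
 have "f (r 0) - (f (r 0) - g) \<in> L2 K M" by (rule mem(3)[OF f diff[of 0 "r 0"]]) simp
 moreover have "f (r 0) - (f (r 0) - g) = g" by (simp add: fun_eq_iff)
 ultimately have g: "g \<in> L2 K M" by (simp only:)
 have "(\<lambda>n. nrm (f n - g)) \<longlonglongrightarrow> 0"
 proof (rule LIMSEQ_I)
  fix e :: real assume e: "e > 0"
  then obtain k where k: "(1/2) ^ k < e" using real_arch_pow_inv[of e "1/2"] by auto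
  have "norm (nrm (f m - g) - 0) < e" if m: "m \<ge> r k" for m
  proof -
   have "ennreal ((nrm (f m - g))\<^sup>2) \<le> ennreal (((1/2) ^ k)\<^sup>2)"
    using fatou[OF m] L2_nn_integral[OF diff[OF m]] by simp
   then have "(nrm (f m - g))\<^sup>2 \<le> ((1/2) ^ k)\<^sup>2" by (simp add: ennreal_le_iff)
   then have "nrm (f m - g) \<le> (1/2) ^ k" by (rule power2_le_imp_le) simp
   then show ?thesis using k diff[OF m] by simp
  qed
  then show "\<exists>no. \<forall>n\<ge>no. norm (nrm (f n - g) - 0) < e" by blast
 qed
 then show "\<exists>y\<in>L2 K M. (\<lambda>n. nrm (f n - y)) \<longlonglongrightarrow> 0" using g by blast
qed

end

section \<open>Test functions\<close>

lemma DERIV_max_0_sq: "((\<lambda>x::real. (max 0 x)\<^sup>2) has_real_derivative 2 * max 0 x) (at x)"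
proof (cases "x = 0")
 case True
 have "((\<lambda>h::real. ((max 0 (0 + h))\<^sup>2 - (max 0 0)\<^sup>2) / h) \<longlongrightarrow> 0) (at 0)"
 proof (rule Lim_null_comparison)
  show "\<forall>\<^sub>F h::real in at 0. norm (((max 0 (0 + h))\<^sup>2 - (max 0 0)\<^sup>2) / h) \<le> \<bar>h\<bar>"
   by (intro always_eventually allI) (auto simp: max_def power2_eq_square)
  show "((\<lambda>h::real. \<bar>h\<bar>) \<longlongrightarrow> 0) (at 0)" by (rule tendsto_eq_intros refl | simp)+
 qed
 then show ?thesis using True by (simp add: DERIV_def)
next
 case False
 show ?thesis
 proof (cases "x > 0")
  case True
  have "((\<lambda>x::real. x\<^sup>2) has_real_derivative 2 * max 0 x) (at x)"
   using True by (auto intro!: derivative_eq_intros)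
  then show ?thesis
   by (rule DERIV_cong_ev[THEN iffD1, rotated -1])
    (use True in \<open>auto simp: eventually_nhds intro!: exI[of _ "{0<..}"]\<close>)
 next
  case False
  then have x: "x < 0" using \<open>x \<noteq> 0\<close> by simp
  have "((\<lambda>x::real. 0) has_real_derivative 2 * max 0 x) (at x)" using x by simp
  then show ?thesis
   by (rule DERIV_cong_ev[THEN iffD1, rotated -1])
    (use x in \<open>auto simp: eventually_nhds intro!: exI[of _ "{..<0}"]\<close>)
 qed
qed

text \<open>A \<open>C1\<close> transition from 0 to 1 across \<open>[0, 1]\<close>. The two squares
  in the denominator never vanish together. Being \<open>C1\<close> is enough, as weak derivatives
  are tested against \<open>C1\<close> functions.\<close>

definition smoothstep :: "real \<Rightarrow> real" where
 "smoothstep x = (max 0 x)\<^sup>2 / ((max 0 x)\<^sup>2 + (max 0 (1 - x))\<^sup>2)"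

definition dsmoothstep :: "real \<Rightarrow> real" where
 "dsmoothstep x = (2 * max 0 x * ((max 0 x)\<^sup>2 + (max 0 (1 - x))\<^sup>2) -
   (max 0 x)\<^sup>2 * (2 * max 0 x - 2 * max 0 (1 - x))) / ((max 0 x)\<^sup>2 + (max 0 (1 - x))\<^sup>2)\<^sup>2"

lemma smoothstep_den_pos: "(max 0 x)\<^sup>2 + (max 0 (1 - x))\<^sup>2 > (0::real)"
proof (cases "x > 0")
 case True then show ?thesis by (intro add_pos_nonneg) auto
qed (auto intro!: add_nonneg_pos)

lemma DERIV_smoothstep: "(smoothstep has_real_derivative dsmoothstep x) (at x)"
proof -
 have 1: "((\<lambda>x::real. (max 0 (1 - x))\<^sup>2) has_real_derivative 2 * max 0 (1 - x) * (- 1)) (at x)"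
  by (rule DERIV_chain2[OF DERIV_max_0_sq]) (auto intro!: derivative_eq_intros)
 have "(smoothstep has_real_derivative
   (2 * max 0 x * ((max 0 x)\<^sup>2 + (max 0 (1 - x))\<^sup>2) - (max 0 x)\<^sup>2 * (2 * max 0 x + 2 * max 0 (1 - x) * (- 1))) /
   (((max 0 x)\<^sup>2 + (max 0 (1 - x))\<^sup>2) * ((max 0 x)\<^sup>2 + (max 0 (1 - x))\<^sup>2))) (at x)"
  unfolding smoothstep_def[abs_def]
  by (rule DERIV_divide DERIV_add DERIV_max_0_sq 1)+ (rule less_imp_neq[OF smoothstep_den_pos, THEN not_sym])
 then show ?thesis by (simp add: dsmoothstep_def power2_eq_square)
qed

lemma continuous_dsmoothstep: "continuous_on S dsmoothstep"
proof -
 have "((max 0 x)\<^sup>2 + (max 0 (1 - x))\<^sup>2)\<^sup>2 \<noteq> 0" for x :: real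
  using smoothstep_den_pos[of x] by (metis less_irrefl power_eq_0_iff)
 then show ?thesis unfolding dsmoothstep_def[abs_def] by (intro continuous_intros ballI)
qed

lemma smoothstep_0: "x \<le> 0 \<Longrightarrow> smoothstep x = 0" by (simp add: smoothstep_def)

lemma smoothstep_1: "x \<ge> 1 \<Longrightarrow> smoothstep x = 1" by (simp add: smoothstep_def)

lemma smoothstep_bounds: "0 \<le> smoothstep x" "smoothstep x \<le> 1"
 using smoothstep_den_pos[of x] by (auto simp: smoothstep_def)

lemma dsmoothstep_0: "x \<notin> {0..1} \<Longrightarrow> dsmoothstep x = 0" by (auto simp: dsmoothstep_def power2_eq_square)

text \<open>The offset \<open>k\<close> decides the limit at the single point \<open>c\<close>; this
  is how open or half-open intervals are obtained as limits of cutoffs.\<close>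

lemma smoothstep_tendsto:
 "(\<lambda>n. smoothstep (real n * (x - c) + k)) \<longlonglongrightarrow> (if x > c then 1 else if x = c then smoothstep k else 0)"
proof -
 consider "x > c" | "x = c" | "x < c" by linarith
 then show ?thesis
 proof cases
  case 1
  obtain m where m: "real m > (1 - k) / (x - c)" using reals_Archimedean2 by blast
  have "smoothstep (real n * (x - c) + k) = 1" if "n \<ge> m" for n
  proof (rule smoothstep_1)
   have "(1 - k) / (x - c) \<le> real n" using m that by linarith
   then show "1 \<le> real n * (x - c) + k" using 1 by (simp add: field_simps)
  qed
  then show ?thesis using 1 by (auto intro!: tendsto_eventually eventually_sequentiallyI[of m])
 next
  case 3
  obtain m where m: "real m > k / (c - x)" using reals_Archimedean2 by blast
  have "smoothstep (real n * (x - c) + k) = 0" if "n \<ge> m" for n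
  proof (rule smoothstep_0)
   have "k / (c - x) \<le> real n" using m that by linarith
   then show "real n * (x - c) + k \<le> 0" using 3 by (simp add: field_simps)
  qed
  then show ?thesis using 3 by (auto intro!: tendsto_eventually eventually_sequentiallyI[of m])
 qed simp
qed

text \<open>Rises on \<open>[c, c + 1/n]\<close> and falls on \<open>[d, d + 1/n]\<close>. For large
  \<open>n\<close> its values approach the indicator of \<open>(c, d]\<close>, while its derivative
  approaches the difference of the point masses at \<open>c\<close> and \<open>d\<close>.\<close>

definition plateau :: "real \<Rightarrow> real \<Rightarrow> real \<Rightarrow> real \<Rightarrow> real" where
 "plateau n c d x = smoothstep (n * (x - c)) - smoothstep (n * (x - d))"

lemma DERIV_plateau:
 "(plateau n c d has_real_derivative n * dsmoothstep (n * (x - c)) - n * dsmoothstep (n * (x - d))) (at x)"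
proof -
 have "((\<lambda>x. smoothstep (n * (x - c))) has_real_derivative dsmoothstep (n * (x - c)) * n) (at x)" for c
  by (rule DERIV_chain2[OF DERIV_smoothstep]) (auto intro!: derivative_eq_intros)
 from DERIV_diff[OF this[of c] this[of d]] show ?thesis
  by (simp add: plateau_def[abs_def] mult.commute)
qed

lemma test_fun_plateau:
 assumes "a < c" "c \<le> d" "d + 1 / n < b" "n > 0"
 shows "test_fun a b (plateau n c d)"
 unfolding test_fun_def
proof
 show "plateau n c d C1_differentiable_on UNIV"
  unfolding C1_differentiable_on_def
 proof (intro exI conjI ballI)
  fix x show "(plateau n c d has_vector_derivative n * dsmoothstep (n * (x - c)) - n * dsmoothstep (n * (x - d))) (at x)"
   using DERIV_plateau by (simp add: has_real_derivative_iff_has_vector_derivative)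
  show "continuous_on UNIV (\<lambda>x. n * dsmoothstep (n * (x - c)) - n * dsmoothstep (n * (x - d)))"
   by (intro continuous_intros continuous_on_compose2[OF continuous_dsmoothstep[of UNIV]]) auto
 qed
 have "x \<in> {c..d + 1/n}" if nz: "plateau n c d x \<noteq> 0" for x
 proof (rule ccontr)
  assume "x \<notin> {c..d + 1/n}"
  then consider "x < c" | "x > d + 1/n" by fastforce
  then show False
  proof cases
   case 1
   then have "n * (x - c) \<le> 0" "n * (x - d) \<le> 0" using assms by (auto intro!: mult_nonneg_nonpos)
   then show False using nz by (simp add: plateau_def smoothstep_0)
  next
   case 2
   then have d: "1 \<le> n * (x - d)" using assms by (simp add: field_simps)
   moreover have "n * (x - d) \<le> n * (x - c)" using assms by (intro mult_left_mono) auto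
   ultimately show False using nz by (simp add: plateau_def smoothstep_1)
  qed
 qed
 then have "closure {x. plateau n c d x \<noteq> 0} \<subseteq> {c..d + 1/n}" by (intro closure_minimal) auto
 then show "closure {x. plateau n c d x \<noteq> 0} \<subseteq> {a<..<b}" using assms by (auto simp: subset_iff)
qed

lemma plateau_bound: "\<bar>plateau n c d x\<bar> \<le> 1"
 using smoothstep_bounds[of "n * (x - c)"] smoothstep_bounds[of "n * (x - d)"] unfolding plateau_def by linarith

lemma test_fun_D:
 assumes "test_fun a b \<phi>"
 shows "(\<phi> has_real_derivative deriv \<phi> x) (at x)" "continuous_on UNIV (deriv \<phi>)" "x \<notin> {a<..<b} \<Longrightarrow> \<phi> x = 0"
  "continuous_on UNIV \<phi>"
proof -
 obtain D where D: "\<And>x. (\<phi> has_vector_derivative D x) (at x)" "continuous_on UNIV D"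
  using assms unfolding test_fun_def C1_differentiable_on_def by blast
 have d: "(\<phi> has_real_derivative D x) (at x)" for x
  using D(1) by (simp add: has_real_derivative_iff_has_vector_derivative)
 then have eq: "deriv \<phi> = D" by (auto intro: DERIV_imp_deriv)
 show "(\<phi> has_real_derivative deriv \<phi> x) (at x)" "continuous_on UNIV (deriv \<phi>)" unfolding eq by (rule d D)+
 show "continuous_on UNIV \<phi>"     by (intro continuous_at_imp_continuous_on ballI) (rule DERIV_isCont[OF d])
 show "\<phi> x = 0" if "x \<notin> {a<..<b}"
 proof (rule ccontr)
  assume "\<phi> x \<noteq> 0"
  then have "x \<in> closure {x. \<phi> x \<noteq> 0}" using closure_subset[of "{x. \<phi> x \<noteq> 0}"] by auto
  then show False using that assms by (auto simp: test_fun_def)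
 qed
qed

lemma bounded_continuous_fun:
 fixes f :: "real \<Rightarrow> 'a::real_normed_vector"
 assumes "continuous_on {a..b} f" shows "\<exists>B\<ge>0. \<forall>x\<in>{a..b}. norm (f x) \<le> B"
proof -
 have "bounded (f ` {a..b})" by (intro compact_imp_bounded compact_continuous_image assms compact_Icc)
 then obtain B where "\<forall>x\<in>{a..b}. norm (f x) \<le> B" by (auto simp: bounded_iff)
 then show ?thesis by (intro exI[of _ "max B 0"]) auto
qed

lemma test_fun_bounded:
 assumes "test_fun a b \<phi>" shows "\<exists>B\<ge>0. \<forall>x. \<bar>\<phi> x\<bar> \<le> B"
proof -
 have "continuous_on {a..b} \<phi>" using test_fun_D(4)[OF assms] by (rule continuous_on_subset) simp
 then obtain B where B: "B \<ge> 0" "\<And>x. x \<in> {a..b} \<Longrightarrow> norm (\<phi> x) \<le> B" using bounded_continuous_fun by blast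
 have "\<bar>\<phi> x\<bar> \<le> B" for x using B test_fun_D(3)[OF assms, of x] by (cases "x \<in> {a<..<b}") auto
 then show ?thesis using B by blast
qed

text \<open>Test functions approximate the indicator functions of \<open>(a, d]\<close> and of \<open>(a, b)\<close>.\<close>

lemma test_fun_separating:
 fixes h :: "real \<Rightarrow> complex"
 assumes M: "sigma_finite_measure M" "sets M = sets (restrict_space borel \<Omega>)" "\<Omega> \<in> sets borel"
  and ab: "a < b" and h: "integrable M h"
  and zero: "\<And>\<phi>. test_fun a b \<phi> \<Longrightarrow> (LINT x|M. h x * complex_of_real (\<phi> x)) = 0"
 shows "AE x in M. x \<in> {a<..<b} \<longrightarrow> h x = 0"
proof -
 have sp: "space M = \<Omega>" using sets_eq_imp_space_eq[OF M(2)] by (simp add: space_restrict_space)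
 have in_M: "A \<inter> \<Omega> \<in> sets M" if "A \<in> sets borel" for A
  using that unfolding M(2) by (auto simp: sets_restrict_space)
 have meas: "f \<in> borel_measurable M" if "f \<in> borel_measurable borel" for f :: "real \<Rightarrow> 'z::topological_space"
  unfolding measurable_cong_sets[OF M(2) refl] by (rule measurable_restrict_space1[OF that])
 have [measurable]: "h \<in> borel_measurable M" using h by simp
 have lim: "(LINT x|M. h x * indicator S x) = 0"
  if S: "S \<in> sets borel" and t: "\<And>n. n \<ge> m \<Longrightarrow> test_fun a b (u n)" "\<And>n x. \<bar>u n x\<bar> \<le> 1"
   and l: "\<And>x. (\<lambda>n. u n x) \<longlonglongrightarrow> indicator S x" for S and u :: "nat \<Rightarrow> real \<Rightarrow> real" and m
 proof -
  have "(\<lambda>n. LINT x|M. h x * complex_of_real (u (n + m) x)) \<longlonglongrightarrow> (LINT x|M. h x * indicator S x)"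
  proof (rule integral_dominated_convergence)
   show "integrable M (\<lambda>x. cmod (h x))" using h by simp
   show "(\<lambda>x. h x * indicator S x) \<in> borel_measurable M"
    using meas[of "indicator S :: real \<Rightarrow> complex"] S by (intro borel_measurable_times) auto
   have "u (n + m) \<in> borel_measurable M" for n
    using test_fun_D(4)[OF t(1), of "n + m"] by (intro meas borel_measurable_continuous_onI) simp
   then show "(\<lambda>x. h x * complex_of_real (u (n + m) x)) \<in> borel_measurable M" for n
    by (intro borel_measurable_times borel_measurable_of_real) auto
   show "AE x in M. cmod (h x * complex_of_real (u (n + m) x)) \<le> cmod (h x)" for n
   proof (intro AE_I2)
    fix x show "cmod (h x * complex_of_real (u (n + m) x)) \<le> cmod (h x)"
     using mult_left_mono[OF t(2)[of "n + m" x], of "cmod (h x)"] by (simp add: norm_mult)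
   qed
   show "AE x in M. (\<lambda>n. h x * complex_of_real (u (n + m) x)) \<longlonglongrightarrow> h x * indicator S x"
   proof (intro AE_I2)
    fix x
    have "(\<lambda>n. h x * complex_of_real (u (n + m) x)) \<longlonglongrightarrow> h x * complex_of_real (indicator S x)"
     by (intro tendsto_intros LIMSEQ_ignore_initial_segment l)
    also have "complex_of_real (indicator S x) = indicator S x" by (simp add: indicator_def)
    finally show "(\<lambda>n. h x * complex_of_real (u (n + m) x)) \<longlonglongrightarrow> h x * indicator S x" .
   qed
  qed
  moreover have "(LINT x|M. h x * complex_of_real (u (n + m) x)) = 0" for n by (rule zero[OF t(1)]) simp
  ultimately show ?thesis by (simp add: LIMSEQ_const_iff)
 qed
 have Iab: "(LINT x|M. h x * indicator {a<..<b} x) = 0"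
 proof -
  \<comment> \<open>Three units of length \<open>1 / n\<close> are needed to have
    \<open>a + 1 / n\<close> to the left of \<open>b - 2 / n\<close>.\<close>
  obtain m :: nat where m: "real m > 3 / (b - a)" using reals_Archimedean2 by blast
  have m0: "real m > 0" using m ab by (smt (verit) divide_pos_pos)
  \<comment> \<open>The offsets -1 and 2 below come from the points \<open>a + 1 / n\<close> and
    \<open>b - 2 / n\<close>. In the limit, \<open>smoothstep (- 1) = 0\<close> excludes
    \<open>a\<close>, and \<open>smoothstep 2 = 1\<close> excludes \<open>b\<close>.\<close>
  let ?\<phi> = "\<lambda>n. plateau (real n) (a + 1 / real n) (b - 2 / real n)"
  show ?thesis
  proof (rule lim[where ?u1 = "\<lambda>n x. smoothstep (real n * (x - a) + (- 1)) - smoothstep (real n * (x - b) + 2)" and ?m1 = m])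
   fix n assume n: "n \<ge> m"
   have n0: "real n > 0" "3 / (b - a) < real n" using m m0 n by linarith+
   then have "3 / real n < b - a" using ab by (simp add: field_simps)
   moreover have "2 / real n = 2 * (1 / real n)" "3 / real n = 3 * (1 / real n)" "1 / real n > 0"
    using n0 by auto
   ultimately have "test_fun a b (?\<phi> n)" using n0 by (intro test_fun_plateau) linarith+
   moreover have "real n * (x - (a + 1 / real n)) = real n * (x - a) + (- 1)"
    "real n * (x - (b - 2 / real n)) = real n * (x - b) + 2" for x
    using n0 by (simp_all add: field_simps)
   then have "?\<phi> n = (\<lambda>x. smoothstep (real n * (x - a) + (- 1)) - smoothstep (real n * (x - b) + 2))"
    unfolding plateau_def[abs_def] by presburger
   ultimately show "test_fun a b (\<lambda>x. smoothstep (real n * (x - a) + (- 1)) - smoothstep (real n * (x - b) + 2))" by simp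
  next
   fix n x show "\<bar>smoothstep (real n * (x - a) + (- 1)) - smoothstep (real n * (x - b) + 2)\<bar> \<le> 1"
    using smoothstep_bounds[of "real n * (x - a) + (- 1)"] smoothstep_bounds[of "real n * (x - b) + 2"] by linarith
  next
   fix x
   show "(\<lambda>n. smoothstep (real n * (x - a) + (- 1)) - smoothstep (real n * (x - b) + 2)) \<longlonglongrightarrow> indicator {a<..<b} x"
    using tendsto_diff[OF smoothstep_tendsto[of x a "- 1"] smoothstep_tendsto[of x b 2]] ab
    by (auto simp: indicator_def smoothstep_0 smoothstep_1 split: if_splits)
  qed auto
 qed
 have Iad: "(LINT x|M. h x * indicator {a<..d} x) = 0" if d: "a < d" "d < b" for d
 proof -
  obtain m where m: "real m > max (2 / (d - a)) (2 / (b - d))" using reals_Archimedean2 by blast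
  have m0: "real m > 0" using m d by (smt (verit) divide_pos_pos)
  \<comment> \<open>The right offset is 0 here, and \<open>smoothstep 0 = 0\<close> keeps
    \<open>d\<close> in the limit set.\<close>
  let ?\<phi> = "\<lambda>n. plateau (real n) (a + 1 / real n) d"
  show ?thesis
  proof (rule lim[where ?u1 = "\<lambda>n x. smoothstep (real n * (x - a) + (- 1)) - smoothstep (real n * (x - d) + 0)" and ?m1 = m])
   fix n assume n: "n \<ge> m"
   have n0: "real n > 0" "2 / (d - a) < real n" "2 / (b - d) < real n" using m m0 n by auto
   then have "2 / real n < d - a" "2 / real n < b - d" using d by (auto simp: field_simps)
   moreover have "1 / real n < 2 / real n" using n0 by (simp add: divide_strict_right_mono)
   ultimately have "test_fun a b (?\<phi> n)" using n0 by (intro test_fun_plateau) auto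
   moreover have "real n * (x - (a + 1 / real n)) = real n * (x - a) + (- 1)"
    "real n * (x - d) = real n * (x - d) + 0" for x
    using n0 by (simp_all add: field_simps)
   then have "?\<phi> n = (\<lambda>x. smoothstep (real n * (x - a) + (- 1)) - smoothstep (real n * (x - d) + 0))"
    unfolding plateau_def[abs_def] by presburger
   ultimately show "test_fun a b (\<lambda>x. smoothstep (real n * (x - a) + (- 1)) - smoothstep (real n * (x - d) + 0))" by simp
  next
   fix n x show "\<bar>smoothstep (real n * (x - a) + (- 1)) - smoothstep (real n * (x - d) + 0)\<bar> \<le> 1"
    using smoothstep_bounds[of "real n * (x - a) + (- 1)"] smoothstep_bounds[of "real n * (x - d) + 0"] by linarith
  next
   fix x
   show "(\<lambda>n. smoothstep (real n * (x - a) + (- 1)) - smoothstep (real n * (x - d) + 0)) \<longlonglongrightarrow> indicator {a<..d} x"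
    using tendsto_diff[OF smoothstep_tendsto[of x a "- 1"] smoothstep_tendsto[of x d 0]] d
    by (auto simp: indicator_def smoothstep_0 smoothstep_1 split: if_splits)
  qed auto
 qed
 define h' where "h' x = h x * indicator {a<..<b} x" for x
 have ind_meas: "(indicator A :: real \<Rightarrow> complex) \<in> borel_measurable M" if "A \<in> sets borel" for A
  using that by (intro meas) auto
 have h'_int: "integrable M h'"
  unfolding h'_def
 proof (rule Bochner_Integration.integrable_bound[OF h])
  show "(\<lambda>x. h x * indicator {a<..<b} x) \<in> borel_measurable M"
   by (intro borel_measurable_times ind_meas) auto
 qed (auto simp: indicator_def)
 have h'_set: "integrable M (\<lambda>x. h' x * indicator A x)" if A: "A \<in> sets borel" for A
 proof (rule Bochner_Integration.integrable_bound[OF h'_int])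
  show "(\<lambda>x. h' x * indicator A x) \<in> borel_measurable M"
   using h'_int by (intro borel_measurable_times ind_meas A) auto
 qed (auto simp: indicator_def)
 \<comment> \<open>Half-lines form an intersection-stable generator of the Borel sets. As
   \<open>h'\<close> is cut off to \<open>(a, b)\<close>, on half-lines only zero and the two
   integrals already computed can occur.\<close>
 have G: "(LINT x|M. h' x * indicator A x) = 0" if A: "A \<in> sets borel" for A
 proof -
  have gen: "sets (borel :: real measure) = sigma_sets UNIV (range (\<lambda>d. {..d}))"
   by (subst borel_eq_atMost) (simp add: sets_measure_of)
  have "Int_stable (range (\<lambda>d::real. {..d}))" by (auto simp: Int_stable_def)
  moreover have "range (\<lambda>d::real. {..d}) \<subseteq> Pow UNIV" by simp
  moreover have "A \<in> sigma_sets UNIV (range (\<lambda>d. {..d}))" using A gen by simp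
  ultimately show ?thesis
  proof (induction rule: sigma_sets_induct_disjoint)
   case (basic A)
   then obtain d where A: "A = {..d}" by blast
   consider "d \<le> a" | "a < d" "d < b" | "d \<ge> b" by linarith
   then show ?case
   proof cases
    case 1
    then have "(\<lambda>x. h' x * indicator A x) = (\<lambda>_. 0)" by (auto simp: h'_def A indicator_def fun_eq_iff)
    then show ?thesis by (simp only: Bochner_Integration.integral_zero)
   next
    case 2
    then have "h' x * indicator A x = h x * indicator {a<..d} x" for x by (auto simp: h'_def A indicator_def)
    then show ?thesis using Iad 2 by simp
   next
    case 3
    then have "h' x * indicator A x = h x * indicator {a<..<b} x" for x by (auto simp: h'_def A indicator_def)
    then show ?thesis using Iab by simp
   qed
  next
   case empty then show ?case by simp
  next
   case (compl A)
   then have A: "A \<in> sets borel" using gen by simp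
   have "(LINT x|M. h' x * indicator (UNIV - A) x) = (LINT x|M. h' x - h' x * indicator A x)"
    by (intro Bochner_Integration.integral_cong) (auto simp: indicator_def)
   also have "\<dots> = (LINT x|M. h' x) - (LINT x|M. h' x * indicator A x)"
    by (rule Bochner_Integration.integral_diff[OF h'_int h'_set[OF A]])
   also have "\<dots> = 0" using compl Iab by (simp add: h'_def[abs_def])
   finally show ?case .
  next
   case (union A)
   then have A: "A i \<in> sets borel" for i using gen by auto
   have "(LINT x:(\<Union>i. A i \<inter> \<Omega>)|M. h' x) = (\<Sum>i. (LINT x:(A i \<inter> \<Omega>)|M. h' x))"
   proof (rule lebesgue_integral_countable_add)
    show "A i \<inter> \<Omega> \<in> sets M" for i by (rule in_M[OF A])
    show "(A i \<inter> \<Omega>) \<inter> (A j \<inter> \<Omega>) = {}" if "i \<noteq> j" for i j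
     using union(1) that by (auto simp: disjoint_family_on_def)
    show "set_integrable M (\<Union>i. A i \<inter> \<Omega>) h'"
     unfolding set_integrable_def by (rule integrable_mult_indicator[OF _ h'_int]) (use in_M[OF A] in blast)
   qed
   moreover have "(LINT x:(B \<inter> \<Omega>)|M. h' x) = (LINT x|M. h' x * indicator B x)" for B
    unfolding set_lebesgue_integral_def
    by (intro Bochner_Integration.integral_cong) (auto simp: indicator_def sp)
   moreover have "(\<Union>i. A i \<inter> \<Omega>) = (\<Union>i. A i) \<inter> \<Omega>" by auto
   ultimately show ?case using union by simp
  qed
 qed
 have "AE x in M. h' x = 0"
 proof (rule sigma_finite_measure.density_zero[OF M(1) h'_int])
  fix A assume "A \<in> sets M"
  then obtain B where B: "B \<in> sets borel" "A = B \<inter> \<Omega>" unfolding M(2) by (auto simp: sets_restrict_space)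
  have "(LINT x:A|M. h' x) = (LINT x|M. h' x * indicator B x)"
   unfolding set_lebesgue_integral_def
   by (intro Bochner_Integration.integral_cong) (auto simp: indicator_def sp B)
  then show "(LINT x:A|M. h' x) = 0" using G[OF B(1)] by simp
 qed
 then show ?thesis by (rule AE_mp) (auto simp: h'_def)
qed

section \<open>The Sobolev space as primitives of \<open>L\<^sub>2\<close>-functions\<close>

lemma space_leb [simp]: "space (leb a b) = {a<..<b}"
 by (simp add: space_restrict_space)

lemma sets_leb: "sets (leb a b) = sets (restrict_space borel {a<..<b})"
 by (rule sets_restrict_space_cong) simp

lemma finite_measure_leb: "finite_measure (leb a b)"
 by (rule finite_measureI) (cases "a \<le> b"; simp add: emeasure_restrict_space space_restrict_space)

lemma borel_measurable_leb: "f \<in> borel_measurable borel \<Longrightarrow> f \<in> borel_measurable (leb a b)"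
 unfolding measurable_cong_sets[OF sets_leb refl] by (rule measurable_restrict_space1)

lemma borel_measurable_leb_continuous:
 "continuous_on {a<..<b} f \<Longrightarrow> (f :: real \<Rightarrow> 'a::topological_space) \<in> borel_measurable (leb a b)"
 unfolding measurable_cong_sets[OF sets_leb refl] by (rule borel_measurable_continuous_on_restrict)

definition primit :: "real \<Rightarrow> real \<Rightarrow> (real \<Rightarrow> complex) \<Rightarrow> real \<Rightarrow> complex" where
 "primit a b g x = (LINT y|leb a b. g y * indicator {..x} y)"

text \<open>Continuous Sobolev functions are handled as an initial value plus the primitive of a
  square integrable function. Compositions and limits are accessible in this form without test
  functions, and \<open>W12_Cont_iff\<close> shows that both notions agree.\<close>

definition is_prim :: "real \<Rightarrow> real \<Rightarrow> (real \<Rightarrow> complex) \<Rightarrow> (real \<Rightarrow> complex) \<Rightarrow> bool" where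
 "is_prim a b g f \<longleftrightarrow> (\<forall>x\<in>{a..b}. f x = f a + primit a b g x)"

lemma is_primD: "is_prim a b g f \<Longrightarrow> x \<in> {a..b} \<Longrightarrow> f x = f a + primit a b g x"
 unfolding is_prim_def by (rule bspec)

abbreviation l2n :: "'a measure \<Rightarrow> ('a \<Rightarrow> complex) \<Rightarrow> real" where
 "l2n M \<equiv> semi_inner.nrm (l2ip M)"

context scalars
begin

lemma indicator_L2:
 assumes "A \<in> sets borel" shows "(indicator A :: real \<Rightarrow> complex) \<in> L2 K (leb a b)"
proof (rule L2_bounded[OF finite_measure_leb])
 show "(indicator A :: real \<Rightarrow> complex) \<in> borel_measurable (leb a b)"
  by (rule borel_measurable_leb) (use assms in simp)
 show "indicator A x \<in> K" for x :: real by (auto simp: indicator_def)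
 show "cmod (indicator A x) \<le> 1" for x :: real by (auto simp: indicator_def)
qed

lemma integrable_indicator:
 assumes "g \<in> L2 K (leb a b)" "A \<in> sets borel"
 shows "integrable (leb a b) (\<lambda>y. g y * indicator A y)"
 by (rule L2_product_integrable(2)[OF assms(1) indicator_L2[OF assms(2)]])

lemma L2_integrable_leb: assumes "g \<in> L2 K (leb a b)" shows "integrable (leb a b) g"
 using integrable_indicator[OF assms, of UNIV] by simp

lemma l2n_indicator: assumes "c \<le> d" shows "l2n (leb a b) (indicator {c<..d}) \<le> sqrt (d - c)"
proof -
 have "(l2n (leb a b) (indicator {c<..d}))\<^sup>2 = (LINT x|leb a b. (cmod (indicator {c<..d} x))\<^sup>2)"
  by (rule L2_nrm_sq[OF indicator_L2]) simp
 also have "\<dots> = (LINT x|lborel. indicator ({c<..d} \<inter> {a<..<b}) x)"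
 proof (subst integral_restrict_space, simp, rule Bochner_Integration.integral_cong[OF refl])
  fix x :: real
  show "indicator {a<..<b} x *\<^sub>R (cmod (indicator {c<..d} x))\<^sup>2 = (indicator ({c<..d} \<inter> {a<..<b}) x :: real)"
   by (auto simp: indicator_def)
 qed
 also have "\<dots> = measure lborel ({c<..d} \<inter> {a<..<b})" by simp
 also have "\<dots> \<le> measure lborel {c<..d}" by (rule measure_mono_fmeasurable) (use assms in \<open>auto simp: fmeasurable_def\<close>)
 also have "\<dots> = d - c" using assms by simp
 finally show ?thesis by (rule real_le_rsqrt)
qed

lemma primit_a: "primit a b g a = 0"
proof -
 have "primit a b g a = (LINT y|leb a b. 0)" unfolding primit_def
  by (intro Bochner_Integration.integral_cong) (auto simp: indicator_def)
 then show ?thesis by simp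
qed

lemma primit_diff:
 assumes "g \<in> L2 K (leb a b)" "c \<le> d"
 shows "primit a b g d - primit a b g c = (LINT y|leb a b. g y * indicator {c<..d} y)"
proof -
 have "(LINT y|leb a b. g y * indicator {c<..d} y) = (LINT y|leb a b. g y * indicator {..d} y - g y * indicator {..c} y)"
  by (intro Bochner_Integration.integral_cong) (use assms(2) in \<open>auto simp: indicator_def\<close>)
 also have "\<dots> = primit a b g d - primit a b g c"
  unfolding primit_def by (intro Bochner_Integration.integral_diff integrable_indicator assms) auto
 finally show ?thesis by simp
qed

text \<open>Cauchy-Schwarz against an indicator gives Hoelder continuity of order one half.
  Continuity of primitives, trace bounds and convergence of primitives all rest on it.\<close>

lemma primit_diff_le:
 assumes "g \<in> L2 K (leb a b)" "c \<le> d"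
 shows "cmod (primit a b g d - primit a b g c) \<le> l2n (leb a b) g * sqrt (d - c)"
proof -
 interpret L: semi_inner "L2 K (leb a b)" "l2ip (leb a b)" by (rule L2_semi_inner)
 have "cmod (LINT y|leb a b. g y * cnj (indicator {c<..d} y)) \<le> l2n (leb a b) g * l2n (leb a b) (indicator {c<..d})"
  by (rule L2_cauchy_schwarz(1)[OF assms(1) indicator_L2]) simp
 also have "\<dots> \<le> l2n (leb a b) g * sqrt (d - c)" by (intro mult_left_mono l2n_indicator assms L.nrm_nonneg)
 finally show ?thesis
  unfolding primit_diff[OF assms] by (simp add: indicator_def of_bool_def if_distrib[of cnj] cong: if_cong)
qed

lemma primit_dist_le:
 assumes "g \<in> L2 K (leb a b)"
 shows "cmod (primit a b g d - primit a b g c) \<le> l2n (leb a b) g * sqrt \<bar>d - c\<bar>"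
 using primit_diff_le[OF assms, of c d] primit_diff_le[OF assms, of d c] norm_minus_commute[of "primit a b g d"]
 by (cases "c \<le> d") auto

lemma primit_continuous:
 assumes "g \<in> L2 K (leb a b)" shows "continuous_on S (primit a b g)"
proof -
 have "isCont (primit a b g) c" for c
 proof -
  have "((\<lambda>d. primit a b g d - primit a b g c) \<longlongrightarrow> 0) (at c)"
  proof (rule Lim_null_comparison)
   show "\<forall>\<^sub>F d in at c. norm (primit a b g d - primit a b g c) \<le> l2n (leb a b) g * sqrt \<bar>d - c\<bar>"
    using primit_dist_le[OF assms] by simp
   have "((\<lambda>d. l2n (leb a b) g * sqrt \<bar>d - c\<bar>) \<longlongrightarrow> l2n (leb a b) g * sqrt \<bar>c - c\<bar>) (at c)"
    by (intro tendsto_intros)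
   then show "((\<lambda>d. l2n (leb a b) g * sqrt \<bar>d - c\<bar>) \<longlongrightarrow> 0) (at c)" by simp
  qed
  then show ?thesis unfolding isCont_def by (rule LIM_zero_cancel)
 qed
 then show ?thesis by (intro continuous_at_imp_continuous_on ballI)
qed

lemma primit_K:
 assumes "g \<in> L2 K (leb a b)" shows "primit a b g x \<in> K"
 unfolding primit_def
proof (rule K_integral)
 fix y assume "y \<in> space (leb a b)"
 then have "g y \<in> K" by (rule L2_D(2)[OF assms])
 then show "g y * indicator {..x} y \<in> K" by (simp add: indicator_def)
qed

lemma primit_add:
 assumes "g \<in> L2 K (leb a b)" "h \<in> L2 K (leb a b)"
 shows "primit a b (\<lambda>y. c * g y + h y) x = c * primit a b g x + primit a b h x"
proof -
 have "primit a b (\<lambda>y. c * g y + h y) x = (LINT y|leb a b. c * (g y * indicator {..x} y) + h y * indicator {..x} y)"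
  unfolding primit_def by (intro Bochner_Integration.integral_cong) (auto simp: algebra_simps)
 also have "\<dots> = (LINT y|leb a b. c * (g y * indicator {..x} y)) + primit a b h x"
  unfolding primit_def
  by (intro Bochner_Integration.integral_add integrable_mult_right integrable_indicator assms) auto
 also have "(LINT y|leb a b. c * (g y * indicator {..x} y)) = c * primit a b g x"
  unfolding primit_def by (rule integral_mult_right_zero)
 finally show ?thesis .
qed

lemma primit_cong_AE:
 assumes "g \<in> L2 K (leb a b)" "h \<in> L2 K (leb a b)" "AE x in leb a b. g x = h x"
 shows "primit a b g x = primit a b h x"
 unfolding primit_def
proof (rule integral_cong_AE)
 show "(\<lambda>y. g y * indicator {..x} y) \<in> borel_measurable (leb a b)" "(\<lambda>y. h y * indicator {..x} y) \<in> borel_measurable (leb a b)"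
  using integrable_indicator[OF assms(1), of "{..x}"] integrable_indicator[OF assms(2), of "{..x}"] by auto
 show "AE y in leb a b. g y * indicator {..x} y = h y * indicator {..x} y"
  using assms(3) by eventually_elim simp
qed

lemma is_prim_Cont:
 assumes "g \<in> L2 K (leb a b)" "is_prim a b g f" "f a \<in> K"
 shows "f \<in> Cont K a b"
proof -
 have "continuous_on {a..b} (\<lambda>x. f a + primit a b g x)" by (rule continuous_on_add[OF continuous_on_const primit_continuous[OF assms(1)]])
 then have "continuous_on {a..b} f"
  by (rule continuous_on_eq) (rule is_primD[OF assms(2), symmetric])
 moreover have "f x \<in> K" if "x \<in> {a..b}" for x
 proof -
  have "f x = f a + primit a b g x" by (rule is_primD[OF assms(2) that])
  then show ?thesis using assms(3) primit_K[OF assms(1)] by simp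
 qed
 ultimately show ?thesis by (simp add: Cont_def)
qed

lemma Cont_L2_leb: assumes "f \<in> Cont K a b" shows "f \<in> L2 K (leb a b)"
proof -
 have c: "continuous_on {a..b} f" using assms by (simp add: Cont_def)
 obtain B where B: "\<And>x. x \<in> {a..b} \<Longrightarrow> norm (f x) \<le> B" using bounded_continuous_fun[OF c] by blast
 show ?thesis
 proof (rule L2_bounded[OF finite_measure_leb borel_measurable_leb_continuous])
  show "continuous_on {a<..<b} f" by (rule continuous_on_subset[OF c]) auto
  show "f x \<in> K" "cmod (f x) \<le> B" if "x \<in> space (leb a b)" for x
   using that assms B[of x] by (auto simp: Cont_def)
 qed
qed

section \<open>Equivalence of weak derivatives and primitives\<close>

lemma integral_deriv_test_fun:
 assumes t: "test_fun a b \<phi>" and y: "a \<le> y" "y < b"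
 shows "(LINT x|leb a b. indicator {y..} x * deriv \<phi> x) = - \<phi> y"
proof -
 have "(LINT x|leb a b. indicator {y..} x * deriv \<phi> x) = (LINT x|lborel. indicator {a<..<b} x *\<^sub>R (indicator {y..} x * deriv \<phi> x))"
  by (rule integral_restrict_space) simp
 also have "\<dots> = (LINT x|lborel. indicator {y..b} x *\<^sub>R deriv \<phi> x)"
 proof (rule integral_cong_AE)
  have dm[measurable]: "deriv \<phi> \<in> borel_measurable borel" by (rule borel_measurable_continuous_onI[OF test_fun_D(2)[OF t]])
  show "(\<lambda>x. indicator {a<..<b} x *\<^sub>R (indicator {y..} x * deriv \<phi> x)) \<in> borel_measurable lborel" by measurable
  show "(\<lambda>x. indicator {y..b} x *\<^sub>R deriv \<phi> x) \<in> borel_measurable lborel" by measurable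
  have "AE x in lborel. x \<noteq> a" "AE x in lborel. x \<noteq> b" by (rule AE_lborel_singleton)+
  then show "AE x in lborel. indicator {a<..<b} x *\<^sub>R (indicator {y..} x * deriv \<phi> x) = indicator {y..b} x *\<^sub>R deriv \<phi> x"
   by eventually_elim (use y in \<open>auto simp: indicator_def\<close>)
 qed
 also have "\<dots> = \<phi> b - \<phi> y"
 proof (rule integral_FTC_Icc)
  fix x show "(\<phi> has_vector_derivative deriv \<phi> x) (at x within {y..b})"
   using test_fun_D(1)[OF t] by (auto simp: has_real_derivative_iff_has_vector_derivative intro: has_vector_derivative_at_within)
  show "continuous_on {y..b} (deriv \<phi>)" by (rule continuous_on_subset[OF test_fun_D(2)[OF t]]) simp
 qed (use y in simp)
 also have "\<phi> b = 0" by (rule test_fun_D(3)[OF t]) simp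
 finally show ?thesis by simp
qed

lemma test_fun_L2: assumes "test_fun a b \<phi>" shows "(\<lambda>x. complex_of_real (\<phi> x)) \<in> L2 K (leb a b)"
proof -
 obtain B where B: "\<And>x. \<bar>\<phi> x\<bar> \<le> B" using test_fun_bounded[OF assms] by blast
 have "continuous_on {a<..<b} (\<lambda>x. complex_of_real (\<phi> x))"
  by (intro continuous_intros continuous_on_subset[OF test_fun_D(4)[OF assms]]) simp
 then show ?thesis by (intro L2_bounded[OF finite_measure_leb borel_measurable_leb_continuous]) (use B in auto)
qed

lemma deriv_test_fun_L2: assumes "test_fun a b \<phi>" shows "(\<lambda>x. complex_of_real (deriv \<phi> x)) \<in> L2 K (leb a b)"
proof -
 have "(\<lambda>x. complex_of_real (deriv \<phi> x)) \<in> Cont K a b"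
  by (auto simp: Cont_def intro!: continuous_intros continuous_on_subset[OF test_fun_D(2)[OF assms]])
 then show ?thesis by (rule Cont_L2_leb)
qed

text \<open>Fubini on the triangle \<open>y \<le> x\<close>: integrating the derivative of the test
  function from \<open>y\<close> to the right end leaves \<open>- \<phi> y\<close>. The initial
  value \<open>f a\<close> contributes nothing, as that derivative has integral 0.\<close>

lemma is_prim_weak_deriv:
 assumes g: "g \<in> L2 K (leb a b)" and f: "is_prim a b g f" and ab: "a < b"
 shows "is_weak_deriv a b f g"
 unfolding is_weak_deriv_def
proof (intro allI impI)
 fix \<phi> assume t: "test_fun a b \<phi>"
 let ?D = "\<lambda>x. complex_of_real (deriv \<phi> x)"
 have D: "?D \<in> L2 K (leb a b)" by (rule deriv_test_fun_L2[OF t])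
 have Di: "integrable (leb a b) ?D" by (rule L2_integrable_leb[OF D])
 have pc: "primit a b g \<in> Cont K a b" using primit_continuous[OF g] primit_K[OF g] by (auto simp: Cont_def)
 interpret P: pair_sigma_finite "leb a b" "leb a b"
  using finite_measure_leb by (intro pair_sigma_finite.intro finite_measure.axioms)
 have gm[measurable]: "g \<in> borel_measurable (leb a b)" by (rule L2_D(1)[OF g])
 have Dm[measurable]: "?D \<in> borel_measurable (leb a b)" by (rule L2_D(1)[OF D])
 define F where "F x y = g y * indicator {..x} y * ?D x" for x y
 have Fm: "case_prod F \<in> borel_measurable (leb a b \<Otimes>\<^sub>M leb a b)"
 proof -
  have 1: "(\<lambda>z. g (snd z)) \<in> borel_measurable (leb a b \<Otimes>\<^sub>M leb a b)" by measurable
  have 2: "(\<lambda>z. ?D (fst z)) \<in> borel_measurable (leb a b \<Otimes>\<^sub>M leb a b)"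
   by (rule measurable_compose[OF measurable_fst Dm])
  have id: "(\<lambda>x. x) \<in> borel_measurable (leb a b)" by (rule borel_measurable_leb) simp
  have [measurable]: "fst \<in> borel_measurable (leb a b \<Otimes>\<^sub>M leb a b)"
   by (rule measurable_compose[OF measurable_fst id])
  have [measurable]: "snd \<in> borel_measurable (leb a b \<Otimes>\<^sub>M leb a b)"
   by (rule measurable_compose[OF measurable_snd id])
  have 3: "Measurable.pred (leb a b \<Otimes>\<^sub>M leb a b) (\<lambda>z. snd z \<le> fst z)" by measurable
  have "(\<lambda>z. (if snd z \<le> fst z then g (snd z) * ?D (fst z) else 0)) \<in> borel_measurable (leb a b \<Otimes>\<^sub>M leb a b)"
   by (intro measurable_If 3 borel_measurable_times 1 2) auto
  also have "(\<lambda>z. (if snd z \<le> fst z then g (snd z) * ?D (fst z) else 0)) = case_prod F"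
   by (auto simp: F_def fun_eq_iff indicator_def)
  finally show ?thesis .
 qed
 have Fi: "integrable (leb a b \<Otimes>\<^sub>M leb a b) (case_prod F)"
 proof (rule P.Fubini_integrable[OF Fm])
  show "AE x in leb a b. integrable (leb a b) (\<lambda>y. case_prod F (x, y))"
   using integrable_indicator[OF g, of "{..x}" for x] by (auto simp: F_def intro!: AE_I2)
  show "integrable (leb a b) (\<lambda>x. LINT y|leb a b. norm (case_prod F (x, y)))"
  proof (rule Bochner_Integration.integrable_bound)
   show "integrable (leb a b) (\<lambda>x. (LINT y|leb a b. cmod (g y)) * cmod (?D x))"
    using Di by (intro integrable_mult_right integrable_norm)
   show "(\<lambda>x. LINT y|leb a b. norm (case_prod F (x, y))) \<in> borel_measurable (leb a b)"
   proof (rule sigma_finite_measure.borel_measurable_lebesgue_integral)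
    show "sigma_finite_measure (leb a b)" using finite_measure_leb by (rule finite_measure.axioms)
    have "(\<lambda>z. norm (case_prod F z)) \<in> borel_measurable (leb a b \<Otimes>\<^sub>M leb a b)"
     by (rule measurable_compose[OF Fm borel_measurable_norm])
    then show "(\<lambda>(x, y). norm (case_prod F (x, y))) \<in> borel_measurable (leb a b \<Otimes>\<^sub>M leb a b)"
     by (simp add: case_prod_beta')
   qed
   show "AE x in leb a b. norm (LINT y|leb a b. norm (case_prod F (x, y))) \<le> norm ((LINT y|leb a b. cmod (g y)) * cmod (?D x))"
   proof (intro AE_I2)
    fix x
    have "(LINT y|leb a b. norm (case_prod F (x, y))) = (LINT y|leb a b. cmod (g y * indicator {..x} y) * cmod (?D x))"
     by (simp add: F_def norm_mult)
    also have "\<dots> = (LINT y|leb a b. cmod (g y * indicator {..x} y)) * cmod (?D x)" by simp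
    also have "\<dots> \<le> (LINT y|leb a b. cmod (g y)) * cmod (?D x)"
     using L2_integrable_leb[OF g] integrable_indicator[OF g, of "{..x}"]
     by (intro mult_right_mono integral_mono) (auto simp: indicator_def)
    finally show "norm (LINT y|leb a b. norm (case_prod F (x, y))) \<le> norm ((LINT y|leb a b. cmod (g y)) * cmod (?D x))"
     by (simp add: abs_mult)
   qed
  qed
 qed
 have "(LINT x|leb a b. primit a b g x * ?D x) = (LINT x|leb a b. LINT y|leb a b. F x y)"
  by (simp add: primit_def F_def)
 also have "\<dots> = (LINT y|leb a b. LINT x|leb a b. F x y)" using P.Fubini_integral[OF Fi] by simp
 also have "\<dots> = (LINT y|leb a b. - (g y * complex_of_real (\<phi> y)))"
 proof (rule Bochner_Integration.integral_cong[OF refl])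
  fix y assume y: "y \<in> space (leb a b)"
  have "(LINT x|leb a b. F x y) = (LINT x|leb a b. g y * complex_of_real (indicator {y..} x * deriv \<phi> x))"
   by (intro Bochner_Integration.integral_cong) (auto simp: F_def indicator_def)
  also have "\<dots> = g y * complex_of_real (LINT x|leb a b. indicator {y..} x * deriv \<phi> x)"
   by (simp only: integral_mult_right_zero integral_complex_of_real)
  finally show "(LINT x|leb a b. F x y) = - (g y * complex_of_real (\<phi> y))"
   using integral_deriv_test_fun[OF t, of y] y by simp
 qed
 finally have 1: "(LINT x|leb a b. primit a b g x * ?D x) = - (LINT y|leb a b. g y * complex_of_real (\<phi> y))"
  by simp
 have "(LINT x|leb a b. ?D x) = complex_of_real (LINT x|leb a b. deriv \<phi> x)" by (simp only: integral_complex_of_real)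
 also have "(LINT x|leb a b. deriv \<phi> x) = (LINT x|leb a b. indicator {a..} x * deriv \<phi> x)"
  by (intro Bochner_Integration.integral_cong) (auto simp: indicator_def)
 also have "\<dots> = 0" using integral_deriv_test_fun[OF t, of a] test_fun_D(3)[OF t, of a] ab by simp
 finally have 2: "(LINT x|leb a b. ?D x) = 0" by simp
 have "(LINT x|leb a b. f x * ?D x) = (LINT x|leb a b. f a * ?D x + primit a b g x * ?D x)"
 proof (rule Bochner_Integration.integral_cong[OF refl])
  fix x assume "x \<in> space (leb a b)"
  then have "x \<in> {a..b}" by simp
  from is_primD[OF f this] show "f x * ?D x = f a * ?D x + primit a b g x * ?D x"
   by (simp only: distrib_right)
 qed
 also have "\<dots> = f a * (LINT x|leb a b. ?D x) + (LINT x|leb a b. primit a b g x * ?D x)"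
  using Di L2_product_integrable(2)[OF Cont_L2_leb[OF pc] D] by simp
 finally show "(LINT x|leb a b. f x * ?D x) = - (LINT x|leb a b. g x * complex_of_real (\<phi> x))"
  using 1 2 by simp
qed

lemma weak_deriv_unique:
 assumes ab: "a < b" and g: "g \<in> L2 K (leb a b)" and h: "h \<in> L2 K (leb a b)"
  and "is_weak_deriv a b f g" "is_weak_deriv a b f h"
 shows "AE x in leb a b. g x = h x"
proof -
 have "AE x in leb a b. x \<in> {a<..<b} \<longrightarrow> g x - h x = 0"
 proof (rule test_fun_separating[OF _ sets_leb _ ab])
  show "sigma_finite_measure (leb a b)" using finite_measure_leb by (rule finite_measure.axioms)
  show "integrable (leb a b) (\<lambda>x. g x - h x)" by (intro L2_integrable_leb L2_diff g h)
  fix \<phi> assume t: "test_fun a b \<phi>"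
  have "(LINT x|leb a b. g x * complex_of_real (\<phi> x)) = (LINT x|leb a b. h x * complex_of_real (\<phi> x))"
  proof -
   let ?I = "LINT x|leb a b. f x * complex_of_real (deriv \<phi> x)"
   have "?I = - (LINT x|leb a b. g x * complex_of_real (\<phi> x))" "?I = - (LINT x|leb a b. h x * complex_of_real (\<phi> x))"
    using assms(4,5) t unfolding is_weak_deriv_def by blast+
   then show ?thesis by (simp only: neg_equal_iff_equal)
  qed
  then show "(LINT x|leb a b. (g x - h x) * complex_of_real (\<phi> x)) = 0"
   using L2_product_integrable(2)[OF g test_fun_L2[OF t]] L2_product_integrable(2)[OF h test_fun_L2[OF t]]
   by (simp add: left_diff_distrib)
 qed simp
 then show ?thesis by (rule AE_mp) (auto intro!: AE_I2)
qed

lemma dsmoothstep_integral: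
 "integrable lborel dsmoothstep" "(LINT y|lborel. dsmoothstep y) = 1" "\<exists>B. \<forall>y. \<bar>dsmoothstep y\<bar> \<le> B"
proof -
 have eq: "dsmoothstep = (\<lambda>y. indicator {0..1} y *\<^sub>R dsmoothstep y)"
  using dsmoothstep_0 by (auto simp: fun_eq_iff indicator_def)
 have "set_integrable lborel {0..1} dsmoothstep"
  by (rule borel_integrable_atLeastAtMost'[OF continuous_dsmoothstep])
 then show "integrable lborel dsmoothstep" unfolding set_integrable_def eq[symmetric] .
 have "(LINT y|lborel. indicator {0..1} y *\<^sub>R dsmoothstep y) = smoothstep 1 - smoothstep 0"
 proof (rule integral_FTC_Icc)
  fix x show "(smoothstep has_vector_derivative dsmoothstep x) (at x within {0..1})"
   using DERIV_smoothstep by (auto simp: has_real_derivative_iff_has_vector_derivative intro: has_vector_derivative_at_within)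
 qed (auto intro: continuous_dsmoothstep)
 then show "(LINT y|lborel. dsmoothstep y) = 1" unfolding eq[symmetric] by (simp add: smoothstep_0 smoothstep_1)
 obtain B where B: "B \<ge> 0" "\<And>x. x \<in> {0..1} \<Longrightarrow> norm (dsmoothstep x) \<le> B"
  using bounded_continuous_fun[OF continuous_dsmoothstep] by blast
 have "\<bar>dsmoothstep y\<bar> \<le> B" for y using B dsmoothstep_0[of y] by (cases "y \<in> {0..1}") auto
 then show "\<exists>B. \<forall>y. \<bar>dsmoothstep y\<bar> \<le> B" by blast
qed

text \<open>The rescaled derivatives of the cutoff have integral 1 and concentrate at
  \<open>c\<close>; the substitution \<open>y = n (x - c)\<close> turns the claim into dominated
  convergence with a fixed kernel.\<close>

lemma approximate_identity:
 assumes f: "f \<in> Cont K a b" and c: "a < c" "c < b"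
 shows "(\<lambda>n. LINT x|leb a b. f x * complex_of_real (real (Suc n) * dsmoothstep (real (Suc n) * (x - c)))) \<longlonglongrightarrow> f c"
proof -
 have cont: "continuous_on {a..b} f" using f by (simp add: Cont_def)
 obtain B where B: "B \<ge> 0" "\<And>x. x \<in> {a..b} \<Longrightarrow> norm (f x) \<le> B" using bounded_continuous_fun[OF cont] by blast
 define F where "F x = indicator {a<..<b} x *\<^sub>R f x" for x
 have Fm[measurable]: "F \<in> borel_measurable borel"
  unfolding F_def by (rule borel_measurable_continuous_on_indicator) (auto intro: continuous_on_subset[OF cont])
 have FB: "cmod (F x) \<le> B" for x using B by (auto simp: F_def indicator_def)
 have dm[measurable]: "dsmoothstep \<in> borel_measurable borel"
  by (intro borel_measurable_continuous_onI continuous_dsmoothstep)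
 have eq: "(LINT x|leb a b. f x * complex_of_real (real (Suc n) * dsmoothstep (real (Suc n) * (x - c))))
   = (LINT y|lborel. F (c + (1 / real (Suc n)) * y) * complex_of_real (dsmoothstep y))" for n
 proof -
  let ?k = "real (Suc n)"
  have "(LINT x|leb a b. f x * complex_of_real (?k * dsmoothstep (?k * (x - c))))
   = (LINT x|lborel. F x * complex_of_real (?k * dsmoothstep (?k * (x - c))))"
   by (subst integral_restrict_space) (auto simp: F_def)
  also have "\<dots> = \<bar>1 / ?k\<bar> *\<^sub>R (LINT y|lborel. F (c + (1 / ?k) * y) * complex_of_real (?k * dsmoothstep (?k * (c + (1 / ?k) * y - c))))"
   by (rule lborel_integral_real_affine) simp
  also have "(\<lambda>y. F (c + (1 / ?k) * y) * complex_of_real (?k * dsmoothstep (?k * (c + (1 / ?k) * y - c))))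
   = (\<lambda>y. complex_of_real ?k * (F (c + (1 / ?k) * y) * complex_of_real (dsmoothstep y)))"
  proof
   fix y
   have "?k * (c + (1 / ?k) * y - c) = y" by (simp del: of_nat_Suc)
   then show "F (c + (1 / ?k) * y) * complex_of_real (?k * dsmoothstep (?k * (c + (1 / ?k) * y - c)))
    = complex_of_real ?k * (F (c + (1 / ?k) * y) * complex_of_real (dsmoothstep y))"
    by (simp only: of_real_mult mult_ac)
  qed
  also have "\<bar>1 / ?k\<bar> *\<^sub>R (LINT y|lborel. complex_of_real ?k * (F (c + (1 / ?k) * y) * complex_of_real (dsmoothstep y)))
   = (\<bar>1 / ?k\<bar> * ?k) *\<^sub>R (LINT y|lborel. F (c + (1 / ?k) * y) * complex_of_real (dsmoothstep y))"
   by (simp only: integral_mult_right_zero scaleR_conv_of_real of_real_mult mult.assoc)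
  also have "\<bar>1 / ?k\<bar> * ?k = 1" by (simp del: of_nat_Suc)
  finally show ?thesis by simp
 qed
 have "(\<lambda>n. LINT y|lborel. F (c + (1 / real (Suc n)) * y) * complex_of_real (dsmoothstep y))
   \<longlonglongrightarrow> (LINT y|lborel. f c * complex_of_real (dsmoothstep y))"
 proof (rule integral_dominated_convergence)
  show "integrable lborel (\<lambda>y. B * \<bar>dsmoothstep y\<bar>)" using dsmoothstep_integral(1) by simp
  show "AE y in lborel. cmod (F (c + (1 / real (Suc n)) * y) * complex_of_real (dsmoothstep y)) \<le> B * \<bar>dsmoothstep y\<bar>" for n
   using FB by (auto simp: norm_mult intro!: AE_I2 mult_right_mono)
  show "AE y in lborel. (\<lambda>n. F (c + (1 / real (Suc n)) * y) * complex_of_real (dsmoothstep y)) \<longlonglongrightarrow> f c * complex_of_real (dsmoothstep y)"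
  proof (intro AE_I2 tendsto_mult_right)
   fix y
   have "isCont F c"
   proof -
    have "\<forall>\<^sub>F x in nhds c. F x = f x"
     using c by (auto simp: eventually_nhds F_def intro!: exI[of _ "{a<..<b}"])
    moreover have "isCont f c" using continuous_on_interior[OF cont, of c] c by simp
    ultimately show ?thesis by (simp add: isCont_cong)
   qed
   moreover have "(\<lambda>n. c + (1 / real (Suc n)) * y) \<longlonglongrightarrow> c + 0 * y"
    by (intro tendsto_intros) (rule LIMSEQ_Suc[OF lim_const_over_n])
   ultimately have "(\<lambda>n. F (c + (1 / real (Suc n)) * y)) \<longlonglongrightarrow> F c"
    by (intro isCont_tendsto_compose[of c F]) auto
   then show "(\<lambda>n. F (c + (1 / real (Suc n)) * y)) \<longlonglongrightarrow> f c" using c by (simp add: F_def)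
  qed
 qed measurable
 also have "(LINT y|lborel. f c * complex_of_real (dsmoothstep y)) = f c * complex_of_real (LINT y|lborel. dsmoothstep y)"
  by (simp only: integral_mult_right_zero integral_complex_of_real)
 finally show ?thesis unfolding eq dsmoothstep_integral(2) by simp
qed

text \<open>Tested with plateaus over \<open>(c, d]\<close>: the derivative side tends to
  \<open>f c - f d\<close> because the plateau derivative is a difference of two approximate
  identities, and the other side tends to the integral over \<open>(c, d]\<close>.\<close>

lemma weak_deriv_increment:
 assumes f: "f \<in> Cont K a b" and g: "g \<in> L2 K (leb a b)" and w: "is_weak_deriv a b f g"
  and cd: "a < c" "c \<le> d" "d < b"
 shows "f d - f c = (LINT y|leb a b. g y * indicator {c<..d} y)"
proof -
 let ?p = "\<lambda>n. plateau (real (Suc n)) c d"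
 let ?s = "\<lambda>n c x. f x * complex_of_real (real (Suc n) * dsmoothstep (real (Suc n) * (x - c)))"
 obtain m :: nat where m: "1 / (b - d) < real m" using reals_Archimedean2 by blast
 have t: "test_fun a b (?p n)" if n: "n \<ge> m" for n
 proof (rule test_fun_plateau)
  have "1 / (b - d) < real (Suc n)" using m n by simp
  then show "d + 1 / real (Suc n) < b" using cd by (simp add: field_simps)
 qed (use cd in auto)
 have lhs: "(LINT x|leb a b. f x * complex_of_real (deriv (?p n) x)) = (LINT x|leb a b. ?s n c x) - (LINT x|leb a b. ?s n d x)" for n
 proof -
  have si: "integrable (leb a b) (?s n e)" for e
  proof (rule L2_product_integrable(2)[OF Cont_L2_leb[OF f]])
   have "(\<lambda>x. complex_of_real (real (Suc n) * dsmoothstep (real (Suc n) * (x - e)))) \<in> Cont K a b"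
    unfolding Cont_def
    by (intro CollectI conjI ballI K_closed_ops(3) continuous_intros
      continuous_on_compose2[OF continuous_dsmoothstep[of UNIV]]) auto
   then show "(\<lambda>x. complex_of_real (real (Suc n) * dsmoothstep (real (Suc n) * (x - e)))) \<in> L2 K (leb a b)"
    by (rule Cont_L2_leb)
  qed
  have "deriv (?p n) x = real (Suc n) * dsmoothstep (real (Suc n) * (x - c)) - real (Suc n) * dsmoothstep (real (Suc n) * (x - d))" for x
   by (rule DERIV_imp_deriv[OF DERIV_plateau])
  then have "(LINT x|leb a b. f x * complex_of_real (deriv (?p n) x)) = (LINT x|leb a b. ?s n c x - ?s n d x)"
   by (simp only: of_real_diff right_diff_distrib)
  also have "\<dots> = (LINT x|leb a b. ?s n c x) - (LINT x|leb a b. ?s n d x)"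
   by (rule Bochner_Integration.integral_diff[OF si si])
  finally show ?thesis .
 qed
 have lim1: "(\<lambda>n. (LINT x|leb a b. ?s n c x) - (LINT x|leb a b. ?s n d x)) \<longlonglongrightarrow> f c - f d"
  by (intro tendsto_diff approximate_identity f) (use cd in auto)
 have lim2: "(\<lambda>n. - (LINT x|leb a b. g x * complex_of_real (?p n x))) \<longlonglongrightarrow> - (LINT x|leb a b. g x * indicator {c<..d} x)"
 proof (intro tendsto_minus integral_dominated_convergence)
  show "integrable (leb a b) (\<lambda>x. cmod (g x))" using L2_integrable_leb[OF g] by simp
  show "(\<lambda>x. g x * indicator {c<..d} x) \<in> borel_measurable (leb a b)"
   using integrable_indicator[OF g, of "{c<..d}"] by auto
  have pc: "continuous_on S (?p n)" for S n
   by (intro continuous_at_imp_continuous_on ballI) (rule DERIV_isCont[OF DERIV_plateau])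
  have "(\<lambda>x. complex_of_real (?p n x)) \<in> borel_measurable (leb a b)" for n
   by (intro borel_measurable_leb_continuous continuous_on_of_real pc)
  then show "(\<lambda>x. g x * complex_of_real (?p n x)) \<in> borel_measurable (leb a b)" for n
   by (intro borel_measurable_times L2_D(1)[OF g])
  show "AE x in leb a b. cmod (g x * complex_of_real (?p n x)) \<le> cmod (g x)" for n
  proof (intro AE_I2)
   fix x show "cmod (g x * complex_of_real (?p n x)) \<le> cmod (g x)"
    using mult_left_mono[OF plateau_bound[of "real (Suc n)" c d x], of "cmod (g x)"] by (simp add: norm_mult del: of_nat_Suc)
  qed
  show "AE x in leb a b. (\<lambda>n. g x * complex_of_real (?p n x)) \<longlonglongrightarrow> g x * indicator {c<..d} x"
  proof (intro AE_I2)
   fix x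
   have "(\<lambda>n. smoothstep (real n * (x - c) + 0) - smoothstep (real n * (x - d) + 0)) \<longlonglongrightarrow> indicator {c<..d} x"
    using tendsto_diff[OF smoothstep_tendsto[of x c 0] smoothstep_tendsto[of x d 0]] cd
    by (auto simp: indicator_def smoothstep_0 split: if_splits)
   then have "(\<lambda>n. ?p n x) \<longlonglongrightarrow> indicator {c<..d} x"
    by (intro LIMSEQ_Suc) (simp add: plateau_def)
   then have "(\<lambda>n. g x * complex_of_real (?p n x)) \<longlonglongrightarrow> g x * complex_of_real (indicator {c<..d} x)"
    by (intro tendsto_mult tendsto_const tendsto_of_real)
   also have "complex_of_real (indicator {c<..d} x) = indicator {c<..d} x" by (simp add: indicator_def)
   finally show "(\<lambda>n. g x * complex_of_real (?p n x)) \<longlonglongrightarrow> g x * indicator {c<..d} x" .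
  qed
 qed
 have ev: "\<forall>\<^sub>F n in sequentially. - (LINT x|leb a b. g x * complex_of_real (?p n x))
   = (LINT x|leb a b. ?s n c x) - (LINT x|leb a b. ?s n d x)"
  using w t unfolding lhs[symmetric] is_weak_deriv_def by (intro eventually_sequentiallyI[of m]) simp
 have "f c - f d = - (LINT x|leb a b. g x * indicator {c<..d} x)"
  by (rule LIMSEQ_unique[OF lim1 Lim_transform_eventually[OF lim2 ev]])
 then show ?thesis by (simp add: algebra_simps)
qed

lemma weak_deriv_is_prim:
 assumes f: "f \<in> Cont K a b" and g: "g \<in> L2 K (leb a b)" and w: "is_weak_deriv a b f g" and ab: "a < b"
 shows "is_prim a b g f"
proof -
 define k where "k x = f x - primit a b g x" for x
 have kc: "continuous_on {a..b} k"
  unfolding k_def using f by (intro continuous_on_diff primit_continuous g) (simp add: Cont_def)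
 define z where "z = (a + b) / 2"
 have z: "a < z" "z < b" using ab by (auto simp: z_def)
 have "k x = k z" if x: "x \<in> {a<..<b}" for x
 proof (cases "x \<le> z")
  case True
  then show ?thesis
   using weak_deriv_increment[OF f g w, of x z] primit_diff[OF g, of x z] x z by (simp add: k_def algebra_simps)
 next
  case False
  then show ?thesis
   using weak_deriv_increment[OF f g w, of z x] primit_diff[OF g, of z x] x z by (simp add: k_def algebra_simps)
 qed
 then have const: "k x = k z" if "x \<in> {a..b}" for x
  using continuous_constant_on_closure[of "{a<..<b}" k "k z" x] kc that ab by simp
 have "f x = f a + primit a b g x" if x: "x \<in> {a..b}" for x
 proof -
  have "k x = k a" using const[OF x] const[of a] ab by simp
  then show ?thesis by (simp add: k_def primit_a algebra_simps)
 qed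
 then show ?thesis unfolding is_prim_def by blast
qed

lemma W12_Cont_iff:
 assumes ab: "a < b"
 shows "f \<in> W12 K a b \<inter> Cont K a b \<longleftrightarrow> f a \<in> K \<and> (\<exists>g\<in>L2 K (leb a b). is_prim a b g f)"
proof
 assume f: "f \<in> W12 K a b \<inter> Cont K a b"
 then obtain g where "g \<in> L2 K (leb a b)" "is_weak_deriv a b f g" by (auto simp: W12_def)
 moreover have "f a \<in> K" using f ab by (simp add: Cont_def)
 ultimately show "f a \<in> K \<and> (\<exists>g\<in>L2 K (leb a b). is_prim a b g f)" using weak_deriv_is_prim ab f by blast
next
 assume "f a \<in> K \<and> (\<exists>g\<in>L2 K (leb a b). is_prim a b g f)"
 then obtain g where g: "g \<in> L2 K (leb a b)" "is_prim a b g f" and a: "f a \<in> K" by blast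
 have c: "f \<in> Cont K a b" by (rule is_prim_Cont[OF g a])
 then show "f \<in> W12 K a b \<inter> Cont K a b"
  using Cont_L2_leb[OF c] is_prim_weak_deriv[OF g ab] g by (auto simp: W12_def)
qed

lemma weak_deriv_prim:
 assumes ab: "a < b" and g: "g \<in> L2 K (leb a b)" "is_prim a b g f"
 shows "weak_deriv K a b f \<in> L2 K (leb a b)" "AE x in leb a b. weak_deriv K a b f x = g x"
proof -
 have w: "is_weak_deriv a b f g" by (rule is_prim_weak_deriv[OF g ab])
 then have "\<exists>h. h \<in> L2 K (leb a b) \<and> is_weak_deriv a b f h" using g by blast
 from someI_ex[OF this] have h: "weak_deriv K a b f \<in> L2 K (leb a b)" "is_weak_deriv a b f (weak_deriv K a b f)"
  unfolding weak_deriv_def by blast+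
 then show "weak_deriv K a b f \<in> L2 K (leb a b)" by blast
 show "AE x in leb a b. weak_deriv K a b f x = g x" by (rule weak_deriv_unique[OF ab h(1) g(1) h(2) w])
qed

end

section \<open>Composition with firmly nonexpansive maps\<close>

locale firm_map = scalars +
 fixes P :: "complex \<Rightarrow> complex"
 assumes firm: "(cmod (P z - P w))\<^sup>2 \<le> Re ((P z - P w) * cnj (z - w))"
  and P_0 [simp]: "P 0 = 0"
  and P_K: "z \<in> K \<Longrightarrow> P z \<in> K"
begin

lemma P_lipschitz: "cmod (P z - P w) \<le> cmod (z - w)"
proof -
 have "cmod (P z - P w) * cmod (P z - P w) \<le> cmod ((P z - P w) * cnj (z - w))"
  using firm[of z w] complex_Re_le_cmod[of "(P z - P w) * cnj (z - w)"] by (simp add: power2_eq_square)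
 also have "\<dots> = cmod (P z - P w) * cmod (z - w)" by (simp add: norm_mult flip: complex_cnj_diff)
 finally show ?thesis
  by (metis mult_le_cancel_left_pos norm_ge_zero order.order_iff_strict)
qed

lemma P_norm: "cmod (P z) \<le> cmod z" using P_lipschitz[of z 0] by simp

lemma P_continuous: "continuous_on S P"
proof -
 have "isCont P z" for z
 proof -
  have "((\<lambda>w. P w - P z) \<longlongrightarrow> 0) (at z)"
  proof (rule Lim_null_comparison)
   show "\<forall>\<^sub>F w in at z. norm (P w - P z) \<le> norm (w - z)" using P_lipschitz by simp
   have "((\<lambda>w. norm (w - z)) \<longlongrightarrow> norm (z - z)) (at z)" by (intro tendsto_intros)
   then show "((\<lambda>w. norm (w - z)) \<longlongrightarrow> 0) (at z)" by simp
  qed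
  then show ?thesis unfolding isCont_def by (rule LIM_zero_cancel)
 qed
 then show ?thesis by (intro continuous_at_imp_continuous_on ballI)
qed

lemma P_L2: assumes "f \<in> L2 K M" shows "(\<lambda>x. P (f x)) \<in> L2 K M"
proof -
 have m: "(\<lambda>x. P (f x)) \<in> borel_measurable M"
  by (rule borel_measurable_continuous_on[OF P_continuous L2_D(1)[OF assms]])
 have "integrable M (\<lambda>x. (cmod (P (f x)))\<^sup>2)"
 proof (rule Bochner_Integration.integrable_bound[OF L2_D(3)[OF assms]])
  show "(\<lambda>x. (cmod (P (f x)))\<^sup>2) \<in> borel_measurable M" using m by measurable
  show "AE x in M. norm ((cmod (P (f x)))\<^sup>2) \<le> norm ((cmod (f x))\<^sup>2)"
   using P_norm by (intro AE_I2) (simp add: power_mono)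
 qed
 then show ?thesis using m L2_D(2)[OF assms] P_K by (auto simp: L2_def)
qed

end

section \<open>Derivatives of compositions as limits of dyadic slopes\<close>

context scalars
begin

lemma LINT_indicator_leb:
 assumes "a \<le> c" "c \<le> d" "d \<le> b"
 shows "(LINT x|leb a b. (indicator {c<..d} x :: complex)) = complex_of_real (d - c)"
proof -
 have "(LINT x|leb a b. (indicator {c<..d} x :: complex)) = (LINT x|lborel. indicator {a<..<b} x *\<^sub>R (indicator {c<..d} x :: complex))"
  by (rule integral_restrict_space) simp
 also have "\<dots> = (LINT x|lborel. complex_of_real (indicator {c<..d} x))"
 proof (rule integral_cong_AE)
  have "AE x in lborel. x \<noteq> b" by (rule AE_lborel_singleton)
  then show "AE x in lborel. indicator {a<..<b} x *\<^sub>R (indicator {c<..d} x :: complex) = complex_of_real (indicator {c<..d} x)"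
   by eventually_elim (use assms in \<open>auto simp: indicator_def\<close>)
 qed measurable
 also have "\<dots> = complex_of_real (LINT x|lborel. indicator {c<..d} x)" by (rule integral_complex_of_real)
 also have "(LINT x|lborel. indicator {c<..d} x) = measure lborel {c<..d}" by simp
 also have "\<dots> = d - c" using assms by simp
 finally show ?thesis .
qed

lemma primit_indicator:
 assumes "a \<le> c" "c \<le> d" "d \<le> b"
 shows "x \<le> c \<Longrightarrow> primit a b (indicator {c<..d}) x = 0"
  "d \<le> x \<Longrightarrow> primit a b (indicator {c<..d}) x = complex_of_real (d - c)"
proof -
 assume "x \<le> c"
 then have "primit a b (indicator {c<..d}) x = (LINT y|leb a b. 0)"
  unfolding primit_def by (intro Bochner_Integration.integral_cong) (auto simp: indicator_def)
 then show "primit a b (indicator {c<..d}) x = 0" by simp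
next
 assume "d \<le> x"
 then have "primit a b (indicator {c<..d}) x = (LINT y|leb a b. indicator {c<..d} y)"
  unfolding primit_def by (intro Bochner_Integration.integral_cong) (auto simp: indicator_def)
 then show "primit a b (indicator {c<..d}) x = complex_of_real (d - c)" using LINT_indicator_leb[OF assms] by simp
qed

lemma primit_zero: "primit a b (\<lambda>_. 0) x = 0"
 by (simp add: primit_def)

lemma primit_scale:
 assumes "g \<in> L2 K (leb a b)" shows "primit a b (\<lambda>y. c * g y) x = c * primit a b g x"
 using primit_add[OF assms L2_zero, of c x] by (simp add: primit_zero)

lemma primit_minus:
 assumes "g \<in> L2 K (leb a b)" "h \<in> L2 K (leb a b)"
 shows "primit a b (g - h) x = primit a b g x - primit a b h x"
 using primit_add[OF assms(2,1), of "- 1" x] by (simp add: fun_diff_def)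

lemma l2ip_indicator:
 assumes "g \<in> L2 K (leb a b)" "c \<le> d"
 shows "l2ip (leb a b) g (\<lambda>y. s * indicator {c<..d} y) = Re (cnj s * (primit a b g d - primit a b g c))"
proof -
 have "(LINT y|leb a b. g y * cnj (s * indicator {c<..d} y)) = (LINT y|leb a b. cnj s * (g y * indicator {c<..d} y))"
  by (intro Bochner_Integration.integral_cong) (auto simp: indicator_def)
 also have "\<dots> = cnj s * (primit a b g d - primit a b g c)"
  unfolding primit_diff[OF assms] by (rule integral_mult_right_zero)
 finally show ?thesis by (simp add: l2ip_def)
qed

lemma tendsto_primit:
 assumes "(\<lambda>n. l2n (leb a b) (g n - h)) \<longlonglongrightarrow> 0" "\<And>n. g n \<in> L2 K (leb a b)" "h \<in> L2 K (leb a b)"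
 shows "(\<lambda>n. primit a b (g n) x) \<longlonglongrightarrow> primit a b h x"
proof -
 interpret L: semi_inner "L2 K (leb a b)" "l2ip (leb a b)" by (rule L2_semi_inner)
 have "(\<lambda>n. primit a b (g n) x - primit a b h x) \<longlonglongrightarrow> 0"
 proof (rule Lim_null_comparison)
  have "cmod (primit a b (g n) x - primit a b h x) \<le> l2n (leb a b) (g n - h) * sqrt \<bar>x - a\<bar>" for n
   using primit_dist_le[of "g n - h" a b x a] assms(2,3) by (simp add: primit_minus primit_a)
  then show "\<forall>\<^sub>F n in sequentially. norm (primit a b (g n) x - primit a b h x) \<le> l2n (leb a b) (g n - h) * sqrt \<bar>x - a\<bar>"
   by simp
  show "(\<lambda>n. l2n (leb a b) (g n - h) * sqrt \<bar>x - a\<bar>) \<longlonglongrightarrow> 0" by (rule tendsto_mult_left_zero[OF assms(1)])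
 qed
 then show ?thesis by (rule LIM_zero_cancel)
qed

end

text \<open>The slopes of \<open>P \<circ> G\<close> over dyadic partitions form a bounded martingale in \<open>L\<^sub>2\<close>;
 its limit is the derivative of \<open>P \<circ> G\<close>.\<close>

lemma (in firm_map) firm_primitive:
 assumes ab: "a < b" and g: "g \<in> L2 K (leb a b)" and G: "is_prim a b g G" and Ga: "G a \<in> K"
 shows "\<exists>f\<in>L2 K (leb a b). is_prim a b f (\<lambda>x. P (G x)) \<and> (l2n (leb a b) f)\<^sup>2 \<le> l2ip (leb a b) g f"
proof -
 interpret L: semi_hilbert "L2 K (leb a b)" "l2ip (leb a b)" by (rule L2_semi_hilbert)
 define F where "F x = P (G x)" for x
 have GC: "G \<in> Cont K a b" by (rule is_prim_Cont[OF g G Ga])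
 then have Gc: "continuous_on {a..b} G" and GK: "\<And>x. x \<in> {a..b} \<Longrightarrow> G x \<in> K" by (auto simp: Cont_def)
 have Fc: "continuous_on {a..b} F"
  unfolding F_def by (rule continuous_on_compose2[OF P_continuous[of UNIV] Gc]) simp
 have FK: "x \<in> {a..b} \<Longrightarrow> F x \<in> K" for x using GK P_K by (simp add: F_def)
 define \<delta> where "\<delta> n = (b - a) / 2 ^ n" for n :: nat
 have \<delta>: "\<delta> n > 0" for n using ab by (simp add: \<delta>_def)
 define p where "p n k = a + real k * \<delta> n" for n k
 have p0: "p n 0 = a" for n by (simp add: p_def)
 have p_mono: "j \<le> k \<Longrightarrow> p n j \<le> p n k" for j k n using \<delta>[of n] by (simp add: p_def mult_right_mono)
 have p_end: "p n (2 ^ n) = b" for n by (simp add: p_def \<delta>_def)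
 have p_ab: "p n k \<in> {a..b}" if "k \<le> 2 ^ n" for n k
  using p_mono[of 0 k n] p_mono[OF that, of n] p0 p_end by simp
 have p_suc: "p n (Suc k) - p n k = \<delta> n" for n k by (simp add: p_def algebra_simps)
 have p_refine: "p n k = p m (k * 2 ^ (m - n))" if "n \<le> m" for n m k
 proof -
  have "(2::real) ^ m = 2 ^ (m - n) * 2 ^ n" using that by (simp flip: power_add)
  then show ?thesis by (simp add: p_def \<delta>_def)
 qed
 define sl where "sl n k = (F (p n (Suc k)) - F (p n k)) / complex_of_real (\<delta> n)" for n k
 have slK: "sl n k \<in> K" if "k < 2 ^ n" for n k
 proof -
  have "F (p n (Suc k)) - F (p n k) \<in> K" using FK[OF p_ab[of "Suc k" n]] FK[OF p_ab[of k n]] that by simp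
  then have "complex_of_real (1 / \<delta> n) * (F (p n (Suc k)) - F (p n k)) \<in> K" by (intro K_closed_ops(6,3))
  then show ?thesis by (simp add: sl_def)
 qed
 \<comment> \<open>The step function of slopes of \<open>F\<close> over the \<open>n\<close>-th
   dyadic partition: the conditional expectation of the derivative that is to be found.\<close>
 define s where "s n = (\<Sum>k<2 ^ n. (\<lambda>y. sl n k * indicator {p n k<..p n (Suc k)} y))" for n
 have piece: "(\<lambda>y. sl n k * indicator {p n k<..p n (Suc k)} y) \<in> L2 K (leb a b)" if "k < 2 ^ n" for n k
  by (rule L2_mult[OF indicator_L2 slK[OF that]]) simp
 have part: "(\<Sum>k<j. (\<lambda>y. sl n k * indicator {p n k<..p n (Suc k)} y)) \<in> L2 K (leb a b)
   \<and> (\<forall>x. primit a b (\<Sum>k<j. (\<lambda>y. sl n k * indicator {p n k<..p n (Suc k)} y)) x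
     = (\<Sum>k<j. sl n k * primit a b (indicator {p n k<..p n (Suc k)}) x))
   \<and> (\<forall>h\<in>L2 K (leb a b). l2ip (leb a b) h (\<Sum>k<j. (\<lambda>y. sl n k * indicator {p n k<..p n (Suc k)} y))
     = (\<Sum>k<j. Re (cnj (sl n k) * (primit a b h (p n (Suc k)) - primit a b h (p n k)))))"
  if "j \<le> 2 ^ n" for n j
  using that
 proof (induction j)
  case 0
  then show ?case by (simp add: primit_zero zero_fun_def L2_zero l2ip_def)
 next
  case (Suc j)
  then have j: "j < 2 ^ n" by simp
  let ?S = "\<Sum>k<j. (\<lambda>y. sl n k * indicator {p n k<..p n (Suc k)} y)"
  let ?q = "\<lambda>y. sl n j * indicator {p n j<..p n (Suc j)} y"
  have S: "?S \<in> L2 K (leb a b)"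
   and S_prim: "\<And>x. primit a b ?S x = (\<Sum>k<j. sl n k * primit a b (indicator {p n k<..p n (Suc k)}) x)"
   and S_ip: "\<And>h. h \<in> L2 K (leb a b) \<Longrightarrow> l2ip (leb a b) h ?S
     = (\<Sum>k<j. Re (cnj (sl n k) * (primit a b h (p n (Suc k)) - primit a b h (p n k))))"
   using Suc.IH Suc.prems by (blast dest: Suc_leD)+
  have eq: "(\<Sum>k<Suc j. (\<lambda>y. sl n k * indicator {p n k<..p n (Suc k)} y)) = ?S + ?q" by simp
  have "primit a b (?S + ?q) x = primit a b ?S x + sl n j * primit a b (indicator {p n j<..p n (Suc j)}) x" for x
   using primit_add[OF indicator_L2 S, of "{p n j<..p n (Suc j)}" "sl n j" x]
   by (simp add: plus_fun_def add.commute)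
  moreover have "l2ip (leb a b) h (?S + ?q) = l2ip (leb a b) h ?S + Re (cnj (sl n j) * (primit a b h (p n (Suc j)) - primit a b h (p n j)))"
   if h: "h \<in> L2 K (leb a b)" for h
   unfolding L.ip_add_right[OF S piece[OF j] h] l2ip_indicator[OF h p_mono[OF le_SucI[OF order_refl]]] ..
  ultimately show ?case unfolding eq sum.lessThan_Suc
   using L.mem(2)[OF S piece[OF j]] S_prim S_ip by (intro conjI allI ballI) (simp_all only:)
 qed
 have s: "s n \<in> L2 K (leb a b)" for n using part[of "2 ^ n" n] by (simp add: s_def)
 have s_ip: "l2ip (leb a b) h (s n) = (\<Sum>k<2 ^ n. Re (cnj (sl n k) * (primit a b h (p n (Suc k)) - primit a b h (p n k))))"
  if "h \<in> L2 K (leb a b)" for h n using part[of "2 ^ n" n] that by (simp add: s_def)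
 have s_prim: "primit a b (s n) (p n j) = F (p n j) - F a" if j: "j \<le> 2 ^ n" for n j
 proof -
  have "primit a b (s n) (p n j) = (\<Sum>k<2 ^ n. sl n k * primit a b (indicator {p n k<..p n (Suc k)}) (p n j))"
   using part[of "2 ^ n" n] by (simp add: s_def)
  also have "\<dots> = (\<Sum>k<2 ^ n. if k < j then F (p n (Suc k)) - F (p n k) else 0)"
  proof (rule sum.cong[OF refl])
   fix k assume "k \<in> {..<2 ^ n :: nat}"
   then have k: "k < 2 ^ n" by simp
   then have r: "a \<le> p n k" "p n k \<le> p n (Suc k)" "p n (Suc k) \<le> b"
    using p_ab[of k n] p_ab[of "Suc k" n] p_mono[of k "Suc k" n] by auto
   show "sl n k * primit a b (indicator {p n k<..p n (Suc k)}) (p n j) = (if k < j then F (p n (Suc k)) - F (p n k) else 0)"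
   proof (cases "k < j")
    case True
    then have "primit a b (indicator {p n k<..p n (Suc k)}) (p n j) = complex_of_real (\<delta> n)"
     using primit_indicator(2)[OF r, of "p n j"] p_mono[of "Suc k" j n] p_suc by simp
    then show ?thesis using True \<delta>[of n] by (simp add: sl_def)
   next
    case False
    then show ?thesis using primit_indicator(1)[OF r, of "p n j"] p_mono[of j k n] by simp
   qed
  qed
  also have "\<dots> = (\<Sum>k<j. F (p n (Suc k)) - F (p n k))"
  proof -
   have "{..<2 ^ n} \<inter> {k. k < j} = {..<j}" using j by auto
   then show ?thesis by (simp add: sum.If_cases)
  qed
  also have "\<dots> = F (p n j) - F (p n 0)" by (rule sum_lessThan_telescope)
  finally show ?thesis by (simp add: p0)
 qed
 \<comment> \<open>Martingale property: a finer step function has the same integral over each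
   coarser dyadic interval. Its scalar product with a coarser one therefore sees only the coarse
   energy \<open>E n\<close>.\<close>
 have s_inc: "primit a b (s m) (p n (Suc k)) - primit a b (s m) (p n k) = F (p n (Suc k)) - F (p n k)"
  if "n \<le> m" "k < 2 ^ n" for m n k
 proof -
  have "Suc k * 2 ^ (m - n) \<le> 2 ^ n * 2 ^ (m - n)" using that by (intro mult_right_mono) auto
  also have "\<dots> = 2 ^ m" using that by (simp flip: power_add)
  finally have 1: "Suc k * 2 ^ (m - n) \<le> 2 ^ m" .
  moreover have "k * 2 ^ (m - n) \<le> Suc k * 2 ^ (m - n)" by simp
  ultimately have 2: "k * 2 ^ (m - n) \<le> 2 ^ m" by linarith
  show ?thesis unfolding p_refine[OF that(1)] s_prim[OF 1] s_prim[OF 2] by simp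
 qed
 define E where "E n = (\<Sum>k<2 ^ n. (cmod (F (p n (Suc k)) - F (p n k)))\<^sup>2 / \<delta> n)" for n
 have Re_sl: "Re (cnj (sl n k) * (F (p n (Suc k)) - F (p n k))) = (cmod (F (p n (Suc k)) - F (p n k)))\<^sup>2 / \<delta> n" for n k
 proof -
  let ?d = "F (p n (Suc k)) - F (p n k)"
  have "cnj (sl n k) * ?d = ?d * cnj ?d / complex_of_real (\<delta> n)"
   by (simp add: sl_def mult.commute)
  then have "cnj (sl n k) * ?d = complex_of_real ((cmod ?d)\<^sup>2 / \<delta> n)"
   by (simp only: complex_norm_square of_real_divide)
  then show ?thesis by (simp only: Re_complex_of_real)
 qed
 have ip_s: "l2ip (leb a b) (s m) (s n) = E n" if "n \<le> m" for m n
  unfolding s_ip[OF s] E_def by (intro sum.cong refl) (use s_inc[OF that] Re_sl in simp)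
 have nrm_s: "(L.nrm (s n))\<^sup>2 = E n" for n using L.nrm_sq[OF s] ip_s[of n n] by simp
 \<comment> \<open>The firm inequality applied to each increment and divided by the mesh size
   compares the energy of the slopes with their pairing against \<open>g\<close>.\<close>
 have firm_s: "E n \<le> l2ip (leb a b) g (s n)" for n
  unfolding s_ip[OF g] E_def
 proof (rule sum_mono)
  fix k assume "k \<in> {..<2 ^ n :: nat}"
  then have k: "Suc k \<le> 2 ^ n" "k \<le> 2 ^ n" by auto
  let ?d = "F (p n (Suc k)) - F (p n k)" and ?e = "G (p n (Suc k)) - G (p n k)"
  have e: "primit a b g (p n (Suc k)) - primit a b g (p n k) = ?e"
   using is_primD[OF G p_ab[OF k(1)]] is_primD[OF G p_ab[OF k(2)]] by simp
  have "(cmod ?d)\<^sup>2 / \<delta> n \<le> Re (?d * cnj ?e) / \<delta> n"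
   using firm \<delta>[of n] by (intro divide_right_mono) (auto simp: F_def)
  also have "Re (?d * cnj ?e) / \<delta> n = Re (cnj (sl n k) * ?e)"
  proof -
   have "cnj (sl n k) * ?e = cnj (?d * cnj ?e) / complex_of_real (\<delta> n)" by (simp add: sl_def)
   then have "Re (cnj (sl n k) * ?e) = Re (cnj (?d * cnj ?e)) / \<delta> n" by (simp only: Re_divide_of_real)
   then show ?thesis by (simp only: cnj.sel(1))
  qed
  finally show "(cmod ?d)\<^sup>2 / \<delta> n \<le> Re (cnj (sl n k) * (primit a b g (p n (Suc k)) - primit a b g (p n k)))"
   unfolding e .
 qed
 have bound: "E n \<le> (L.nrm g)\<^sup>2" for n
 proof -
  have "(L.nrm (s n))\<^sup>2 \<le> L.nrm g * L.nrm (s n)"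
   using firm_s[of n] L.ip_le_nrm[OF g s, of n] nrm_s[of n] by linarith
  then have "L.nrm (s n) \<le> L.nrm g"
  proof (cases "L.nrm (s n) > 0")
   case True
   then show ?thesis using \<open>(L.nrm (s n))\<^sup>2 \<le> L.nrm g * L.nrm (s n)\<close>
    unfolding power2_eq_square by (rule mult_right_le_imp_le[rotated])
  next
   case False
   then show ?thesis using L.nrm_nonneg[OF g] by linarith
  qed
  then have "(L.nrm (s n))\<^sup>2 \<le> (L.nrm g)\<^sup>2" by (rule power_mono) (rule L.nrm_nonneg[OF s])
  then show ?thesis unfolding nrm_s .
 qed
 \<comment> \<open>Pythagoras for martingale increments: the energies increase and are bounded, so
   the step functions form a Cauchy sequence.\<close>
 have diff: "(L.nrm (s m - s n))\<^sup>2 = E m - E n" if "n \<le> m" for m n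
 proof -
  have "(L.nrm (s m - s n))\<^sup>2 = l2ip (leb a b) (s m) (s m) - 2 * l2ip (leb a b) (s m) (s n) + l2ip (leb a b) (s n) (s n)"
   using s L.ip_sym[OF s s, of n m] by (simp add: L.nrm_sq L.ip_lin)
  then show ?thesis using ip_s[of m m] ip_s[OF that] ip_s[of n n] by simp
 qed
 have "incseq E"
 proof (rule incseq_SucI)
  fix n have "0 \<le> (L.nrm (s (Suc n) - s n))\<^sup>2" by simp
  then show "E n \<le> E (Suc n)" using diff[of n "Suc n"] by simp
 qed
 then obtain l where "E \<longlonglongrightarrow> l" using incseq_convergent[of E] bound by blast
 then have Ec: "Cauchy E" by (rule LIMSEQ_imp_Cauchy)
 have "L.cau s" unfolding L.cau_def
 proof (intro allI impI)
  fix e :: real assume e: "e > 0"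
  then have "e\<^sup>2 > 0" by simp
  then obtain M where M: "\<And>m n. m \<ge> M \<Longrightarrow> n \<ge> M \<Longrightarrow> dist (E m) (E n) < e\<^sup>2" using Ec unfolding Cauchy_def by blast
  have le: "L.nrm (s m - s n) < e" if mn: "n \<ge> M" "n \<le> m" for m n
  proof (rule power2_less_imp_less)
   show "(L.nrm (s m - s n))\<^sup>2 < e\<^sup>2" using M[of m n] mn diff[OF mn(2)] by (simp add: dist_real_def)
  qed (use e in simp)
  have "L.nrm (s m - s n) < e" if "m \<ge> M" "n \<ge> M" for m n
   using le[of n m] le[of m n] that L.nrm_diff_commute[OF s s, of m n] by (cases "n \<le> m") auto
  then show "\<exists>M. \<forall>m\<ge>M. \<forall>n\<ge>M. L.nrm (s m - s n) < e" by blast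
 qed
 then obtain f where f: "f \<in> L2 K (leb a b)" "(\<lambda>n. L.nrm (s n - f)) \<longlonglongrightarrow> 0" using L.complete s by blast
 have f_dyadic: "primit a b f (p n j) = F (p n j) - F a" if j: "j \<le> 2 ^ n" for n j
 proof (rule LIMSEQ_unique[OF tendsto_primit[OF f(2) s f(1)]])
  have "primit a b (s m) (p n j) = F (p n j) - F a" if m: "m \<ge> n" for m
  proof -
   have "j * 2 ^ (m - n) \<le> 2 ^ n * 2 ^ (m - n)" using j by (intro mult_right_mono) auto
   also have "\<dots> = 2 ^ m" using m by (simp flip: power_add)
   finally show ?thesis unfolding p_refine[OF m] by (rule s_prim)
  qed
  then show "(\<lambda>m. primit a b (s m) (p n j)) \<longlonglongrightarrow> F (p n j) - F a"
   by (intro tendsto_eventually eventually_sequentiallyI[of n])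
 qed
 have "F x = F a + primit a b f x" if x: "x \<in> {a..b}" for x
 proof -
  \<comment> \<open>Index of the last dyadic point not to the right of \<open>x\<close>; these
    points converge to \<open>x\<close>, and continuity extends the identity from dyadic
    points.\<close>
  define j where "j n = nat \<lfloor>(x - a) / \<delta> n\<rfloor>" for n
  define q where "q n = p n (j n)" for n
  have nn: "(x - a) / \<delta> n \<ge> 0" for n using x \<delta>[of n] by simp
  have jr: "real (j n) \<le> (x - a) / \<delta> n" "(x - a) / \<delta> n < real (j n) + 1" for n
   using nn[of n] by (simp_all add: j_def)
  have jle: "j n \<le> 2 ^ n" for n
  proof -
   have "(x - a) / \<delta> n \<le> (b - a) / \<delta> n" using x \<delta>[of n] by (intro divide_right_mono) auto
   also have "\<dots> = 2 ^ n" using ab by (simp add: \<delta>_def)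
   finally have "real (j n) \<le> 2 ^ n" using jr(1)[of n] by linarith
   then show ?thesis using of_nat_le_iff[of "j n" "2 ^ n", where 'a = real] by simp
  qed
  have qx: "\<bar>q n - x\<bar> \<le> \<delta> n" for n
  proof -
   have "real (j n) * \<delta> n \<le> x - a" "x - a \<le> (real (j n) + 1) * \<delta> n"
    using jr[of n] \<delta>[of n] by (auto simp: field_simps)
   then show ?thesis unfolding q_def p_def by (simp add: algebra_simps abs_le_iff)
  qed
  have "\<delta> \<longlonglongrightarrow> 0"
  proof -
   have "(\<lambda>n. (b - a) * (1/2) ^ n) \<longlonglongrightarrow> (b - a) * 0" by (intro tendsto_intros) auto
   then show ?thesis by (simp add: \<delta>_def[abs_def] power_divide)
  qed
  then have "(\<lambda>n. q n - x) \<longlonglongrightarrow> 0" by (rule Lim_null_comparison[rotated]) (use qx in simp)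
  then have qlim: "q \<longlonglongrightarrow> x" by (rule LIM_zero_cancel)
  have qab: "q n \<in> {a..b}" for n unfolding q_def by (rule p_ab[OF jle])
  have "continuous_on {a..b} (\<lambda>x. F x - F a - primit a b f x)"
   by (intro continuous_on_diff Fc continuous_on_const primit_continuous f(1))
  then have "(\<lambda>n. F (q n) - F a - primit a b f (q n)) \<longlonglongrightarrow> F x - F a - primit a b f x"
   by (rule continuous_on_tendsto_compose[OF _ qlim x]) (use qab in simp)
  moreover have "F (q n) - F a - primit a b f (q n) = 0" for n unfolding q_def f_dyadic[OF jle] by simp
  ultimately have "F x - F a - primit a b f x = 0" by (simp add: LIMSEQ_const_iff)
  then show ?thesis by (simp add: algebra_simps)
 qed
 then have prim: "is_prim a b f (\<lambda>x. P (G x))" unfolding is_prim_def F_def by blast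
 have "(L.nrm f)\<^sup>2 \<le> l2ip (leb a b) g f"
 proof (rule LIMSEQ_le)
  show "(\<lambda>n. (L.nrm (s n))\<^sup>2) \<longlonglongrightarrow> (L.nrm f)\<^sup>2" by (intro tendsto_power L.tendsto_nrm f s)
  have "(\<lambda>n. l2ip (leb a b) (s n) g) \<longlonglongrightarrow> l2ip (leb a b) f g" by (rule L.tendsto_ip[OF f(2) s f(1) g])
  then show "(\<lambda>n. l2ip (leb a b) g (s n)) \<longlonglongrightarrow> l2ip (leb a b) g f" using L.ip_sym[OF g] s f(1) by simp
  show "\<exists>N. \<forall>n\<ge>N. (L.nrm (s n))\<^sup>2 \<le> l2ip (leb a b) g (s n)" using firm_s nrm_s by simp
 qed
 then show ?thesis using prim f(1) by blast
qed

section \<open>A single edge\<close>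

text \<open>The hypothesis compares the two chords meeting at an intermediate point. Equality of
  neighbouring slopes forces every chord between points of \<open>C\<close> to have the slope
  \<open>p\<close> of one fixed chord.\<close>

lemma affine_if_slopes:
 fixes f :: "real \<Rightarrow> complex"
 assumes slopes: "\<And>x y z. x \<in> C \<Longrightarrow> z \<in> C \<Longrightarrow> x < y \<Longrightarrow> y < z \<Longrightarrow>
  (f y - f x) / complex_of_real (y - x) = (f z - f y) / complex_of_real (z - y)"
 shows "\<exists>p q. \<forall>x\<in>C. f x = p * complex_of_real x + q"
proof (cases "\<exists>u v. u \<in> C \<and> v \<in> C \<and> u < v")
 case False
 then have "x = y" if "x \<in> C" "y \<in> C" for x y using that by (meson linorder_neqE)
 then have "\<forall>x\<in>C. f x = 0 * complex_of_real x + f (SOME x. x \<in> C)" by (metis mult_zero_left add_0 someI)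
 then show ?thesis by blast
next
 case True
 then obtain u v where uv: "u \<in> C" "v \<in> C" "u < v" by blast
 define p where "p = (f v - f u) / complex_of_real (v - u)"
 have line: "f y - f x = p * complex_of_real (y - x)" if "(f y - f x) / complex_of_real (y - x) = p" "x < y" for x y
  using that by (simp add: field_simps)
 have mid: "f z - f x = s * complex_of_real (z - x)"
  if "(f y - f x) / complex_of_real (y - x) = s" "(f z - f y) / complex_of_real (z - y) = s" "x < y" "y < z" for x y z s
 proof -
  have "f y - f x = s * complex_of_real (y - x)" "f z - f y = s * complex_of_real (z - y)"
   using that by (auto simp: field_simps)
  then have "(f z - f y) + (f y - f x) = s * (complex_of_real (z - y) + complex_of_real (y - x))"
   by (simp only: distrib_left)
  then show ?thesis by simp
 qed
 have "f x - f u = p * complex_of_real (x - u)" if x: "x \<in> C" for x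
 proof -
  consider "x < u" | "x = u" | "u < x" "x < v" | "x = v" | "v < x" by linarith
  then show ?thesis
  proof cases
   case 1
   then have "f u - f x = p * complex_of_real (u - x)"
    using slopes[of x v u] x uv by (intro line) (auto simp: p_def)
   then have "- (f u - f x) = - (p * complex_of_real (u - x))" by simp
   then show ?thesis by (simp add: algebra_simps)
  next
   case 3
   define s where "s = (f x - f u) / complex_of_real (x - u)"
   have s: "(f v - f x) / complex_of_real (v - x) = s" using slopes[of u v x] 3 uv by (simp add: s_def)
   have "f v - f u = s * complex_of_real (v - u)" by (rule mid[OF _ s]) (use 3 in \<open>auto simp: s_def\<close>)
   then have "s = p" using uv by (simp add: p_def)
   then show ?thesis using 3 by (auto simp: s_def field_simps)
  next
   case 4
   then show ?thesis using uv by (simp add: p_def)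
  next
   case 5
   have "(f x - f v) / complex_of_real (x - v) = p" using slopes[of u x v] 5 x uv by (simp add: p_def)
   then show ?thesis by (intro mid[of v u p x]) (use 5 uv in \<open>auto simp: p_def\<close>)
  qed simp
 qed
 then have "f x = p * complex_of_real x + (f u - p * complex_of_real u)" if "x \<in> C" for x
  using that by (simp add: algebra_simps)
 then show ?thesis by blast
qed

section \<open>Support of the measure and orthogonal decomposition of derivatives\<close>

locale edge = scalars +
 fixes a b :: real and M :: "real measure"
 assumes ab: "a < b" and finite_M: "finite_measure M"
  and sets_M: "sets M = sets (restrict_space borel {a..b})"
  and ends_spt: "{a, b} \<subseteq> spt M" and ends_null: "emeasure M {a, b} = 0"
begin

interpretation L: semi_hilbert "L2 K (leb a b)" "l2ip (leb a b)" by (rule L2_semi_hilbert)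
interpretation MM: semi_hilbert "L2 K M" "l2ip M" by (rule L2_semi_hilbert)

lemma space_M: "space M = {a..b}"
 using sets_eq_imp_space_eq[OF sets_M] by (simp add: space_restrict_space)

lemma spt_sub: "spt M \<subseteq> {a..b}" by (auto simp: spt_def space_M)

lemma a_spt: "a \<in> spt M" and b_spt: "b \<in> spt M" using ends_spt by auto

lemma in_sets: "A \<in> sets borel \<Longrightarrow> A \<inter> {a..b} \<in> sets M"
 unfolding sets_M by (auto simp: sets_restrict_space)

text \<open>The complement of the support is a union of null open sets; by the Lindelof property
  countably many of them suffice, so it is null.\<close>

lemma AE_spt: "AE x in M. x \<in> spt M"
proof -
 define F where "F = {U :: real set. open U \<and> emeasure M (U \<inter> {a..b}) = 0}"
 obtain F' where F': "F' \<subseteq> F" "countable F'" "\<Union> F' = \<Union> F"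
  using Lindelof[of F] by (auto simp: F_def)
 have "(\<Union>U\<in>F'. U \<inter> {a..b}) \<in> null_sets M"
 proof (rule null_sets_UN')
  show "countable F'" by (rule F'(2))
  fix U assume "U \<in> F'"
  then show "U \<inter> {a..b} \<in> null_sets M" using F'(1) in_sets[of U] by (auto simp: F_def null_sets_def)
 qed
 moreover have "{x \<in> space M. x \<notin> spt M} \<subseteq> (\<Union>U\<in>F'. U \<inter> {a..b})"
 proof
  fix x assume x: "x \<in> {x \<in> space M. x \<notin> spt M}"
  then obtain U where "open U" "x \<in> U" "emeasure M (U \<inter> {a..b}) = 0" by (auto simp: spt_def space_M)
  then have "x \<in> \<Union> F" by (auto simp: F_def)
  then show "x \<in> (\<Union>U\<in>F'. U \<inter> {a..b})" using F'(3) x by (auto simp: space_M)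
 qed
 ultimately show ?thesis by (rule AE_I')
qed

lemma closed_spt: "closed (spt M)"
proof -
 have "\<exists>T. open T \<and> x \<in> T \<and> T \<subseteq> - spt M" if x: "x \<in> - spt M" for x
 proof (cases "x \<in> {a..b}")
   case True
   then obtain U where U: "open U" "x \<in> U" "emeasure M (U \<inter> space M) = 0" using x by (auto simp: spt_def space_M)
   then have "U \<subseteq> - spt M" by (auto simp: spt_def)
   then show ?thesis using U by blast
  next
   case False
   then show ?thesis using spt_sub by (intro exI[of _ "- {a..b}"]) auto
 qed
 then have "open (- spt M)" by (subst open_subopen) blast
 then show ?thesis by (simp add: closed_def)
qed

lemma eq_on_spt:
 fixes f g :: "real \<Rightarrow> complex"
 assumes "continuous_on {a..b} f" "continuous_on {a..b} g" "AE x in M. f x = g x" "x \<in> spt M"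
 shows "f x = g x"
proof (rule ccontr)
 assume ne: "f x \<noteq> g x"
 have x: "x \<in> {a..b}" using assms(4) spt_sub by blast
 have c: "continuous_on {a..b} (\<lambda>y. f y - g y)" using assms by (intro continuous_on_diff)
 obtain U where U: "open U" "U \<inter> {a..b} = (\<lambda>y. f y - g y) -` (- {0}) \<inter> {a..b}"
  using continuous_on_open_invariant[THEN iffD1, OF c] by (metis open_Compl closed_singleton)
 have "U \<inter> {a..b} \<in> null_sets M"
 proof -
  have "AE y in M. y \<notin> U \<inter> {a..b}" using assms(3) by eventually_elim (use U(2) in auto)
  then show ?thesis using in_sets[of U] U(1) by (subst AE_iff_null_sets) auto
 qed
 moreover have "x \<in> U" using U(2) x ne by auto
 ultimately show False using assms(4) U(1) by (auto simp: spt_def space_M)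
qed

text \<open>Derivatives of Sobolev functions that vanish on the support. Since \<open>a\<close> lies
  in the support, such functions are the primitives starting at 0, and they are exactly the freedom
  left in a continuous representative of a given class.\<close>

definition Z :: "(real \<Rightarrow> complex) set" where
 "Z = {h \<in> L2 K (leb a b). \<forall>x\<in>spt M. primit a b h x = 0}"

lemma Z_L2: "h \<in> Z \<Longrightarrow> h \<in> L2 K (leb a b)" by (simp add: Z_def)

lemma Z_mult: "h \<in> Z \<Longrightarrow> c \<in> K \<Longrightarrow> (\<lambda>x. c * h x) \<in> Z"
 by (auto simp: Z_def L2_mult primit_scale)

lemma Z_subspace: "subspace Z"
 unfolding subspace_def
proof (intro conjI ballI allI)
 show "0 \<in> Z" by (simp add: Z_def zero_fun_def L2_zero primit_zero)
 show "x + y \<in> Z" if "x \<in> Z" "y \<in> Z" for x y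
  using that L2_add primit_add[of x a b y 1] by (auto simp: Z_def plus_fun_def)
 show "r *\<^sub>R x \<in> Z" if "x \<in> Z" for r x
  using Z_mult[OF that, of "complex_of_real r"] by (simp add: scaleR_fun_def scaleR_conv_of_real)
qed

definition orth :: "(real \<Rightarrow> complex) \<Rightarrow> bool" where
 "orth h \<longleftrightarrow> h \<in> L2 K (leb a b) \<and> (\<forall>z\<in>Z. l2ip (leb a b) h z = 0)"

lemma orth_L2: "orth h \<Longrightarrow> h \<in> L2 K (leb a b)" by (simp add: orth_def)

lemma orth_Z: "orth h \<Longrightarrow> z \<in> Z \<Longrightarrow> l2ip (leb a b) h z = 0" by (simp add: orth_def)

text \<open>\<open>Z\<close> is closed, because point evaluations of primitives are continuous in
  the \<open>L2\<close>-norm of the derivative; so the limit delivered by the projection lies in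
  \<open>Z\<close> itself.\<close>

lemma orth_decomposition:
 assumes g: "g \<in> L2 K (leb a b)" shows "\<exists>h. orth h \<and> g - h \<in> Z"
proof -
 obtain w y where w: "\<And>n. w n \<in> Z" "y \<in> L2 K (leb a b)" "(\<lambda>n. L.nrm (w n - y)) \<longlonglongrightarrow> 0"
   "\<And>z. z \<in> Z \<Longrightarrow> l2ip (leb a b) (g - y) z = 0"
  using L.projection[OF Z_subspace _ g] Z_L2 by blast
 have "primit a b y x = 0" if x: "x \<in> spt M" for x
  using tendsto_primit[OF w(3) Z_L2[OF w(1)] w(2), of x] w(1) x by (simp add: Z_def LIMSEQ_const_iff)
 then have "y \<in> Z" using w(2) by (simp add: Z_def)
 moreover have "orth (g - y)" using g w by (simp add: orth_def)
 ultimately show ?thesis by (intro exI[of _ "g - y"]) simp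
qed

text \<open>The test function is the derivative of a tent over \<open>[x, z]\<close> with its tip at
  \<open>y\<close>. The tent lives in a gap of the support, so its derivative belongs to
  \<open>Z\<close>, and orthogonality compares the mean values of \<open>h\<close> on both sides of
  \<open>y\<close>.\<close>

lemma orth_slopes:
 assumes h: "orth h" and x: "a \<le> x" "x < y" "y < z" "z \<le> b" and gap: "{x..z} \<inter> spt M = {}"
 shows "(primit a b h y - primit a b h x) / complex_of_real (y - x) = (primit a b h z - primit a b h y) / complex_of_real (z - y)"
proof -
 note hL = orth_L2[OF h]
 define A B where "A = primit a b h y - primit a b h x" and "B = primit a b h z - primit a b h y"
 \<comment> \<open>\<open>c\<close> is the difference of the two slopes. The heights
   \<open>s\<close> and \<open>t\<close> below make the integral of the test function vanish and
   turn the pairing into \<open>(cmod c)^2\<close>.\<close>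
 define c where "c = complex_of_real (1 / (y - x)) * A - complex_of_real (1 / (z - y)) * B"
 have "A \<in> K" "B \<in> K" unfolding A_def B_def by (intro K_closed_ops(5) primit_K hL)+
 then have cK: "c \<in> K" unfolding c_def by (intro K_closed_ops(5,6,3))
 define s t where "s = c * complex_of_real (1 / (y - x))" and "t = - (c * complex_of_real (1 / (z - y)))"
 have st: "s \<in> K" "t \<in> K" unfolding s_def t_def by (intro K_closed_ops(6,8,3) cK)+
 let ?u = "\<lambda>v. s * indicator {x<..y} v" and ?w = "\<lambda>v. t * indicator {y<..z} v"
 have u: "?u \<in> L2 K (leb a b)" "?w \<in> L2 K (leb a b)" by (intro L2_mult indicator_L2 st; simp)+
 have "?u + ?w \<in> Z"
  unfolding Z_def
 proof (intro CollectI conjI ballI)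
  show "?u + ?w \<in> L2 K (leb a b)" using u by (rule L.mem(2))
  fix v assume v: "v \<in> spt M"
  have "primit a b (?u + ?w) v = s * primit a b (indicator {x<..y}) v + t * primit a b (indicator {y<..z}) v"
   using primit_add[OF indicator_L2 u(2), of "{x<..y}" s v] primit_scale[OF indicator_L2, of "{y<..z}" a b t v]
   by (simp add: plus_fun_def)
  also have "\<dots> = 0"
  proof (cases "v < x")
   case True
   then show ?thesis using primit_indicator(1)[of a x y b v] primit_indicator(1)[of a y z b v] x by simp
  next
   case False
   then have "v > z" using gap v by (metis atLeastAtMost_iff disjoint_iff not_less)
   then show ?thesis using primit_indicator(2)[of a x y b v] primit_indicator(2)[of a y z b v] x
    by (simp add: s_def t_def)
  qed
  finally show "primit a b (?u + ?w) v = 0" .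
 qed
 then have "0 = l2ip (leb a b) h (?u + ?w)" using orth_Z[OF h] by simp
 also have "\<dots> = l2ip (leb a b) h ?u + l2ip (leb a b) h ?w" by (rule L.ip_add_right[OF u hL])
 also have "\<dots> = Re (cnj s * A) + Re (cnj t * B)"
  unfolding A_def B_def using x by (simp only: l2ip_indicator[OF hL] less_imp_le)
 also have "\<dots> = Re (cnj s * A + cnj t * B)" by simp
 also have "cnj s * A + cnj t * B = cnj c * c"
 proof -
  have "cnj s = cnj c * complex_of_real (1 / (y - x))" "cnj t = - (cnj c * complex_of_real (1 / (z - y)))"
   unfolding s_def t_def by (simp_all only: complex_cnj_mult complex_cnj_minus complex_cnj_complex_of_real)
  then have "cnj s * A + cnj t * B = cnj c * (complex_of_real (1 / (y - x)) * A) - cnj c * (complex_of_real (1 / (z - y)) * B)"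
   by (simp only: mult.assoc minus_mult_left[symmetric] diff_conv_add_uminus[symmetric])
  also have "\<dots> = cnj c * c" unfolding right_diff_distrib[symmetric] by (simp only: c_def)
  finally show ?thesis .
 qed
 also have "Re (cnj c * c) = (cmod c)\<^sup>2" unfolding cmod_power2 by (simp add: power2_eq_square)
 finally have "c = 0" by simp
 then show ?thesis by (simp add: c_def A_def B_def)
qed

lemma Cont_L2_M: assumes "f \<in> Cont K a b" shows "f \<in> L2 K M"
proof -
 have c: "continuous_on {a..b} f" using assms by (simp add: Cont_def)
 obtain B where B: "\<And>x. x \<in> {a..b} \<Longrightarrow> norm (f x) \<le> B" using bounded_continuous_fun[OF c] by blast
 show ?thesis
 proof (rule L2_bounded[OF finite_M])
  show "f \<in> borel_measurable M"
   unfolding measurable_cong_sets[OF sets_M refl] by (rule borel_measurable_continuous_on_restrict[OF c])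
  show "f x \<in> K" "cmod (f x) \<le> B" if "x \<in> space M" for x using that assms B[of x] by (auto simp: Cont_def space_M)
 qed
qed

lemma orth_W12_mu:
 assumes h: "orth h" and G: "is_prim a b h G" and Ga: "G a \<in> K"
 shows "G \<in> W12_mu K a b M"
proof -
 note hL = orth_L2[OF h]
 have "G \<in> W12 K a b \<inter> Cont K a b" unfolding W12_Cont_iff[OF ab] using Ga G hL by blast
 moreover have "\<exists>p q. \<forall>x\<in>C. G x = p * complex_of_real x + q" if C: "C \<in> components ({a..b} - spt M)" for C
 proof (rule affine_if_slopes)
  fix x y z assume xz: "x \<in> C" "z \<in> C" "x < y" "y < z"
  have CS: "C \<subseteq> {a..b} - spt M" by (rule in_components_subset[OF C])
  have "{x..z} \<subseteq> C" by (rule connected_contains_Icc[OF in_components_connected[OF C] xz(1,2)])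
  then have gap: "{x..z} \<inter> spt M = {}" using CS by blast
  have "x \<in> {a..b}" "z \<in> {a..b}" using xz(1,2) CS by blast+
  then have r: "a \<le> x" "z \<le> b" by simp_all
  then have "x \<in> {a..b}" "y \<in> {a..b}" "z \<in> {a..b}" using xz(3,4) by auto
  note r = r this
  show "(G y - G x) / complex_of_real (y - x) = (G z - G y) / complex_of_real (z - y)"
   using orth_slopes[OF h r(1) xz(3,4) r(2) gap(1)] is_primD[OF G r(3)] is_primD[OF G r(4)] is_primD[OF G r(5)] by simp
 qed
 ultimately show ?thesis by (auto simp: W12_mu_def Cont_mu_def)
qed

text \<open>Between the nearest points \<open>c\<close> and \<open>d\<close> of the support on
  either side of \<open>x\<close>, the difference is affine; it vanishes at both ends and therefore
  at \<open>x\<close>.\<close>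

lemma Cont_mu_unique:
 assumes f: "f \<in> Cont_mu K a b M" and g: "g \<in> Cont_mu K a b M" and eq: "\<And>x. x \<in> spt M \<Longrightarrow> f x = g x"
  and x: "x \<in> {a..b}"
 shows "f x = g x"
proof (cases "x \<in> spt M")
 case False
 define D where "D y = f y - g y" for y
 have Dc: "continuous_on {a..b} D"
  unfolding D_def using f g by (intro continuous_on_diff) (auto simp: Cont_mu_def Cont_def)
 define c where "c = Sup (spt M \<inter> {a..x})"
 define d where "d = Inf (spt M \<inter> {x..b})"
 have c: "c \<in> spt M \<inter> {a..x}"
  unfolding c_def by (rule closed_contains_Sup) (use a_spt x closed_spt in \<open>auto intro!: bdd_above_Int2\<close>)
 have d: "d \<in> spt M \<inter> {x..b}"
  unfolding d_def by (rule closed_contains_Inf) (use b_spt x closed_spt in \<open>auto intro!: bdd_below_Int2\<close>)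
 have cd: "c < x" "x < d" using c d False by (auto simp: order.order_iff_strict)
 have gap: "y \<notin> spt M" if y: "y \<in> {c<..<d}" for y
 proof
  assume s: "y \<in> spt M"
  show False
  proof (cases "y \<le> x")
   case True
   then have "y \<le> c" unfolding c_def using s spt_sub by (intro cSup_upper bdd_above_Int2) auto
   then show False using y by simp
  next
   case False
   then have "d \<le> y" unfolding d_def using s spt_sub by (intro cInf_lower bdd_below_Int2) auto
   then show False using y by simp
  qed
 qed
 have sub: "{c<..<d} \<subseteq> {a..b} - spt M" using gap c d by auto
 define C where "C = connected_component_set ({a..b} - spt M) x"
 have C: "C \<in> components ({a..b} - spt M)" unfolding C_def components_def using x False by blast
 have cdC: "{c<..<d} \<subseteq> C" unfolding C_def by (rule connected_component_maximal) (use cd sub in auto)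
 obtain p q where pq: "\<And>y. y \<in> C \<Longrightarrow> f y = p * complex_of_real y + q" using f C unfolding Cont_mu_def by blast
 obtain p' q' where pq': "\<And>y. y \<in> C \<Longrightarrow> g y = p' * complex_of_real y + q'" using g C unfolding Cont_mu_def by blast
 have aff: "D y = (p - p') * complex_of_real y + (q - q')" if y: "y \<in> {c..d}" for y
 proof -
  have "continuous_on {c..d} (\<lambda>y. D y - ((p - p') * complex_of_real y + (q - q')))"
   using c d by (intro continuous_intros continuous_on_subset[OF Dc]) auto
  moreover have "D y - ((p - p') * complex_of_real y + (q - q')) = 0" if "y \<in> {c<..<d}" for y
   using pq[of y] pq'[of y] that cdC by (auto simp: D_def algebra_simps)
  ultimately have "D y - ((p - p') * complex_of_real y + (q - q')) = 0"
   using continuous_constant_on_closure[of "{c<..<d}" "\<lambda>y. D y - ((p - p') * complex_of_real y + (q - q'))" 0 y] cd y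
   by (simp only: closure_greaterThanLessThan)
  then show ?thesis by simp
 qed
 have "D c = 0" "D d = 0" using eq c d by (auto simp: D_def)
 then have 0: "(p - p') * complex_of_real c + (q - q') = 0" "(p - p') * complex_of_real d + (q - q') = 0"
  using aff[of c] aff[of d] cd by auto
 then have "(p - p') * complex_of_real d - (p - p') * complex_of_real c = 0" by (metis add_diff_cancel_right diff_0_right diff_self)
 then have "(p - p') * complex_of_real (d - c) = 0" by (simp add: right_diff_distrib)
 then have "p - p' = 0" using cd by simp
 then have "D x = 0" using aff[of x] 0 cd by simp
 then show ?thesis by (simp add: D_def)
qed (use eq in simp)

abbreviation "iotae \<equiv> iota_edge K a b M"
abbreviation "De f \<equiv> weak_deriv K a b (iota_edge K a b M f)"
abbreviation "dome \<equiv> dom_iota_edge K a b M"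

text \<open>Every continuous Sobolev function representing \<open>f\<close> determines \<open>iotae f\<close>: its derivative is the
 projection onto the orthogonal complement of \<open>Z\<close>.\<close>

lemma iota_eqI:
 assumes f: "f \<in> L2 K M" and g: "g \<in> L2 K (leb a b)" and G: "is_prim a b g G" and Ga: "G a \<in> K"
  and ae: "AE x in M. G x = f x"
 shows "f \<in> dome" "x \<in> spt M \<Longrightarrow> iotae f x = G x" "g - De f \<in> Z" "De f \<in> L2 K (leb a b)" "orth (De f)"
  "is_prim a b (De f) (iotae f)" "iotae f a \<in> K" "AE x in M. iotae f x = f x"
proof -
 have GW: "G \<in> W12 K a b \<inter> Cont K a b" unfolding W12_Cont_iff[OF ab] using Ga G g by blast
 then show "f \<in> dome" using f ae by (auto simp: dom_iota_edge_def)
 obtain h where h: "orth h" "g - h \<in> Z" using orth_decomposition[OF g] by blast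
 note hL = orth_L2[OF h(1)]
 \<comment> \<open>Only the part of \<open>g\<close> orthogonal to \<open>Z\<close> is kept. The
   discarded part has a primitive vanishing on the support, so \<open>G'\<close> represents the same
   class, and orthogonality makes it affine on the gaps.\<close>
 define G' where "G' x = G a + primit a b h x" for x
 have G'a: "G' a = G a" by (simp add: G'_def primit_a)
 have G': "is_prim a b h G'" by (simp add: is_prim_def G'_def primit_a)
 have G'_spt: "G' x = G x" if x: "x \<in> spt M" for x
 proof -
  have "primit a b (g - h) x = 0" using h(2) x by (simp add: Z_def)
  then have "primit a b g x = primit a b h x" using primit_minus[OF g hL, of x] by simp
  moreover have "G x = G a + primit a b g x" using is_primD[OF G] x spt_sub by blast
  ultimately show ?thesis by (simp only: G'_def)
 qed
 have "AE x in M. G' x = f x" using AE_spt ae by eventually_elim (use G'_spt in auto)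
 then have ex: "\<exists>g. g \<in> W12_mu K a b M \<and> (AE x in M. g x = f x)"
  using orth_W12_mu[OF h(1) G'] Ga G'a by auto
 from someI_ex[OF this] have i: "iotae f \<in> W12_mu K a b M" "AE x in M. iotae f x = f x"
  unfolding iota_edge_def by blast+
 show "AE x in M. iotae f x = f x" by (rule i(2))
 have ic: "iotae f \<in> Cont K a b" using i(1) by (simp add: W12_mu_def W12_def Cont_mu_def)
 have i_spt: "iotae f x = G x" if x: "x \<in> spt M" for x
 proof (rule eq_on_spt[OF _ _ _ x])
  show "continuous_on {a..b} (iotae f)" "continuous_on {a..b} G" using ic GW by (auto simp: Cont_def)
  show "AE x in M. iotae f x = G x" using i(2) ae by eventually_elim simp
 qed
 then show "x \<in> spt M \<Longrightarrow> iotae f x = G x" .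
 have eq: "iotae f x = G' x" if "x \<in> {a..b}" for x
 proof (rule Cont_mu_unique[OF _ _ _ that])
  show "iotae f \<in> Cont_mu K a b M" "G' \<in> Cont_mu K a b M"
   using i(1) orth_W12_mu[OF h(1) G'] Ga G'a by (auto simp: W12_mu_def)
  show "iotae f x = G' x" if "x \<in> spt M" for x using i_spt[OF that] G'_spt[OF that] by simp
 qed
 have ip: "is_prim a b h (iotae f)"
  unfolding is_prim_def
 proof
  fix x assume x: "x \<in> {a..b}"
  have "iotae f x = G' a + primit a b h x" unfolding eq[OF x] by (rule is_primD[OF G' x])
  also have "G' a = iotae f a" using eq[of a] ab by simp
  finally show "iotae f x = iotae f a + primit a b h x" .
 qed
 note wd = weak_deriv_prim[OF ab hL ip]
 show DL: "De f \<in> L2 K (leb a b)" by (rule wd(1))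
 have nul: "L.nrm (De f - h) = 0" using L2_nrm_cong[OF wd(1) hL] wd(2) by simp
 show "orth (De f)" unfolding orth_def
 proof (intro conjI ballI DL)
  fix z assume z: "z \<in> Z"
  show "l2ip (leb a b) (De f) z = 0" using L.ip_cong[OF DL hL Z_L2[OF z] nul] orth_Z[OF h(1) z] by simp
 qed
 have pc: "primit a b (De f) x = primit a b h x" for x by (rule primit_cong_AE[OF DL hL wd(2)])
 show "is_prim a b (De f) (iotae f)" unfolding is_prim_def pc using ip unfolding is_prim_def .
 show "iotae f a \<in> K" using ic ab by (simp add: Cont_def)
 have "primit a b (g - De f) x = primit a b (g - h) x" for x
  using primit_minus[OF g DL] primit_minus[OF g hL] pc by simp
 then show "g - De f \<in> Z" using h(2) L.mem(3)[OF g DL] by (simp add: Z_def)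
qed

lemma dome_ex:
 assumes "f \<in> dome" shows "\<exists>g G. f \<in> L2 K M \<and> g \<in> L2 K (leb a b) \<and> is_prim a b g G \<and> G a \<in> K \<and> (AE x in M. G x = f x)"
proof -
 obtain G where G: "f \<in> L2 K M" "G \<in> W12 K a b \<inter> Cont K a b" "AE x in M. G x = f x"
  using assms by (auto simp: dom_iota_edge_def)
 then show ?thesis using W12_Cont_iff[OF ab, of G] by blast
qed

lemma dome_D:
 assumes "f \<in> dome"
 shows "f \<in> L2 K M" "De f \<in> L2 K (leb a b)" "orth (De f)" "is_prim a b (De f) (iotae f)" "iotae f a \<in> K"
  "AE x in M. iotae f x = f x"
proof -
 obtain g G where g: "f \<in> L2 K M" "g \<in> L2 K (leb a b)" "is_prim a b g G" "G a \<in> K" "AE x in M. G x = f x"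
  using dome_ex[OF assms] by blast
 show "f \<in> L2 K M" "De f \<in> L2 K (leb a b)" "orth (De f)" "is_prim a b (De f) (iotae f)" "iotae f a \<in> K"
  "AE x in M. iotae f x = f x"
  using g(1) iota_eqI[OF g] by blast+
qed

text \<open>A derivative that is already orthogonal needs no projection: its difference from
  \<open>De f\<close> lies in \<open>Z\<close> and is orthogonal to \<open>Z\<close>.\<close>

lemma iota_eqI_orth:
 assumes f: "f \<in> L2 K M" and g: "orth g" and G: "is_prim a b g G" and Ga: "G a \<in> K"
  and ae: "AE x in M. G x = f x"
 shows "L.nrm (De f - g) = 0"
proof -
 note i = iota_eqI[OF f orth_L2[OF g] G Ga ae]
 have z: "g - De f \<in> Z" "g - De f \<in> L2 K (leb a b)" using i(3) Z_L2 by auto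
 have "l2ip (leb a b) (g - De f) (g - De f) = 0"
  using L.ip_diff[OF orth_L2[OF g] i(4) z(2)] orth_Z[OF g z(1)] orth_Z[OF i(5) z(1)] by simp
 then have "L.nrm (g - De f) = 0" by (simp add: L.nrm_def)
 then show ?thesis using L.nrm_diff_commute[OF orth_L2[OF g] i(4)] by simp
qed

end

section \<open>Linearity of the representative, trace inequality and closedness on an edge\<close>

context edge
begin

interpretation L: semi_hilbert "L2 K (leb a b)" "l2ip (leb a b)" by (rule L2_semi_hilbert)
interpretation MM: semi_hilbert "L2 K M" "l2ip M" by (rule L2_semi_hilbert)

lemma is_prim_linear:
 assumes "g \<in> L2 K (leb a b)" "h \<in> L2 K (leb a b)" "is_prim a b g G" "is_prim a b h F"
 shows "is_prim a b (\<lambda>x. c * g x + h x) (\<lambda>x. c * G x + F x)"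
 unfolding is_prim_def
proof
 fix x assume x: "x \<in> {a..b}"
 show "c * G x + F x = c * G a + F a + primit a b (\<lambda>x. c * g x + h x) x"
  unfolding primit_add[OF assms(1,2)] is_primD[OF assms(3) x] is_primD[OF assms(4) x] distrib_left
  by (simp only: add_ac)
qed

lemma is_prim_diff:
 assumes "g \<in> L2 K (leb a b)" "h \<in> L2 K (leb a b)" "is_prim a b g G" "is_prim a b h F"
 shows "is_prim a b (g - h) (\<lambda>x. G x - F x)"
 using is_prim_linear[OF assms(2,1,4,3), of "- 1"] by (simp add: fun_diff_def)

text \<open>Orthogonality refers to the real part of the scalar product; a scalar \<open>c\<close>
  is moved to the other side as \<open>cnj c\<close>, which is harmless because \<open>Z\<close> is
  invariant under multiplication by \<open>K\<close>.\<close>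

lemma orth_linear:
 assumes "orth g" "orth h" "c \<in> K" shows "orth (\<lambda>x. c * g x + h x)"
 unfolding orth_def
proof (intro conjI ballI)
 note gL = orth_L2[OF assms(1)] and hL = orth_L2[OF assms(2)]
 show "(\<lambda>x. c * g x + h x) \<in> L2 K (leb a b)" by (intro L2_add L2_mult gL hL assms)
 fix z assume z: "z \<in> Z"
 have cz: "(\<lambda>x. cnj c * z x) \<in> Z" using assms z by (intro Z_mult) auto
 have "l2ip (leb a b) (\<lambda>x. c * g x) z = l2ip (leb a b) g (\<lambda>x. cnj c * z x)"
  by (simp add: l2ip_def mult_ac)
 also have "\<dots> = 0" by (rule orth_Z[OF assms(1) cz])
 finally show "l2ip (leb a b) (\<lambda>x. c * g x + h x) z = 0"
  using L.ip_add[OF L2_mult[OF gL assms(3)] hL Z_L2[OF z]] orth_Z[OF assms(2) z] by (simp add: plus_fun_def)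
qed

lemma iota_linear:
 assumes f: "f \<in> dome" and g: "g \<in> dome" and c: "c \<in> K"
 shows "(\<lambda>x. c * f x + g x) \<in> dome"
  "L.nrm (De (\<lambda>x. c * f x + g x) - (\<lambda>x. c * De f x + De g x)) = 0"
  "x \<in> spt M \<Longrightarrow> iotae (\<lambda>x. c * f x + g x) x = c * iotae f x + iotae g x"
proof -
 note F = dome_D[OF f] and G = dome_D[OF g]
 have 1: "(\<lambda>x. c * f x + g x) \<in> L2 K M" by (intro L2_add L2_mult F G c)
 have 2: "orth (\<lambda>x. c * De f x + De g x)" by (rule orth_linear[OF F(3) G(3) c])
 have 3: "is_prim a b (\<lambda>x. c * De f x + De g x) (\<lambda>x. c * iotae f x + iotae g x)"
  by (rule is_prim_linear[OF F(2) G(2) F(4) G(4)])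
 have 4: "c * iotae f a + iotae g a \<in> K" by (intro K_closed_ops F(5) G(5) c)
 have 5: "AE x in M. c * iotae f x + iotae g x = c * f x + g x" using F(6) G(6) by eventually_elim simp
 show "(\<lambda>x. c * f x + g x) \<in> dome" by (rule iota_eqI(1)[OF 1 orth_L2[OF 2] 3 4 5])
 show "L.nrm (De (\<lambda>x. c * f x + g x) - (\<lambda>x. c * De f x + De g x)) = 0" by (rule iota_eqI_orth[OF 1 2 3 4 5])
 show "x \<in> spt M \<Longrightarrow> iotae (\<lambda>x. c * f x + g x) x = c * iotae f x + iotae g x"
  by (rule iota_eqI(2)[OF 1 orth_L2[OF 2] 3 4 5])
qed

lemma iota_cong:
 assumes f: "f \<in> dome" and g: "g \<in> L2 K M" and ae: "AE x in M. g x = f x"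
 shows "g \<in> dome" "L.nrm (De g - De f) = 0" "x \<in> spt M \<Longrightarrow> iotae g x = iotae f x"
proof -
 note F = dome_D[OF f]
 have 5: "AE x in M. iotae f x = g x" using F(6) ae by eventually_elim simp
 show "g \<in> dome" by (rule iota_eqI(1)[OF g F(2) F(4) F(5) 5])
 show "L.nrm (De g - De f) = 0" by (rule iota_eqI_orth[OF g F(3) F(4) F(5) 5])
 show "x \<in> spt M \<Longrightarrow> iotae g x = iotae f x" by (rule iota_eqI(2)[OF g F(2) F(4) F(5) 5])
qed

lemma zero_dome: "(\<lambda>_. 0) \<in> dome" "L.nrm (De (\<lambda>_. 0)) = 0" "x \<in> spt M \<Longrightarrow> iotae (\<lambda>_. 0) x = 0"
proof -
 have 1: "orth (\<lambda>_. 0)" by (auto simp: orth_def L2_zero l2ip_def)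
 have 2: "is_prim a b (\<lambda>_. 0) (\<lambda>_. 0)" by (simp add: is_prim_def primit_zero)
 have 3: "AE x in M. (0::complex) = 0" by simp
 note i = iota_eqI[OF L2_zero orth_L2[OF 1] 2 K_closed_ops(1) 3]
 show "(\<lambda>_. 0) \<in> dome" by (rule i(1))
 show "x \<in> spt M \<Longrightarrow> iotae (\<lambda>_. 0) x = 0" by (rule i(2))
 show "L.nrm (De (\<lambda>_. 0)) = 0"
  using L.nrm_cong[OF i(4) orth_L2[OF 1] iota_eqI_orth[OF L2_zero 1 2 K_closed_ops(1) 3]]
  by (simp add: L.nrm_def l2ip_def)
qed

lemma is_prim_L2_M: "g \<in> L2 K (leb a b) \<Longrightarrow> is_prim a b g G \<Longrightarrow> G a \<in> K \<Longrightarrow> G \<in> L2 K M"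
 by (intro Cont_L2_M is_prim_Cont)

text \<open>Near \<open>p\<close> the function changes by at most a square root of the distance
  times the energy norm of its derivative. Averaging over a neighbourhood of radius
  \<open>\<epsilon> / 2\<close>, which has positive measure because \<open>p\<close> is in the
  support, bounds the point value. The constant is \<open>2 / m\<close>, with \<open>m\<close> that
  measure.\<close>

lemma trace_inequality:
 assumes p: "p \<in> spt M" and \<epsilon>: "\<epsilon> > 0"
 shows "\<exists>C\<ge>0. \<forall>g G. g \<in> L2 K (leb a b) \<longrightarrow> is_prim a b g G \<longrightarrow> G a \<in> K \<longrightarrow>
  (cmod (G p))\<^sup>2 \<le> \<epsilon> * (L.nrm g)\<^sup>2 + C * (MM.nrm G)\<^sup>2"
proof -
 define \<delta> where "\<delta> = \<epsilon> / 2"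
 have \<delta>: "\<delta> > 0" using \<epsilon> by (simp add: \<delta>_def)
 define I where "I = {p - \<delta><..<p + \<delta>} \<inter> {a..b}"
 have pI: "p \<in> {a..b}" using p spt_sub by blast
 have Is: "I \<in> sets M" unfolding I_def by (rule in_sets) simp
 interpret fM: finite_measure M by (rule finite_M)
 define m where "m = measure M I"
 have "emeasure M I \<noteq> 0" using p \<delta> unfolding spt_def I_def space_M by simp
 then have m: "m > 0" unfolding m_def by (simp add: fM.emeasure_eq_measure zero_less_measure_iff)
 have "(cmod (G p))\<^sup>2 \<le> \<epsilon> * (L.nrm g)\<^sup>2 + 2 / m * (MM.nrm G)\<^sup>2"
  if g: "g \<in> L2 K (leb a b)" and G: "is_prim a b g G" and Ga: "G a \<in> K" for g G
 proof -
  have GM: "G \<in> L2 K M" by (rule is_prim_L2_M[OF g G Ga])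
  have near: "(cmod (G p))\<^sup>2 \<le> 2 * (cmod (G x))\<^sup>2 + \<epsilon> * (L.nrm g)\<^sup>2" if x: "x \<in> I" for x
  proof -
   have xr: "x \<in> {a..b}" "\<bar>p - x\<bar> \<le> \<delta>" using x by (auto simp: I_def)
   have eq: "G p - G x = primit a b g p - primit a b g x"
    using is_primD[OF G pI] is_primD[OF G xr(1)] by simp
   have "cmod (G p - G x) \<le> L.nrm g * sqrt \<bar>p - x\<bar>" unfolding eq by (rule primit_dist_le[OF g])
   then have "(cmod (G p - G x))\<^sup>2 \<le> (L.nrm g * sqrt \<bar>p - x\<bar>)\<^sup>2" by (rule power_mono) simp
   also have "\<dots> = (L.nrm g)\<^sup>2 * \<bar>p - x\<bar>" by (simp add: power_mult_distrib)
   also have "\<dots> \<le> (L.nrm g)\<^sup>2 * \<delta>" by (rule mult_left_mono[OF xr(2)]) simp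
   finally have 1: "(cmod (G p - G x))\<^sup>2 \<le> (L.nrm g)\<^sup>2 * \<delta>" .
   have "(cmod (G p))\<^sup>2 \<le> 2 * (cmod (G x))\<^sup>2 + 2 * (cmod (G p - G x))\<^sup>2"
    using cmod_sq_add_le[of "G x" "G p - G x"] by simp
   also have "2 * (cmod (G p - G x))\<^sup>2 \<le> \<epsilon> * (L.nrm g)\<^sup>2" using 1 by (simp add: \<delta>_def mult.commute)
   finally show ?thesis by simp
  qed
  have "(LINT x|M. indicator I x * (cmod (G p))\<^sup>2) \<le> (LINT x|M. 2 * (cmod (G x))\<^sup>2 + indicator I x * (\<epsilon> * (L.nrm g)\<^sup>2))"
  proof (rule integral_mono)
   have ii: "integrable M (indicat_real I)" using Is by (simp add: fM.emeasure_eq_measure)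
   then show "integrable M (\<lambda>x. indicator I x * (cmod (G p))\<^sup>2)" by simp
   show "integrable M (\<lambda>x. 2 * (cmod (G x))\<^sup>2 + indicator I x * (\<epsilon> * (L.nrm g)\<^sup>2))"
    using ii L2_D(3)[OF GM] by simp
   fix x show "indicator I x * (cmod (G p))\<^sup>2 \<le> 2 * (cmod (G x))\<^sup>2 + indicator I x * (\<epsilon> * (L.nrm g)\<^sup>2)"
    using near[of x] by (cases "x \<in> I") auto
  qed
  also have "\<dots> = 2 * (MM.nrm G)\<^sup>2 + m * (\<epsilon> * (L.nrm g)\<^sup>2)"
  proof -
   have ii: "integrable M (indicat_real I)" using Is by (simp add: fM.emeasure_eq_measure)
   have "(LINT x|M. 2 * (cmod (G x))\<^sup>2 + indicator I x * (\<epsilon> * (L.nrm g)\<^sup>2))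
    = (LINT x|M. 2 * (cmod (G x))\<^sup>2) + (LINT x|M. indicator I x * (\<epsilon> * (L.nrm g)\<^sup>2))"
    using ii L2_D(3)[OF GM] by (intro Bochner_Integration.integral_add) auto
   then show ?thesis using sets.sets_into_space[OF Is] L2_nrm_sq[OF GM]
    by (simp add: m_def Int_absorb2)
  qed
  also have "(LINT x|M. indicator I x * (cmod (G p))\<^sup>2) = m * (cmod (G p))\<^sup>2"
   using sets.sets_into_space[OF Is] by (simp add: m_def Int_absorb2)
  finally show ?thesis using m by (simp add: field_simps)
 qed
 then show ?thesis using m by (intro exI[of _ "2 / m"]) auto
qed

text \<open>The trace inequality makes the values at \<open>a\<close> a Cauchy sequence; together
  with the limit \<open>g\<close> of the derivatives they determine a uniform limit
  \<open>G\<close>. It represents \<open>h\<close>, and \<open>g\<close> stays orthogonal to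
  \<open>Z\<close>, so \<open>g\<close> is the derivative belonging to \<open>h\<close>.\<close>

lemma edge_complete:
 assumes f: "\<And>n. f n \<in> dome" and h: "h \<in> L2 K M" "(\<lambda>n. MM.nrm (f n - h)) \<longlonglongrightarrow> 0"
  and cau: "L.cau (\<lambda>n. De (f n))"
 shows "h \<in> dome" "(\<lambda>n. L.nrm (De (f n) - De h)) \<longlonglongrightarrow> 0"
  "p \<in> spt M \<Longrightarrow> (\<lambda>n. iotae (f n) p) \<longlonglongrightarrow> iotae h p"
proof -
 note F = dome_D[OF f]
 obtain g where g: "g \<in> L2 K (leb a b)" "(\<lambda>n. L.nrm (De (f n) - g)) \<longlonglongrightarrow> 0"
  using L.complete[of "\<lambda>n. De (f n)"] F(2) cau by blast
 obtain C where C: "C \<ge> 0" "\<And>g G. g \<in> L2 K (leb a b) \<Longrightarrow> is_prim a b g G \<Longrightarrow> G a \<in> K \<Longrightarrow>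
  (cmod (G a))\<^sup>2 \<le> 1 * (L.nrm g)\<^sup>2 + C * (MM.nrm G)\<^sup>2"
  using trace_inequality[OF a_spt zero_less_one] by blast
 have diff_a: "cmod (iotae (f n) a - iotae (f m) a) \<le> L.nrm (De (f n) - De (f m)) + sqrt C * MM.nrm (f n - f m)" for n m
 proof -
  let ?G = "\<lambda>x. iotae (f n) x - iotae (f m) x"
  have G: "is_prim a b (De (f n) - De (f m)) ?G" by (rule is_prim_diff[OF F(2) F(2) F(4) F(4)])
  have Ga: "?G a \<in> K" by (intro K_closed_ops F(5))
  have gL: "De (f n) - De (f m) \<in> L2 K (leb a b)" by (rule L.mem(3)[OF F(2) F(2)])
  have GM: "?G \<in> L2 K M" by (rule is_prim_L2_M[OF gL G Ga])
  have fM: "f n - f m \<in> L2 K M" by (rule MM.mem(3)[OF F(1) F(1)])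
  have "AE x in M. ?G x = (f n - f m) x" using F(6)[of n] F(6)[of m] by eventually_elim simp
  then have "MM.nrm (?G - (f n - f m)) = 0" using L2_nrm_cong[OF GM fM] by blast
  then have nG: "MM.nrm ?G = MM.nrm (f n - f m)" by (rule MM.nrm_cong[OF GM fM])
  have nn: "0 \<le> L.nrm (De (f n) - De (f m))" "0 \<le> MM.nrm (f n - f m)" "0 \<le> sqrt C"
   using L.nrm_nonneg[OF gL] MM.nrm_nonneg[OF fM] C(1) by simp_all
  have "(cmod (?G a))\<^sup>2 \<le> (L.nrm (De (f n) - De (f m)))\<^sup>2 + (sqrt C * MM.nrm (f n - f m))\<^sup>2"
   using C(2)[OF gL G Ga] C(1) unfolding nG by (simp add: power_mult_distrib)
  also have "\<dots> \<le> (L.nrm (De (f n) - De (f m)) + sqrt C * MM.nrm (f n - f m))\<^sup>2"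
   using nn by (simp add: power2_sum)
  finally show ?thesis using nn by (intro power2_le_imp_le[of "cmod (?G a)"]) auto
 qed
 have cauM: "MM.cau f" by (rule MM.convergent_cau[OF h(2) F(1) h(1)])
 have "Cauchy (\<lambda>n. iotae (f n) a)"
  unfolding Cauchy_def
 proof (intro allI impI)
  fix e :: real assume e: "e > 0"
  have sC: "sqrt C + 1 > 0" using C(1) by (simp add: add_nonneg_pos)
  have e2: "e / 2 > 0" "e / (2 * (sqrt C + 1)) > 0" using e sC by auto
  obtain N1 where N1: "\<And>m n. m \<ge> N1 \<Longrightarrow> n \<ge> N1 \<Longrightarrow> L.nrm (De (f m) - De (f n)) < e / 2"
   using cau[unfolded L.cau_def, rule_format, OF e2(1)] by blast
  obtain N2 where N2: "\<And>m n. m \<ge> N2 \<Longrightarrow> n \<ge> N2 \<Longrightarrow> MM.nrm (f m - f n) < e / (2 * (sqrt C + 1))"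
   using cauM[unfolded MM.cau_def, rule_format, OF e2(2)] by blast
  have "dist (iotae (f m) a) (iotae (f n) a) < e" if "m \<ge> max N1 N2" "n \<ge> max N1 N2" for m n
  proof -
   have "sqrt C * MM.nrm (f m - f n) \<le> (sqrt C + 1) * (e / (2 * (sqrt C + 1)))"
    using N2[of m n] that C(1) MM.nrm_nonneg[OF MM.mem(3)[OF F(1) F(1)], of m n] by (intro mult_mono) auto
   also have "\<dots> = e / 2" using sC by (simp add: field_simps)
   finally show ?thesis using diff_a[of m n] N1[of m n] that by (simp add: dist_norm)
  qed
  then show "\<exists>M. \<forall>m\<ge>M. \<forall>n\<ge>M. dist (iotae (f m) a) (iotae (f n) a) < e" by blast
 qed
 then have "convergent (\<lambda>n. iotae (f n) a)" by (rule Cauchy_convergent)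
 then obtain c where c: "(\<lambda>n. iotae (f n) a) \<longlonglongrightarrow> c" unfolding convergent_def by blast
 have cK: "c \<in> K" by (rule closed_sequentially[OF closed_K _ c]) (rule F(5))
 define G where "G x = c + primit a b g x" for x
 have Ga: "G a = c" by (simp add: G_def primit_a)
 have G: "is_prim a b g G" by (simp add: is_prim_def G_def primit_a)
 have GaK: "G a \<in> K" using cK Ga by simp
 have GM: "G \<in> L2 K M" by (rule is_prim_L2_M[OF g(1) G GaK])
 define r where "r n = cmod (iotae (f n) a - c) + L.nrm (De (f n) - g) * sqrt (b - a)" for n
 have r0: "r \<longlonglongrightarrow> 0"
 proof -
  have "(\<lambda>n. cmod (iotae (f n) a - c) + L.nrm (De (f n) - g) * sqrt (b - a)) \<longlonglongrightarrow> cmod (c - c) + 0 * sqrt (b - a)"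
   by (intro tendsto_intros c g(2))
  then show ?thesis by (simp add: r_def[abs_def])
 qed
 have unif: "cmod (iotae (f n) x - G x) \<le> r n" if x: "x \<in> {a..b}" for n x
 proof -
  have gL: "De (f n) - g \<in> L2 K (leb a b)" by (rule L.mem(3)[OF F(2) g(1)])
  have eq: "iotae (f n) x - G x = (iotae (f n) a - c) + (primit a b (De (f n) - g) x - primit a b (De (f n) - g) a)"
   unfolding is_primD[OF F(4) x] G_def primit_minus[OF F(2) g(1)] primit_a by (simp only: diff_0_right add_diff_add)
  have 1: "cmod (iotae (f n) x - G x) \<le> cmod (iotae (f n) a - c) + cmod (primit a b (De (f n) - g) x - primit a b (De (f n) - g) a)"
   unfolding eq by (rule norm_triangle_ineq)
  have 2: "cmod (primit a b (De (f n) - g) x - primit a b (De (f n) - g) a) \<le> L.nrm (De (f n) - g) * sqrt \<bar>x - a\<bar>"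
   by (rule primit_dist_le[OF gL])
  have 3: "L.nrm (De (f n) - g) * sqrt \<bar>x - a\<bar> \<le> L.nrm (De (f n) - g) * sqrt (b - a)"
   using x L.nrm_nonneg[OF gL] by (intro mult_left_mono) auto
  show ?thesis unfolding r_def using 1 2 3 by linarith
 qed
 interpret fM: finite_measure M by (rule finite_M)
 have "(\<lambda>n. MM.nrm (f n - G)) \<longlonglongrightarrow> 0"
 proof (rule Lim_null_comparison)
  have "MM.nrm (f n - G) \<le> sqrt (measure M (space M)) * r n" for n
  proof -
   have dL: "f n - G \<in> L2 K M" by (rule MM.mem(3)[OF F(1) GM])
   have rn: "r n \<ge> 0" using order_trans[OF norm_ge_zero unif[of a n]] ab by simp
   have "(MM.nrm (f n - G))\<^sup>2 = (LINT x|M. (cmod ((f n - G) x))\<^sup>2)" by (rule L2_nrm_sq[OF dL])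
   also have "\<dots> \<le> (LINT x|M. (r n)\<^sup>2)"
   proof (rule integral_mono_AE)
    show "integrable M (\<lambda>x. (cmod ((f n - G) x))\<^sup>2)" by (rule L2_D(3)[OF dL])
    show "AE x in M. (cmod ((f n - G) x))\<^sup>2 \<le> (r n)\<^sup>2"
     using F(6)[of n] AE_space
    proof eventually_elim
     case (elim x)
     then have "cmod ((f n - G) x) \<le> r n" using unif[of x n] by (simp add: space_M)
     then show ?case by (rule power_mono) simp
    qed
   qed simp
   also have "\<dots> = (sqrt (measure M (space M)) * r n)\<^sup>2" by (simp add: power_mult_distrib)
   finally show ?thesis using rn by (intro power2_le_imp_le[of "MM.nrm (f n - G)"]) auto
  qed
  then show "\<forall>\<^sub>F n in sequentially. norm (MM.nrm (f n - G)) \<le> sqrt (measure M (space M)) * r n"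
   using MM.nrm_nonneg[OF MM.mem(3)[OF F(1) GM]] by simp
  show "(\<lambda>n. sqrt (measure M (space M)) * r n) \<longlonglongrightarrow> 0" by (rule tendsto_mult_right_zero[OF r0])
 qed
 then have "MM.nrm (G - h) = 0"
  by (rule MM.limit_unique[OF _ h(2) F(1) GM h(1) sequentially_bot])
 then have ae: "AE x in M. G x = h x" using L2_nrm_cong[OF GM h(1)] by blast
 have og: "orth g" unfolding orth_def
 proof (intro conjI ballI g(1))
  fix z assume z: "z \<in> Z"
  have "(\<lambda>n. l2ip (leb a b) (De (f n)) z) \<longlonglongrightarrow> l2ip (leb a b) g z" by (rule L.tendsto_ip[OF g(2) F(2) g(1) Z_L2[OF z]])
  then show "l2ip (leb a b) g z = 0" using orth_Z[OF F(3) z] by (simp add: LIMSEQ_const_iff)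
 qed
 note i = iota_eqI[OF h(1) g(1) G GaK ae]
 show "h \<in> dome" by (rule i(1))
 have z: "L.nrm (De h - g) = 0" by (rule iota_eqI_orth[OF h(1) og G GaK ae])
 show "(\<lambda>n. L.nrm (De (f n) - De h)) \<longlonglongrightarrow> 0"
 proof (rule Lim_null_comparison[OF _ g(2)])
  have "L.nrm (De (f n) - De h) \<le> L.nrm (De (f n) - g)" for n
   using L.nrm_diff_triangle[OF F(2) g(1) i(4)] L.nrm_diff_commute[OF g(1) i(4)] z by simp
  then show "\<forall>\<^sub>F n in sequentially. norm (L.nrm (De (f n) - De h)) \<le> L.nrm (De (f n) - g)"
   using L.nrm_nonneg[OF L.mem(3)[OF F(2) i(4)]] by simp
 qed
 show "(\<lambda>n. iotae (f n) p) \<longlonglongrightarrow> iotae h p" if p: "p \<in> spt M"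
 proof -
  have "(\<lambda>n. iotae (f n) p - G p) \<longlonglongrightarrow> 0"
   by (rule Lim_null_comparison[OF _ r0]) (use unif p spt_sub in auto)
  then have "(\<lambda>n. iotae (f n) p) \<longlonglongrightarrow> G p" by (rule LIM_zero_cancel)
  then show ?thesis using i(2)[OF p] by simp
 qed
qed

lemma is_prim_C1:
 assumes F: "\<And>x. (F has_real_derivative D x) (at x)" and D: "continuous_on UNIV D"
 shows "is_prim a b (\<lambda>x. c * complex_of_real (D x)) (\<lambda>x. k + c * complex_of_real (F x))"
 unfolding is_prim_def
proof
 fix x assume x: "x \<in> {a..b}"
 have Dm[measurable]: "D \<in> borel_measurable borel" by (rule borel_measurable_continuous_onI[OF D])
 have "primit a b (\<lambda>x. c * complex_of_real (D x)) x = (LINT y|leb a b. c * complex_of_real (D y * indicator {..x} y))"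
  unfolding primit_def by (intro Bochner_Integration.integral_cong) (auto simp: indicator_def)
 also have "\<dots> = c * complex_of_real (LINT y|leb a b. D y * indicator {..x} y)"
  by (simp only: integral_mult_right_zero integral_complex_of_real)
 also have "(LINT y|leb a b. D y * indicator {..x} y) = (LINT y|lborel. indicator {a<..<b} y *\<^sub>R (D y * indicator {..x} y))"
  by (rule integral_restrict_space) simp
 also have "\<dots> = (LINT y|lborel. indicator {a..x} y *\<^sub>R D y)"
 proof (rule integral_cong_AE)
  have "AE y in lborel. y \<noteq> a" "AE y in lborel. y \<noteq> b" by (rule AE_lborel_singleton)+
  then show "AE y in lborel. indicator {a<..<b} y *\<^sub>R (D y * indicator {..x} y) = indicator {a..x} y *\<^sub>R D y"
   by eventually_elim (use x in \<open>auto simp: indicator_def\<close>)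
 qed measurable
 also have "\<dots> = F x - F a"
 proof (rule integral_FTC_Icc)
  fix y show "(F has_vector_derivative D y) (at y within {a..x})"
   using F by (auto simp: has_real_derivative_iff_has_vector_derivative intro: has_vector_derivative_at_within)
  show "continuous_on {a..x} D" by (rule continuous_on_subset[OF D]) simp
 qed (use x in simp)
 finally show "k + c * complex_of_real (F x) = k + c * complex_of_real (F a) + primit a b (\<lambda>x. c * complex_of_real (D x)) x"
  by (simp add: algebra_simps)
qed

lemma C1_dome:
 assumes F: "\<And>x. (F has_real_derivative D x) (at x)" and D: "continuous_on UNIV D" and c: "c \<in> K" and k: "k \<in> K"
 shows "(\<lambda>x. k + c * complex_of_real (F x)) \<in> dome"
  "x \<in> spt M \<Longrightarrow> iotae (\<lambda>x. k + c * complex_of_real (F x)) x = k + c * complex_of_real (F x)"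
proof -
 let ?G = "\<lambda>x. k + c * complex_of_real (F x)" and ?g = "\<lambda>x. c * complex_of_real (D x)"
 have "(\<lambda>x. complex_of_real (D x)) \<in> Cont K a b"
  by (auto simp: Cont_def intro!: continuous_on_of_real continuous_on_subset[OF D])
 then have g: "?g \<in> L2 K (leb a b)" by (intro L2_mult Cont_L2_leb c)
 have G: "is_prim a b ?g ?G" by (rule is_prim_C1[OF F D])
 have GK: "?G a \<in> K" by (intro K_closed_ops c k)
 note i = iota_eqI[OF is_prim_L2_M[OF g G GK] g G GK]
 show "(\<lambda>x. k + c * complex_of_real (F x)) \<in> dome" by (rule i(1)) simp
 show "x \<in> spt M \<Longrightarrow> iotae ?G x = ?G x" by (rule i(2)) simp
qed

lemma test_fun_dome:
 assumes "test_fun a b \<phi>" "c \<in> K"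
 shows "(\<lambda>x. c * complex_of_real (\<phi> x)) \<in> dome" "iotae (\<lambda>x. c * complex_of_real (\<phi> x)) a = 0"
  "iotae (\<lambda>x. c * complex_of_real (\<phi> x)) b = 0"
 using C1_dome[OF test_fun_D(1,2)[OF assms(1)] assms(2) K_closed_ops(1)] a_spt b_spt
  test_fun_D(3)[OF assms(1), of a] test_fun_D(3)[OF assms(1), of b] by simp_all

text \<open>Arbitrary values at both end points are attained; this realises any boundary vector by
  an element of the form domain.\<close>

lemma affine_dome:
 assumes "p \<in> K" "q \<in> K"
 shows "\<exists>f\<in>dome. iotae f a = p \<and> iotae f b = q"
proof -
 define c where "c = complex_of_real (1 / (b - a)) * (q - p)"
 have c: "c \<in> K" unfolding c_def by (intro K_closed_ops assms)
 have d: "((\<lambda>x. x - a) has_real_derivative 1) (at x)" for x by (auto intro!: derivative_eq_intros)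
 have cont: "continuous_on UNIV (\<lambda>x::real. 1::real)" by simp
 note C = C1_dome[OF d cont c assms(1)]
 have "p + c * complex_of_real (b - a) = q" using ab by (simp add: c_def)
 then show ?thesis using C(1) C(2)[OF a_spt] C(2)[OF b_spt]
  by (intro bexI[of _ "\<lambda>x. p + c * complex_of_real (x - a)"]) auto
qed

text \<open>Test functions do not see the two end points, which carry no mass. Taking the integral
  \<open>I\<close> itself as the scalar \<open>c\<close> turns the real part of the pairing into
  \<open>(cmod I)^2\<close>, so real orthogonality is enough.\<close>

lemma test_fun_total:
 assumes h: "h \<in> L2 K M" and zero: "\<And>\<phi> c. test_fun a b \<phi> \<Longrightarrow> c \<in> K \<Longrightarrow> l2ip M h (\<lambda>x. c * complex_of_real (\<phi> x)) = 0"
 shows "AE x in M. h x = 0"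
proof -
 interpret fM: finite_measure M by (rule finite_M)
 have one: "(\<lambda>_. 1) \<in> L2 K M" by (rule L2_bounded[OF finite_M, of _ 1]) auto
 have hi: "integrable M h" using L2_product_integrable(2)[OF h one] by simp
 have "AE x in M. x \<in> {a<..<b} \<longrightarrow> h x = 0"
 proof (rule test_fun_separating[OF _ sets_M _ ab hi])
  show "sigma_finite_measure M" by (rule finite_measure.axioms[OF finite_M])
  fix \<phi> assume t: "test_fun a b \<phi>"
  define I where "I = (LINT x|M. h x * complex_of_real (\<phi> x))"
  have IK: "I \<in> K" unfolding I_def by (rule K_integral) (use L2_D(2)[OF h] in simp)
  have "(LINT x|M. h x * cnj (I * complex_of_real (\<phi> x))) = (LINT x|M. cnj I * (h x * complex_of_real (\<phi> x)))"
   by (simp add: mult_ac)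
  also have "\<dots> = cnj I * I" unfolding I_def by (rule integral_mult_right_zero)
  finally have "l2ip M h (\<lambda>x. I * complex_of_real (\<phi> x)) = Re (cnj I * I)" by (simp add: l2ip_def)
  then have "Re (cnj I * I) = 0" using zero[OF t IK] by simp
  moreover have "Re (cnj I * I) = (cmod I)\<^sup>2" unfolding cmod_power2 by (simp add: power2_eq_square)
  ultimately show "(LINT x|M. h x * complex_of_real (\<phi> x)) = 0" unfolding I_def by simp
 qed simp
 moreover have "AE x in M. x \<notin> {a, b}"
 proof -
  have "{a, b} \<in> sets M" using in_sets[of "{a, b}"] ab by simp
  then have "{a, b} \<in> null_sets M" using ends_null by (simp add: null_sets_def)
  then show ?thesis by (rule AE_not_in)
 qed
 ultimately show ?thesis using AE_space by eventually_elim (auto simp: space_M)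
qed

end

section \<open>Pointwise projections on an edge\<close>

locale edge_firm = edge + firm_map
begin

interpretation L: semi_hilbert "L2 K (leb a b)" "l2ip (leb a b)" by (rule L2_semi_hilbert)

text \<open>Let \<open>g\<close> be the derivative of \<open>P\<close> composed with
  \<open>iotae f\<close>, and \<open>w = De f - g\<close>. From
  \<open>(L.nrm g)\<^sup>2 \<le> l2ip (leb a b) (De f) g\<close> follows the same inequality for
  \<open>w\<close>. The derivative belonging to \<open>f - P f\<close> differs from \<open>w\<close>
  by an element of \<open>Z\<close>, to which \<open>De f\<close> is orthogonal, so the pairing is
  unchanged.\<close>

lemma firm_dome:
 assumes f: "f \<in> dome"
 shows "(\<lambda>x. P (f x)) \<in> dome" "x \<in> spt M \<Longrightarrow> iotae (\<lambda>x. P (f x)) x = P (iotae f x)"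
  "\<exists>w W. w \<in> L2 K (leb a b) \<and> is_prim a b w W \<and> W a \<in> K \<and> (\<forall>x\<in>spt M. W x = iotae f x - P (iotae f x)) \<and>
   (AE x in M. W x = f x - P (f x)) \<and> (L.nrm w)\<^sup>2 \<le> l2ip (leb a b) (De f) (De (\<lambda>x. f x - P (f x)))"
proof -
 note F = dome_D[OF f]
 obtain g where g: "g \<in> L2 K (leb a b)" "is_prim a b g (\<lambda>x. P (iotae f x))"
   "(L.nrm g)\<^sup>2 \<le> l2ip (leb a b) (De f) g"
  using firm_primitive[OF ab F(2) F(4) F(5)] by blast
 have PK: "P (iotae f a) \<in> K" by (rule P_K[OF F(5)])
 have ae: "AE x in M. P (iotae f x) = P (f x)" using F(6) by eventually_elim simp
 note i = iota_eqI[OF P_L2[OF F(1)] g(1,2) PK ae]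
 show "(\<lambda>x. P (f x)) \<in> dome" by (rule i(1))
 show "x \<in> spt M \<Longrightarrow> iotae (\<lambda>x. P (f x)) x = P (iotae f x)" by (rule i(2))
 let ?w = "De f - g" and ?W = "\<lambda>x. iotae f x - P (iotae f x)"
 have w: "?w \<in> L2 K (leb a b)" by (rule L.mem(3)[OF F(2) g(1)])
 have W: "is_prim a b ?w ?W" by (rule is_prim_diff[OF F(2) g(1) F(4) g(2)])
 have WK: "?W a \<in> K" by (intro K_closed_ops F(5) PK)
 have ae2: "AE x in M. ?W x = f x - P (f x)" using F(6) by eventually_elim simp
 note j = iota_eqI[OF L2_diff[OF F(1) P_L2[OF F(1)]] w W WK ae2]
 have "0 = l2ip (leb a b) (De f) (?w - De (\<lambda>x. f x - P (f x)))" by (rule orth_Z[OF F(3) j(3), symmetric])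
 also have "\<dots> = l2ip (leb a b) (De f) ?w - l2ip (leb a b) (De f) (De (\<lambda>x. f x - P (f x)))"
  by (rule L.ip_diff_right[OF w j(4) F(2)])
 finally have 1: "l2ip (leb a b) (De f) (De (\<lambda>x. f x - P (f x))) = l2ip (leb a b) (De f) ?w" by simp
 have "(L.nrm ?w)\<^sup>2 = l2ip (leb a b) (De f) ?w - l2ip (leb a b) g ?w"
  using L.nrm_sq[OF w] L.ip_diff[OF F(2) g(1) w] by simp
 also have "l2ip (leb a b) g ?w = l2ip (leb a b) (De f) g - (L.nrm g)\<^sup>2"
  using L.ip_diff_right[OF F(2) g(1) g(1)] L.ip_sym[OF g(1) F(2)] L.nrm_sq[OF g(1)] by simp
 finally have "(L.nrm ?w)\<^sup>2 \<le> l2ip (leb a b) (De f) ?w" using g(3) by linarith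
 then have "(L.nrm ?w)\<^sup>2 \<le> l2ip (leb a b) (De f) (De (\<lambda>x. f x - P (f x)))" unfolding 1 .
 then show "\<exists>w W. w \<in> L2 K (leb a b) \<and> is_prim a b w W \<and> W a \<in> K \<and> (\<forall>x\<in>spt M. W x = iotae f x - P (iotae f x)) \<and>
   (AE x in M. W x = f x - P (f x)) \<and> (L.nrm w)\<^sup>2 \<le> l2ip (leb a b) (De f) (De (\<lambda>x. f x - P (f x)))"
  using w W WK ae2 by (intro exI[of _ ?w] exI[of _ ?W] conjI ballI refl) assumption+
qed

end

section \<open>Finite-dimensional boundary spaces\<close>

context semi_inner
begin

text \<open>Gram-Schmidt, by induction on the spanning set. The expansion shows that
  finite-dimensional subspaces are closed and that linear maps on them are bounded.\<close>

lemma orthonormal_expansion: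
 assumes "finite B" "B \<subseteq> H" and definite: "\<And>x. x \<in> H \<Longrightarrow> ip x x = 0 \<Longrightarrow> x = 0"
 shows "\<exists>E. finite E \<and> E \<subseteq> H \<and> (\<forall>e\<in>E. ip e e = 1) \<and> (\<forall>e\<in>E. \<forall>e'\<in>E. e \<noteq> e' \<longrightarrow> ip e e' = 0) \<and>
  (\<forall>x\<in>span B. x = (\<Sum>e\<in>E. ip x e *\<^sub>R e))"
 using assms(1,2)
proof (induction B)
 case empty
 then show ?case by (intro exI[of _ "{}"]) simp
next
 case (insert b B)
 have b: "b \<in> H" and BH: "B \<subseteq> H" using insert.prems by simp_all
 from insert.IH[OF BH] obtain E where EE: "finite E \<and> E \<subseteq> H \<and> (\<forall>e\<in>E. ip e e = 1) \<and>
   (\<forall>e\<in>E. \<forall>e'\<in>E. e \<noteq> e' \<longrightarrow> ip e e' = 0) \<and> (\<forall>x\<in>span B. x = (\<Sum>e\<in>E. ip x e *\<^sub>R e))" ..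
 then have E: "finite E" "E \<subseteq> H" "\<And>e. e \<in> E \<Longrightarrow> ip e e = 1"
   "\<And>e e'. e \<in> E \<Longrightarrow> e' \<in> E \<Longrightarrow> e \<noteq> e' \<Longrightarrow> ip e e' = 0" by simp_all
 have E5: "x \<in> {x \<in> H. x = (\<Sum>e\<in>E. ip x e *\<^sub>R e)}" if "x \<in> B" for x
 proof -
  have "x = (\<Sum>e\<in>E. ip x e *\<^sub>R e)" by (rule EE[THEN conjunct2, THEN conjunct2, THEN conjunct2, THEN conjunct2, THEN bspec]) (rule span_base[OF that])
  then show ?thesis using that BH by (intro CollectI conjI) auto
 qed
 have sumH: "(\<Sum>e\<in>E'. c e *\<^sub>R e) \<in> H" if "E' \<subseteq> H" for E' c
  using that by (intro subspace_sum[OF subspace_H]) auto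
 have ip_sum: "ip (\<Sum>e\<in>E'. c e *\<^sub>R e) z = (\<Sum>e\<in>E'. c e * ip e z)" if "E' \<subseteq> H" "finite E'" "z \<in> H" for E' c z
  using that(2,1)
 proof (induction E')
  case (insert f F)
  then have "ip (f_c *\<^sub>R f + (\<Sum>e\<in>F. c e *\<^sub>R e)) z = f_c * ip f z + ip (\<Sum>e\<in>F. c e *\<^sub>R e) z" for f_c
   using sumH[of F c] that(3) by (subst ip_add) (auto simp: ip_scale)
  then show ?case using insert by simp
 qed (use that in simp)
 define w where "w = b - (\<Sum>e\<in>E. ip b e *\<^sub>R e)"
 have w: "w \<in> H" using b sumH[OF E(2)] by (simp add: w_def)
 have w_orth: "ip w e = 0" if e: "e \<in> E" for e
 proof -
  have eH: "e \<in> H" using e E(2) by blast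
  have "ip (\<Sum>e\<in>E. ip b e *\<^sub>R e) e = (\<Sum>f\<in>E. ip b f * ip f e)" by (rule ip_sum[OF E(2,1) eH])
  also have "\<dots> = (\<Sum>f\<in>E. if f = e then ip b e else 0)"
   using E(3,4) e by (intro sum.cong refl) auto
  also have "\<dots> = ip b e" using E(1) e by simp
  finally show ?thesis using b eH sumH[OF E(2)] by (simp add: w_def ip_diff)
 qed
 \<comment> \<open>The vectors satisfying the expansion form a subspace, so it suffices to check the
   generators.\<close>
 have sub: "subspace {x \<in> H. x = (\<Sum>e\<in>E'. ip x e *\<^sub>R e)}" if E': "E' \<subseteq> H" for E'
  unfolding subspace_def
 proof (intro conjI ballI allI)
  have "(\<Sum>e\<in>E'. ip 0 e *\<^sub>R e) = 0"
  proof (intro sum.neutral ballI)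
   fix e assume "e \<in> E'"
   then have "e \<in> H" using E' by blast
   then show "ip 0 e *\<^sub>R e = 0" by simp
  qed
  then show "0 \<in> {x \<in> H. x = (\<Sum>e\<in>E'. ip x e *\<^sub>R e)}" by simp
 next
  fix x y assume xy: "x \<in> {x \<in> H. x = (\<Sum>e\<in>E'. ip x e *\<^sub>R e)}" "y \<in> {x \<in> H. x = (\<Sum>e\<in>E'. ip x e *\<^sub>R e)}"
  have "(\<Sum>e\<in>E'. ip (x + y) e *\<^sub>R e) = (\<Sum>e\<in>E'. ip x e *\<^sub>R e + ip y e *\<^sub>R e)"
   using xy E' by (intro sum.cong refl) (auto simp: ip_add scaleR_add_left)
  also have "\<dots> = (\<Sum>e\<in>E'. ip x e *\<^sub>R e) + (\<Sum>e\<in>E'. ip y e *\<^sub>R e)" by (rule sum.distrib)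
  also have "\<dots> = x + y" using xy by simp
  finally show "x + y \<in> {x \<in> H. x = (\<Sum>e\<in>E'. ip x e *\<^sub>R e)}" using xy by simp
 next
  fix x c assume x: "x \<in> {x \<in> H. x = (\<Sum>e\<in>E'. ip x e *\<^sub>R e)}"
  have "(\<Sum>e\<in>E'. ip (c *\<^sub>R x) e *\<^sub>R e) = (\<Sum>e\<in>E'. c *\<^sub>R (ip x e *\<^sub>R e))"
   using x E' by (intro sum.cong refl) (auto simp: ip_scale)
  also have "\<dots> = c *\<^sub>R (\<Sum>e\<in>E'. ip x e *\<^sub>R e)" by (rule scaleR_sum_right[symmetric])
  also have "\<dots> = c *\<^sub>R x" using x by simp
  finally show "c *\<^sub>R x \<in> {x \<in> H. x = (\<Sum>e\<in>E'. ip x e *\<^sub>R e)}" using x by simp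
 qed
 show ?case
 proof (cases "w = 0")
  case True
  then have "b = (\<Sum>e\<in>E. ip b e *\<^sub>R e)" by (simp add: w_def)
  then have "b \<in> {x \<in> H. x = (\<Sum>e\<in>E. ip x e *\<^sub>R e)}" using b by (intro CollectI conjI)
  then have "insert b B \<subseteq> {x \<in> H. x = (\<Sum>e\<in>E. ip x e *\<^sub>R e)}"
   using E5 by (intro insert_subsetI subsetI)
  then have S: "span (insert b B) \<subseteq> {x \<in> H. x = (\<Sum>e\<in>E. ip x e *\<^sub>R e)}" by (rule span_minimal[OF _ sub[OF E(2)]])
  show ?thesis
  proof (intro exI[of _ E] conjI ballI impI)
   fix x assume "x \<in> span (insert b B)"
   then have "x \<in> {x \<in> H. x = (\<Sum>e\<in>E. ip x e *\<^sub>R e)}" using S by (rule rev_subsetD)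
   then show "x = (\<Sum>e\<in>E. ip x e *\<^sub>R e)" unfolding mem_Collect_eq by (rule conjunct2)
  qed (use E in auto)
 next
  case False
  have "nrm w \<noteq> 0"
  proof
   assume "nrm w = 0"
   then have "ip w w = 0" using nrm_sq[OF w] by simp
   then show False using definite[OF w] False by blast
  qed
  then have nw: "nrm w > 0" using nrm_nonneg[OF w] by linarith
  define w' where "w' = (1 / nrm w) *\<^sub>R w"
  have w': "w' \<in> H" using w by (simp add: w'_def)
  have "ip w' w' = (1 / nrm w) * ((1 / nrm w) * ip w w)"
   by (simp only: w'_def ip_scale[OF w mem(4)[OF w]] ip_scale_right[OF w w])
  also have "\<dots> = 1" unfolding nrm_sq[OF w, symmetric] using nw by (simp add: power2_eq_square)
  finally have ww: "ip w' w' = 1" .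
  have w'_orth: "ip w' e = 0" "ip e w' = 0" if e: "e \<in> E" for e
   using w_orth[OF e] w e E(2) ip_sym[of e w] by (auto simp: w'_def ip_lin)
  have wE: "w' \<notin> E" using w'_orth(1)[of w'] ww by auto
  let ?E = "insert w' E"
  have EH: "?E \<subseteq> H" using E(2) w' by simp
  have old: "x \<in> {x \<in> H. x = (\<Sum>e\<in>?E. ip x e *\<^sub>R e)}" if xB: "x \<in> B" for x
  proof -
   have x: "x \<in> H" using E5[OF xB] unfolding mem_Collect_eq by (rule conjunct1)
   have x2: "x = (\<Sum>e\<in>E. ip x e *\<^sub>R e)" using E5[OF xB] unfolding mem_Collect_eq by (rule conjunct2)
   have "ip (\<Sum>e\<in>E. ip x e *\<^sub>R e) w' = 0"
    unfolding ip_sum[OF E(2,1) w'] by (intro sum.neutral ballI) (simp add: w'_orth)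
   then have "ip x w' = 0" unfolding x2[symmetric] .
   then have "(\<Sum>e\<in>?E. ip x e *\<^sub>R e) = (\<Sum>e\<in>E. ip x e *\<^sub>R e)" using wE E(1) by simp
   also have "\<dots> = x" by (rule x2[symmetric])
   finally show ?thesis by (intro CollectI conjI x) (rule sym)
  qed
  have new: "b \<in> {x \<in> H. x = (\<Sum>e\<in>?E. ip x e *\<^sub>R e)}"
  proof -
   have "ip (\<Sum>e\<in>E. ip b e *\<^sub>R e) w' = 0"
    unfolding ip_sum[OF E(2,1) w'] by (intro sum.neutral ballI) (simp add: w'_orth)
   moreover have "ip b w' = ip w w' + ip (\<Sum>e\<in>E. ip b e *\<^sub>R e) w'"
    using ip_diff[OF b sumH[OF E(2)] w'] unfolding w_def by simp
   moreover have "ip w w' = nrm w"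
   proof -
    have "ip w w' = (1 / nrm w) * ip w w" by (simp only: w'_def ip_scale_right[OF w w])
    also have "\<dots> = nrm w" unfolding nrm_sq[OF w, symmetric] using nw by (simp add: power2_eq_square)
    finally show ?thesis .
   qed
   ultimately have "ip b w' *\<^sub>R w' = w" using nw by (simp add: w'_def)
   moreover have "b = w + (\<Sum>e\<in>E. ip b e *\<^sub>R e)" by (simp add: w_def)
   ultimately have "b = ip b w' *\<^sub>R w' + (\<Sum>e\<in>E. ip b e *\<^sub>R e)" by (simp only:)
   also have "\<dots> = (\<Sum>e\<in>?E. ip b e *\<^sub>R e)" by (rule sum.insert[OF E(1) wE, symmetric])
   finally show ?thesis by (intro CollectI conjI b)
  qed
  have "insert b B \<subseteq> {x \<in> H. x = (\<Sum>e\<in>?E. ip x e *\<^sub>R e)}"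
   using new old by (intro insert_subsetI subsetI)
  then have S: "span (insert b B) \<subseteq> {x \<in> H. x = (\<Sum>e\<in>?E. ip x e *\<^sub>R e)}" by (rule span_minimal[OF _ sub[OF EH]])
  show ?thesis
  proof (intro exI[of _ ?E] conjI ballI impI)
   fix x assume "x \<in> span (insert b B)"
   then have "x \<in> {x \<in> H. x = (\<Sum>e\<in>?E. ip x e *\<^sub>R e)}" using S by (rule rev_subsetD)
   then show "x = (\<Sum>e\<in>?E. ip x e *\<^sub>R e)" unfolding mem_Collect_eq by (rule conjunct2)
  next
   fix e e' assume "e \<in> ?E" "e' \<in> ?E" "e \<noteq> e'"
   then show "ip e e' = 0" using w'_orth E(4) by auto
  qed (use ww E EH in auto)
 qed
qed

lemma bounded_if_expansion:
 assumes E: "finite E" "E \<subseteq> H" "\<And>e. e \<in> E \<Longrightarrow> ip e e = 1" "\<And>x. x \<in> H \<Longrightarrow> x = (\<Sum>e\<in>E. ip x e *\<^sub>R e)"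
  and L: "\<And>x. x \<in> H \<Longrightarrow> L x \<in> H" "\<And>x y. x \<in> H \<Longrightarrow> y \<in> H \<Longrightarrow> L (x + y) = L x + L y"
   "\<And>x r. x \<in> H \<Longrightarrow> L (r *\<^sub>R x) = r *\<^sub>R L x"
 shows "\<exists>C\<ge>0. \<forall>x\<in>H. nrm (L x) \<le> C * nrm x"
proof -
 have L0: "L 0 = 0" using L(3)[of 0 0] by simp
 have "nrm (L (\<Sum>e\<in>F. c e *\<^sub>R e)) \<le> (\<Sum>e\<in>F. \<bar>c e\<bar> * nrm (L e)) \<and> (\<Sum>e\<in>F. c e *\<^sub>R e) \<in> H"
  if "finite F" "F \<subseteq> H" for F c
  using that
 proof (induction F)
  case (insert f F)
  then have m: "f \<in> H" "(\<Sum>e\<in>F. c e *\<^sub>R e) \<in> H" by auto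
  have "L (c f *\<^sub>R f + (\<Sum>e\<in>F. c e *\<^sub>R e)) = c f *\<^sub>R L f + L (\<Sum>e\<in>F. c e *\<^sub>R e)"
   using m by (simp add: L)
  moreover have "nrm (c f *\<^sub>R L f + L (\<Sum>e\<in>F. c e *\<^sub>R e)) \<le> nrm (c f *\<^sub>R L f) + nrm (L (\<Sum>e\<in>F. c e *\<^sub>R e))"
   using m by (intro nrm_triangle) (simp_all add: L)
  moreover have "nrm (c f *\<^sub>R L f) = \<bar>c f\<bar> * nrm (L f)" using m by (intro nrm_scale L)
  ultimately show ?case using insert m by simp
 qed (simp add: L0)
 note sum = this
 have "nrm (L x) \<le> (\<Sum>e\<in>E. nrm (L e)) * nrm x" if x: "x \<in> H" for x
 proof -
  have "nrm (L x) = nrm (L (\<Sum>e\<in>E. ip x e *\<^sub>R e))" using E(4)[OF x] by simp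
  also have "\<dots> \<le> (\<Sum>e\<in>E. \<bar>ip x e\<bar> * nrm (L e))" using sum[OF E(1,2), of "ip x"] by simp
  also have "\<dots> \<le> (\<Sum>e\<in>E. nrm x * nrm (L e))"
  proof (intro sum_mono mult_right_mono)
   fix e assume e: "e \<in> E"
   then have eH: "e \<in> H" using E(2) by blast
   have "nrm e = 1" using E(3)[OF e] by (simp add: nrm_def)
   then show "\<bar>ip x e\<bar> \<le> nrm x" using ip_le_nrm[OF x eH] by simp
   show "0 \<le> nrm (L e)" using L(1)[OF eH] by simp
  qed
  also have "\<dots> = (\<Sum>e\<in>E. nrm (L e)) * nrm x" by (simp add: sum_distrib_left[symmetric] mult.commute)
  finally show ?thesis .
 qed
 moreover have "(\<Sum>e\<in>E. nrm (L e)) \<ge> 0" using E(2) L(1) by (intro sum_nonneg) auto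
 ultimately show ?thesis by blast
qed

end

section \<open>Derivative of the operator exponential, and projections in the scalar field\<close>

text \<open>The geometric bound on the iterates makes the coordinate a power series converging at 1,
  so it can be differentiated at 0; the limit is then taken along \<open>z = - t\<close>.\<close>

lemma op_exp_derivative:
 assumes "\<And>n. cmod ((L ^^ n) x s) \<le> A * C ^ n"
 shows "((\<lambda>t. (op_exp L (- t) x s - x s) / complex_of_real t) \<longlongrightarrow> - L x s) (at_right 0)"
proof -
 define c where "c n = (L ^^ n) x s / fact n" for n
 have C: "summable (\<lambda>n. c n * (1::complex) ^ n)"
 proof (rule summable_comparison_test'[where N = 0])
  show "summable (\<lambda>n. \<bar>A\<bar> * (inverse (fact n) * \<bar>C\<bar> ^ n))" by (intro summable_mult summable_exp)
  show "norm (c n * 1 ^ n) \<le> \<bar>A\<bar> * (inverse (fact n) * \<bar>C\<bar> ^ n)" for n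
  proof -
   have "A * C ^ n \<le> \<bar>A\<bar> * \<bar>C\<bar> ^ n" using abs_ge_self[of "A * C ^ n"] by (simp add: abs_mult power_abs)
   then have "cmod ((L ^^ n) x s) \<le> \<bar>A\<bar> * \<bar>C\<bar> ^ n" using assms[of n] by linarith
   then have "cmod ((L ^^ n) x s) / fact n \<le> (\<bar>A\<bar> * \<bar>C\<bar> ^ n) / fact n" by (rule divide_right_mono) simp
   moreover have "norm (c n * 1 ^ n) = cmod ((L ^^ n) x s) / fact n" by (simp add: c_def norm_divide)
   moreover have "(\<bar>A\<bar> * \<bar>C\<bar> ^ n) / fact n = \<bar>A\<bar> * (inverse (fact n) * \<bar>C\<bar> ^ n)" by (simp add: divide_inverse mult_ac)
   ultimately show ?thesis by linarith
  qed
 qed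
 have "DERIV (\<lambda>z. \<Sum>n. c n * z ^ n) 0 :> (\<Sum>n. diffs c n * 0 ^ n)"
  by (rule termdiffs_strong[OF C]) simp
 then have "DERIV (\<lambda>z. \<Sum>n. c n * z ^ n) 0 :> L x s"
  by (simp add: diffs_def c_def)
 then have "((\<lambda>z. ((\<Sum>n. c n * z ^ n) - (\<Sum>n. c n * 0 ^ n)) / z) \<longlongrightarrow> L x s) (at 0)"
  by (simp only: has_field_derivative_iff diff_zero)
 moreover have "filterlim (\<lambda>t. - complex_of_real t) (at 0) (at_right 0)"
 proof -
  have "((\<lambda>t. - complex_of_real t) \<longlongrightarrow> - complex_of_real 0) (at_right 0)" by (intro tendsto_intros)
  moreover have "\<forall>\<^sub>F t::real in at_right 0. - complex_of_real t \<noteq> 0"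
   using eventually_at_right_less[of "0::real"] by eventually_elim simp
  ultimately show ?thesis by (simp add: filterlim_at)
 qed
 ultimately have "((\<lambda>t. ((\<Sum>n. c n * (- complex_of_real t) ^ n) - (\<Sum>n. c n * 0 ^ n)) / (- complex_of_real t)) \<longlongrightarrow> L x s) (at_right 0)"
  by (rule filterlim_compose)
 then have "((\<lambda>t. - (((\<Sum>n. c n * (- complex_of_real t) ^ n) - (\<Sum>n. c n * 0 ^ n)) / (- complex_of_real t))) \<longlongrightarrow> - L x s) (at_right 0)"
  by (rule tendsto_minus)
 moreover have "(\<Sum>n. c n * (- complex_of_real t) ^ n) = op_exp L (- t) x s" for t
  unfolding op_exp_def by (intro suminf_cong) (simp add: c_def)
 moreover have "(\<Sum>n. c n * 0 ^ n) = x s" unfolding powser_zero by (simp add: c_def)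
 ultimately show ?thesis by simp
qed

text \<open>\<open>cone\<close> is the variational inequality of the nearest-point projection onto
  the range of \<open>P\<close>: the displacement \<open>z - P z\<close> forms an obtuse angle with
  every direction into the set.\<close>

locale cone_map = scalars +
 fixes P :: "complex \<Rightarrow> complex"
 assumes cone: "Re ((z - P z) * cnj (P w - P z)) \<le> 0"
  and P_idem: "P (P z) = P z"
  and P_0': "P 0 = 0"
  and P_K': "z \<in> K \<Longrightarrow> P z \<in> K"

text \<open>Adding the variational inequalities at \<open>z\<close> and at \<open>w\<close> gives
  firm nonexpansiveness.\<close>

sublocale cone_map \<subseteq> firm_map
proof
 fix z w
 have "Re ((z - P z) * cnj (P w - P z)) + Re ((w - P w) * cnj (P z - P w)) \<le> 0"
  using cone[of z w] cone[of w z] by linarith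
 then show "(cmod (P z - P w))\<^sup>2 \<le> Re ((P z - P w) * cnj (z - w))"
  unfolding cmod_power2 by (simp add: power2_eq_square algebra_simps)
qed (use P_0' P_K' in auto)

context cone_map
begin

lemma P_nearest: "cmod (z - P z) \<le> cmod (z - P w)"
proof (rule power2_le_imp_le)
 have "(cmod (z - P w))\<^sup>2 = (cmod (z - P z))\<^sup>2 + (cmod (P z - P w))\<^sup>2 - 2 * Re ((z - P z) * cnj (P w - P z))"
  unfolding cmod_power2 by (simp add: power2_eq_square algebra_simps)
 then show "(cmod (z - P z))\<^sup>2 \<le> (cmod (z - P w))\<^sup>2"
  using cone[of z w] zero_le_power2[of "cmod (P z - P w)"] by linarith
qed simp

end

text \<open>The nearest-point projection of the complex plane onto the nonnegative half-line; it
  also removes the imaginary part, so positivity includes being real.\<close>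

lemma (in scalars) cone_map_positive: "cone_map K (\<lambda>z. complex_of_real (max (Re z) 0))"
proof
 fix z w :: complex
 have "(Re z - max (Re z) 0) * (max (Re w) 0 - max (Re z) 0) \<le> 0"
  by (cases "Re z \<ge> 0") (auto simp: max_def mult_nonpos_nonneg)
 then show "Re ((z - complex_of_real (max (Re z) 0)) * cnj (complex_of_real (max (Re w) 0) - complex_of_real (max (Re z) 0))) \<le> 0"
  by simp
qed auto

text \<open>Outside the disc, \<open>z - P z\<close> is a nonnegative multiple of \<open>z\<close>,
  and by Cauchy-Schwarz \<open>P z\<close> has the largest pairing with \<open>z\<close> among all
  points of the disc.\<close>

lemma (in scalars) cone_map_ball:
 assumes r: "r > 0" shows "cone_map K (\<lambda>z. if cmod z \<le> r then z else complex_of_real (r / cmod z) * z)"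
proof
 fix z w :: complex
 let ?P = "\<lambda>z. if cmod z \<le> r then z else complex_of_real (r / cmod z) * z"
 have nr: "cmod (complex_of_real (r / cmod u) * u) = r" if "cmod u > r" for u
 proof -
  have "cmod (complex_of_real (r / cmod u) * u) = \<bar>r / cmod u\<bar> * cmod u" by (simp only: norm_mult norm_of_real)
  moreover have "cmod u \<noteq> 0" using that r by linarith
  ultimately show ?thesis using r by simp
 qed
 have nP: "cmod (?P u) \<le> r" for u using nr[of u] by (cases "cmod u \<le> r") (simp_all del: of_real_divide)
 show "Re ((z - ?P z) * cnj (?P w - ?P z)) \<le> 0"
 proof (cases "cmod z \<le> r")
  case False
  then have z: "cmod z > r" by simp
  have 1: "z - ?P z = complex_of_real (1 - r / cmod z) * z" using z by (simp add: algebra_simps)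
  have "Re (z * cnj (?P w)) \<le> cmod (z * cnj (?P w))" by (rule complex_Re_le_cmod)
  also have "\<dots> = cmod z * cmod (?P w)" by (simp only: norm_mult complex_mod_cnj)
  also have "\<dots> \<le> cmod z * r" by (rule mult_left_mono[OF nP]) simp
  finally have 2: "Re (z * cnj (?P w)) \<le> cmod z * r" .
  have "z * cnj (?P z) = complex_of_real (r / cmod z) * (z * cnj z)" using z by simp
  also have "\<dots> = complex_of_real (r / cmod z * (cmod z)\<^sup>2)" by (simp only: complex_norm_square of_real_mult)
  also have "r / cmod z * (cmod z)\<^sup>2 = cmod z * r" using z r by (simp add: power2_eq_square)
  finally have 3: "Re (z * cnj (?P z)) = cmod z * r" by (simp only: Re_complex_of_real)
  have "Re ((z - ?P z) * cnj (?P w - ?P z)) = (1 - r / cmod z) * (Re (z * cnj (?P w)) - Re (z * cnj (?P z)))"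
  proof -
   define W V where "W = ?P w" and "V = ?P z"
   have "complex_of_real (1 - r / cmod z) * z * cnj (W - V) = complex_of_real (1 - r / cmod z) * (z * cnj W - z * cnj V)"
    by (simp only: complex_cnj_diff right_diff_distrib mult.assoc)
   then have "Re (complex_of_real (1 - r / cmod z) * z * cnj (W - V)) = (1 - r / cmod z) * Re (z * cnj W - z * cnj V)"
    by (simp only: Re_complex_of_real Im_complex_of_real times_complex.sel(1) mult_zero_left diff_zero)
   moreover have "z - V = complex_of_real (1 - r / cmod z) * z" unfolding V_def by (rule 1)
   ultimately show ?thesis unfolding W_def[symmetric] V_def[symmetric] by (simp only: minus_complex.sel(1))
  qed
  also have "\<dots> \<le> 0"
  proof (rule mult_nonneg_nonpos)
   have "r / cmod z \<le> 1" using z r by (subst divide_le_eq_1_pos) linarith+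
   then show "0 \<le> 1 - r / cmod z" by simp
  qed (use 2 3 in linarith)
  finally show ?thesis .
 qed simp
 show "?P (?P z) = ?P z" using nP[of z] by (simp del: of_real_divide)
 show "?P z \<in> K" if "z \<in> K" using that by (simp del: of_real_divide)
qed auto

section \<open>The boundary space of a network as a finite-dimensional inner product space\<close>

locale net = weighted_network N + scalars K for N :: "('v, 'e) network" and K
begin

definition rb :: "('v, 'e) bvec \<Rightarrow> ('v, 'e) bvec \<Rightarrow> real" where
 "rb x y = Re (binner N x y)"

lemma finite_E1 [simp]: "finite (E1 N)" by (simp add: E1_def)

lemma finite_V1 [simp]: "finite (V1 N)" by (simp add: V1_def)

lemma V1_pos: "v \<in> V1 N \<Longrightarrow> vweight N v > 0"
 using vweight_nonneg by (fastforce simp: V1_def)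

lemma rb_sum: "rb x y = (\<Sum>p\<in>E1 N \<times> {0, 1}. Re (x (Inl p) * cnj (y (Inl p)))) +
  (\<Sum>v\<in>V1 N. Re (x (Inr v) * cnj (y (Inr v))) * vweight N v)"
 by (simp add: rb_def binner_def)

lemma rb_self: "rb x x = (\<Sum>p\<in>E1 N \<times> {0, 1}. (cmod (x (Inl p)))\<^sup>2) + (\<Sum>v\<in>V1 N. (cmod (x (Inr v)))\<^sup>2 * vweight N v)"
 unfolding rb_sum cmod_power2 by (simp add: power2_eq_square)

lemma rb_semi_inner: assumes "subspace Y" shows "semi_inner Y rb"
proof
 fix x y z :: "('v, 'e) bvec" and r :: real
 show "rb x y = rb y x" unfolding rb_sum by (simp add: mult.commute)
 show "rb (x + y) z = rb x z + rb y z" unfolding rb_sum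
  by (simp add: distrib_right sum.distrib algebra_simps)
 show "rb (r *\<^sub>R x) y = r * rb x y" unfolding rb_sum scaleR_fun_def
  by (simp add: sum_distrib_left algebra_simps)
 show "0 \<le> rb x x" unfolding rb_self
  by (intro add_nonneg_nonneg sum_nonneg mult_nonneg_nonneg) (auto simp: less_imp_le V1_pos)
qed (rule assms)

lemma rb_definite:
 assumes "x \<in> KS K (bd_index N)" "rb x x = 0" shows "x = 0"
proof -
 let ?A = "\<Sum>p\<in>E1 N \<times> {0, 1}. (cmod (x (Inl p)))\<^sup>2" and ?B = "\<Sum>v\<in>V1 N. (cmod (x (Inr v)))\<^sup>2 * vweight N v"
 have nn: "?A \<ge> 0" "?B \<ge> 0" by (auto intro!: sum_nonneg mult_nonneg_nonneg simp: less_imp_le V1_pos)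
 then have AB: "?A = 0" "?B = 0" using assms(2) unfolding rb_self by linarith+
 have "\<forall>p\<in>E1 N \<times> {0, 1}. (cmod (x (Inl p)))\<^sup>2 = 0" using AB(1) by (subst (asm) sum_nonneg_eq_0_iff) auto
 then have A: "x (Inl p) = 0" if "p \<in> E1 N \<times> {0, 1}" for p using that by auto
 have "\<forall>v\<in>V1 N. (cmod (x (Inr v)))\<^sup>2 * vweight N v = 0"
  using AB(2) by (subst (asm) sum_nonneg_eq_0_iff) (auto simp: less_imp_le V1_pos)
 then have B: "x (Inr v) = 0" if "v \<in> V1 N" for v using that V1_pos[of v] by auto
 have "x i = 0" for i
 proof (cases "i \<in> bd_index N")
  case True
  then show ?thesis using A B by (auto simp: bd_index_def)
 qed (use assms(1) in \<open>simp add: KS_def\<close>)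
 then show ?thesis by (simp add: fun_eq_iff)
qed

lemma finite_bd_index [simp]: "finite (bd_index N)" by (simp add: bd_index_def)

lemma subspace_of_real: "subspace_of K W Y \<Longrightarrow> subspace Y"
 unfolding subspace_def subspace_of_def zero_fun_def plus_fun_def scaleR_fun_def scaleR_conv_of_real
 by (intro conjI ballI allI) (auto intro: K_closed_ops(3))

text \<open>Spans are taken over the reals, so each coordinate contributes the two vectors with
  entries \<open>1\<close> and \<open>\<i>\<close>.\<close>

lemma KS_span:
 "\<exists>D. finite D \<and> KS K (bd_index N) \<subseteq> span (D :: ('v, 'e) bvec set)"
proof -
 define d where "d c i = (\<lambda>j. if j = i then c else (0::complex))" for c and i :: "('e \<times> nat) + 'v"
 define D where "D = d 1 ` bd_index N \<union> d \<i> ` bd_index N"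
 have "x \<in> span D" if x: "x \<in> KS K (bd_index N)" for x
 proof -
  have "x = (\<Sum>i\<in>bd_index N. Re (x i) *\<^sub>R d 1 i + Im (x i) *\<^sub>R d \<i> i)"
  proof
   fix j
   have sum_apply: "(\<Sum>i\<in>I. f i) j = (\<Sum>i\<in>I. f i j)" if "finite I" for I and f :: "('e \<times> nat) + 'v \<Rightarrow> ('v, 'e) bvec"
    using that by induction auto
   have "(\<Sum>i\<in>bd_index N. Re (x i) *\<^sub>R d 1 i + Im (x i) *\<^sub>R d \<i> i) j
    = (\<Sum>i\<in>bd_index N. if i = j then x j else 0)"
    unfolding sum_apply[OF finite_bd_index]
    by (intro sum.cong refl) (auto simp: d_def scaleR_fun_def complex_eq_iff)
   also have "\<dots> = x j" using x by (auto simp: KS_def)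
   finally show "x j = (\<Sum>i\<in>bd_index N. Re (x i) *\<^sub>R d 1 i + Im (x i) *\<^sub>R d \<i> i) j" by simp
  qed
  also have "\<dots> \<in> span D"
   by (intro span_sum span_add span_scale span_base) (auto simp: D_def)
  finally show ?thesis .
 qed
 moreover have "finite D" by (simp add: D_def)
 ultimately show ?thesis by blast
qed

lemma rb_expansion:
 assumes Y: "subspace Y" "Y \<subseteq> KS K (bd_index N)"
 shows "\<exists>E. finite E \<and> E \<subseteq> Y \<and> (\<forall>e\<in>E. rb e e = 1) \<and> (\<forall>x\<in>Y. x = (\<Sum>e\<in>E. rb x e *\<^sub>R e))"
proof -
 interpret Y: semi_inner Y rb by (rule rb_semi_inner[OF Y(1)])
 obtain D where D: "finite D" "KS K (bd_index N) \<subseteq> span (D :: ('v, 'e) bvec set)" using KS_span by blast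
 obtain B where B: "B \<subseteq> Y" "independent B" "Y \<subseteq> span B" by (rule maximal_independent_subset)
 have fin: "finite B"
  using independent_span_bound[OF D(1) B(2) order_trans[OF B(1) order_trans[OF Y(2) D(2)]]] by (rule conjunct1)
 have def: "x = 0" if "x \<in> Y" "rb x x = 0" for x
  by (rule rb_definite[OF subsetD[OF Y(2) that(1)] that(2)])
 from Y.orthonormal_expansion[OF fin B(1) def] obtain E where E: "finite E \<and> E \<subseteq> Y \<and> (\<forall>e\<in>E. rb e e = 1) \<and>
   (\<forall>e\<in>E. \<forall>e'\<in>E. e \<noteq> e' \<longrightarrow> rb e e' = 0) \<and> (\<forall>x\<in>span B. x = (\<Sum>e\<in>E. rb x e *\<^sub>R e))" ..
 show ?thesis
 proof (intro exI[of _ E] conjI)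
  show "\<forall>x\<in>Y. x = (\<Sum>e\<in>E. rb x e *\<^sub>R e)"
   by (rule ballI, rule E[THEN conjunct2, THEN conjunct2, THEN conjunct2, THEN conjunct2, THEN bspec])
    (rule subsetD[OF B(3)])
 qed (use E in simp_all)
qed

lemma rb_bounded:
 assumes Y: "subspace_of K (KS K (bd_index N)) Y"
  and L: "\<And>x. x \<in> Y \<Longrightarrow> L x \<in> Y" "\<And>x y. x \<in> Y \<Longrightarrow> y \<in> Y \<Longrightarrow> L (x + y) = L x + L y"
   "\<And>x r. x \<in> Y \<Longrightarrow> L (r *\<^sub>R x) = r *\<^sub>R L x"
 shows "\<exists>C\<ge>0. \<forall>x\<in>Y. sqrt (rb (L x) (L x)) \<le> C * sqrt (rb x x)"
proof -
 have sY: "subspace Y" by (rule subspace_of_real[OF Y])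
 interpret Y: semi_inner Y rb by (rule rb_semi_inner[OF sY])
 have sub: "Y \<subseteq> KS K (bd_index N)" using Y by (simp add: subspace_of_def)
 obtain E where EE: "finite E \<and> E \<subseteq> Y \<and> (\<forall>e\<in>E. rb e e = 1) \<and> (\<forall>x\<in>Y. x = (\<Sum>e\<in>E. rb x e *\<^sub>R e))"
  using rb_expansion[OF sY sub] by (rule exE)
 note E = EE[THEN conjunct1] EE[THEN conjunct2, THEN conjunct1] EE[THEN conjunct2, THEN conjunct2, THEN conjunct1] EE[THEN conjunct2, THEN conjunct2, THEN conjunct2]
 have "\<exists>C\<ge>0. \<forall>x\<in>Y. Y.nrm (L x) \<le> C * Y.nrm x"
  by (rule Y.bounded_if_expansion[OF E(1,2) bspec[OF E(3)] bspec[OF E(4)] L])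
 then show ?thesis by (simp add: Y.nrm_def)
qed

text \<open>The coefficients of the orthonormal expansion are continuous under pointwise
  convergence, so the limit has an expansion in the same vectors of \<open>Y\<close>.\<close>

lemma rb_closed:
 assumes Y: "subspace_of K (KS K (bd_index N)) Y" and x: "\<And>n. x n \<in> Y"
  and lim: "\<And>i. i \<in> bd_index N \<Longrightarrow> (\<lambda>n. x n i) \<longlonglongrightarrow> y i" and off: "\<And>i. i \<notin> bd_index N \<Longrightarrow> y i = 0"
 shows "y \<in> Y"
proof -
 have sY: "subspace Y" by (rule subspace_of_real[OF Y])
 have sub: "Y \<subseteq> KS K (bd_index N)" using Y by (simp add: subspace_of_def)
 obtain E where EE: "finite E \<and> E \<subseteq> Y \<and> (\<forall>e\<in>E. rb e e = 1) \<and> (\<forall>x\<in>Y. x = (\<Sum>e\<in>E. rb x e *\<^sub>R e))"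
  using rb_expansion[OF sY sub] by (rule exE)
 note E = EE[THEN conjunct1] EE[THEN conjunct2, THEN conjunct1] EE[THEN conjunct2, THEN conjunct2, THEN conjunct1] EE[THEN conjunct2, THEN conjunct2, THEN conjunct2]
 have limi: "(\<lambda>n. x n i) \<longlonglongrightarrow> y i" for i
 proof (cases "i \<in> bd_index N")
  case False
  have "x n i = 0" for n using x[of n] sub False by (auto simp: KS_def)
  then show ?thesis using off[OF False] by simp
 qed (rule lim)
 have rbl: "(\<lambda>n. rb (x n) e) \<longlonglongrightarrow> rb y e" for e
  unfolding rb_sum by (intro tendsto_intros limi)
 have "y i = (\<Sum>e\<in>E. rb y e *\<^sub>R e) i" for i
 proof (rule LIMSEQ_unique[OF limi])
  have app: "(\<Sum>e\<in>F. c e *\<^sub>R e) i = (\<Sum>e\<in>F. c e *\<^sub>R e i)" if "finite F" for F and c :: "('v, 'e) bvec \<Rightarrow> real"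
   using that by induction (auto simp: scaleR_fun_def)
  have "x n i = (\<Sum>e\<in>E. rb (x n) e *\<^sub>R e i)" for n
  proof -
   have "x n = (\<Sum>e\<in>E. rb (x n) e *\<^sub>R e)" by (rule bspec[OF E(4) x])
   then have "x n i = (\<Sum>e\<in>E. rb (x n) e *\<^sub>R e) i" by (rule fun_cong)
   then show ?thesis unfolding app[OF E(1)] .
  qed
  moreover have "(\<lambda>n. \<Sum>e\<in>E. rb (x n) e *\<^sub>R e i) \<longlonglongrightarrow> (\<Sum>e\<in>E. rb y e *\<^sub>R e i)"
   by (intro tendsto_sum tendsto_scaleR rbl tendsto_const)
  ultimately show "(\<lambda>n. x n i) \<longlonglongrightarrow> (\<Sum>e\<in>E. rb y e *\<^sub>R e) i" unfolding app[OF E(1)] by simp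
 qed
 then have "y = (\<Sum>e\<in>E. rb y e *\<^sub>R e)" by (simp add: fun_eq_iff)
 also have "\<dots> \<in> Y" using E(2) by (intro subspace_sum[OF sY] subspace_scale[OF sY]) auto
 finally show ?thesis .
qed

lemma bd_index_at_sub: "bd_index_at N v \<subseteq> bd_index N"
 by (auto simp: bd_index_at_def bd_index_def E1_at_def)

lemma KS_mono: "S \<subseteq> S' \<Longrightarrow> KS K S \<subseteq> KS K S'"
 by (auto simp: KS_def)

lemma subspace_of_at: "subspace_of K (KS K (bd_index_at N v)) Y \<Longrightarrow> subspace_of K (KS K (bd_index N)) Y"
 using KS_mono[OF bd_index_at_sub] unfolding subspace_of_def by blast

lemma coordinate_le:
 assumes "i \<in> bd_index N"
 shows "\<exists>A\<ge>0. \<forall>x :: ('v, 'e) bvec. cmod (x i) \<le> A * sqrt (rb x x)"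
proof -
 have nn: "0 \<le> (cmod (x (Inr v)))\<^sup>2 * vweight N v" if "v \<in> V1 N" for x :: "('v, 'e) bvec" and v
  using that V1_pos[of v] by simp
 show ?thesis
 proof (cases i)
  case (Inl p)
  have "cmod (x i) \<le> 1 * sqrt (rb x x)" for x :: "('v, 'e) bvec"
  proof -
   have "(cmod (x (Inl p)))\<^sup>2 \<le> (\<Sum>p\<in>E1 N \<times> {0, 1}. (cmod (x (Inl p)))\<^sup>2)"
    using assms Inl by (intro member_le_sum) (auto simp: bd_index_def)
   also have "\<dots> \<le> rb x x" unfolding rb_self using nn by (simp add: sum_nonneg)
   finally show ?thesis using Inl by (simp add: real_le_rsqrt)
  qed
  then show ?thesis by (intro exI[of _ 1]) simp
 next
  case (Inr v)
  then have v: "v \<in> V1 N" "vweight N v > 0" using assms V1_pos by (auto simp: bd_index_def)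
  have "cmod (x i) \<le> (1 / sqrt (vweight N v)) * sqrt (rb x x)" for x :: "('v, 'e) bvec"
  proof -
   have "(cmod (x (Inr v)))\<^sup>2 * vweight N v \<le> (\<Sum>v\<in>V1 N. (cmod (x (Inr v)))\<^sup>2 * vweight N v)"
    using v nn by (intro member_le_sum) auto
   also have "\<dots> \<le> rb x x" unfolding rb_self by (simp add: sum_nonneg)
   finally have "sqrt ((cmod (x (Inr v)))\<^sup>2 * vweight N v) \<le> sqrt (rb x x)" by (rule real_sqrt_le_mono)
   then have "cmod (x (Inr v)) * sqrt (vweight N v) \<le> sqrt (rb x x)" by (simp add: real_sqrt_mult)
   then show ?thesis using Inr v by (simp add: field_simps)
  qed
  then show ?thesis using v by (intro exI[of _ "1 / sqrt (vweight N v)"]) simp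
 qed
qed

lemma op_exp_derivative_subspace:
 assumes Y: "subspace_of K (KS K (bd_index N)) Y" and sa: "selfadjoint_in K N Y L" and x: "x \<in> Y"
  and i: "i \<in> bd_index N"
 shows "((\<lambda>t. (op_exp L (- t) x i - x i) / complex_of_real t) \<longlongrightarrow> - L x i) (at_right 0)"
proof -
 have LY: "L x \<in> Y" if "x \<in> Y" for x using sa that by (auto simp: selfadjoint_in_def)
 have "\<exists>C\<ge>0. \<forall>x\<in>Y. sqrt (rb (L x) (L x)) \<le> C * sqrt (rb x x)"
 proof (rule rb_bounded[OF Y LY])
  show "L (x + y) = L x + L y" if "x \<in> Y" "y \<in> Y" for x y
   using sa that by (simp add: selfadjoint_in_def plus_fun_def)
  show "L (r *\<^sub>R x) = r *\<^sub>R L x" if "x \<in> Y" for x r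
   using sa that K_closed_ops(3)[of r] by (simp add: selfadjoint_in_def scaleR_fun_def scaleR_conv_of_real)
 qed
 then obtain C where C: "C \<ge> 0" "\<And>x. x \<in> Y \<Longrightarrow> sqrt (rb (L x) (L x)) \<le> C * sqrt (rb x x)" by blast
 obtain A where A: "A \<ge> 0" "\<And>x :: ('v, 'e) bvec. cmod (x i) \<le> A * sqrt (rb x x)" using coordinate_le[OF i] by blast
 have pow: "(L ^^ n) x \<in> Y \<and> sqrt (rb ((L ^^ n) x) ((L ^^ n) x)) \<le> C ^ n * sqrt (rb x x)" for n
 proof (induction n)
  case (Suc n)
  have "sqrt (rb (L ((L ^^ n) x)) (L ((L ^^ n) x))) \<le> C * sqrt (rb ((L ^^ n) x) ((L ^^ n) x))" using C(2) Suc by blast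
  also have "\<dots> \<le> C * (C ^ n * sqrt (rb x x))" using Suc C(1) by (intro mult_left_mono) auto
  finally show ?case using LY Suc by simp
 qed (use x in simp)
 show ?thesis
 proof (rule op_exp_derivative)
  fix n
  have "cmod ((L ^^ n) x i) \<le> A * sqrt (rb ((L ^^ n) x) ((L ^^ n) x))" by (rule A(2))
  also have "\<dots> \<le> A * (C ^ n * sqrt (rb x x))" using pow[of n] A(1) by (intro mult_left_mono) auto
  finally show "cmod ((L ^^ n) x i) \<le> (A * sqrt (rb x x)) * C ^ n" by (simp add: mult_ac)
 qed
qed

end

locale net_cone = net + cone_map
begin

text \<open>Infinitesimal form of the invariance of \<open>{x. P \<circ> x = x}\<close> under \<open>exp (-t L)\<close>.\<close>

lemma invariant_derivative:
 assumes Y: "subspace_of K (KS K (bd_index N)) Y" and sa: "selfadjoint_in K N Y L" and y: "y \<in> Y"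
  and px: "\<And>i. y i = P (x i)"
  and inv: "\<And>t i. t \<ge> 0 \<Longrightarrow> i \<in> bd_index N \<Longrightarrow> P (op_exp L (- t) y i) = op_exp L (- t) y i"
 shows "0 \<le> rb (L y) (\<lambda>i. x i - y i)"
proof -
 have "((\<lambda>t. rb (\<lambda>i. (op_exp L (- t) y i - y i) / complex_of_real t) (\<lambda>i. x i - y i))
   \<longlongrightarrow> rb (\<lambda>i. - L y i) (\<lambda>i. x i - y i)) (at_right 0)"
  unfolding rb_sum
  by (intro tendsto_intros op_exp_derivative_subspace[OF Y sa y]) (auto simp: bd_index_def)
 moreover have "\<forall>\<^sub>F t in at_right 0. rb (\<lambda>i. (op_exp L (- t) y i - y i) / complex_of_real t) (\<lambda>i. x i - y i) \<le> 0"
  using eventually_at_right_less[of "0::real"]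
 proof eventually_elim
  case (elim t)
  have le: "Re ((op_exp L (- t) y i - y i) / complex_of_real t * cnj (x i - y i)) \<le> 0" if i: "i \<in> bd_index N" for i
  proof -
   let ?u = "op_exp L (- t) y i"
   \<comment> \<open>\<open>op_exp L (- t) y\<close> is again fixed by \<open>P\<close>, so it is an
     admissible point of the convex set in the variational inequality at \<open>x i\<close>.\<close>
   have "Re ((x i - P (x i)) * cnj (P ?u - P (x i))) \<le> 0" by (rule cone)
   then have "Re ((x i - y i) * cnj (?u - y i)) \<le> 0" using inv[of t i] elim i px[of i] by simp
   moreover have "(?u - y i) / complex_of_real t * cnj (x i - y i) = cnj ((x i - y i) * cnj (?u - y i)) / complex_of_real t"
    by (simp add: mult.commute)
   then have "Re ((?u - y i) / complex_of_real t * cnj (x i - y i)) = Re ((x i - y i) * cnj (?u - y i)) / t"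
    by (simp only: Re_divide_of_real cnj.sel(1))
   ultimately show ?thesis using elim by (simp only: divide_nonpos_pos)
  qed
  show ?case unfolding rb_sum
  proof (intro add_nonpos_nonpos sum_nonpos)
   show "Re ((op_exp L (- t) y (Inl p) - y (Inl p)) / complex_of_real t * cnj (x (Inl p) - y (Inl p))) \<le> 0"
    if p: "p \<in> E1 N \<times> {0, 1}" for p
    by (rule le[unfolded bd_index_def]) (rule InlI[OF p])
   show "Re ((op_exp L (- t) y (Inr v) - y (Inr v)) / complex_of_real t * cnj (x (Inr v) - y (Inr v))) * vweight N v \<le> 0"
    if v: "v \<in> V1 N" for v
   proof (rule mult_nonpos_nonneg[OF le])
    show "Inr v \<in> bd_index N" unfolding bd_index_def by (rule InrI[OF v])
    show "0 \<le> vweight N v" using V1_pos[OF v] by simp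
   qed
  qed
 qed
 ultimately have "rb (\<lambda>i. - L y i) (\<lambda>i. x i - y i) \<le> 0" by (rule tendsto_upperbound) simp
 moreover have "rb (\<lambda>i. - L y i) (\<lambda>i. x i - y i) = - rb (L y) (\<lambda>i. x i - y i)"
  unfolding rb_sum minus_add_distrib sum_negf[symmetric]
  by (intro arg_cong2[of _ _ _ _ "(+)"] sum.cong refl) (simp_all add: algebra_simps)
 ultimately show ?thesis by linarith
qed

end

section \<open>Sublattices and local boundary conditions\<close>

lemma subspace_ofD:
 assumes "subspace_of K W Y"
 shows "x \<in> Y \<Longrightarrow> x \<in> W" "(\<lambda>_. 0) \<in> Y" "x \<in> Y \<Longrightarrow> y \<in> Y \<Longrightarrow> (\<lambda>i. x i + y i) \<in> Y"
  "c \<in> K \<Longrightarrow> x \<in> Y \<Longrightarrow> (\<lambda>i. c * x i) \<in> Y"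
 using assms unfolding subspace_of_def by blast+

lemma subspace_of_sum:
 assumes "subspace_of K W Y" "finite A" "\<And>a. a \<in> A \<Longrightarrow> x a \<in> Y"
 shows "(\<lambda>i. \<Sum>a\<in>A. x a i) \<in> Y"
 using assms(2,3) by induction (auto intro: subspace_ofD[OF assms(1)])

text \<open>This is the derivative of the modulus at \<open>cmod z\<close> in the direction
  \<open>z\<close>, along the step sizes \<open>1 / Suc n\<close>. The quotient is computed by
  extending with \<open>cmod (w n) + r\<close>, since the difference of the squares is polynomial in
  the step size.\<close>

lemma tendsto_Re_modulus:
 "(\<lambda>n. real (Suc n) * (cmod (complex_of_real (cmod z) + complex_of_real (1 / real (Suc n)) * z) - cmod z)) \<longlonglongrightarrow> Re z"
proof (cases "z = 0")
 case False
 define r where "r = cmod z"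
 have r: "r > 0" using False by (simp add: r_def)
 define w where "w n = complex_of_real r + complex_of_real (1 / real (Suc n)) * z" for n
 have lim: "(\<lambda>n. 1 / real (Suc n)) \<longlonglongrightarrow> 0" using LIMSEQ_inverse_real_of_nat by (simp add: inverse_eq_divide)
 have "w \<longlonglongrightarrow> complex_of_real r + complex_of_real 0 * z"
  unfolding w_def by (intro tendsto_add tendsto_const tendsto_mult tendsto_of_real lim)
 then have "(\<lambda>n. cmod (w n)) \<longlonglongrightarrow> cmod (complex_of_real r)" by (intro tendsto_norm) simp
 then have wl: "(\<lambda>n. cmod (w n)) \<longlonglongrightarrow> r" using r by simp
 have eq: "real (Suc n) * (cmod (w n) - r) = (2 * r * Re z + r\<^sup>2 * (1 / real (Suc n))) / (cmod (w n) + r)" for n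
 proof -
  define k where "k = 1 / real (Suc n)"
  have rz: "r\<^sup>2 = (Re z)\<^sup>2 + (Im z)\<^sup>2" unfolding r_def by (rule cmod_power2)
  have "(cmod (w n))\<^sup>2 = (r + k * Re z)\<^sup>2 + (k * Im z)\<^sup>2"
   unfolding cmod_power2 w_def k_def[symmetric] by simp
  also have "\<dots> = r\<^sup>2 + 2 * r * k * Re z + k\<^sup>2 * r\<^sup>2" using rz by algebra
  finally have "(cmod (w n) - r) * (cmod (w n) + r) = k * (2 * r * Re z + r\<^sup>2 * k)"
   by (simp add: power2_eq_square algebra_simps)
  then have "real (Suc n) * (cmod (w n) - r) * (cmod (w n) + r) = (real (Suc n) * k) * (2 * r * Re z + r\<^sup>2 * k)"
   by (simp only: mult.assoc)
  also have "real (Suc n) * k = 1" by (simp add: k_def)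
  finally have "real (Suc n) * (cmod (w n) - r) * (cmod (w n) + r) = 2 * r * Re z + r\<^sup>2 * k" by simp
  moreover have "cmod (w n) + r \<noteq> 0" using r norm_ge_zero[of "w n"] by linarith
  ultimately show ?thesis unfolding k_def[symmetric] by (rule nonzero_eq_divide_eq[THEN iffD2, rotated])
 qed
 have "(\<lambda>n. (2 * r * Re z + r\<^sup>2 * (1 / real (Suc n))) / (cmod (w n) + r)) \<longlonglongrightarrow> (2 * r * Re z + r\<^sup>2 * 0) / (r + r)"
  using r by (intro tendsto_divide tendsto_add tendsto_const tendsto_mult lim wl) auto
 moreover have "(2 * r * Re z + r\<^sup>2 * 0) / (r + r) = Re z" using r by simp
 ultimately have "(\<lambda>n. real (Suc n) * (cmod (w n) - r)) \<longlonglongrightarrow> Re z" unfolding eq by simp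
 then show ?thesis unfolding w_def r_def .
qed simp

context net
begin

text \<open>In the complex case, the real part is recovered as the directional derivative of the modulus.\<close>

lemma positive_part_mem:
 assumes Y: "subspace_of K (KS K (bd_index N)) Y" and abs: "\<And>x. x \<in> Y \<Longrightarrow> (\<lambda>i. complex_of_real (cmod (x i))) \<in> Y"
  and x: "x \<in> Y"
 shows "(\<lambda>i. complex_of_real (max (Re (x i)) 0)) \<in> Y"
proof -
 have re: "(\<lambda>i. complex_of_real (Re (x i))) \<in> Y"
 proof (rule rb_closed[OF Y])
  fix n
  let ?a = "\<lambda>i. complex_of_real (cmod (x i))" and ?k = "complex_of_real (1 / real (Suc n))"
  let ?b = "\<lambda>i. complex_of_real (cmod (?a i + ?k * x i))"
  have "?b \<in> Y"
   by (intro abs subspace_ofD(3,4)[OF Y] x K_closed_ops(3))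
  then have "(\<lambda>i. complex_of_real (real (Suc n)) * (?b i + complex_of_real (- 1) * ?a i)) \<in> Y"
   by (intro abs subspace_ofD(3,4)[OF Y] x K_closed_ops(3))
  moreover have "complex_of_real (real (Suc n)) * (?b i + complex_of_real (- 1) * ?a i)
   = complex_of_real (real (Suc n) * (cmod (?a i + ?k * x i) - cmod (x i)))" for i
   by (simp only: of_real_mult of_real_diff of_real_minus of_real_1 mult_minus1 add_uminus_conv_diff)
  ultimately show "(\<lambda>i. complex_of_real (real (Suc n) * (cmod (?a i + ?k * x i) - cmod (x i)))) \<in> Y" by simp
 next
  fix i show "(\<lambda>n. complex_of_real (real (Suc n) * (cmod (complex_of_real (cmod (x i)) + complex_of_real (1 / real (Suc n)) * x i) - cmod (x i))))
   \<longlonglongrightarrow> complex_of_real (Re (x i))" by (rule tendsto_of_real[OF tendsto_Re_modulus])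
 next
  fix i assume "i \<notin> bd_index N"
  then show "complex_of_real (Re (x i)) = 0" using subspace_ofD(1)[OF Y x] by (simp add: KS_def)
 qed
 have "(\<lambda>i. complex_of_real (1/2) * (complex_of_real (Re (x i)) + complex_of_real (cmod (complex_of_real (Re (x i)))))) \<in> Y"
  by (intro subspace_ofD(3,4)[OF Y] abs re K_closed_ops(3))
 moreover have "complex_of_real (1/2) * (complex_of_real (Re (x i)) + complex_of_real (cmod (complex_of_real (Re (x i)))))
  = complex_of_real (max (Re (x i)) 0)" for i
  unfolding of_real_add[symmetric] of_real_mult[symmetric] norm_of_real by (simp add: max_def)
 ultimately show ?thesis by simp
qed

text \<open>Truncating large multiples of \<open>\<bar>w\<bar>\<close> gives the indicator of \<open>{w \<noteq> 0}\<close>; so a Stonean sublattice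
 contains the indicators of the level sets of its elements.\<close>

lemma stonean_compose:
 assumes Y: "stonean_sublattice K S Y" and S: "finite S" and x: "x \<in> Y"
  and F: "F 0 = 0" "\<And>c. c \<in> K \<Longrightarrow> F c \<in> K"
 shows "(\<lambda>i. F (x i)) \<in> Y"
proof -
 have sY: "subspace_of K (KS K S) Y" using Y by (simp add: stonean_sublattice_def sublattice_def)
 have KSD: "w i = 0" if "w \<in> Y" "i \<notin> S" for w i using subspace_ofD(1)[OF sY that(1)] that(2) by (simp add: KS_def)
 have ind: "(\<lambda>i. if w i \<noteq> 0 then 1 else 0) \<in> Y" if w: "w \<in> Y" for w
 proof -
  \<comment> \<open>A factor for which \<open>c * cmod (w i) \<ge> 1\<close> wherever
    \<open>w i\<close> is nonzero; at zeros of \<open>w\<close> the summand is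
    \<open>1 / 0 = 0\<close>.\<close>
  define c where "c = (\<Sum>i\<in>S. 1 / cmod (w i))"
  have c: "c * cmod (w i) \<ge> 1" if i: "i \<in> S" "w i \<noteq> 0" for i
  proof -
   have "1 / cmod (w i) \<le> c" unfolding c_def using S i by (intro member_le_sum) auto
   then show ?thesis using i by (simp add: divide_le_eq)
  qed
  have "(\<lambda>i. complex_of_real (cmod (w i))) \<in> Y"
   using Y w by (simp add: stonean_sublattice_def sublattice_def)
  then have "(\<lambda>i. complex_of_real c * complex_of_real (cmod (w i))) \<in> Y"
   by (intro subspace_ofD(4)[OF sY] K_closed_ops(3))
  then have m: "(\<lambda>i. complex_of_real (min (Re (complex_of_real c * complex_of_real (cmod (w i)))) (indicator S i))) \<in> Y"
   using Y unfolding stonean_sublattice_def by auto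
  have "complex_of_real (min (Re (complex_of_real c * complex_of_real (cmod (w i)))) (indicator S i)) = (if w i \<noteq> 0 then 1 else 0)" for i
  proof (cases "i \<in> S")
   case True
   then show ?thesis using c[OF True] by (cases "w i = 0") (auto simp: min_def)
  next
   case False
   then show ?thesis using KSD[OF w False] by simp
  qed
  then show ?thesis using m by simp
 qed
 define e where "e i = (if x i \<noteq> 0 then 1 else 0 :: complex)" for i
 have e: "e \<in> Y" using ind[OF x] by (simp add: e_def[abs_def])
 \<comment> \<open>\<open>d c\<close> is the indicator of the points where \<open>x\<close> differs
   from both \<open>c\<close> and 0, so \<open>f c\<close> is that of the points where
   \<open>x\<close> equals \<open>c\<close> and is nonzero. Using \<open>e\<close> in place of the
   constant 1 keeps everything inside \<open>Y\<close>.\<close>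
 define d where "d c i = (if x i + (- c) * e i \<noteq> 0 then 1 else 0 :: complex)" for c i
 define f where "f c i = e i + complex_of_real (- 1) * d c i" for c i
 have xK: "x i \<in> K" if "i \<in> S" for i using subspace_ofD(1)[OF sY x] that by (simp add: KS_def)
 have "f c \<in> Y" if c: "c \<in> K" for c
 proof -
  have "(\<lambda>i. x i + (- c) * e i) \<in> Y" using c by (intro subspace_ofD(3,4)[OF sY] x e K_closed_ops(8))
  then have "d c \<in> Y" unfolding d_def by (rule ind)
  then show ?thesis unfolding f_def by (intro subspace_ofD(3,4)[OF sY] e K_closed_ops(3))
 qed
 then have m: "(\<lambda>i. \<Sum>c\<in>x ` S. F c * f c i) \<in> Y"
  using S xK F(2) by (intro subspace_of_sum[OF sY] subspace_ofD(4)[OF sY]) auto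
 have "(\<Sum>c\<in>x ` S. F c * f c i) = F (x i)" for i
 proof (cases "x i = 0")
  case True
  then show ?thesis by (simp add: f_def d_def e_def F)
 next
  case False
  then have i: "i \<in> S" using KSD[OF x] by blast
  have "(\<Sum>c\<in>x ` S. F c * f c i) = (\<Sum>c\<in>x ` S. if c = x i then F (x i) else 0)"
   using False by (intro sum.cong refl) (auto simp: f_def d_def e_def)
  also have "\<dots> = F (x i)" using S i by simp
  finally show ?thesis .
 qed
 then show ?thesis using m by simp
qed

lemma bd_index_at_disjoint: "i \<in> bd_index_at N v \<Longrightarrow> i \<in> bd_index_at N w \<Longrightarrow> v = w"
 by (auto simp: bd_index_at_def E1_at_def split: if_splits)

lemma finite_bd_index_at: "finite (bd_index_at N v)"
 by (rule finite_subset[OF bd_index_at_sub finite_bd_index])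

lemma rb_cong:
 assumes "\<And>i. i \<in> bd_index N \<Longrightarrow> Re (x i * cnj (y i)) = Re (x' i * cnj (y' i))"
 shows "rb x y = rb x' y'"
 unfolding rb_sum
proof (intro arg_cong2[of _ _ _ _ "(+)"] sum.cong refl)
 show "Re (x (Inl p) * cnj (y (Inl p))) = Re (x' (Inl p) * cnj (y' (Inl p)))" if "p \<in> E1 N \<times> {0, 1}" for p
  by (rule assms) (unfold bd_index_def, rule InlI[OF that])
 show "Re (x (Inr p) * cnj (y (Inr p))) * vweight N p = Re (x' (Inr p) * cnj (y' (Inr p))) * vweight N p" if "p \<in> V1 N" for p
  by (rule arg_cong[of _ _ "\<lambda>r. r * vweight N p"], rule assms) (unfold bd_index_def, rule InrI[OF that])
qed

lemma rb_sum_left: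
 assumes "finite A" shows "rb (\<lambda>i. \<Sum>a\<in>A. z a i) y = (\<Sum>a\<in>A. rb (z a) y)"
proof -
 interpret U: semi_inner UNIV rb by (rule rb_semi_inner) simp
 show ?thesis using assms
 proof induction
  case empty
  show ?case by (simp add: rb_sum)
 next
  case (insert a A)
  have "rb (z a + (\<lambda>i. \<Sum>a\<in>A. z a i)) y = rb (z a) y + rb (\<lambda>i. \<Sum>a\<in>A. z a i) y" by (rule U.ip_add) auto
  then show ?case using insert by (simp add: plus_fun_def)
 qed
qed

end

section \<open>The boundary term under vertexwise projections\<close>

context net_cone
begin

text \<open>The blocks of different vertices have disjoint index sets, and \<open>P\<close> acts
  coordinatewise with \<open>P 0 = 0\<close>. Projection therefore commutes with the direct
  decomposition, and the boundary term becomes a sum of single-vertex terms, each nonnegative by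
  invariance.\<close>

lemma local_form:
 assumes loc: "local_bc K N X L Xv Lv"
  and cl: "\<And>v x. v \<in> verts (graph N) \<Longrightarrow> x \<in> Xv v \<Longrightarrow> (\<lambda>i. P (x i)) \<in> Xv v"
  and inv: "\<And>v x t i. v \<in> verts (graph N) \<Longrightarrow> x \<in> Xv v \<Longrightarrow> (\<And>i. P (x i) = x i) \<Longrightarrow> t \<ge> 0 \<Longrightarrow>
   i \<in> bd_index_at N v \<Longrightarrow> P (op_exp (Lv v) (- t) x i) = op_exp (Lv v) (- t) x i"
  and x: "x \<in> X"
 shows "(\<lambda>i. P (x i)) \<in> X" "0 \<le> rb (L (\<lambda>i. P (x i))) (\<lambda>i. x i - P (x i))"
proof -
 let ?V = "verts (graph N)"
 note l = loc[unfolded local_bc_def]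
 have sub: "subspace_of K (KS K (bd_index_at N v)) (Xv v)" and sa: "selfadjoint_in K N (Xv v) (Lv v)" if "v \<in> ?V" for v
  using bspec[OF conjunct1[OF l] that] by (rule conjunct1, rule conjunct2)
 obtain z where z: "x = (\<lambda>i. \<Sum>v\<in>?V. z v i)" "\<And>v. v \<in> ?V \<Longrightarrow> z v \<in> Xv v"
  using x conjunct1[OF conjunct2[OF l]] by auto
 define y where "y v = (\<lambda>i. P (z v i))" for v
 have yX: "y v \<in> Xv v" if "v \<in> ?V" for v unfolding y_def by (rule cl[OF that z(2)[OF that]])
 have off: "u i = 0" if "v \<in> ?V" "u \<in> Xv v" "i \<notin> bd_index_at N v" for u v i
  using subspace_ofD(1)[OF sub[OF that(1)] that(2)] that(3) by (simp add: KS_def)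
 have at: "(\<Sum>v\<in>?V. u v i) = u w i" if u: "\<And>v. v \<in> ?V \<Longrightarrow> u v \<in> Xv v" and w: "w \<in> ?V" "i \<in> bd_index_at N w"
  for u :: "'a \<Rightarrow> ('a, 'b) bvec" and i w
 proof -
  have "(\<Sum>v\<in>?V. u v i) = (\<Sum>v\<in>?V. if v = w then u w i else 0)"
   using off[OF _ u] bd_index_at_disjoint[OF w(2)] by (intro sum.cong refl) auto
  then show ?thesis using w(1) by simp
 qed
 have out: "(\<Sum>v\<in>?V. u v i) = 0" if u: "\<And>v. v \<in> ?V \<Longrightarrow> u v \<in> Xv v" and i: "\<And>w. w \<in> ?V \<Longrightarrow> i \<notin> bd_index_at N w"
  for u :: "'a \<Rightarrow> ('a, 'b) bvec" and i
  by (rule sum.neutral) (use off[OF _ u] i in auto)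
 have Px: "(\<lambda>i. P (x i)) = (\<lambda>i. \<Sum>v\<in>?V. y v i)"
 proof
  fix i
  show "P (x i) = (\<Sum>v\<in>?V. y v i)"
  proof (cases "\<exists>w\<in>?V. i \<in> bd_index_at N w")
   case True
   then obtain w where w: "w \<in> ?V" "i \<in> bd_index_at N w" by blast
   have "x i = z w i" unfolding z(1) by (rule at[OF z(2) w])
   moreover have "(\<Sum>v\<in>?V. y v i) = y w i" by (rule at[OF yX w])
   ultimately show ?thesis by (simp add: y_def)
  next
   case False
   then have i: "w \<in> ?V \<Longrightarrow> i \<notin> bd_index_at N w" for w by blast
   have "x i = 0" unfolding z(1) by (rule out[OF z(2) i])
   moreover have "(\<Sum>v\<in>?V. y v i) = 0" by (rule out[OF yX i])
   ultimately show ?thesis by simp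
  qed
 qed
 show "(\<lambda>i. P (x i)) \<in> X" unfolding Px using yX conjunct1[OF conjunct2[OF l]] by blast
 have Ly: "Lv v (y v) \<in> Xv v" if "v \<in> ?V" for v
  using sa[OF that] yX[OF that] by (auto simp: selfadjoint_in_def)
 have "L (\<lambda>i. P (x i)) = (\<lambda>i. \<Sum>v\<in>?V. Lv v (y v) i)"
  unfolding Px using yX conjunct2[OF conjunct2[OF l]] by blast
 then have "rb (L (\<lambda>i. P (x i))) (\<lambda>i. x i - P (x i)) = (\<Sum>v\<in>?V. rb (Lv v (y v)) (\<lambda>i. x i - P (x i)))"
  by (simp add: rb_sum_left)
 also have "\<dots> \<ge> 0"
 proof (rule sum_nonneg)
  fix v assume v: "v \<in> ?V"
  have "rb (Lv v (y v)) (\<lambda>i. x i - P (x i)) = rb (Lv v (y v)) (\<lambda>i. z v i - y v i)"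
  proof (rule rb_cong)
   fix i
   show "Re (Lv v (y v) i * cnj (x i - P (x i))) = Re (Lv v (y v) i * cnj (z v i - y v i))"
   proof (cases "i \<in> bd_index_at N v")
    case True
    have "x i = z v i" unfolding z(1) by (rule at[OF z(2) v True])
    then show ?thesis by (simp add: y_def)
   qed (simp add: off[OF v Ly[OF v]])
  qed
  also have "0 \<le> \<dots>"
  proof (rule invariant_derivative[OF subspace_of_at[OF sub[OF v]] sa[OF v] yX[OF v]])
   show "y v i = P (z v i)" for i by (simp add: y_def)
   fix t :: real and i assume t: "t \<ge> 0"
   show "P (op_exp (Lv v) (- t) (y v) i) = op_exp (Lv v) (- t) (y v) i"
   proof (cases "i \<in> bd_index_at N v")
    case True
    show ?thesis by (rule inv[OF v yX[OF v] _ t True]) (simp add: y_def P_idem)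
   next
    case False
    \<comment> \<open>\<open>op_exp\<close> is a coordinatewise series; all iterates stay in
      \<open>Xv v\<close> and hence vanish off the block of \<open>v\<close>, where the claim is
      then \<open>P 0 = 0\<close>.\<close>
    have "(Lv v ^^ n) (y v) \<in> Xv v" for n
     using sa[OF v] yX[OF v] by (induction n) (auto simp: selfadjoint_in_def)
    then have "(Lv v ^^ n) (y v) i = 0" for n by (rule off[OF v _ False])
    then have "op_exp (Lv v) (- t) (y v) i = 0" by (simp add: op_exp_def)
    then show ?thesis by simp
   qed
  qed
  finally show "0 \<le> rb (Lv v (y v)) (\<lambda>i. x i - P (x i))" .
 qed
 finally show "0 \<le> rb (L (\<lambda>i. P (x i))) (\<lambda>i. x i - P (x i))" .
qed

end

context net
begin

lemma local_positive:
 assumes loc: "local_bc K N X L Xv Lv"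
  and pos: "\<forall>v\<in>verts (graph N). sublattice K (bd_index_at N v) (Xv v) \<and>
     positivity_preserving (Xv v) (nonneg_on (bd_index_at N v)) (\<lambda>t. op_exp (Lv v) (- t))"
  and x: "x \<in> X"
 defines "P \<equiv> \<lambda>z. complex_of_real (max (Re z) 0)"
 shows "(\<lambda>i. P (x i)) \<in> X \<and> 0 \<le> rb (L (\<lambda>i. P (x i))) (\<lambda>i. x i - P (x i))"
proof -
 interpret C: net_cone N K P unfolding P_def
  by (rule net_cone.intro[OF net_axioms cone_map_positive])
 have nn: "P z = z \<longleftrightarrow> z \<in> \<real>\<^sub>\<ge>\<^sub>0" for z
  by (auto simp: P_def complex_eq_iff complex_nonneg_Reals_iff max_def)
 have cl: "(\<lambda>i. P (y i)) \<in> Xv v" if v: "v \<in> verts (graph N)" and y: "y \<in> Xv v" for v y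
 proof -
  note p = bspec[OF pos v]
  have Y: "subspace_of K (KS K (bd_index_at N v)) (Xv v)" "\<And>x. x \<in> Xv v \<Longrightarrow> (\<lambda>i. complex_of_real (cmod (x i))) \<in> Xv v"
   using p by (auto simp: sublattice_def)
  show ?thesis unfolding P_def by (rule positive_part_mem[OF subspace_of_at[OF Y(1)] Y(2) y])
 qed
 have inv: "P (op_exp (Lv v) (- t) y i) = op_exp (Lv v) (- t) y i"
  if v: "v \<in> verts (graph N)" and y: "y \<in> Xv v" and fx: "\<And>i. P (y i) = y i" and t: "t \<ge> 0" and i: "i \<in> bd_index_at N v"
  for v y t i
 proof -
  note p = bspec[OF pos v]
  have "nonneg_on (bd_index_at N v) y" unfolding nonneg_on_def using nn fx by blast
  then have "nonneg_on (bd_index_at N v) (op_exp (Lv v) (- t) y)"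
   using p y t by (auto simp: positivity_preserving_def)
  then show ?thesis
   unfolding nn nonneg_on_def using i by blast
 qed
 show ?thesis by (intro conjI C.local_form[OF loc cl inv x])
qed

text \<open>The vectors fixed by \<open>P\<close> are those of sup-norm at most \<open>r\<close>, so
  invariance under the vertex semigroup is its contractivity in the sup-norm. Closedness of
  \<open>Xv v\<close> under the radial projection comes from the Stonean property.\<close>

lemma local_ball:
 assumes loc: "local_bc K N X L Xv Lv"
  and pos: "\<forall>v\<in>verts (graph N). stonean_sublattice K (bd_index_at N v) (Xv v) \<and>
     submarkovian (Xv v) (nonneg_on (bd_index_at N v)) (sup_norm_on (bd_index_at N v)) (\<lambda>t. op_exp (Lv v) (- t))"
  and x: "x \<in> X" and r: "r > 0"
 defines "P \<equiv> \<lambda>z. if cmod z \<le> r then z else complex_of_real (r / cmod z) * z"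
 shows "(\<lambda>i. P (x i)) \<in> X \<and> 0 \<le> rb (L (\<lambda>i. P (x i))) (\<lambda>i. x i - P (x i))"
proof -
 interpret C: net_cone N K P unfolding P_def
  by (rule net_cone.intro[OF net_axioms cone_map_ball[OF r]])
 have cl: "(\<lambda>i. P (y i)) \<in> Xv v" if v: "v \<in> verts (graph N)" and y: "y \<in> Xv v" for v y
 proof -
  note p = bspec[OF pos v]
  show ?thesis
   by (rule stonean_compose[where F = P, OF conjunct1[OF p] finite_bd_index_at y C.P_0 C.P_K])
 qed
 have inv: "P (op_exp (Lv v) (- t) y i) = op_exp (Lv v) (- t) y i"
  if v: "v \<in> verts (graph N)" and y: "y \<in> Xv v" and fx: "\<And>i. P (y i) = y i" and t: "t \<ge> 0" and i: "i \<in> bd_index_at N v"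
  for v y t i
 proof -
  note p = bspec[OF pos v]
  have "cmod (P z) \<le> r" for z using r by (cases "z = 0") (auto simp: P_def norm_mult norm_divide)
  then have le: "cmod (y i) \<le> r" for i using fx[of i] by metis
  have "sup_norm_on (bd_index_at N v) y \<le> ennreal r"
   unfolding sup_norm_on_def by (intro SUP_least ennreal_leI le)
  moreover have "sup_norm_on (bd_index_at N v) y < \<infinity>" using calculation ennreal_less_top[of r] by (simp add: le_less_trans)
  ultimately have "sup_norm_on (bd_index_at N v) (op_exp (Lv v) (- t) y) \<le> ennreal r"
   using p y t unfolding submarkovian_def by (blast intro: order_trans)
  then have "ennreal (cmod (op_exp (Lv v) (- t) y i)) \<le> ennreal r"
   unfolding sup_norm_on_def using i by (auto simp: SUP_le_iff)
  then have "cmod (op_exp (Lv v) (- t) y i) \<le> r" using r by simp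
  then show ?thesis by (simp add: P_def)
 qed
 show ?thesis by (intro conjI C.local_form[OF loc cl inv x])
qed

end

section \<open>The Hilbert space of a network\<close>

context net
begin

lemma edge_E1: assumes e: "e \<in> E1 N" shows "edge K (lft N e) (rgt N e) (emeas N e)"
proof -
 have a: "e \<in> arcs (graph N)" using e by (simp add: E1_def)
 show ?thesis
  by (intro edge.intro scalars_axioms edge_axioms.intro lft_less_rgt finite_emeas sets_emeas ends_in_spt ends_null a e)
qed

definition rip :: "('v, 'e) gfun \<Rightarrow> ('v, 'e) gfun \<Rightarrow> real" where
 "rip f g = Re (hinner N f g)"

abbreviation hn :: "('v, 'e) gfun \<Rightarrow> real" where "hn \<equiv> semi_inner.nrm rip"

lemma rip_sum: "rip f g = (\<Sum>e\<in>E1 N. l2ip (emeas N e) (edge_part f e) (edge_part g e)) +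
  (\<Sum>v\<in>V1 N. Re (f (Inr v) * cnj (g (Inr v))) * vweight N v)"
 by (simp add: rip_def hinner_def l2ip_def)

lemma HS_D: "f \<in> HS K N \<Longrightarrow> e \<in> E1 N \<Longrightarrow> edge_part f e \<in> L2 K (emeas N e)" "f \<in> HS K N \<Longrightarrow> v \<in> V1 N \<Longrightarrow> f (Inr v) \<in> K"
 by (auto simp: HS_def)

lemma edge_part_fun:
 "edge_part (f + g) e = edge_part f e + edge_part g e" "edge_part (f - g) e = edge_part f e - edge_part g e"
 "edge_part (r *\<^sub>R f) e = r *\<^sub>R edge_part f e" "edge_part 0 e = 0"
 by (simp_all add: fun_eq_iff scaleR_fun_def)

lemma HS_linear: "f \<in> HS K N \<Longrightarrow> g \<in> HS K N \<Longrightarrow> c \<in> K \<Longrightarrow> (\<lambda>p. c * f p + g p) \<in> HS K N"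
 unfolding HS_def by (auto intro!: L2_add L2_mult)

lemma HS_zero: "(\<lambda>_. 0) \<in> HS K N" by (simp add: HS_def L2_zero)

lemma HS_mult: "f \<in> HS K N \<Longrightarrow> c \<in> K \<Longrightarrow> (\<lambda>p. c * f p) \<in> HS K N"
 using HS_linear[OF _ HS_zero] by simp

lemma HS_subspace: "subspace (HS K N)"
 unfolding subspace_def
proof (intro conjI ballI allI)
 fix f g :: "('v, 'e) gfun" and r :: real assume f: "f \<in> HS K N"
 show "r *\<^sub>R f \<in> HS K N" using HS_mult[OF f K_closed_ops(3)[of r]] by (simp add: scaleR_fun_def scaleR_conv_of_real)
 assume g: "g \<in> HS K N"
 show "f + g \<in> HS K N" using HS_linear[OF f g K_closed_ops(2)] by (simp add: plus_fun_def)
qed (use HS_zero in \<open>simp add: zero_fun_def\<close>)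

lemma HS_semi_inner: "semi_inner (HS K N) rip"
proof
 show "subspace (HS K N)" by (rule HS_subspace)
 fix f g h :: "('v, 'e) gfun" and r :: real
 assume f: "f \<in> HS K N" and g: "g \<in> HS K N"
 show "rip f g = rip g f" unfolding rip_sum
 proof (intro arg_cong2[of _ _ _ _ "(+)"] sum.cong refl)
  show "l2ip (emeas N e) (edge_part f e) (edge_part g e) = l2ip (emeas N e) (edge_part g e) (edge_part f e)" if "e \<in> E1 N" for e
   by (rule semi_inner.ip_sym[OF L2_semi_inner HS_D(1)[OF f that] HS_D(1)[OF g that]])
 qed (simp add: mult.commute)
 have "rip (r *\<^sub>R f) g = (\<Sum>e\<in>E1 N. r * l2ip (emeas N e) (edge_part f e) (edge_part g e)) +
  (\<Sum>v\<in>V1 N. r * (Re (f (Inr v) * cnj (g (Inr v))) * vweight N v))"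
  unfolding rip_sum edge_part_fun
 proof (intro arg_cong2[of _ _ _ _ "(+)"] sum.cong refl)
  show "l2ip (emeas N e) (r *\<^sub>R edge_part f e) (edge_part g e) = r * l2ip (emeas N e) (edge_part f e) (edge_part g e)" if "e \<in> E1 N" for e
   by (rule semi_inner.ip_scale[OF L2_semi_inner HS_D(1)[OF f that] HS_D(1)[OF g that]])
 qed (simp add: scaleR_fun_def algebra_simps)
 then show "rip (r *\<^sub>R f) g = r * rip f g" unfolding rip_sum by (simp only: sum_distrib_left distrib_left)
 show "0 \<le> rip f f" unfolding rip_sum
 proof (intro add_nonneg_nonneg sum_nonneg)
  show "0 \<le> l2ip (emeas N e) (edge_part f e) (edge_part f e)" if "e \<in> E1 N" for e
   by (rule semi_inner.ip_pos[OF L2_semi_inner HS_D(1)[OF f that]])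
  show "0 \<le> Re (f (Inr v) * cnj (f (Inr v))) * vweight N v" if "v \<in> V1 N" for v
   using V1_pos[OF that] by simp
 qed
 assume h: "h \<in> HS K N"
 have "rip (f + g) h = (\<Sum>e\<in>E1 N. l2ip (emeas N e) (edge_part f e) (edge_part h e) + l2ip (emeas N e) (edge_part g e) (edge_part h e)) +
  (\<Sum>v\<in>V1 N. Re (f (Inr v) * cnj (h (Inr v))) * vweight N v + Re (g (Inr v) * cnj (h (Inr v))) * vweight N v)"
  unfolding rip_sum edge_part_fun
 proof (intro arg_cong2[of _ _ _ _ "(+)"] sum.cong refl)
  show "l2ip (emeas N e) (edge_part f e + edge_part g e) (edge_part h e)
   = l2ip (emeas N e) (edge_part f e) (edge_part h e) + l2ip (emeas N e) (edge_part g e) (edge_part h e)" if "e \<in> E1 N" for e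
   by (rule semi_inner.ip_add[OF L2_semi_inner HS_D(1)[OF f that] HS_D(1)[OF g that] HS_D(1)[OF h that]])
 qed (simp add: algebra_simps)
 then show "rip (f + g) h = rip f h + rip g h" unfolding rip_sum sum.distrib by simp
qed

sublocale HH: semi_inner "HS K N" rip by (rule HS_semi_inner)

lemma rip_self:
 assumes "f \<in> HS K N"
 shows "rip f f = (\<Sum>e\<in>E1 N. (l2n (emeas N e) (edge_part f e))\<^sup>2) + (\<Sum>v\<in>V1 N. (cmod (f (Inr v)))\<^sup>2 * vweight N v)"
 unfolding rip_sum
proof (intro arg_cong2[of _ _ _ _ "(+)"] sum.cong refl)
 show "l2ip (emeas N e) (edge_part f e) (edge_part f e) = (l2n (emeas N e) (edge_part f e))\<^sup>2" if "e \<in> E1 N" for e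
  by (rule semi_inner.nrm_sq[OF L2_semi_inner HS_D(1)[OF assms that], symmetric])
 show "Re (f (Inr v) * cnj (f (Inr v))) * vweight N v = (cmod (f (Inr v)))\<^sup>2 * vweight N v" for v
  unfolding cmod_power2 by (simp add: power2_eq_square)
qed

lemma vertex_nonneg: "v \<in> V1 N \<Longrightarrow> 0 \<le> (cmod (z v))\<^sup>2 * vweight N v"
 using V1_pos by (simp add: less_imp_le)

lemma edge_le: assumes f: "f \<in> HS K N" and e: "e \<in> E1 N" shows "l2n (emeas N e) (edge_part f e) \<le> hn f"
proof -
 have "(l2n (emeas N e) (edge_part f e))\<^sup>2 \<le> (\<Sum>e\<in>E1 N. (l2n (emeas N e) (edge_part f e))\<^sup>2)"
  using e by (intro member_le_sum) auto
 also have "\<dots> \<le> rip f f" unfolding rip_self[OF f] by (simp, intro sum_nonneg vertex_nonneg)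
 finally show ?thesis unfolding HH.nrm_def by (rule real_le_rsqrt)
qed

lemma vertex_le: assumes f: "f \<in> HS K N" and v: "v \<in> V1 N" shows "cmod (f (Inr v)) * sqrt (vweight N v) \<le> hn f"
proof -
 have "(cmod (f (Inr v)) * sqrt (vweight N v))\<^sup>2 = (cmod (f (Inr v)))\<^sup>2 * vweight N v"
  using V1_pos[OF v] by (simp add: power_mult_distrib)
 also have "\<dots> \<le> (\<Sum>v\<in>V1 N. (cmod (f (Inr v)))\<^sup>2 * vweight N v)"
  using v vertex_nonneg by (intro member_le_sum) auto
 also have "\<dots> \<le> rip f f" unfolding rip_self[OF f] by (simp add: sum_nonneg)
 finally show ?thesis unfolding HH.nrm_def by (rule real_le_rsqrt)
qed

lemma vertex_bound: assumes f: "f \<in> HS K N" and v: "v \<in> V1 N" shows "cmod (f (Inr v)) \<le> hn f / sqrt (vweight N v)"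
 using vertex_le[OF assms] V1_pos[OF v] by (simp add: pos_le_divide_eq)

lemma hn_tendsto:
 assumes f: "\<And>n. f n \<in> HS K N"
  and e: "\<And>e. e \<in> E1 N \<Longrightarrow> (\<lambda>n. l2n (emeas N e) (edge_part (f n) e)) \<longlonglongrightarrow> 0"
  and v: "\<And>v. v \<in> V1 N \<Longrightarrow> (\<lambda>n. f n (Inr v)) \<longlonglongrightarrow> 0"
 shows "(\<lambda>n. hn (f n)) \<longlonglongrightarrow> 0"
proof -
 have "(\<lambda>n. rip (f n) (f n)) \<longlonglongrightarrow> (\<Sum>e\<in>E1 N. 0\<^sup>2) + (\<Sum>v\<in>V1 N. (cmod 0)\<^sup>2 * vweight N v)"
  unfolding rip_self[OF f]
  by (intro tendsto_add tendsto_sum tendsto_power tendsto_mult tendsto_norm tendsto_const e v)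
 then have "(\<lambda>n. sqrt (rip (f n) (f n))) \<longlonglongrightarrow> sqrt 0" by (intro tendsto_real_sqrt) simp
 then show ?thesis by (simp add: HH.nrm_def)
qed

lemma hn_zero_iff:
 assumes f: "f \<in> HS K N"
 shows "hn f = 0 \<longleftrightarrow> (\<forall>e\<in>E1 N. AE x in emeas N e. f (Inl (e, x)) = 0) \<and> (\<forall>v\<in>V1 N. f (Inr v) = 0)"
proof -
 have null: "l2n (emeas N e) (edge_part f e) = 0 \<longleftrightarrow> (AE x in emeas N e. f (Inl (e, x)) = 0)" if "e \<in> E1 N" for e
  using L2_nrm_cong[OF HS_D(1)[OF f that] L2_zero] by (simp add: fun_diff_def)
 show ?thesis
 proof
  assume 0: "hn f = 0"
  show "(\<forall>e\<in>E1 N. AE x in emeas N e. f (Inl (e, x)) = 0) \<and> (\<forall>v\<in>V1 N. f (Inr v) = 0)"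
  proof (intro conjI ballI)
   fix e assume e: "e \<in> E1 N"
   have "l2n (emeas N e) (edge_part f e) = 0"
    using edge_le[OF f e] 0 semi_inner.nrm_nonneg[OF L2_semi_inner HS_D(1)[OF f e]] by linarith
   then show "AE x in emeas N e. f (Inl (e, x)) = 0" using null[OF e] by simp
  next
   fix v assume v: "v \<in> V1 N"
   show "f (Inr v) = 0" using vertex_bound[OF f v] 0 by simp
  qed
 next
  assume "(\<forall>e\<in>E1 N. AE x in emeas N e. f (Inl (e, x)) = 0) \<and> (\<forall>v\<in>V1 N. f (Inr v) = 0)"
  then have "rip f f = 0" unfolding rip_self[OF f] using null by simp
  then show "hn f = 0" by (simp add: HH.nrm_def)
 qed
qed

lemma HS_semi_hilbert: "semi_hilbert (HS K N) rip"
proof (rule semi_hilbert.intro[OF HS_semi_inner], unfold_locales)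
 fix x :: "nat \<Rightarrow> ('v, 'e) gfun" assume x: "\<And>n. x n \<in> HS K N" and cau: "HH.cau x"
 have d: "x m - x n \<in> HS K N" for m n using x by simp
 have "\<exists>y. y \<in> L2 K (emeas N e) \<and> (\<lambda>n. l2n (emeas N e) (edge_part (x n) e - y)) \<longlonglongrightarrow> 0" if e: "e \<in> E1 N" for e
 proof -
  interpret E: semi_hilbert "L2 K (emeas N e)" "l2ip (emeas N e)" by (rule L2_semi_hilbert)
  have "E.cau (\<lambda>n. edge_part (x n) e)" unfolding E.cau_def
  proof (intro allI impI)
   fix r :: real assume "r > 0"
   then obtain M where M: "\<forall>m\<ge>M. \<forall>n\<ge>M. hn (x m - x n) < r" using cau unfolding HH.cau_def by blast
   have "E.nrm (edge_part (x m) e - edge_part (x n) e) \<le> hn (x m - x n)" for m n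
    using edge_le[OF d e, of m n] unfolding edge_part_fun .
   then show "\<exists>M. \<forall>m\<ge>M. \<forall>n\<ge>M. E.nrm (edge_part (x m) e - edge_part (x n) e) < r"
    using M by (blast intro: le_less_trans)
  qed
  then show ?thesis using E.complete[of "\<lambda>n. edge_part (x n) e"] HS_D(1)[OF x e] by blast
 qed
 then have "\<exists>y. \<forall>e\<in>E1 N. y e \<in> L2 K (emeas N e) \<and> (\<lambda>n. l2n (emeas N e) (edge_part (x n) e - y e)) \<longlonglongrightarrow> 0"
  by (intro bchoice) blast
 then obtain y where y: "\<And>e. e \<in> E1 N \<Longrightarrow> y e \<in> L2 K (emeas N e)"
  "\<And>e. e \<in> E1 N \<Longrightarrow> (\<lambda>n. l2n (emeas N e) (edge_part (x n) e - y e)) \<longlonglongrightarrow> 0" by blast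
 have "\<exists>c. c \<in> K \<and> (\<lambda>n. x n (Inr v)) \<longlonglongrightarrow> c" if v: "v \<in> V1 N" for v
 proof -
  have w: "sqrt (vweight N v) > 0" using V1_pos[OF v] by simp
  have "Cauchy (\<lambda>n. x n (Inr v))"
  proof (rule metric_CauchyI)
   fix r :: real assume "r > 0"
   then obtain M where M: "\<forall>m\<ge>M. \<forall>n\<ge>M. hn (x m - x n) < r * sqrt (vweight N v)"
    using cau w unfolding HH.cau_def by (meson mult_pos_pos)
   have "dist (x m (Inr v)) (x n (Inr v)) < r" if "m \<ge> M" "n \<ge> M" for m n
   proof -
    have "cmod (x m (Inr v) - x n (Inr v)) * sqrt (vweight N v) \<le> hn (x m - x n)" using vertex_le[OF d v, of m n] by simp
    also have "\<dots> < r * sqrt (vweight N v)" using M that by blast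
    finally show ?thesis using w by (simp add: dist_norm)
   qed
   then show "\<exists>M. \<forall>m\<ge>M. \<forall>n\<ge>M. dist (x m (Inr v)) (x n (Inr v)) < r" by blast
  qed
  then obtain c where c: "(\<lambda>n. x n (Inr v)) \<longlonglongrightarrow> c" using Cauchy_convergent unfolding convergent_def by blast
  then have "c \<in> K" by (rule closed_sequentially[OF closed_K HS_D(2)[OF x v]])
  then show ?thesis using c by blast
 qed
 then have "\<exists>c. \<forall>v\<in>V1 N. c v \<in> K \<and> (\<lambda>n. x n (Inr v)) \<longlonglongrightarrow> c v" by (intro bchoice) blast
 then obtain c where c: "\<And>v. v \<in> V1 N \<Longrightarrow> c v \<in> K" "\<And>v. v \<in> V1 N \<Longrightarrow> (\<lambda>n. x n (Inr v)) \<longlonglongrightarrow> c v" by blast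
 define z where "z p = (case p of Inl (e, x) \<Rightarrow> y e x | Inr v \<Rightarrow> c v)" for p
 have zi: "edge_part z e = y e" "z (Inr v) = c v" for e v by (simp_all add: z_def)
 have z: "z \<in> HS K N" unfolding HS_def using y(1) c(1) zi by simp
 have "(\<lambda>n. hn (x n - z)) \<longlonglongrightarrow> 0"
 proof (rule hn_tendsto)
  show "x n - z \<in> HS K N" for n using x z by simp
  show "(\<lambda>n. l2n (emeas N e) (edge_part (x n - z) e)) \<longlonglongrightarrow> 0" if "e \<in> E1 N" for e
   unfolding edge_part_fun zi by (rule y(2)[OF that])
  show "(\<lambda>n. (x n - z) (Inr v)) \<longlonglongrightarrow> 0" if "v \<in> V1 N" for v
   using tendsto_diff[OF c(2)[OF that] tendsto_const[of "c v"]] by (simp add: zi)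
 qed
 then show "\<exists>y\<in>HS K N. (\<lambda>n. hn (x n - y)) \<longlonglongrightarrow> 0" using z by blast
qed

lemma hdist_hn: "hdist N f g = hn (f - g)"
 by (simp add: hdist_def HH.nrm_def rip_def fun_diff_def)

lemma hinner_linear:
 assumes "f \<in> HS K N" "g \<in> HS K N" "h \<in> HS K N"
 shows "hinner N (\<lambda>p. c * f p + g p) h = c * hinner N f h + hinner N g h"
proof -
 have "(LINT x|emeas N e. (c * f (Inl (e, x)) + g (Inl (e, x))) * cnj (h (Inl (e, x)))) =
  c * (LINT x|emeas N e. f (Inl (e, x)) * cnj (h (Inl (e, x)))) + (LINT x|emeas N e. g (Inl (e, x)) * cnj (h (Inl (e, x))))"
  if e: "e \<in> E1 N" for e
 proof -
  have "(LINT x|emeas N e. (c * f (Inl (e, x)) + g (Inl (e, x))) * cnj (h (Inl (e, x)))) =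
   (LINT x|emeas N e. c * (f (Inl (e, x)) * cnj (h (Inl (e, x)))) + g (Inl (e, x)) * cnj (h (Inl (e, x))))"
   by (simp add: algebra_simps)
  also have "\<dots> = (LINT x|emeas N e. c * (f (Inl (e, x)) * cnj (h (Inl (e, x))))) + (LINT x|emeas N e. g (Inl (e, x)) * cnj (h (Inl (e, x))))"
   using L2_product_integrable(1)[OF HS_D(1)[OF assms(1) e] HS_D(1)[OF assms(3) e]]
    L2_product_integrable(1)[OF HS_D(1)[OF assms(2) e] HS_D(1)[OF assms(3) e]]
   by (intro Bochner_Integration.integral_add integrable_mult_right)
  finally show ?thesis by simp
 qed
 then have 1: "(\<Sum>e\<in>E1 N. LINT x|emeas N e. (c * f (Inl (e, x)) + g (Inl (e, x))) * cnj (h (Inl (e, x)))) =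
  c * (\<Sum>e\<in>E1 N. LINT x|emeas N e. f (Inl (e, x)) * cnj (h (Inl (e, x)))) + (\<Sum>e\<in>E1 N. LINT x|emeas N e. g (Inl (e, x)) * cnj (h (Inl (e, x))))"
  by (simp add: sum.distrib sum_distrib_left)
 have 2: "(\<Sum>v\<in>V1 N. (c * f (Inr v) + g (Inr v)) * cnj (h (Inr v)) * complex_of_real (vweight N v)) =
  c * (\<Sum>v\<in>V1 N. f (Inr v) * cnj (h (Inr v)) * complex_of_real (vweight N v)) + (\<Sum>v\<in>V1 N. g (Inr v) * cnj (h (Inr v)) * complex_of_real (vweight N v))"
  by (simp add: sum.distrib sum_distrib_left algebra_simps)
 show ?thesis unfolding hinner_def 1 2 by (simp add: algebra_simps)
qed

lemma cnj_LINT_product: "cnj (LINT x|M. g x * cnj (f x)) = (LINT x|M. f x * cnj (g x))"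
proof -
 have "cnj (LINT x|M. g x * cnj (f x)) = (LINT x|M. cnj (g x * cnj (f x)))"
  by (rule integral_bounded_linear'[OF bounded_linear_cnj bounded_linear_cnj, symmetric]) simp
 then show ?thesis by (simp add: mult.commute)
qed

lemma hinner_sym: "hinner N g f = cnj (hinner N f g)"
 by (simp add: hinner_def cnj_LINT_product mult_ac)

lemma hn_mult:
 assumes f: "f \<in> HS K N" and c: "c \<in> K"
 shows "hn (\<lambda>p. c * f p) = cmod c * hn f"
proof -
 have "l2ip (emeas N e) (\<lambda>x. c * f (Inl (e, x))) (\<lambda>x. c * f (Inl (e, x))) = (cmod c)\<^sup>2 * l2ip (emeas N e) (edge_part f e) (edge_part f e)" for e
  unfolding L2_self by (simp add: norm_mult power_mult_distrib)
 moreover have "Re (c * f (Inr v) * cnj (c * f (Inr v))) * vweight N v = (cmod c)\<^sup>2 * (Re (f (Inr v) * cnj (f (Inr v))) * vweight N v)" for v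
  unfolding cmod_power2 by (simp add: power2_eq_square algebra_simps)
 ultimately have "rip (\<lambda>p. c * f p) (\<lambda>p. c * f p) = (cmod c)\<^sup>2 * rip f f"
  unfolding rip_sum by (simp only: sum_distrib_left distrib_left)
 then show ?thesis by (simp add: HH.nrm_def real_sqrt_mult)
qed

end

context net_cone
begin

lemma P_HS: "f \<in> HS K N \<Longrightarrow> (\<lambda>p. P (f p)) \<in> HS K N"
 unfolding HS_def using P_K by (auto intro!: P_L2)

text \<open>\<open>P\<close> applied to an arbitrary \<open>g\<close> stands for an arbitrary point
  of the convex set. The pointwise comparison integrates over edges and vertices.\<close>

lemma P_hn_nearest:
 assumes f: "f \<in> HS K N" and g: "g \<in> HS K N"
 shows "hn (f - (\<lambda>p. P (f p))) \<le> hn (f - (\<lambda>p. P (g p)))"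
proof -
 have d: "f - (\<lambda>p. P (f p)) \<in> HS K N" "f - (\<lambda>p. P (g p)) \<in> HS K N" using f g P_HS by simp_all
 have "rip (f - (\<lambda>p. P (f p))) (f - (\<lambda>p. P (f p))) \<le> rip (f - (\<lambda>p. P (g p))) (f - (\<lambda>p. P (g p)))"
  unfolding rip_self[OF d(1)] rip_self[OF d(2)]
 proof (intro add_mono sum_mono)
  fix e assume e: "e \<in> E1 N"
  show "(l2n (emeas N e) (edge_part (f - (\<lambda>p. P (f p))) e))\<^sup>2 \<le> (l2n (emeas N e) (edge_part (f - (\<lambda>p. P (g p))) e))\<^sup>2"
   unfolding L2_nrm_sq[OF HS_D(1)[OF d(1) e]] L2_nrm_sq[OF HS_D(1)[OF d(2) e]]
   by (rule integral_mono[OF L2_D(3)[OF HS_D(1)[OF d(1) e]] L2_D(3)[OF HS_D(1)[OF d(2) e]]])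
    (simp add: power_mono P_nearest)
 next
  fix v assume v: "v \<in> V1 N"
  show "(cmod ((f - (\<lambda>p. P (f p))) (Inr v)))\<^sup>2 * vweight N v \<le> (cmod ((f - (\<lambda>p. P (g p))) (Inr v)))\<^sup>2 * vweight N v"
   using V1_pos[OF v] by (intro mult_right_mono power_mono) (auto simp: P_nearest)
 qed
 then show ?thesis by (simp add: HH.nrm_def)
qed

end

section \<open>The form on a network\<close>

context net
begin

text \<open>Formulated for arbitrary primitives \<open>G\<close> of \<open>g\<close> and not for
  representatives given by \<open>iota\<close>: it is applied both to an element of the form domain
  and to the remainder \<open>u - P u\<close>, whose natural primitive need not be affine on the
  gaps of the support.\<close>

lemma trace_bound:
 assumes \<epsilon>: "\<epsilon> > 0"
 shows "\<exists>C\<ge>0. \<forall>g G \<xi>. (\<forall>e\<in>E1 N. g e \<in> L2 K (leb (lft N e) (rgt N e)) \<and> is_prim (lft N e) (rgt N e) (g e) (G e) \<and>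
   G e (lft N e) \<in> K \<and> \<xi> (Inl (e, 0)) = G e (lft N e) \<and> \<xi> (Inl (e, 1)) = G e (rgt N e)) \<longrightarrow>
  rb \<xi> \<xi> \<le> \<epsilon> * (\<Sum>e\<in>E1 N. (l2n (leb (lft N e) (rgt N e)) (g e))\<^sup>2) +
   C * ((\<Sum>e\<in>E1 N. (l2n (emeas N e) (G e))\<^sup>2) + (\<Sum>v\<in>V1 N. (cmod (\<xi> (Inr v)))\<^sup>2 * vweight N v))"
proof -
 let ?l = "\<lambda>e. leb (lft N e) (rgt N e)"
 have "\<exists>C\<ge>0. \<forall>g G. g \<in> L2 K (?l e) \<longrightarrow> is_prim (lft N e) (rgt N e) g G \<longrightarrow> G (lft N e) \<in> K \<longrightarrow>
  (cmod (G (lft N e)))\<^sup>2 + (cmod (G (rgt N e)))\<^sup>2 \<le> \<epsilon> * (l2n (?l e) g)\<^sup>2 + C * (l2n (emeas N e) G)\<^sup>2" if e: "e \<in> E1 N" for e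
 proof -
  interpret E: edge K "lft N e" "rgt N e" "emeas N e" by (rule edge_E1[OF e])
  have \<epsilon>2: "\<epsilon> / 2 > 0" using \<epsilon> by simp
  obtain C where C: "C \<ge> 0" "\<forall>g G. g \<in> L2 K (?l e) \<longrightarrow> is_prim (lft N e) (rgt N e) g G \<longrightarrow> G (lft N e) \<in> K \<longrightarrow>
   (cmod (G (lft N e)))\<^sup>2 \<le> \<epsilon> / 2 * (l2n (?l e) g)\<^sup>2 + C * (l2n (emeas N e) G)\<^sup>2"
   using E.trace_inequality[OF E.a_spt \<epsilon>2] by blast
  obtain D where D: "D \<ge> 0" "\<forall>g G. g \<in> L2 K (?l e) \<longrightarrow> is_prim (lft N e) (rgt N e) g G \<longrightarrow> G (lft N e) \<in> K \<longrightarrow>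
   (cmod (G (rgt N e)))\<^sup>2 \<le> \<epsilon> / 2 * (l2n (?l e) g)\<^sup>2 + D * (l2n (emeas N e) G)\<^sup>2"
   using E.trace_inequality[OF E.b_spt \<epsilon>2] by blast
  show ?thesis
  proof (intro exI[of _ "C + D"] conjI allI impI)
   fix g G assume g: "g \<in> L2 K (?l e)" "is_prim (lft N e) (rgt N e) g G" "G (lft N e) \<in> K"
   have "(cmod (G (lft N e)))\<^sup>2 \<le> \<epsilon> / 2 * (l2n (?l e) g)\<^sup>2 + C * (l2n (emeas N e) G)\<^sup>2" using C(2) g by blast
   moreover have "(cmod (G (rgt N e)))\<^sup>2 \<le> \<epsilon> / 2 * (l2n (?l e) g)\<^sup>2 + D * (l2n (emeas N e) G)\<^sup>2" using D(2) g by blast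
   moreover have "\<epsilon> * (l2n (?l e) g)\<^sup>2 = \<epsilon> / 2 * (l2n (?l e) g)\<^sup>2 + \<epsilon> / 2 * (l2n (?l e) g)\<^sup>2" by (simp add: field_simps)
   ultimately show "(cmod (G (lft N e)))\<^sup>2 + (cmod (G (rgt N e)))\<^sup>2 \<le> \<epsilon> * (l2n (?l e) g)\<^sup>2 + (C + D) * (l2n (emeas N e) G)\<^sup>2"
    unfolding distrib_right by linarith
  qed (use C D in simp)
 qed
 then have "\<exists>C. \<forall>e\<in>E1 N. C e \<ge> 0 \<and> (\<forall>g G. g \<in> L2 K (?l e) \<longrightarrow> is_prim (lft N e) (rgt N e) g G \<longrightarrow> G (lft N e) \<in> K \<longrightarrow>
  (cmod (G (lft N e)))\<^sup>2 + (cmod (G (rgt N e)))\<^sup>2 \<le> \<epsilon> * (l2n (?l e) g)\<^sup>2 + C e * (l2n (emeas N e) G)\<^sup>2)"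
  by (intro bchoice ballI)
 then obtain C where C: "\<And>e. e \<in> E1 N \<Longrightarrow> C e \<ge> 0" "\<And>e g G. e \<in> E1 N \<Longrightarrow> g \<in> L2 K (?l e) \<Longrightarrow> is_prim (lft N e) (rgt N e) g G \<Longrightarrow> G (lft N e) \<in> K \<Longrightarrow>
  (cmod (G (lft N e)))\<^sup>2 + (cmod (G (rgt N e)))\<^sup>2 \<le> \<epsilon> * (l2n (?l e) g)\<^sup>2 + C e * (l2n (emeas N e) G)\<^sup>2" by blast
 \<comment> \<open>A common constant for all edges; the summand 1 makes \<open>D\<close> large
   enough for the vertex part as well.\<close>
 define D where "D = 1 + sum C (E1 N)"
 have D1: "D \<ge> 1" using C(1) by (simp add: D_def sum_nonneg)
 have CD: "C e \<le> D" if "e \<in> E1 N" for e using member_le_sum[OF that, of C] C(1) by (simp add: D_def)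
 show ?thesis
 proof (intro exI[of _ D] conjI allI impI)
  fix g :: "'e \<Rightarrow> real \<Rightarrow> complex" and G and \<xi> :: "('v, 'e) bvec"
  assume g: "\<forall>e\<in>E1 N. g e \<in> L2 K (?l e) \<and> is_prim (lft N e) (rgt N e) (g e) (G e) \<and>
   G e (lft N e) \<in> K \<and> \<xi> (Inl (e, 0)) = G e (lft N e) \<and> \<xi> (Inl (e, 1)) = G e (rgt N e)"
  let ?v = "\<Sum>v\<in>V1 N. (cmod (\<xi> (Inr v)))\<^sup>2 * vweight N v" and ?G = "\<lambda>e. (l2n (emeas N e) (G e))\<^sup>2" and ?g = "\<lambda>e. (l2n (?l e) (g e))\<^sup>2"
  have "(\<Sum>p\<in>E1 N \<times> {0, 1}. (cmod (\<xi> (Inl p)))\<^sup>2) = (\<Sum>e\<in>E1 N. \<Sum>j\<in>{0, 1}. (cmod (\<xi> (Inl (e, j))))\<^sup>2)"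
   by (simp only: sum.cartesian_product split_def prod.collapse)
  also have "\<dots> \<le> (\<Sum>e\<in>E1 N. \<epsilon> * ?g e + D * ?G e)"
  proof (rule sum_mono)
   fix e assume e: "e \<in> E1 N"
   note ge = bspec[OF g e]
   have "(\<Sum>j\<in>{0, 1}. (cmod (\<xi> (Inl (e, j))))\<^sup>2) = (cmod (\<xi> (Inl (e, 0))))\<^sup>2 + (cmod (\<xi> (Inl (e, 1))))\<^sup>2" by simp
   also have "\<dots> = (cmod (G e (lft N e)))\<^sup>2 + (cmod (G e (rgt N e)))\<^sup>2" using ge by (simp only:)
   also have "\<dots> \<le> \<epsilon> * ?g e + C e * ?G e" by (rule C(2)[OF e]) (use ge in blast)+
   also have "\<dots> \<le> \<epsilon> * ?g e + D * ?G e" using CD[OF e] by (intro add_left_mono mult_right_mono) auto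
   finally show "(\<Sum>j\<in>{0, 1}. (cmod (\<xi> (Inl (e, j))))\<^sup>2) \<le> \<epsilon> * ?g e + D * ?G e" .
  qed
  also have "\<dots> = \<epsilon> * sum ?g (E1 N) + D * sum ?G (E1 N)" by (simp only: sum.distrib sum_distrib_left)
  finally have 1: "(\<Sum>p\<in>E1 N \<times> {0, 1}. (cmod (\<xi> (Inl p)))\<^sup>2) \<le> \<epsilon> * sum ?g (E1 N) + D * sum ?G (E1 N)" .
  have "0 \<le> ?v" by (intro sum_nonneg vertex_nonneg)
  then have "?v \<le> D * ?v" using D1 mult_right_mono[of 1 D ?v] by simp
  then show "rb \<xi> \<xi> \<le> \<epsilon> * sum ?g (E1 N) + D * (sum ?G (E1 N) + ?v)"
   unfolding rb_self distrib_left using 1 by linarith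
 qed (use D1 in simp)
qed

end

section \<open>The form with boundary conditions and its two-sided bounds\<close>

locale net_form = net N K for N :: "('v, 'e) network" and K +
 fixes X :: "('v, 'e) bvec set" and L :: "('v, 'e) bvec \<Rightarrow> ('v, 'e) bvec"
 assumes X_sub: "subspace_of K (KS K (bd_index N)) X" and L_sa: "selfadjoint_in K N X L"
  and X_dense: "v \<in> V1 N \<Longrightarrow> \<exists>\<xi>\<in>X. \<xi> (Inr v) = 1 \<and> (\<forall>w\<in>V1 N. w \<noteq> v \<longrightarrow> \<xi> (Inr w) = 0)"
begin

abbreviation "lb e \<equiv> leb (lft N e) (rgt N e)"
abbreviation "io f e \<equiv> iota_edge K (lft N e) (rgt N e) (emeas N e) (edge_part f e)"
abbreviation "De f e \<equiv> weak_deriv K (lft N e) (rgt N e) (io f e)"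
abbreviation "dm e \<equiv> dom_iota_edge K (lft N e) (rgt N e) (emeas N e)"
abbreviation "tr f \<equiv> btrace N (iota K N f)"
abbreviation "V \<equiv> dom_tau K N X"

lemma edge_iota: "edge_part (iota K N f) e = io f e"
 by (simp add: iota_def)

lemma V_iff: "f \<in> V \<longleftrightarrow> f \<in> HS K N \<and> (\<forall>e\<in>E1 N. edge_part f e \<in> dm e) \<and> tr f \<in> X"
 by (auto simp: dom_tau_def dom_iota_def)

lemma V_HS: "f \<in> V \<Longrightarrow> f \<in> HS K N" by (simp add: V_iff)

lemma V_edge:
 assumes "f \<in> V" "e \<in> E1 N"
 shows "edge_part f e \<in> dm e" "De f e \<in> L2 K (lb e)" "is_prim (lft N e) (rgt N e) (De f e) (io f e)"
  "io f e (lft N e) \<in> K" "AE x in emeas N e. io f e x = f (Inl (e, x))"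
proof -
 interpret E: edge K "lft N e" "rgt N e" "emeas N e" by (rule edge_E1[OF assms(2)])
 show d: "edge_part f e \<in> dm e" using assms by (simp add: V_iff)
 show "De f e \<in> L2 K (lb e)" "is_prim (lft N e) (rgt N e) (De f e) (io f e)"
  "io f e (lft N e) \<in> K" "AE x in emeas N e. io f e x = f (Inl (e, x))" by (rule E.dome_D[OF d])+
qed

lemma tr_val:
 "e \<in> E1 N \<Longrightarrow> tr f (Inl (e, 0)) = io f e (lft N e)" "e \<in> E1 N \<Longrightarrow> tr f (Inl (e, 1)) = io f e (rgt N e)"
 "v \<in> V1 N \<Longrightarrow> tr f (Inr v) = f (Inr v)"
 by (auto simp: btrace_def bd_index_def iota_def)

lemma tr_eqI:
 assumes "\<And>i. i \<notin> bd_index N \<Longrightarrow> \<xi> i = 0"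
  and "\<And>e. e \<in> E1 N \<Longrightarrow> \<xi> (Inl (e, 0)) = io f e (lft N e)" "\<And>e. e \<in> E1 N \<Longrightarrow> \<xi> (Inl (e, 1)) = io f e (rgt N e)"
  and "\<And>v. v \<in> V1 N \<Longrightarrow> \<xi> (Inr v) = f (Inr v)"
 shows "tr f = \<xi>"
proof
 fix i show "tr f i = \<xi> i"
 proof (cases "i \<in> bd_index N")
  case True
  then consider e where "e \<in> E1 N" "i = Inl (e, 0)" | e where "e \<in> E1 N" "i = Inl (e, 1)" | v where "v \<in> V1 N" "i = Inr v"
   unfolding bd_index_def by blast
  then show ?thesis by cases (simp_all only: tr_val assms)
 qed (simp add: btrace_def assms(1))
qed

lemma tr_off: "i \<notin> bd_index N \<Longrightarrow> tr f i = 0" by (simp add: btrace_def)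

lemma V_tr: "f \<in> V \<Longrightarrow> tr f \<in> X" by (simp add: V_iff)

lemma V_linear:
 assumes f: "f \<in> V" and g: "g \<in> V" and c: "c \<in> K"
 shows "(\<lambda>p. c * f p + g p) \<in> V" "tr (\<lambda>p. c * f p + g p) = (\<lambda>i. c * tr f i + tr g i)"
  "e \<in> E1 N \<Longrightarrow> AE x in lb e. De (\<lambda>p. c * f p + g p) e x = c * De f e x + De g e x"
proof -
 have lin: "edge_part (\<lambda>p. c * f p + g p) e \<in> dm e"
  "AE x in lb e. De (\<lambda>p. c * f p + g p) e x = c * De f e x + De g e x"
  "io (\<lambda>p. c * f p + g p) e (lft N e) = c * io f e (lft N e) + io g e (lft N e)"
  "io (\<lambda>p. c * f p + g p) e (rgt N e) = c * io f e (rgt N e) + io g e (rgt N e)" if e: "e \<in> E1 N" for e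
 proof -
  interpret E: edge K "lft N e" "rgt N e" "emeas N e" by (rule edge_E1[OF e])
  note l = E.iota_linear[OF V_edge(1)[OF f e] V_edge(1)[OF g e] c]
  show 1: "edge_part (\<lambda>p. c * f p + g p) e \<in> dm e" by (rule l(1))
  have 2: "(\<lambda>x. c * De f e x + De g e x) \<in> L2 K (lb e)" by (intro L2_add L2_mult V_edge(2) f g e c)
  show "AE x in lb e. De (\<lambda>p. c * f p + g p) e x = c * De f e x + De g e x"
   by (rule L2_nrm_cong[OF E.dome_D(2)[OF 1] 2, THEN iffD1, OF l(2)])
  show "io (\<lambda>p. c * f p + g p) e (lft N e) = c * io f e (lft N e) + io g e (lft N e)" by (rule l(3)[OF E.a_spt])
  show "io (\<lambda>p. c * f p + g p) e (rgt N e) = c * io f e (rgt N e) + io g e (rgt N e)" by (rule l(3)[OF E.b_spt])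
 qed
 show "e \<in> E1 N \<Longrightarrow> AE x in lb e. De (\<lambda>p. c * f p + g p) e x = c * De f e x + De g e x" by (rule lin(2))
 show tr: "tr (\<lambda>p. c * f p + g p) = (\<lambda>i. c * tr f i + tr g i)"
  by (rule tr_eqI, simp add: tr_off) (simp_all only: tr_val lin)
 have "tr (\<lambda>p. c * f p + g p) \<in> X" unfolding tr by (intro subspace_ofD(3,4)[OF X_sub] V_tr f g c)
 then show "(\<lambda>p. c * f p + g p) \<in> V" unfolding V_iff using lin(1) HS_linear[OF V_HS[OF f] V_HS[OF g] c] by blast
qed

lemma V_null:
 assumes d: "d \<in> HS K N" "hn d = 0"
 shows "d \<in> V" "e \<in> E1 N \<Longrightarrow> l2n (lb e) (De d e) = 0"
proof -
 have ae: "AE x in emeas N e. d (Inl (e, x)) = 0" if "e \<in> E1 N" for e using hn_zero_iff[OF d(1)] d(2) that by blast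
 have dv: "d (Inr v) = 0" if "v \<in> V1 N" for v using hn_zero_iff[OF d(1)] d(2) that by blast
 have 0: "edge_part d e \<in> dm e" "l2n (lb e) (De d e) = 0" "0 = io d e (lft N e)" "0 = io d e (rgt N e)" if e: "e \<in> E1 N" for e
 proof -
  interpret E: edge K "lft N e" "rgt N e" "emeas N e" by (rule edge_E1[OF e])
  interpret LL: semi_inner "L2 K (lb e)" "l2ip (lb e)" by (rule L2_semi_inner)
  note i = E.iota_cong[OF E.zero_dome(1) HS_D(1)[OF d(1) e] ae[OF e]]
  show 1: "edge_part d e \<in> dm e" by (rule i(1))
  have "l2n (lb e) (De d e) = l2n (lb e) (weak_deriv K (lft N e) (rgt N e) (iota_edge K (lft N e) (rgt N e) (emeas N e) (\<lambda>_. 0)))"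
   by (rule LL.nrm_cong[OF E.dome_D(2)[OF 1] E.dome_D(2)[OF E.zero_dome(1)] i(2)])
  then show "l2n (lb e) (De d e) = 0" unfolding E.zero_dome(2) .
  show "0 = io d e (lft N e)" using i(3)[OF E.a_spt] E.zero_dome(3)[OF E.a_spt] by simp
  show "0 = io d e (rgt N e)" using i(3)[OF E.b_spt] E.zero_dome(3)[OF E.b_spt] by simp
 qed
 show "e \<in> E1 N \<Longrightarrow> l2n (lb e) (De d e) = 0" by (rule 0(2))
 have "tr d = (\<lambda>_. 0)" by (rule tr_eqI) (use 0(3,4) dv in simp_all)
 then have "tr d \<in> X" using subspace_ofD(2)[OF X_sub] by simp
 then show "d \<in> V" unfolding V_iff using d(1) 0(1) by blast
qed

lemma V_zero: "(\<lambda>_. 0) \<in> V"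
 using V_null(1)[OF HS_zero] HH.nrm_zero by (simp add: zero_fun_def)

lemma V_subspace: "subspace V"
 unfolding subspace_def
proof (intro conjI ballI allI)
 fix f g :: "('v, 'e) gfun" and r :: real assume f: "f \<in> V"
 show "r *\<^sub>R f \<in> V" using V_linear(1)[OF f V_zero K_closed_ops(3)[of r]] by (simp add: scaleR_fun_def scaleR_conv_of_real)
 assume g: "g \<in> V"
 show "f + g \<in> V" using V_linear(1)[OF f g K_closed_ops(2)] by (simp add: plus_fun_def)
qed (use V_zero in \<open>simp add: zero_fun_def\<close>)

lemma De_diff:
 assumes "f \<in> V" "g \<in> V" "e \<in> E1 N"
 shows "l2n (lb e) (De (f - g) e) = l2n (lb e) (De f e - De g e)"
proof -
 interpret LL: semi_inner "L2 K (lb e)" "l2ip (lb e)" by (rule L2_semi_inner)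
 have 1: "(\<lambda>p. - 1 * g p + f p) = f - g" by (simp add: fun_eq_iff)
 have e1: "edge_part (f - g) e = (\<lambda>x. - 1 * g (Inl (e, x)) + f (Inl (e, x)))" by (simp add: fun_eq_iff)
 have m1: "- 1 \<in> K" using K_closed_ops(3)[of "- 1"] by simp
 have fg: "f - g \<in> V" using V_linear(1)[OF assms(2,1) m1] unfolding 1 .
 have ae: "AE x in lb e. De (f - g) e x = - 1 * De g e x + De f e x"
  unfolding e1 by (rule V_linear(3)[OF assms(2,1) m1 assms(3)])
 have ae': "AE x in lb e. De (f - g) e x = (De f e - De g e) x" using ae by eventually_elim simp
 have m: "De f e - De g e \<in> L2 K (lb e)" by (intro LL.mem(3) V_edge(2) assms)
 show ?thesis
  by (rule LL.nrm_cong[OF V_edge(2)[OF fg assms(3)] m L2_nrm_cong[OF V_edge(2)[OF fg assms(3)] m, THEN iffD2, OF ae']])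
qed

lemma binner_linear: "binner N (\<lambda>i. c * x i + y i) z = c * binner N x z + binner N y z"
 unfolding binner_def by (simp add: sum.distrib sum_distrib_left algebra_simps)

lemma binner_sym: "binner N y x = cnj (binner N x y)"
 by (simp add: binner_def mult_ac)

lemma tau_eq: "tau K N L f g = (\<Sum>e\<in>E1 N. LINT x|lb e. De f e x * cnj (De g e x)) + binner N (L (tr f)) (tr g)"
 unfolding tau_def edge_iota ..

lemma tau_linear:
 assumes f: "f \<in> V" and g: "g \<in> V" and h: "h \<in> V" and c: "c \<in> K"
 shows "tau K N L (\<lambda>p. c * f p + g p) h = c * tau K N L f h + tau K N L g h"
proof -
 have "(LINT x|lb e. De (\<lambda>p. c * f p + g p) e x * cnj (De h e x)) =
  c * (LINT x|lb e. De f e x * cnj (De h e x)) + (LINT x|lb e. De g e x * cnj (De h e x))" if e: "e \<in> E1 N" for e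
 proof -
  note I = L2_product_integrable(1)[OF V_edge(2)[OF f e] V_edge(2)[OF h e]]
   L2_product_integrable(1)[OF V_edge(2)[OF g e] V_edge(2)[OF h e]]
  have sum: "integrable (lb e) (\<lambda>x. c * (De f e x * cnj (De h e x)) + De g e x * cnj (De h e x))"
   by (intro Bochner_Integration.integrable_add integrable_mult_right I)
  have "(LINT x|lb e. De (\<lambda>p. c * f p + g p) e x * cnj (De h e x)) =
   (LINT x|lb e. c * (De f e x * cnj (De h e x)) + De g e x * cnj (De h e x))"
  proof (rule integral_cong_AE)
   show "AE x in lb e. De (\<lambda>p. c * f p + g p) e x * cnj (De h e x) = c * (De f e x * cnj (De h e x)) + De g e x * cnj (De h e x)"
    using V_linear(3)[OF f g c e] by eventually_elim (simp only: distrib_right mult.assoc)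
  qed (rule borel_measurable_integrable[OF L2_product_integrable(1)[OF V_edge(2)[OF V_linear(1)[OF f g c] e] V_edge(2)[OF h e]]],
   rule borel_measurable_integrable[OF sum])
  also have "\<dots> = (LINT x|lb e. c * (De f e x * cnj (De h e x))) + (LINT x|lb e. De g e x * cnj (De h e x))"
   by (intro Bochner_Integration.integral_add integrable_mult_right I)
  finally show ?thesis by simp
 qed
 then have 1: "(\<Sum>e\<in>E1 N. LINT x|lb e. De (\<lambda>p. c * f p + g p) e x * cnj (De h e x)) =
  c * (\<Sum>e\<in>E1 N. LINT x|lb e. De f e x * cnj (De h e x)) + (\<Sum>e\<in>E1 N. LINT x|lb e. De g e x * cnj (De h e x))"
  by (simp add: sum.distrib sum_distrib_left)
 have "L (\<lambda>i. c * tr f i + tr g i) = (\<lambda>i. c * L (tr f) i + L (tr g) i)"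
 proof -
  have "(\<lambda>i. c * tr f i) \<in> X" by (rule subspace_ofD(4)[OF X_sub c V_tr[OF f]])
  then show ?thesis using L_sa V_tr[OF f] V_tr[OF g] c unfolding selfadjoint_in_def by simp
 qed
 then have 2: "binner N (L (tr (\<lambda>p. c * f p + g p))) (tr h) = c * binner N (L (tr f)) (tr h) + binner N (L (tr g)) (tr h)"
  unfolding V_linear(2)[OF f g c] by (simp only: binner_linear)
 show ?thesis unfolding tau_eq 1 2 by (simp only: distrib_left add_ac)
qed

lemma tau_sym:
 assumes f: "f \<in> V" and g: "g \<in> V" shows "tau K N L g f = cnj (tau K N L f g)"
proof -
 have "binner N (L (tr g)) (tr f) = binner N (tr g) (L (tr f))"
  using L_sa V_tr[OF f] V_tr[OF g] unfolding selfadjoint_in_def by blast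
 also have "\<dots> = cnj (binner N (L (tr f)) (tr g))" by (rule binner_sym)
 finally show ?thesis unfolding tau_eq by (simp add: cnj_LINT_product)
qed

definition a0 :: "('v, 'e) gfun \<Rightarrow> ('v, 'e) gfun \<Rightarrow> real" where "a0 f g = Re (tau K N L f g)"

lemma a0_eq: "a0 f g = (\<Sum>e\<in>E1 N. l2ip (lb e) (De f e) (De g e)) + rb (L (tr f)) (tr g)"
 by (simp add: a0_def tau_eq l2ip_def rb_def)

definition en :: "('v, 'e) gfun \<Rightarrow> real" where "en f = (\<Sum>e\<in>E1 N. (l2n (lb e) (De f e))\<^sup>2)"

lemma a0_self: assumes f: "f \<in> V" shows "a0 f f = en f + rb (L (tr f)) (tr f)"
 unfolding a0_eq en_def using semi_inner.nrm_sq[OF L2_semi_inner V_edge(2)[OF f]] by simp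

text \<open>One pair of constants serves both coercivity and the invariance estimate.
  \<open>C\<close> bounds the quadratic form of \<open>L\<close>; the trace inequality, scaled so
  that it uses half of the derivative energy, absorbs this bound. The reserve of 1 in
  \<open>w - 1\<close> leaves the full squared norm over.\<close>

definition form_const :: "real \<Rightarrow> real \<Rightarrow> bool" where
 "form_const C w \<longleftrightarrow> C \<ge> 0 \<and> w \<ge> 1 \<and> (\<forall>x\<in>X. \<bar>rb (L x) x\<bar> \<le> C * rb x x) \<and>
  (\<forall>g G \<xi>. (\<forall>e\<in>E1 N. g e \<in> L2 K (lb e) \<and> is_prim (lft N e) (rgt N e) (g e) (G e) \<and>
   G e (lft N e) \<in> K \<and> \<xi> (Inl (e, 0)) = G e (lft N e) \<and> \<xi> (Inl (e, 1)) = G e (rgt N e)) \<longrightarrow>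
   C * rb \<xi> \<xi> \<le> 1 / 2 * (\<Sum>e\<in>E1 N. (l2n (lb e) (g e))\<^sup>2) +
    (w - 1) * ((\<Sum>e\<in>E1 N. (l2n (emeas N e) (G e))\<^sup>2) + (\<Sum>v\<in>V1 N. (cmod (\<xi> (Inr v)))\<^sup>2 * vweight N v)))"

lemma form_const_exists: "\<exists>C w. form_const C w"
proof -
 interpret XX: semi_inner X rb by (rule rb_semi_inner[OF subspace_of_real[OF X_sub]])
 have LX: "L x \<in> X" if "x \<in> X" for x using L_sa that by (auto simp: selfadjoint_in_def)
 have "\<exists>C\<ge>0. \<forall>x\<in>X. sqrt (rb (L x) (L x)) \<le> C * sqrt (rb x x)"
 proof (rule rb_bounded[OF X_sub LX])
  show "L (x + y) = L x + L y" if "x \<in> X" "y \<in> X" for x y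
   using L_sa that by (simp add: selfadjoint_in_def plus_fun_def)
  show "L (r *\<^sub>R x) = r *\<^sub>R L x" if "x \<in> X" for x r
   using L_sa that K_closed_ops(3)[of r] by (simp add: selfadjoint_in_def scaleR_fun_def scaleR_conv_of_real)
 qed
 then obtain C where C: "C \<ge> 0" "\<And>x. x \<in> X \<Longrightarrow> XX.nrm (L x) \<le> C * XX.nrm x" unfolding XX.nrm_def by blast
 have Lb: "\<bar>rb (L x) x\<bar> \<le> C * rb x x" if x: "x \<in> X" for x
 proof -
  have "\<bar>rb (L x) x\<bar> \<le> XX.nrm (L x) * XX.nrm x" by (rule XX.ip_le_nrm[OF LX[OF x] x])
  also have "\<dots> \<le> C * XX.nrm x * XX.nrm x" by (rule mult_right_mono[OF C(2)[OF x] XX.nrm_nonneg[OF x]])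
  also have "\<dots> = C * rb x x" using XX.nrm_sq[OF x] by (simp add: power2_eq_square mult.assoc)
  finally show ?thesis .
 qed
 \<comment> \<open>After multiplication by \<open>C\<close> this leaves
   \<open>C / (2 * (C + 1)) \<le> 1 / 2\<close>; the \<open>+ 1\<close> covers
   \<open>C = 0\<close>.\<close>
 have \<epsilon>: "1 / (2 * (C + 1)) > 0" using C(1) by simp
 obtain D where D: "D \<ge> 0" "\<forall>g G \<xi>. (\<forall>e\<in>E1 N. g e \<in> L2 K (lb e) \<and> is_prim (lft N e) (rgt N e) (g e) (G e) \<and>
   G e (lft N e) \<in> K \<and> \<xi> (Inl (e, 0)) = G e (lft N e) \<and> \<xi> (Inl (e, 1)) = G e (rgt N e)) \<longrightarrow>
  rb \<xi> \<xi> \<le> 1 / (2 * (C + 1)) * (\<Sum>e\<in>E1 N. (l2n (lb e) (g e))\<^sup>2) +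
   D * ((\<Sum>e\<in>E1 N. (l2n (emeas N e) (G e))\<^sup>2) + (\<Sum>v\<in>V1 N. (cmod (\<xi> (Inr v)))\<^sup>2 * vweight N v))"
  using trace_bound[OF \<epsilon>] by (elim exE conjE)
 have "form_const C (C * D + 1)" unfolding form_const_def
 proof (intro conjI allI impI ballI Lb)
  fix g :: "'e \<Rightarrow> real \<Rightarrow> complex" and G and \<xi> :: "('v, 'e) bvec"
  assume g: "\<forall>e\<in>E1 N. g e \<in> L2 K (lb e) \<and> is_prim (lft N e) (rgt N e) (g e) (G e) \<and>
   G e (lft N e) \<in> K \<and> \<xi> (Inl (e, 0)) = G e (lft N e) \<and> \<xi> (Inl (e, 1)) = G e (rgt N e)"
  define A B where "A = (\<Sum>e\<in>E1 N. (l2n (lb e) (g e))\<^sup>2)"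
   and "B = (\<Sum>e\<in>E1 N. (l2n (emeas N e) (G e))\<^sup>2) + (\<Sum>v\<in>V1 N. (cmod (\<xi> (Inr v)))\<^sup>2 * vweight N v)"
  have A: "A \<ge> 0" by (simp add: A_def sum_nonneg)
  have "rb \<xi> \<xi> \<le> 1 / (2 * (C + 1)) * A + D * B"
   unfolding A_def B_def using D(2)[rule_format, of g G \<xi>, OF bspec[OF g]] by blast
  then have "C * rb \<xi> \<xi> \<le> C * (1 / (2 * (C + 1)) * A + D * B)" by (rule mult_left_mono[OF _ C(1)])
  also have "\<dots> = C / (2 * (C + 1)) * A + C * D * B" by (simp add: algebra_simps)
  also have "C / (2 * (C + 1)) * A \<le> 1 / 2 * A" using C(1) A by (intro mult_right_mono) (auto simp: field_simps)
  finally show "C * rb \<xi> \<xi> \<le> 1 / 2 * (\<Sum>e\<in>E1 N. (l2n (lb e) (g e))\<^sup>2) +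
    (C * D + 1 - 1) * ((\<Sum>e\<in>E1 N. (l2n (emeas N e) (G e))\<^sup>2) + (\<Sum>v\<in>V1 N. (cmod (\<xi> (Inr v)))\<^sup>2 * vweight N v))"
   unfolding A_def B_def by simp
 qed (use C D in simp_all)
 then show ?thesis by blast
qed

lemma form_constD:
 assumes "form_const C w"
 shows "C \<ge> 0" "w \<ge> 1" "x \<in> X \<Longrightarrow> \<bar>rb (L x) x\<bar> \<le> C * rb x x"
  "(\<And>e. e \<in> E1 N \<Longrightarrow> g e \<in> L2 K (lb e)) \<Longrightarrow> (\<And>e. e \<in> E1 N \<Longrightarrow> is_prim (lft N e) (rgt N e) (g e) (G e)) \<Longrightarrow>
   (\<And>e. e \<in> E1 N \<Longrightarrow> G e (lft N e) \<in> K) \<Longrightarrow> (\<And>e. e \<in> E1 N \<Longrightarrow> \<xi> (Inl (e, 0)) = G e (lft N e)) \<Longrightarrow>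
   (\<And>e. e \<in> E1 N \<Longrightarrow> \<xi> (Inl (e, 1)) = G e (rgt N e)) \<Longrightarrow>
   C * rb \<xi> \<xi> \<le> 1 / 2 * (\<Sum>e\<in>E1 N. (l2n (lb e) (g e))\<^sup>2) +
    (w - 1) * ((\<Sum>e\<in>E1 N. (l2n (emeas N e) (G e))\<^sup>2) + (\<Sum>v\<in>V1 N. (cmod (\<xi> (Inr v)))\<^sup>2 * vweight N v))"
 using assms unfolding form_const_def by blast+

text \<open>The boundary term is at most half the derivative energy plus \<open>w - 1\<close> times
  the squared norm. Hence the shifted form is equivalent to energy plus squared norm; the lower
  bound gives coercivity, the upper one convergence in the form norm.\<close>

lemma form_ineq:
 assumes fc: "form_const C w" and f: "f \<in> V"
 shows "1 / 2 * en f + rip f f \<le> a0 f f + w * rip f f" "a0 f f + w * rip f f \<le> 3 / 2 * en f + 2 * w * rip f f"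
proof -
 have edge_eq: "l2n (emeas N e) (io f e) = l2n (emeas N e) (edge_part f e)" if e: "e \<in> E1 N" for e
 proof -
  interpret E: edge K "lft N e" "rgt N e" "emeas N e" by (rule edge_E1[OF e])
  have m: "io f e \<in> L2 K (emeas N e)" by (rule E.is_prim_L2_M[OF V_edge(2,3,4)[OF f e]])
  show ?thesis
   by (rule semi_inner.nrm_cong[OF L2_semi_inner m HS_D(1)[OF V_HS[OF f] e]
      L2_nrm_cong[OF m HS_D(1)[OF V_HS[OF f] e], THEN iffD2, OF V_edge(5)[OF f e]]])
 qed
 have "C * rb (tr f) (tr f) \<le> 1 / 2 * (\<Sum>e\<in>E1 N. (l2n (lb e) (De f e))\<^sup>2) +
    (w - 1) * ((\<Sum>e\<in>E1 N. (l2n (emeas N e) (io f e))\<^sup>2) + (\<Sum>v\<in>V1 N. (cmod (tr f (Inr v)))\<^sup>2 * vweight N v))"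
  by (rule form_constD(4)[OF fc V_edge(2)[OF f] V_edge(3)[OF f] V_edge(4)[OF f] tr_val(1) tr_val(2)])
 also have "(\<Sum>e\<in>E1 N. (l2n (emeas N e) (io f e))\<^sup>2) + (\<Sum>v\<in>V1 N. (cmod (tr f (Inr v)))\<^sup>2 * vweight N v) = rip f f"
  unfolding rip_self[OF V_HS[OF f]] by (intro arg_cong2[of _ _ _ _ "(+)"] sum.cong refl) (simp_all only: edge_eq tr_val)
 finally have "C * rb (tr f) (tr f) \<le> 1 / 2 * en f + (w - 1) * rip f f" by (simp only: en_def)
 moreover have "\<bar>rb (L (tr f)) (tr f)\<bar> \<le> C * rb (tr f) (tr f)" by (rule form_constD(3)[OF fc V_tr[OF f]])
 moreover have "rip f f \<ge> 0" by (rule HH.ip_pos[OF V_HS[OF f]])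
 moreover have "(w - 1) * rip f f = w * rip f f - rip f f" by (simp add: left_diff_distrib)
 ultimately show "1 / 2 * en f + rip f f \<le> a0 f f + w * rip f f" "a0 f f + w * rip f f \<le> 3 / 2 * en f + 2 * w * rip f f"
  unfolding a0_self[OF f] by linarith+
qed

lemma en_nonneg: "en f \<ge> 0" by (simp add: en_def sum_nonneg)

lemma a0_linear:
 assumes "f \<in> V" "g \<in> V" "h \<in> V"
 shows "a0 (f + g) h = a0 f h + a0 g h" "a0 (r *\<^sub>R f) h = r * a0 f h" "a0 f g = a0 g f"
proof -
 have z: "tau K N L (\<lambda>_. 0) h = 0" using tau_linear[OF V_zero V_zero assms(3) K_closed_ops(2)] by simp
 show "a0 (f + g) h = a0 f h + a0 g h"
  using tau_linear[OF assms K_closed_ops(2)] by (simp add: a0_def plus_fun_def)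
 show "a0 (r *\<^sub>R f) h = r * a0 f h"
  using tau_linear[OF assms(1) V_zero assms(3) K_closed_ops(3)[of r]] z
  by (simp add: a0_def scaleR_fun_def scaleR_conv_of_real)
 show "a0 f g = a0 g f" unfolding a0_def using tau_sym[OF assms(1,2)] by simp
qed

lemma form_semi_inner:
 assumes fc: "form_const C w"
 shows "semi_inner V (\<lambda>f g. a0 f g + w * rip f g)"
proof
 show "subspace V" by (rule V_subspace)
 fix f g h :: "('v, 'e) gfun" and r :: real
 assume f: "f \<in> V" and g: "g \<in> V"
 note fH = V_HS[OF f] and gH = V_HS[OF g]
 show "a0 f g + w * rip f g = a0 g f + w * rip g f" using a0_linear(3)[OF f g g] HH.ip_sym[OF fH gH] by simp
 show "a0 (r *\<^sub>R f) g + w * rip (r *\<^sub>R f) g = r * (a0 f g + w * rip f g)"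
  unfolding a0_linear(2)[OF f g g] HH.ip_scale[OF fH gH] by (simp add: algebra_simps)
 show "0 \<le> a0 f f + w * rip f f" using form_ineq(1)[OF fc f] en_nonneg[of f] HH.ip_pos[OF fH] by linarith
 assume h: "h \<in> V"
 show "a0 (f + g) h + w * rip (f + g) h = a0 f h + w * rip f h + (a0 g h + w * rip g h)"
  unfolding a0_linear(1)[OF f g h] HH.ip_add[OF fH gH V_HS[OF h]] by (simp add: algebra_simps)
qed

end

section \<open>Closedness and density of the form, the generated semigroup, and its invariant
  sets\<close>

context net_form
begin

text \<open>The form norm controls the norm of the space and the derivatives on each edge, so the
  closedness result for a single edge applies. It also gives convergence of the boundary values, and
  the limit trace stays in \<open>X\<close> because a finite-dimensional subspace is closed.\<close>

lemma form_complete: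
 assumes fc: "form_const C w"
 shows "semi_hilbert V (\<lambda>f g. a0 f g + w * rip f g)"
proof (rule semi_hilbert.intro[OF form_semi_inner[OF fc]], unfold_locales)
 interpret VV: semi_inner V "\<lambda>f g. a0 f g + w * rip f g" by (rule form_semi_inner[OF fc])
 interpret HC: semi_hilbert "HS K N" rip by (rule HS_semi_hilbert)
 have hn_le: "hn f \<le> VV.nrm f" if f: "f \<in> V" for f
  unfolding HH.nrm_def VV.nrm_def using form_ineq(1)[OF fc f] en_nonneg[of f] by (intro real_sqrt_le_mono) linarith
 have De_le: "l2n (lb e) (De f e) \<le> 2 * VV.nrm f" if f: "f \<in> V" and e: "e \<in> E1 N" for f e
 proof -
  have "(l2n (lb e) (De f e))\<^sup>2 \<le> en f" unfolding en_def using e by (intro member_le_sum) auto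
  also have "\<dots> \<le> 2\<^sup>2 * (VV.nrm f)\<^sup>2"
   using form_ineq(1)[OF fc f] en_nonneg[of f] HH.ip_pos[OF V_HS[OF f]] VV.nrm_sq[OF f] by simp
  also have "\<dots> = (2 * VV.nrm f)\<^sup>2" by (simp only: power_mult_distrib)
  finally show ?thesis by (rule power2_le_imp_le) (use VV.nrm_nonneg[OF f] in simp)
 qed
 fix x :: "nat \<Rightarrow> ('v, 'e) gfun" assume x: "\<And>n. x n \<in> V" and cau: "VV.cau x"
 note xH = V_HS[OF x]
 have d: "x m - x n \<in> V" for m n using x by simp
 have "HH.cau x" unfolding HH.cau_def
 proof (intro allI impI)
  fix r :: real assume "r > 0"
  then obtain M where "\<forall>m\<ge>M. \<forall>n\<ge>M. VV.nrm (x m - x n) < r" using cau unfolding VV.cau_def by blast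
  then show "\<exists>M. \<forall>m\<ge>M. \<forall>n\<ge>M. hn (x m - x n) < r" using hn_le[OF d] by (blast intro: le_less_trans)
 qed
 then obtain h where h: "h \<in> HS K N" "(\<lambda>n. hn (x n - h)) \<longlonglongrightarrow> 0" using HC.complete[of x] xH by blast
 have xh: "x n - h \<in> HS K N" for n using xH h(1) by simp
 have E: "edge_part h e \<in> dm e" "(\<lambda>n. l2n (lb e) (De (x n) e - De h e)) \<longlonglongrightarrow> 0"
  "(\<lambda>n. io (x n) e (lft N e)) \<longlonglongrightarrow> io h e (lft N e)" "(\<lambda>n. io (x n) e (rgt N e)) \<longlonglongrightarrow> io h e (rgt N e)" if e: "e \<in> E1 N" for e
 proof -
  interpret E: edge K "lft N e" "rgt N e" "emeas N e" by (rule edge_E1[OF e])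
  interpret LL: semi_inner "L2 K (lb e)" "l2ip (lb e)" by (rule L2_semi_inner)
  have 1: "(\<lambda>n. l2n (emeas N e) (edge_part (x n) e - edge_part h e)) \<longlonglongrightarrow> 0"
  proof (rule tendsto_sandwich[OF _ _ tendsto_const h(2)])
   show "\<forall>\<^sub>F n in sequentially. 0 \<le> l2n (emeas N e) (edge_part (x n) e - edge_part h e)"
    unfolding edge_part_fun[symmetric] using semi_inner.nrm_nonneg[OF L2_semi_inner HS_D(1)[OF xh e]] by simp
   show "\<forall>\<^sub>F n in sequentially. l2n (emeas N e) (edge_part (x n) e - edge_part h e) \<le> hn (x n - h)"
    unfolding edge_part_fun[symmetric] using edge_le[OF xh e] by simp
  qed
  have 2: "LL.cau (\<lambda>n. De (x n) e)" unfolding LL.cau_def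
  proof (intro allI impI)
   fix r :: real assume "r > 0"
   then have "r / 2 > 0" by simp
   then obtain M where M: "\<forall>m\<ge>M. \<forall>n\<ge>M. VV.nrm (x m - x n) < r / 2" using cau unfolding VV.cau_def by blast
   have "LL.nrm (De (x m) e - De (x n) e) < r" if "m \<ge> M" "n \<ge> M" for m n
   proof -
    have "LL.nrm (De (x m) e - De (x n) e) = LL.nrm (De (x m - x n) e)" by (rule De_diff[OF x x e, symmetric])
    also have "\<dots> \<le> 2 * VV.nrm (x m - x n)" by (rule De_le[OF d e])
    also have "VV.nrm (x m - x n) < r / 2" using M that by blast
    finally show ?thesis by simp
   qed
   then show "\<exists>M. \<forall>m\<ge>M. \<forall>n\<ge>M. LL.nrm (De (x m) e - De (x n) e) < r" by blast
  qed
  note c = E.edge_complete[OF V_edge(1)[OF x e] HS_D(1)[OF h(1) e] 1 2]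
  show "edge_part h e \<in> dm e" by (rule c(1))
  show "(\<lambda>n. l2n (lb e) (De (x n) e - De h e)) \<longlonglongrightarrow> 0" by (rule c(2))
  show "(\<lambda>n. io (x n) e (lft N e)) \<longlonglongrightarrow> io h e (lft N e)" by (rule c(3)[OF E.a_spt])
  show "(\<lambda>n. io (x n) e (rgt N e)) \<longlonglongrightarrow> io h e (rgt N e)" by (rule c(3)[OF E.b_spt])
 qed
 have vl: "(\<lambda>n. x n (Inr v)) \<longlonglongrightarrow> h (Inr v)" if v: "v \<in> V1 N" for v
 proof (rule LIM_zero_cancel, rule Lim_null_comparison)
  show "\<forall>\<^sub>F n in sequentially. norm (x n (Inr v) - h (Inr v)) \<le> hn (x n - h) / sqrt (vweight N v)"
   using vertex_bound[OF xh v] by simp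
  show "(\<lambda>n. hn (x n - h) / sqrt (vweight N v)) \<longlonglongrightarrow> 0" by (rule tendsto_divide_zero[OF h(2)])
 qed
 have "tr h \<in> X"
 proof (rule rb_closed[OF X_sub V_tr[OF x]])
  fix i assume "i \<in> bd_index N"
  then consider e where "e \<in> E1 N" "i = Inl (e, 0)" | e where "e \<in> E1 N" "i = Inl (e, 1)" | v where "v \<in> V1 N" "i = Inr v"
   unfolding bd_index_def by blast
  then show "(\<lambda>n. tr (x n) i) \<longlonglongrightarrow> tr h i" by cases (simp_all only: tr_val E vl)
 qed (rule tr_off)
 then have hV: "h \<in> V" unfolding V_iff using h(1) E(1) by blast
 have dV: "x n - h \<in> V" for n using x hV by simp
 have en: "(\<lambda>n. en (x n - h)) \<longlonglongrightarrow> (\<Sum>e\<in>E1 N. 0\<^sup>2)"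
  unfolding en_def
 proof (intro tendsto_sum tendsto_power)
  fix e assume e: "e \<in> E1 N"
  show "(\<lambda>n. l2n (lb e) (De (x n - h) e)) \<longlonglongrightarrow> 0" unfolding De_diff[OF x hV e] by (rule E(2)[OF e])
 qed
 have "(\<lambda>n. (VV.nrm (x n - h))\<^sup>2) \<longlonglongrightarrow> 0"
 proof (rule tendsto_sandwich[OF _ _ tendsto_const])
  show "\<forall>\<^sub>F n in sequentially. (VV.nrm (x n - h))\<^sup>2 \<le> 3 / 2 * en (x n - h) + 2 * w * (hn (x n - h))\<^sup>2"
   unfolding VV.nrm_sq[OF dV] HH.nrm_sq[OF xh] using form_ineq(2)[OF fc dV] by simp
  have "(\<lambda>n. 3 / 2 * en (x n - h) + 2 * w * (hn (x n - h))\<^sup>2) \<longlonglongrightarrow> 3 / 2 * (\<Sum>e\<in>E1 N. 0\<^sup>2) + 2 * w * 0\<^sup>2"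
   by (intro tendsto_add tendsto_mult tendsto_power tendsto_const en h(2))
  then show "(\<lambda>n. 3 / 2 * en (x n - h) + 2 * w * (hn (x n - h))\<^sup>2) \<longlonglongrightarrow> 0" by simp
 qed simp
 then have "(\<lambda>n. sqrt ((VV.nrm (x n - h))\<^sup>2)) \<longlonglongrightarrow> sqrt 0" by (rule tendsto_real_sqrt)
 moreover have "sqrt ((VV.nrm (x n - h))\<^sup>2) = VV.nrm (x n - h)" for n by (rule real_sqrt_unique[OF refl VV.nrm_nonneg[OF dV]])
 ultimately have "(\<lambda>n. VV.nrm (x n - h)) \<longlonglongrightarrow> 0" by simp
 then show "\<exists>y\<in>V. (\<lambda>n. VV.nrm (x n - y)) \<longlonglongrightarrow> 0" using hV by blast
qed

text \<open>Test functions on an edge have zero trace and so lie in the form domain for every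
  \<open>X\<close>; they force \<open>h\<close> to vanish on the edges. What remains is tested with
  an element of the domain whose vertex part sits at one vertex, its edge values being filled in
  affinely.\<close>

lemma V_orthogonal:
 assumes h: "h \<in> HS K N" and orth: "\<And>f. f \<in> V \<Longrightarrow> rip h f = 0"
 shows "rip h h = 0"
proof -
 have ae: "AE x in emeas N e. h (Inl (e, x)) = 0" if e: "e \<in> E1 N" for e
 proof -
  interpret E: edge K "lft N e" "rgt N e" "emeas N e" by (rule edge_E1[OF e])
  show ?thesis
  proof (rule E.test_fun_total[OF HS_D(1)[OF h e]])
   fix \<phi> c assume \<phi>: "test_fun (lft N e) (rgt N e) \<phi>" and c: "c \<in> K"
   note t = E.test_fun_dome[OF \<phi> c]
   define f where "f p = (case p of Inl (e', x) \<Rightarrow> if e' = e then c * complex_of_real (\<phi> x) else 0 | Inr v \<Rightarrow> 0)" for p :: "'e \<times> real + 'v"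
   have fe: "edge_part f e = (\<lambda>x. c * complex_of_real (\<phi> x))" by (simp add: f_def)
   have fe': "edge_part f e' = (\<lambda>_. 0)" if "e' \<noteq> e" for e' using that by (simp add: f_def)
   have d: "edge_part f e' \<in> dm e'" "io f e' (lft N e') = 0" "io f e' (rgt N e') = 0" if e': "e' \<in> E1 N" for e'
   proof -
    interpret E': edge K "lft N e'" "rgt N e'" "emeas N e'" by (rule edge_E1[OF e'])
    have "edge_part f e' \<in> dm e' \<and> io f e' (lft N e') = 0 \<and> io f e' (rgt N e') = 0"
    proof (cases "e' = e")
     case True
     show ?thesis unfolding True fe using t by simp
    next
     case False
     show ?thesis unfolding fe'[OF False] using E'.zero_dome(1) E'.zero_dome(3)[OF E'.a_spt] E'.zero_dome(3)[OF E'.b_spt] by simp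
    qed
    then show "edge_part f e' \<in> dm e'" "io f e' (lft N e') = 0" "io f e' (rgt N e') = 0" by blast+
   qed
   have "f \<in> HS K N" unfolding HS_def
   proof (intro CollectI conjI ballI)
    fix e' assume e': "e' \<in> E1 N"
    show "edge_part f e' \<in> L2 K (emeas N e')" by (rule edge.dome_D(1)[OF edge_E1[OF e'] d(1)[OF e']])
   qed (simp add: f_def)
   moreover have "tr f = (\<lambda>_. 0)" by (rule tr_eqI) (use d(2,3) in \<open>simp_all add: f_def\<close>)
   ultimately have "f \<in> V" unfolding V_iff using d(1) subspace_ofD(2)[OF X_sub] by simp
   then have "rip h f = 0" by (rule orth)
   moreover have "rip h f = (\<Sum>e'\<in>E1 N. if e' = e then l2ip (emeas N e) (edge_part h e) (\<lambda>x. c * complex_of_real (\<phi> x)) else 0) + 0"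
    unfolding rip_sum
   proof (intro arg_cong2[of _ _ _ _ "(+)"] sum.cong refl sum.neutral ballI)
    fix e'
    show "l2ip (emeas N e') (edge_part h e') (edge_part f e') = (if e' = e then l2ip (emeas N e) (edge_part h e) (\<lambda>x. c * complex_of_real (\<phi> x)) else 0)"
    proof (cases "e' = e")
     case True
     show ?thesis unfolding True fe by simp
    next
     case False
     show ?thesis unfolding fe'[OF False] using False by (simp add: l2ip_def)
    qed
   qed (simp add: f_def)
   ultimately show "l2ip (emeas N e) (edge_part h e) (\<lambda>x. c * complex_of_real (\<phi> x)) = 0" using e by simp
  qed
 qed
 have edge0: "l2ip (emeas N e) (edge_part h e) g = 0" if e: "e \<in> E1 N" and g: "g \<in> L2 K (emeas N e)" for e g
 proof (rule semi_inner.ip_null[OF L2_semi_inner HS_D(1)[OF h e] g])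
  show "l2n (emeas N e) (edge_part h e) = 0"
   using L2_nrm_cong[OF HS_D(1)[OF h e] L2_zero] ae[OF e] by (simp add: fun_diff_def)
 qed
 have "h (Inr v) = 0" if v: "v \<in> V1 N" for v
 proof -
  obtain \<xi> where \<xi>: "\<xi> \<in> X" "\<xi> (Inr v) = 1" "\<And>w. w \<in> V1 N \<Longrightarrow> w \<noteq> v \<Longrightarrow> \<xi> (Inr w) = 0" using X_dense[OF v] by blast
  \<comment> \<open>The factor \<open>h (Inr v)\<close> turns the real part of the vertex term into
    \<open>(cmod (h (Inr v)))^2\<close> times the weight.\<close>
  define \<eta> where "\<eta> = (\<lambda>i. h (Inr v) * \<xi> i)"
  have \<eta>X: "\<eta> \<in> X" unfolding \<eta>_def by (rule subspace_ofD(4)[OF X_sub HS_D(2)[OF h v] \<xi>(1)])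
  have \<eta>K: "i \<in> bd_index N \<Longrightarrow> \<eta> i \<in> K" "i \<notin> bd_index N \<Longrightarrow> \<eta> i = 0" for i
   using subspace_ofD(1)[OF X_sub \<eta>X] by (auto simp: KS_def)
  have "\<exists>f\<in>dm e. iota_edge K (lft N e) (rgt N e) (emeas N e) f (lft N e) = \<eta> (Inl (e, 0)) \<and>
   iota_edge K (lft N e) (rgt N e) (emeas N e) f (rgt N e) = \<eta> (Inl (e, 1))" if e: "e \<in> E1 N" for e
  proof (rule edge.affine_dome[OF edge_E1[OF e]])
   show "\<eta> (Inl (e, 0)) \<in> K" by (rule \<eta>K(1)) (use e in \<open>simp add: bd_index_def Plus_def\<close>)
   show "\<eta> (Inl (e, 1)) \<in> K" by (rule \<eta>K(1)) (use e in \<open>simp add: bd_index_def Plus_def\<close>)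
  qed
  then have "\<exists>F. \<forall>e\<in>E1 N. F e \<in> dm e \<and> iota_edge K (lft N e) (rgt N e) (emeas N e) (F e) (lft N e) = \<eta> (Inl (e, 0)) \<and>
   iota_edge K (lft N e) (rgt N e) (emeas N e) (F e) (rgt N e) = \<eta> (Inl (e, 1))" by (intro bchoice) blast
  then obtain F where F: "\<And>e. e \<in> E1 N \<Longrightarrow> F e \<in> dm e"
   "\<And>e. e \<in> E1 N \<Longrightarrow> iota_edge K (lft N e) (rgt N e) (emeas N e) (F e) (lft N e) = \<eta> (Inl (e, 0))"
   "\<And>e. e \<in> E1 N \<Longrightarrow> iota_edge K (lft N e) (rgt N e) (emeas N e) (F e) (rgt N e) = \<eta> (Inl (e, 1))" by blast
  define f where "f p = (case p of Inl (e, x) \<Rightarrow> F e x | Inr v \<Rightarrow> \<eta> (Inr v))" for p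
  have fi: "edge_part f e = F e" "f (Inr w) = \<eta> (Inr w)" for e w by (simp_all add: f_def)
  have FL: "F e \<in> L2 K (emeas N e)" if "e \<in> E1 N" for e by (rule edge.dome_D(1)[OF edge_E1[OF that] F(1)[OF that]])
  have "f \<in> HS K N" unfolding HS_def
  proof (intro CollectI conjI ballI)
   show "edge_part f e \<in> L2 K (emeas N e)" if "e \<in> E1 N" for e unfolding fi by (rule FL[OF that])
   show "f (Inr w) \<in> K" if "w \<in> V1 N" for w unfolding fi by (rule \<eta>K(1)) (use that in \<open>simp add: bd_index_def Plus_def\<close>)
  qed
  moreover have "tr f = \<eta>" by (rule tr_eqI[OF \<eta>K(2)]) (simp_all add: fi F)
  ultimately have "f \<in> V" unfolding V_iff fi using F(1) \<eta>X by simp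
  then have "rip h f = 0" by (rule orth)
  moreover have "rip h f = 0 + (\<Sum>w\<in>V1 N. if w = v then (cmod (h (Inr v)))\<^sup>2 * vweight N v else 0)"
   unfolding rip_sum
  proof (intro arg_cong2[of _ _ _ _ "(+)"] sum.cong refl sum.neutral ballI)
   show "l2ip (emeas N e) (edge_part h e) (edge_part f e) = 0" if "e \<in> E1 N" for e unfolding fi by (rule edge0[OF that FL[OF that]])
   fix w assume w: "w \<in> V1 N"
   show "Re (h (Inr w) * cnj (f (Inr w))) * vweight N w = (if w = v then (cmod (h (Inr v)))\<^sup>2 * vweight N v else 0)"
   proof (cases "w = v")
    case True
    then show ?thesis unfolding fi \<eta>_def cmod_power2 using \<xi>(2) by (simp add: power2_eq_square)
   next
    case False
    then show ?thesis unfolding fi \<eta>_def using \<xi>(3)[OF w] by simp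
   qed
  qed
  ultimately have "(cmod (h (Inr v)))\<^sup>2 * vweight N v = 0" using v by simp
  then show ?thesis using V1_pos[OF v] by simp
 qed
 then have "hn h = 0" using hn_zero_iff[OF h] ae by blast
 then show ?thesis using HH.nrm_sq[OF h] by simp
qed

lemma form_coercive:
 assumes fc: "form_const C w"
 shows "coercive_form (HS K N) rip V (\<lambda>f g. a0 f g + w * rip f g)"
proof (rule coercive_form.intro[OF HS_semi_hilbert form_complete[OF fc]], unfold_locales)
 show "V \<subseteq> HS K N" using V_HS by blast
 show "rip f f \<le> a0 f f + w * rip f f" if "f \<in> V" for f using form_ineq(1)[OF fc that] en_nonneg[of f] by linarith
 show "rip h h = 0" if "h \<in> HS K N" "\<And>v. v \<in> V \<Longrightarrow> rip h v = 0" for h by (rule V_orthogonal[OF that])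
 fix d assume d: "d \<in> HS K N" "hn d = 0"
 note n = V_null[OF d]
 have "en d = 0" using n(2) by (simp add: en_def)
 moreover have "rip d d = 0" using HH.nrm_sq[OF d(1)] d(2) by simp
 ultimately show "d \<in> V \<and> a0 d d + w * rip d d = 0" using n(1) form_ineq[OF fc n(1)] by simp
qed

lemma V_mult: "f \<in> V \<Longrightarrow> c \<in> K \<Longrightarrow> (\<lambda>p. c * f p) \<in> V"
 using V_linear(1)[OF _ V_zero] by simp

lemma tau_mult: assumes "f \<in> V" "g \<in> V" "c \<in> K" shows "tau K N L (\<lambda>p. c * f p) g = c * tau K N L f g"
proof -
 have "tau K N L (\<lambda>_. 0) g = 0" using tau_linear[OF V_zero V_zero assms(2) K_closed_ops(2)] by simp
 then show ?thesis using tau_linear[OF assms(1) V_zero assms(2,3)] by simp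
qed

lemma hinner_mult: assumes "f \<in> HS K N" "g \<in> HS K N" shows "hinner N (\<lambda>p. c * f p) g = c * hinner N f g"
proof -
 have "hinner N (\<lambda>_. 0) g = 0" using hinner_linear[OF HS_zero HS_zero assms(2), of 1] by simp
 then show ?thesis using hinner_linear[OF assms(1) HS_zero assms(2), of c] by simp
qed

text \<open>The real parts determine \<open>\<tau>\<close>: test with \<open>z g\<close>, where \<open>z\<close> is the difference of both sides.\<close>

lemma operator_iff:
 "(u, h) \<in> form_operator K N X L \<longleftrightarrow> u \<in> V \<and> h \<in> HS K N \<and> (\<forall>g\<in>V. a0 u g = rip h g)"
proof
 assume "(u, h) \<in> form_operator K N X L"
 then show "u \<in> V \<and> h \<in> HS K N \<and> (\<forall>g\<in>V. a0 u g = rip h g)" by (simp add: form_operator_def a0_def rip_def)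
next
 assume r: "u \<in> V \<and> h \<in> HS K N \<and> (\<forall>g\<in>V. a0 u g = rip h g)"
 then have u: "u \<in> V" and h: "h \<in> HS K N" by auto
 have "tau K N L u g = hinner N h g" if g: "g \<in> V" for g
 proof -
  define z where "z = tau K N L u g - hinner N h g"
  have XK: "x i \<in> K" if "x \<in> X" for x i using subspace_ofD(1)[OF X_sub that] by (cases "i \<in> bd_index N") (auto simp: KS_def)
  have Lu: "L (tr u) \<in> X" using L_sa V_tr[OF u] by (auto simp: selfadjoint_in_def)
  have "tau K N L u g \<in> K" unfolding tau_eq binner_def
   by (intro K_closed_ops K_sum K_integral XK[OF Lu] XK[OF V_tr[OF g]] L2_D(2)[OF V_edge(2)[OF u]] L2_D(2)[OF V_edge(2)[OF g]])
  moreover have "hinner N h g \<in> K" unfolding hinner_def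
   by (intro K_closed_ops K_sum K_integral L2_D(2)[OF HS_D(1)[OF h]] L2_D(2)[OF HS_D(1)[OF V_HS[OF g]]] HS_D(2)[OF h] HS_D(2)[OF V_HS[OF g]])
  ultimately have z: "z \<in> K" by (simp add: z_def)
  have "a0 u (\<lambda>p. z * g p) = rip h (\<lambda>p. z * g p)" using r V_mult[OF g z] by blast
  moreover have "tau K N L u (\<lambda>p. z * g p) = cnj z * tau K N L u g"
   using tau_sym[OF V_mult[OF g z] u] tau_mult[OF g u z] tau_sym[OF g u] by simp
  moreover have "hinner N h (\<lambda>p. z * g p) = cnj z * hinner N h g"
   using hinner_sym[of h "\<lambda>p. z * g p"] hinner_mult[OF V_HS[OF g] h, of z] hinner_sym[of h g] by simp
  ultimately have "Re (cnj z * tau K N L u g) = Re (cnj z * hinner N h g)" by (simp only: a0_def rip_def)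
  then have "Re (cnj z * z) = 0" by (simp only: z_def right_diff_distrib minus_complex.sel(1) diff_self)
  moreover have "Re (cnj z * z) = (cmod z)\<^sup>2" unfolding cmod_power2 by (simp add: power2_eq_square)
  ultimately show ?thesis by (simp add: z_def)
 qed
 then show "(u, h) \<in> form_operator K N X L" using u h by (simp add: form_operator_def)
qed

lemma operator_mult:
 "(u, h) \<in> form_operator K N X L \<Longrightarrow> c \<in> K \<Longrightarrow> ((\<lambda>p. c * u p), (\<lambda>p. c * h p)) \<in> form_operator K N X L"
 unfolding form_operator_def using V_mult HS_mult tau_mult hinner_mult V_HS by auto

lemma opA_iff:
 assumes fc: "form_const C w"
 shows "coercive_form.opA (HS K N) rip V (\<lambda>f g. a0 f g + w * rip f g) u h \<longleftrightarrow> (u, h - w *\<^sub>R u) \<in> form_operator K N X L"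
proof -
 interpret CF: coercive_form "HS K N" rip V "\<lambda>f g. a0 f g + w * rip f g" by (rule form_coercive[OF fc])
 show ?thesis
 proof (cases "u \<in> V")
  case True
  then have u: "u \<in> HS K N" by (rule V_HS)
  have "h \<in> HS K N \<longleftrightarrow> h - w *\<^sub>R u \<in> HS K N"
  proof
   assume "h - w *\<^sub>R u \<in> HS K N"
   then have "(h - w *\<^sub>R u) + w *\<^sub>R u \<in> HS K N" by (rule HH.mem(2)[OF _ HH.mem(4)[OF u]])
   then show "h \<in> HS K N" by (simp only: diff_add_cancel)
  qed (use u in simp)
  moreover have "a0 u g + w * rip u g = rip h g \<longleftrightarrow> a0 u g = rip (h - w *\<^sub>R u) g" if "h \<in> HS K N" "g \<in> V" for g
   using HH.ip_diff[OF that(1) HH.mem(4)[OF u, of w] V_HS[OF that(2)]] HH.ip_scale[OF u V_HS[OF that(2)], of w] by auto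
  ultimately show ?thesis unfolding CF.opA_def operator_iff using True by blast
 qed (auto simp: CF.opA_def operator_iff)
qed

lemma neg_op_iff: "(x, y) \<in> neg_op A \<longleftrightarrow> (x, - y) \<in> A" for A :: "('v, 'e) hop"
proof
 assume "(x, - y) \<in> A"
 then show "(x, y) \<in> neg_op A" unfolding neg_op_def by (intro CollectI exI[of _ x] exI[of _ "- y"]) (simp add: fun_eq_iff)
qed (auto simp: neg_op_def fun_Compl_def)

lemma gen_iff:
 assumes "real_c0_semigroup (HS K N) rip T"
 shows "real_c0_semigroup.gen (HS K N) rip T x y \<longleftrightarrow> (x, y) \<in> generator K N T"
proof -
 have "(1 / t) *\<^sub>R (T t x - x) = (\<lambda>p. (T t x p - x p) / complex_of_real t)" for t
  by (simp add: scaleR_fun_def fun_eq_iff scaleR_conv_of_real divide_inverse mult.commute)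
 then show ?thesis unfolding real_c0_semigroup.gen_def[OF assms] generator_def hdist_hn by simp
qed

lemma real_c0_semigroupI:
 assumes "C0_semigroup K N T" shows "real_c0_semigroup (HS K N) rip T"
proof (rule real_c0_semigroup.intro[OF HS_semi_inner], rule real_c0_semigroup_axioms.intro)
 note c = assms[unfolded C0_semigroup_def hdist_hn]
 have d0: "f - (\<lambda>_. 0) = f" for f :: "('v, 'e) gfun" by (simp add: fun_eq_iff)
 show "T t x \<in> HS K N" if "t \<ge> 0" "x \<in> HS K N" for t x using c that by blast
 show "hn (T t (r *\<^sub>R x + y) - (r *\<^sub>R T t x + T t y)) = 0" if "t \<ge> 0" "x \<in> HS K N" "y \<in> HS K N" for t x y r
  using c[THEN conjunct2, THEN conjunct1] that K_closed_ops(3)[of r]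
  unfolding scaleR_fun_def plus_fun_def scaleR_conv_of_real by blast
 show "\<exists>B. \<forall>x\<in>HS K N. hn (T t x) \<le> B * hn x" if "t \<ge> 0" for t
  using c[THEN conjunct2, THEN conjunct2, THEN conjunct1] that unfolding d0 by blast
 show "hn (T 0 x - x) = 0" if "x \<in> HS K N" for x using c that by blast
 show "hn (T (s + t) x - T s (T t x)) = 0" if "s \<ge> 0" "t \<ge> 0" "x \<in> HS K N" for s t x using c that by blast
 show "((\<lambda>t. hn (T t x - x)) \<longlongrightarrow> 0) (at_right 0)" if "x \<in> HS K N" for x using c that by blast
qed

theorem semigroup_generated: "\<exists>T. generated_semigroup K N (neg_op (form_operator K N X L)) T"
proof -
 obtain C w where fc: "form_const C w" using form_const_exists by blast
 interpret CF: coercive_form "HS K N" rip V "\<lambda>f g. a0 f g + w * rip f g" by (rule form_coercive[OF fc])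
 obtain T where T: "real_c0_semigroup (HS K N) rip T"
  "\<And>x y. real_c0_semigroup.gen (HS K N) rip T x y \<longleftrightarrow> CF.opA x (w *\<^sub>R x - y)"
  "\<And>B t x. (\<forall>x\<in>HS K N. B x \<in> HS K N) \<Longrightarrow> (\<forall>x\<in>HS K N. \<forall>y\<in>HS K N. B (x - y) = B x - B y) \<Longrightarrow>
   (\<forall>x\<in>HS K N. \<forall>r. B (r *\<^sub>R x) = r *\<^sub>R B x) \<Longrightarrow> (\<forall>x\<in>HS K N. hn (B x) \<le> hn x) \<Longrightarrow>
   (\<forall>u h. CF.opA u h \<longrightarrow> CF.opA (B u) (B h)) \<Longrightarrow> t \<ge> 0 \<Longrightarrow> x \<in> HS K N \<Longrightarrow> hn (T t (B x) - B (T t x)) = 0"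
  using CF.semigroup_exists[of w] by blast
 interpret R: real_c0_semigroup "HS K N" rip T by (rule T(1))
 \<comment> \<open>Multiplication by \<open>c\<close> preserves the operator because the form is
   sesquilinear; modulus at most 1 is demanded since only nonexpansive maps were shown to commute
   with the semigroup.\<close>
 have comm: "hn (T t (\<lambda>p. c * x p) - (\<lambda>p. c * T t x p)) = 0" if c: "c \<in> K" "cmod c \<le> 1" and t: "t \<ge> 0" and x: "x \<in> HS K N" for c t x
 proof (rule T(3)[of "\<lambda>f p. c * f p", OF _ _ _ _ _ t x])
  show "\<forall>x\<in>HS K N. (\<lambda>p. c * x p) \<in> HS K N" using HS_mult c by blast
  show "\<forall>x\<in>HS K N. hn (\<lambda>p. c * x p) \<le> hn x" using hn_mult c by (simp add: mult_left_le_one_le)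
  show "\<forall>u h. CF.opA u h \<longrightarrow> CF.opA (\<lambda>p. c * u p) (\<lambda>p. c * h p)"
  proof (intro allI impI)
   fix u h assume "CF.opA u h"
   then have "((\<lambda>p. c * u p), (\<lambda>p. c * (h - w *\<^sub>R u) p)) \<in> form_operator K N X L"
    unfolding opA_iff[OF fc] by (rule operator_mult[OF _ c(1)])
   moreover have "(\<lambda>p. c * (h - w *\<^sub>R u) p) = (\<lambda>p. c * h p) - w *\<^sub>R (\<lambda>p. c * u p)"
    by (simp add: fun_eq_iff scaleR_fun_def right_diff_distrib)
   ultimately show "CF.opA (\<lambda>p. c * u p) (\<lambda>p. c * h p)" unfolding opA_iff[OF fc] by simp
  qed
 qed (simp_all add: fun_eq_iff scaleR_fun_def right_diff_distrib)
 have "hn (T t (\<lambda>p. c * f p + g p) - (\<lambda>p. c * T t f p + T t g p)) = 0"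
  if t: "t \<ge> 0" and c: "c \<in> K" and f: "f \<in> HS K N" and g: "g \<in> HS K N" for t c f g
 proof -
  \<comment> \<open>A general scalar is a positive real factor times one of modulus below 1; real
    linearity handles the first, commutation the second.\<close>
  define r c' where "r = cmod c + 1" and "c' = complex_of_real (1 / r) * c"
  have r: "r > 0" by (simp add: r_def add_nonneg_pos)
  have "cmod c' = 1 / r * cmod c" using r by (simp add: c'_def norm_mult norm_divide)
  moreover have "cmod c \<le> r" by (simp add: r_def)
  ultimately have c'1: "cmod c' \<le> 1" using r by (simp add: pos_divide_le_eq)
  have "c' \<in> K" unfolding c'_def by (intro K_closed_ops c)
  note c' = this c'1
  have cc: "r *\<^sub>R (c' * z) = c * z" for z using r by (simp add: c'_def scaleR_conv_of_real)
  define x where "x = (\<lambda>p. c' * f p)"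
  have x: "x \<in> HS K N" unfolding x_def by (rule HS_mult[OF f c'(1)])
  have m: "T t f \<in> HS K N" "T t g \<in> HS K N" "T t x \<in> HS K N" using R.T_mem[OF t] f g x by auto
  have m': "(\<lambda>p. c' * T t f p) \<in> HS K N" by (rule HS_mult[OF m(1) c'(1)])
  have 1: "hn (T t (r *\<^sub>R x + g) - (r *\<^sub>R T t x + T t g)) = 0" by (rule R.T_linear[OF t x g])
  have "hn (r *\<^sub>R (T t x - (\<lambda>p. c' * T t f p))) = 0"
   using HH.nrm_scale[OF HH.mem(3)[OF m(3) m'], of r] comm[OF c' t f] unfolding x_def by simp
  then have 2: "hn ((r *\<^sub>R T t x + T t g) - (r *\<^sub>R (\<lambda>p. c' * T t f p) + T t g)) = 0" by (simp add: scaleR_diff_right)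
  have "hn (T t (r *\<^sub>R x + g) - (r *\<^sub>R (\<lambda>p. c' * T t f p) + T t g)) = 0"
   by (rule HH.null_trans[OF _ _ _ 1 2]) (intro R.T_mem t HH.mem x g m m')+
  moreover have "r *\<^sub>R x + g = (\<lambda>p. c * f p + g p)" "r *\<^sub>R (\<lambda>p. c' * T t f p) + T t g = (\<lambda>p. c * T t f p + T t g p)"
   by (simp_all add: fun_eq_iff scaleR_fun_def x_def cc)
  ultimately show ?thesis by simp
 qed
 moreover have d0: "f - (\<lambda>_. 0) = f" for f :: "('v, 'e) gfun" by (simp add: fun_eq_iff)
 ultimately have "C0_semigroup K N T" unfolding C0_semigroup_def hdist_hn d0
  using R.T_mem R.T_bounded R.T_zero R.T_add R.T_cont by (intro conjI allI impI ballI) simp_all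
 moreover have "generator K N T = neg_op (form_operator K N X L)"
 proof -
  have "p \<in> generator K N T \<longleftrightarrow> p \<in> neg_op (form_operator K N X L)" for p
  proof -
   obtain x y where p: "p = (x, y)" by (cases p)
   show ?thesis unfolding p gen_iff[OF T(1), symmetric] T(2) opA_iff[OF fc] neg_op_iff by simp
  qed
  then show ?thesis by blast
 qed
 ultimately show ?thesis unfolding generated_semigroup_def by blast
qed

text \<open>\<open>T\<close> is any semigroup with the right generator, so the abstract invariance
  theorem is applied to it directly. The work lies in the lower form bound for
  \<open>u - P u\<close>, with the same \<open>w\<close> that makes the form coercive.\<close>

theorem semigroup_invariant:
 assumes P: "cone_map K P"
  and XP: "\<And>x. x \<in> X \<Longrightarrow> (\<lambda>i. P (x i)) \<in> X \<and> 0 \<le> rb (L (\<lambda>i. P (x i))) (\<lambda>i. x i - P (x i))"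
  and T: "generated_semigroup K N (neg_op (form_operator K N X L)) T"
  and f: "f \<in> HS K N" "hn (f - (\<lambda>p. P (f p))) = 0" and t: "t \<ge> 0"
 shows "hn (T t f - (\<lambda>p. P (T t f p))) = 0"
proof -
 obtain C w where fc: "form_const C w" using form_const_exists by blast
 interpret CF: coercive_form "HS K N" rip V "\<lambda>f g. a0 f g + w * rip f g" by (rule form_coercive[OF fc])
 interpret NC: net_cone N K P by (rule net_cone.intro[OF net_axioms P])
 have TC: "C0_semigroup K N T" "generator K N T = neg_op (form_operator K N X L)"
  using T by (simp_all add: generated_semigroup_def)
 interpret R: real_c0_semigroup "HS K N" rip T by (rule real_c0_semigroupI[OF TC(1)])
 have gen: "R.gen x y \<longleftrightarrow> (x, - y) \<in> form_operator K N X L" for x y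
  unfolding gen_iff[OF real_c0_semigroupI[OF TC(1)]] TC(2) neg_op_iff ..
 have form: "u - (\<lambda>p. P (u p)) \<in> V \<and> - w * rip (u - (\<lambda>p. P (u p))) (u - (\<lambda>p. P (u p))) \<le> a0 u (u - (\<lambda>p. P (u p)))" if u: "u \<in> V" for u
 proof -
  define Pu where "Pu = (\<lambda>p. P (u p))"
  define q where "q = u - Pu"
  have qe: "edge_part q e = (\<lambda>x. u (Inl (e, x)) - P (u (Inl (e, x))))" for e by (simp add: q_def Pu_def)
  have fe: "edge_firm K (lft N e) (rgt N e) (emeas N e) P" if "e \<in> E1 N" for e
   by (rule edge_firm.intro[OF edge_E1[OF that] NC.firm_map_axioms])
  note fd = edge_firm.firm_dome[OF fe V_edge(1)[OF u]]
  have ends: "lft N e \<in> spt (emeas N e)" "rgt N e \<in> spt (emeas N e)" if "e \<in> E1 N" for e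
   by (rule edge.a_spt[OF edge_E1[OF that]], rule edge.b_spt[OF edge_E1[OF that]])
  have io: "io Pu e (lft N e) = P (io u e (lft N e))" "io Pu e (rgt N e) = P (io u e (rgt N e))" if e: "e \<in> E1 N" for e
   unfolding Pu_def by (rule fd(2)[OF e e ends(1)[OF e]], rule fd(2)[OF e e ends(2)[OF e]])
  have trP: "tr Pu = (\<lambda>i. P (tr u i))"
  proof (rule tr_eqI)
   show "P (tr u i) = 0" if "i \<notin> bd_index N" for i by (simp add: tr_off[OF that])
   show "P (tr u (Inr v)) = Pu (Inr v)" if "v \<in> V1 N" for v by (simp add: tr_val(3)[OF that] Pu_def)
  qed (simp_all only: tr_val io)
  have PV: "Pu \<in> V" unfolding V_iff trP
  proof (intro conjI ballI)
   show "Pu \<in> HS K N" unfolding Pu_def by (rule NC.P_HS[OF V_HS[OF u]])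
   show "edge_part Pu e \<in> dm e" if e: "e \<in> E1 N" for e unfolding Pu_def by (rule fd(1)[OF e e])
  qed (use XP V_tr[OF u] in blast)
  have qV: "q \<in> V" unfolding q_def by (rule subspace_diff[OF V_subspace u PV])
  define d where "d = (\<lambda>i. tr u i - P (tr u i))"
  have trq: "tr q = d"
  proof -
   have m1: "- 1 \<in> K" using K_closed_ops(3)[of "- 1"] by simp
   have q1: "q = (\<lambda>p. - 1 * Pu p + u p)" by (simp add: q_def fun_eq_iff)
   show ?thesis unfolding q1 V_linear(2)[OF PV u m1] trP d_def by (simp add: fun_eq_iff)
  qed
  have dX: "d \<in> X" using V_tr[OF qV] unfolding trq .
  \<comment> \<open>\<open>G e\<close> agrees with \<open>io u e - P (io u e)\<close> on the support
    but need not be \<open>io q e\<close>; boundary values and class are those of \<open>q\<close>.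
    The energy of its derivative \<open>g e\<close> is at most the pairing of \<open>De u e\<close>
    with \<open>De q e\<close>.\<close>
  have "\<exists>g. \<forall>e\<in>E1 N. \<exists>G. g e \<in> L2 K (lb e) \<and> is_prim (lft N e) (rgt N e) (g e) G \<and> G (lft N e) \<in> K \<and>
    (\<forall>x\<in>spt (emeas N e). G x = io u e x - P (io u e x)) \<and> (AE x in emeas N e. G x = u (Inl (e, x)) - P (u (Inl (e, x)))) \<and>
    (l2n (lb e) (g e))\<^sup>2 \<le> l2ip (lb e) (De u e) (De q e)"
   unfolding qe by (rule bchoice, rule ballI) (rule fd(3), assumption+)
  then obtain g where "\<forall>e\<in>E1 N. \<exists>G. g e \<in> L2 K (lb e) \<and> is_prim (lft N e) (rgt N e) (g e) G \<and> G (lft N e) \<in> K \<and>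
    (\<forall>x\<in>spt (emeas N e). G x = io u e x - P (io u e x)) \<and> (AE x in emeas N e. G x = u (Inl (e, x)) - P (u (Inl (e, x)))) \<and>
    (l2n (lb e) (g e))\<^sup>2 \<le> l2ip (lb e) (De u e) (De q e)" by (rule exE)
  from bchoice[OF this] obtain G where gG: "\<forall>e\<in>E1 N. g e \<in> L2 K (lb e) \<and> is_prim (lft N e) (rgt N e) (g e) (G e) \<and> G e (lft N e) \<in> K \<and>
    (\<forall>x\<in>spt (emeas N e). G e x = io u e x - P (io u e x)) \<and> (AE x in emeas N e. G e x = u (Inl (e, x)) - P (u (Inl (e, x)))) \<and>
    (l2n (lb e) (g e))\<^sup>2 \<le> l2ip (lb e) (De u e) (De q e)" by (rule exE)
  have G: "g e \<in> L2 K (lb e)" "is_prim (lft N e) (rgt N e) (g e) (G e)" "G e (lft N e) \<in> K"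
   "d (Inl (e, 0)) = G e (lft N e)" "d (Inl (e, 1)) = G e (rgt N e)" "AE x in emeas N e. G e x = q (Inl (e, x))"
   "(l2n (lb e) (g e))\<^sup>2 \<le> l2ip (lb e) (De u e) (De q e)" if e: "e \<in> E1 N" for e
  proof -
   note z = bspec[OF gG e]
   show "g e \<in> L2 K (lb e)" "is_prim (lft N e) (rgt N e) (g e) (G e)" "G e (lft N e) \<in> K" "(l2n (lb e) (g e))\<^sup>2 \<le> l2ip (lb e) (De u e) (De q e)"
    using z by blast+
   have "\<forall>x\<in>spt (emeas N e). G e x = io u e x - P (io u e x)" using z by blast
   note ge = bspec[OF this]
   show "d (Inl (e, 0)) = G e (lft N e)" unfolding d_def tr_val(1)[OF e] by (rule ge[OF ends(1)[OF e], symmetric])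
   show "d (Inl (e, 1)) = G e (rgt N e)" unfolding d_def tr_val(2)[OF e] by (rule ge[OF ends(2)[OF e], symmetric])
   have "AE x in emeas N e. G e x = u (Inl (e, x)) - P (u (Inl (e, x)))" using z by blast
   then show "AE x in emeas N e. G e x = q (Inl (e, x))" by (simp add: q_def Pu_def)
  qed
  have Gq: "l2n (emeas N e) (G e) = l2n (emeas N e) (edge_part q e)" if e: "e \<in> E1 N" for e
  proof -
   have m: "G e \<in> L2 K (emeas N e)" by (rule edge.is_prim_L2_M[OF edge_E1[OF e] G(1,2,3)[OF e]])
   show ?thesis
    by (rule semi_inner.nrm_cong[OF L2_semi_inner m HS_D(1)[OF V_HS[OF qV] e]
       L2_nrm_cong[OF m HS_D(1)[OF V_HS[OF qV] e], THEN iffD2, OF G(6)[OF e]]])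
  qed
  have dq: "d (Inr v) = q (Inr v)" if "v \<in> V1 N" for v unfolding trq[symmetric] by (rule tr_val(3)[OF that])
  have "C * rb d d \<le> 1 / 2 * (\<Sum>e\<in>E1 N. (l2n (lb e) (g e))\<^sup>2) +
    (w - 1) * ((\<Sum>e\<in>E1 N. (l2n (emeas N e) (G e))\<^sup>2) + (\<Sum>v\<in>V1 N. (cmod (d (Inr v)))\<^sup>2 * vweight N v))"
   by (rule form_constD(4)[OF fc G(1) G(2) G(3) G(4) G(5)])
  also have "(\<Sum>e\<in>E1 N. (l2n (emeas N e) (G e))\<^sup>2) + (\<Sum>v\<in>V1 N. (cmod (d (Inr v)))\<^sup>2 * vweight N v) = rip q q"
   unfolding rip_self[OF V_HS[OF qV]] by (intro arg_cong2[of _ _ _ _ "(+)"] sum.cong refl) (simp_all only: Gq dq)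
  finally have 1: "C * rb d d \<le> 1 / 2 * (\<Sum>e\<in>E1 N. (l2n (lb e) (g e))\<^sup>2) + (w - 1) * rip q q" .
  have 2: "(\<Sum>e\<in>E1 N. (l2n (lb e) (g e))\<^sup>2) \<le> (\<Sum>e\<in>E1 N. l2ip (lb e) (De u e) (De q e))"
   by (rule sum_mono[OF G(7)])
  interpret U: semi_inner UNIV rb by (rule rb_semi_inner) simp
  \<comment> \<open>The trace splits into its projection \<open>y\<close> and the remainder
    \<open>d\<close>: local invariance makes \<open>rb (L y) d\<close> nonnegative, and
    \<open>rb (L d) d\<close> is at least \<open>- C * rb d d\<close>.\<close>
  define y where "y = (\<lambda>i. P (tr u i))"
  have yX: "y \<in> X" and yL: "0 \<le> rb (L y) d" using XP[OF V_tr[OF u]] unfolding y_def d_def by auto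
  have "tr u = (\<lambda>i. y i + d i)" by (simp add: y_def d_def)
  then have "L (tr u) = (\<lambda>i. L y i + L d i)" using L_sa yX dX unfolding selfadjoint_in_def by simp
  then have "L (tr u) = L y + L d" by (simp add: plus_fun_def)
  then have 3: "rb (L (tr u)) (tr q) = rb (L y) d + rb (L d) d" unfolding trq using U.ip_add by simp
  have 4: "- (C * rb d d) \<le> rb (L d) d" using form_constD(3)[OF fc dX] by linarith
  have 5: "0 \<le> (\<Sum>e\<in>E1 N. (l2n (lb e) (g e))\<^sup>2)" by (simp add: sum_nonneg)
  have 6: "(w - 1) * rip q q = w * rip q q - rip q q" by (simp add: left_diff_distrib)
  \<comment> \<open>The edges contribute at least the energy of \<open>g\<close>, of which the
    boundary term takes half; beyond that it costs \<open>(w - 1) * rip q q\<close>.\<close>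
  have "- (w * rip q q) \<le> a0 u q" unfolding a0_eq 3 using 1 2 4 5 6 yL HH.ip_pos[OF V_HS[OF qV]] by linarith
  then show ?thesis using qV unfolding q_def Pu_def by simp
 qed
 show ?thesis
 proof (rule R.invariance[where V = V and b = a0 and P = "\<lambda>f p. P (f p)" and w = w, OF _ _ NC.P_HS NC.P_hn_nearest form _ f t])
  fix x y assume "R.gen x y"
  then have "(x, - y) \<in> form_operator K N X L" and y: "y \<in> HS K N" unfolding gen[symmetric] by (auto simp: R.gen_def)
  then show "x \<in> V \<and> (\<forall>v\<in>V. a0 x v = - rip y v)" unfolding operator_iff using HH.ip_minus[OF y V_HS] by simp
 next
  fix x and e :: real assume "x \<in> HS K N" "e > 0"
  then obtain y h where y: "CF.opA y h" "hn (x - y) < e" using CF.dense_opA by blast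
  have "R.gen y (w *\<^sub>R y - h)" using y(1) unfolding gen opA_iff[OF fc] by simp
  then show "\<exists>y z. R.gen y z \<and> hn (x - y) < e" using y(2) by blast
 next
  show "w \<ge> 0" using form_constD(2)[OF fc] by simp
 qed
qed

lemma fixed_iff:
 assumes P: "cone_map K P" and f: "f \<in> HS K N"
 shows "hn (f - (\<lambda>p. P (f p))) = 0 \<longleftrightarrow>
  (\<forall>e\<in>E1 N. AE x in emeas N e. P (f (Inl (e, x))) = f (Inl (e, x))) \<and> (\<forall>v\<in>V1 N. P (f (Inr v)) = f (Inr v))"
proof -
 interpret NC: net_cone N K P by (rule net_cone.intro[OF net_axioms P])
 have "f - (\<lambda>p. P (f p)) \<in> HS K N" by (rule HH.mem(3)[OF f NC.P_HS[OF f]])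
 from hn_zero_iff[OF this] show ?thesis by (simp add: eq_commute[of "P _"])
qed

lemma hsup_norm_le_iff:
 assumes f: "f \<in> HS K N"
 shows "hsup_norm N f \<le> ennreal r \<longleftrightarrow>
  (\<forall>e\<in>E1 N. AE x in emeas N e. ennreal (cmod (f (Inl (e, x)))) \<le> ennreal r) \<and> (\<forall>v\<in>V1 N. ennreal (cmod (f (Inr v))) \<le> ennreal r)"
proof -
 have "esssup (emeas N e) (\<lambda>x. ennreal (cmod (f (Inl (e, x))))) \<le> ennreal r \<longleftrightarrow>
   (AE x in emeas N e. ennreal (cmod (f (Inl (e, x)))) \<le> ennreal r)" if e: "e \<in> E1 N" for e
 proof
  note [measurable] = L2_D(1)[OF HS_D(1)[OF f e]]
  have m: "(\<lambda>x. ennreal (cmod (f (Inl (e, x))))) \<in> borel_measurable (emeas N e)" by measurable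
  show "esssup (emeas N e) (\<lambda>x. ennreal (cmod (f (Inl (e, x))))) \<le> ennreal r"
   if "AE x in emeas N e. ennreal (cmod (f (Inl (e, x)))) \<le> ennreal r" by (rule esssup_I[OF m that])
  assume "esssup (emeas N e) (\<lambda>x. ennreal (cmod (f (Inl (e, x))))) \<le> ennreal r"
  with esssup_AE[of "\<lambda>x. ennreal (cmod (f (Inl (e, x))))" "emeas N e"]
  show "AE x in emeas N e. ennreal (cmod (f (Inl (e, x)))) \<le> ennreal r"
   by (elim eventually_mono) (rule order_trans)
 qed
 then show ?thesis unfolding hsup_norm_def by (simp add: SUP_le_iff)
qed

end

section \<open>From local boundary conditions to positivity and contractivity\<close>

lemma (in net) local_dense:
 assumes loc: "local_bc K N X L Xv Lv" and \<xi>: "\<xi> \<in> Xv v" "\<xi> (Inr v) = 1" and v: "v \<in> V1 N"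
 shows "\<exists>\<xi>\<in>X. \<xi> (Inr v) = 1 \<and> (\<forall>w\<in>V1 N. w \<noteq> v \<longrightarrow> \<xi> (Inr w) = 0)"
proof (intro bexI[of _ \<xi>] conjI ballI impI)
 let ?V = "verts (graph N)"
 note l = loc[unfolded local_bc_def]
 have sub: "subspace_of K (KS K (bd_index_at N u)) (Xv u)" if "u \<in> ?V" for u
  using bspec[OF conjunct1[OF l] that] by (rule conjunct1)
 have vV: "v \<in> ?V" using v by (simp add: V1_def)
 \<comment> \<open>The family with \<open>\<xi>\<close> at \<open>v\<close> and 0 at all other
   vertices; membership in a single block is what makes the other vertex values vanish.\<close>
 define x where "x u = (if u = v then \<xi> else (\<lambda>_. 0))" for u
 have "\<forall>u\<in>?V. x u \<in> Xv u" using \<xi>(1) subspace_ofD(2)[OF sub] by (simp add: x_def)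
 moreover have "\<xi> = (\<lambda>i. \<Sum>u\<in>?V. x u i)"
 proof
  fix i
  have "(\<Sum>u\<in>?V. x u i) = (\<Sum>u\<in>?V. if u = v then \<xi> i else 0)" by (rule sum.cong) (auto simp: x_def)
  then show "\<xi> i = (\<Sum>u\<in>?V. x u i)" using vV by simp
 qed
 ultimately show "\<xi> \<in> X" using conjunct1[OF conjunct2[OF l]] by blast
 show "\<xi> (Inr v) = 1" by (rule \<xi>(2))
 fix w assume "w \<in> V1 N" "w \<noteq> v"
 then have "Inr w \<notin> bd_index_at N v" by (auto simp: bd_index_at_def)
 then show "\<xi> (Inr w) = 0" using subspace_ofD(1)[OF sub[OF vV] \<xi>(1)] by (simp add: KS_def)
qed

theorem corollary5p2:
 fixes K :: "complex set"
  and N :: "('v, 'e) network"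
  and X :: "('v, 'e) bvec set"
  and L :: "('v, 'e) bvec \<Rightarrow> ('v, 'e) bvec"
  and Xv :: "'v \<Rightarrow> ('v, 'e) bvec set"
  and Lv :: "'v \<Rightarrow> ('v, 'e) bvec \<Rightarrow> ('v, 'e) bvec"
 defines "H \<equiv> form_operator K N X L"
 assumes "K = \<real> \<or> K = UNIV"
  and "weighted_network N"
  and "subspace_of K (KS K (bd_index N)) X"
  and "selfadjoint_in K N X L"
  and "local_bc K N X L Xv Lv"
  and "\<forall>v\<in>V1 N. \<exists>\<xi>\<in>Xv v. \<xi> (Inr v) = 1"
 shows
  "((\<forall>v\<in>verts (graph N). sublattice K (bd_index_at N v) (Xv v) \<and>
     positivity_preserving (Xv v) (nonneg_on (bd_index_at N v)) (\<lambda>t. op_exp (Lv v) (- t)))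
   \<longrightarrow>
   (\<exists>T. generated_semigroup K N (neg_op H) T) \<and>
   (\<forall>T. generated_semigroup K N (neg_op H) T \<longrightarrow>
     positivity_preserving (HS K N) (hnonneg N) T))
   \<and>
   ((\<forall>v\<in>verts (graph N). stonean_sublattice K (bd_index_at N v) (Xv v) \<and>
     submarkovian (Xv v) (nonneg_on (bd_index_at N v)) (sup_norm_on (bd_index_at N v))
      (\<lambda>t. op_exp (Lv v) (- t)))
   \<longrightarrow>
   (\<exists>T. generated_semigroup K N (neg_op H) T) \<and>
   (\<forall>T. generated_semigroup K N (neg_op H) T \<longrightarrow>
     submarkovian (HS K N) (hnonneg N) (hsup_norm N) T))"
proof -
 interpret weighted_network N by (rule assms(3))
 interpret NN: net N K by unfold_locales (rule assms(2))
 interpret F: net_form N K X L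
 proof
  show "subspace_of K (KS K (bd_index N)) X" by (rule assms(4))
  show "selfadjoint_in K N X L" by (rule assms(5))
  fix v assume v: "v \<in> V1 N"
  obtain \<xi> where "\<xi> \<in> Xv v" "\<xi> (Inr v) = 1" using assms(7) v by blast
  then show "\<exists>\<xi>\<in>X. \<xi> (Inr v) = 1 \<and> (\<forall>w\<in>V1 N. w \<noteq> v \<longrightarrow> \<xi> (Inr w) = 0)"
   by (rule NN.local_dense[OF assms(6) _ _ v])
 qed
 have ex: "\<exists>T. generated_semigroup K N (neg_op H) T" unfolding H_def by (rule F.semigroup_generated)
 have pos: "positivity_preserving (HS K N) (hnonneg N) T"
  if loc: "\<forall>v\<in>verts (graph N). sublattice K (bd_index_at N v) (Xv v) \<and>
     positivity_preserving (Xv v) (nonneg_on (bd_index_at N v)) (\<lambda>t. op_exp (Lv v) (- t))"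
   and T: "generated_semigroup K N (neg_op H) T" for T
  unfolding positivity_preserving_def
 proof (intro allI impI ballI)
  fix t :: real and f assume t: "0 \<le> t" and f: "f \<in> HS K N" and nn: "hnonneg N f"
  let ?P = "\<lambda>z. complex_of_real (max (Re z) 0)"
  have P: "?P z = z \<longleftrightarrow> z \<in> \<real>\<^sub>\<ge>\<^sub>0" for z
   by (auto simp: complex_eq_iff complex_nonneg_Reals_iff max_def)
  \<comment> \<open>Nonnegativity means being fixed by the projection up to null sets, which
    translates invariance into the order statement.\<close>
  have iff: "NN.hn (g - (\<lambda>p. ?P (g p))) = 0 \<longleftrightarrow> hnonneg N g" if "g \<in> HS K N" for g
   unfolding F.fixed_iff[OF NN.cone_map_positive that] P hnonneg_def ..
  have "T t f \<in> HS K N" using T t f by (simp add: generated_semigroup_def C0_semigroup_def)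
  moreover have "NN.hn (T t f - (\<lambda>p. ?P (T t f p))) = 0"
   by (rule F.semigroup_invariant[OF NN.cone_map_positive NN.local_positive[OF assms(6) loc] T[unfolded H_def] f iff[OF f, THEN iffD2, OF nn] t])
  ultimately show "hnonneg N (T t f)" using iff by blast
 qed
 have sub: "submarkovian (HS K N) (hnonneg N) (hsup_norm N) T"
  if loc: "\<forall>v\<in>verts (graph N). stonean_sublattice K (bd_index_at N v) (Xv v) \<and>
     submarkovian (Xv v) (nonneg_on (bd_index_at N v)) (sup_norm_on (bd_index_at N v)) (\<lambda>t. op_exp (Lv v) (- t))"
   and T: "generated_semigroup K N (neg_op H) T" for T
  unfolding submarkovian_def
 proof (intro conjI allI impI ballI)
  \<comment> \<open>Stonean sublattices are sublattices and submarkovian semigroups are positive, so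
    the first assertion applies.\<close>
  show "positivity_preserving (HS K N) (hnonneg N) T"
   by (rule pos[OF _ T]) (use loc in \<open>simp add: stonean_sublattice_def submarkovian_def\<close>)
  fix t :: real and f assume t: "0 \<le> t" and f: "f \<in> HS K N" and fin: "hsup_norm N f < \<infinity>"
  have Tf: "T t f \<in> HS K N" using T t f by (simp add: generated_semigroup_def C0_semigroup_def)
  have le: "hsup_norm N (T t f) \<le> ennreal r" if r: "r > 0" and fr: "hsup_norm N f \<le> ennreal r" for r
  proof -
   define P where "P z = (if cmod z \<le> r then z else complex_of_real (r / cmod z) * z)" for z
   have Pc: "cone_map K P" unfolding P_def[abs_def] by (rule NN.cone_map_ball[OF r])
   have PX: "(\<lambda>i. P (x i)) \<in> X \<and> 0 \<le> NN.rb (L (\<lambda>i. P (x i))) (\<lambda>i. x i - P (x i))" if "x \<in> X" for x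
    unfolding P_def by (rule NN.local_ball[OF assms(6) loc that r])
   have "cmod (P z) \<le> r" for z using r by (cases "z = 0") (auto simp: P_def norm_mult norm_divide)
   then have P: "P z = z \<longleftrightarrow> ennreal (cmod z) \<le> ennreal r" for z
    using r by (metis P_def ennreal_le_iff less_imp_le)
   have iff: "NN.hn (g - (\<lambda>p. P (g p))) = 0 \<longleftrightarrow> hsup_norm N g \<le> ennreal r" if "g \<in> HS K N" for g
    unfolding F.fixed_iff[OF Pc that] P F.hsup_norm_le_iff[OF that] ..
   have "NN.hn (T t f - (\<lambda>p. P (T t f p))) = 0"
    by (rule F.semigroup_invariant[OF Pc PX T[unfolded H_def] f iff[OF f, THEN iffD2, OF fr] t])
   then show ?thesis using iff[OF Tf] by blast
  qed
  show "hsup_norm N (T t f) \<le> hsup_norm N f"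
  proof (rule ennreal_le_epsilon)
   fix \<epsilon> :: real assume \<epsilon>: "\<epsilon> > 0"
   obtain s where s: "s \<ge> 0" "hsup_norm N f = ennreal s" using fin by (cases "hsup_norm N f") auto
   \<comment> \<open>The disc projection was built for positive radius, while \<open>s\<close> may
     be 0; hence the radius \<open>s + \<epsilon>\<close>.\<close>
   have "hsup_norm N (T t f) \<le> ennreal (s + \<epsilon>)" using s \<epsilon> by (intro le) (auto intro: ennreal_leI)
   then show "hsup_norm N (T t f) \<le> hsup_norm N f + ennreal \<epsilon>" using s \<epsilon> by (simp add: ennreal_plus)
  qed
 qed
 show ?thesis using ex pos sub by blast
qed

end
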